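(* Let $1<p<\infty$, $-1<\alpha<p-2$, and let $g$ be an analytic function in the unit disc $\mathbb{D}$. Then the generalized Hilbert operator $\mathcal{H}_g:A^p_\alpha\to A^p_\alpha$ is compact if and only if $g\in\lambda\left(p,\frac1p\right)$.
   Context: $dA=\frac1\pi dx\,dy$. For $0<p<\infty$ and $\alpha>-1$, the weighted Bergman space $A^p_\alpha$ consists of analytic $f$ in $\mathbb{D}$ with $\|f\|_{A^p_\alpha}=\left((\alpha+1)\int_{\mathbb{D}}|f(z)|^p(1-|z|^2)^\alpha\,dA(z)\right)^{1/p}<\infty$. Given $g$ analytic in $\mathbb{D}$, the generalized Hilbert operator is $\mathcal{H}_g(f)(z)=\int_0^1 f(t)g'(tz)\,dt$, $z\in\mathbb{D}$, defined for analytic $f$ with $\int_0^1|f(t)|\,dt<\infty$ (this holds for every $f\in A^p_\alpha$ when $-1<\alpha<p-2$). Let $M_p(r,f)=\left(\frac1{2\pi}\int_0^{2\pi}|f(re^{it})|^p\,dt\right)^{1/p}$ and let $H^p$ be the Hardy space of analytic $f$ with $\sup_{0<r<1}M_p(r,f)<\infty$. Little-oh mean Lipschitz spaces: for $1\le p<\infty$ and $0<\alpha<1$, $\lambda(p,\alpha)$ is the set of $g\in H^p$ whose boundary function satisfies $\omega_p(g,t)=o(t^\alpha)$ as $t\to0$, where $\omega_p(g,t)=\sup_{0<h\le t}\left(\int_0^{2\pi}|g(e^{i(\theta+h)})-g(e^{i\theta})|^p\frac{d\theta}{2\pi}\right)^{1/p}$; equivalently, $g\in H^p$ and $M_p(r,g')=o((1-r)^{\alpha-1})$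 as $r\to1^-$. *)

theory Defs
  imports "HOL-Complex_Analysis.Complex_Analysis" "HOL-Library.Landau_Symbols"
begin

abbreviation unit_disc :: "complex set" where
  "unit_disc \<equiv> ball 0 1"

text \<open>
  Functions on the disc are total functions on \<^typ>\<open>complex\<close>; only their values on
  the disc enter the definitions below, so two functions that agree on the disc are
  the same element of each of the spaces.
\<close>

text \<open>
  The factor \<open>1 / pi\<close> is the normalisation of the area measure \<open>dA\<close>.
\<close>

definition bergman_norm :: "real \<Rightarrow> real \<Rightarrow> (complex \<Rightarrow> complex) \<Rightarrow> real" where
  "bergman_norm p \<alpha> f =
     ((\<alpha> + 1) * (1 / pi *
        (LINT z:unit_disc|lborel. norm (f z) powr p * (1 - (norm z)\<^sup>2) powr \<alpha>))) powr (1 / p)"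

definition bergman_space :: "real \<Rightarrow> real \<Rightarrow> (complex \<Rightarrow> complex) set" where
  "bergman_space p \<alpha> =
     {f. f holomorphic_on unit_disc \<and>
         set_integrable lborel unit_disc
           (\<lambda>z. norm (f z) powr p * (1 - (norm z)\<^sup>2) powr \<alpha>)}"

definition gen_hilbert :: "(complex \<Rightarrow> complex) \<Rightarrow> (complex \<Rightarrow> complex) \<Rightarrow> complex \<Rightarrow> complex" where
  "gen_hilbert g f z =
     (LINT t:{0..<1}|lborel. f (complex_of_real t) * deriv g (complex_of_real t * z))"

text \<open>
  \<open>NX\<close> and \<open>NY\<close> are the norms of the spaces \<open>X\<close> and \<open>Y\<close>. The operator maps \<open>X\<close> into
  \<open>Y\<close>, and the image of every norm-bounded sequence has a subsequence that converges
  in norm to an element of \<open>Y\<close>. Linearity is not part of the definition.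
\<close>

definition compact_operator ::
  "'a set \<Rightarrow> ('a \<Rightarrow> real) \<Rightarrow> 'b::minus set \<Rightarrow> ('b \<Rightarrow> real) \<Rightarrow> ('a \<Rightarrow> 'b) \<Rightarrow> bool" where
  "compact_operator X NX Y NY T \<longleftrightarrow>
     (\<forall>x\<in>X. T x \<in> Y) \<and>
     (\<forall>u :: nat \<Rightarrow> 'a. (\<forall>n. u n \<in> X) \<and> bdd_above (range (\<lambda>n. NX (u n))) \<longrightarrow>
        (\<exists>\<sigma> :: nat \<Rightarrow> nat. \<exists>y\<in>Y. strict_mono \<sigma> \<and>
           (\<lambda>n. NY (T (u (\<sigma> n)) - y)) \<longlonglongrightarrow> 0))"

definition integral_mean :: "real \<Rightarrow> real \<Rightarrow> (complex \<Rightarrow> complex) \<Rightarrow> real" where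
  "integral_mean p r f =
     (1 / (2 * pi) *
       (LINT t:{0..2*pi}|lborel. norm (f (complex_of_real r * cis t)) powr p)) powr (1 / p)"

definition hardy_space :: "real \<Rightarrow> (complex \<Rightarrow> complex) set" where
  "hardy_space p =
     {f. f holomorphic_on unit_disc \<and> bdd_above ((\<lambda>r. integral_mean p r f) ` {0<..<1})}"

text \<open>
  The boundary function is given by radial limits. For functions in a Hardy space the
  limit exists at almost every point of the circle (Fatou); the value of \<^const>\<open>Lim\<close> at
  the remaining points is irrelevant, as the function is only integrated.
\<close>

definition boundary_function :: "(complex \<Rightarrow> complex) \<Rightarrow> complex \<Rightarrow> complex" where
  "boundary_function g \<zeta> = Lim (at_left 1) (\<lambda>r::real. g (complex_of_real r * \<zeta>))"

text \<open>
  The integral modulus of continuity of a function \<open>G\<close> on the unit circle. For \<open>p \<ge> 1\<close>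
  and \<open>G\<close> in \<open>L\<^sup>p\<close> of the circle, the integrands are integrable and the supremum is over
  a set bounded by twice the norm of \<open>G\<close>.
\<close>

definition integral_modulus :: "real \<Rightarrow> (complex \<Rightarrow> complex) \<Rightarrow> real \<Rightarrow> real" where
  "integral_modulus p G t =
     (SUP h\<in>{0<..t}.
        (1 / (2 * pi) *
          (LINT \<theta>:{0..2*pi}|lborel.
             norm (G (cis (\<theta> + h)) - G (cis \<theta>)) powr p)) powr (1 / p))"

definition little_mean_lipschitz :: "real \<Rightarrow> real \<Rightarrow> (complex \<Rightarrow> complex) set" where
  "little_mean_lipschitz p \<alpha> =
     {g \<in> hardy_space p.
        integral_modulus p (boundary_function g) \<in> o[at_right 0](\<lambda>t. t powr \<alpha>)}"

end

theory Submission
  imports Defs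
begin

text \<open>
  By the Hardy--Littlewood theorem, \<open>g\<close> lies in the mean Lipschitz space exactly when \<open>M\<^sub>p(r, g')\<close> is
  little-oh of \<open>(1 - r) powr (1/p - 1)\<close>; both implications rest on Fatou's theorem.

  If this growth condition holds, Minkowski's inequality bounds \<open>M\<^sub>p(r, H\<^sub>g f)\<close> by the
  integral of \<open>|f t|\<close> against \<open>e (1 - t r) powr (1/p - 1) + C\<close> with \<open>e\<close> arbitrarily small. Schur's test
  and the embedding of the Bergman space into \<open>L\<^sup>p\<close> of the radius with weight \<open>(1 - t) powr (\<alpha> + 1)\<close>
  make the first term of size \<open>e\<close>; the second tends to \<open>0\<close> along a bounded sequence that converges
  locally uniformly to \<open>0\<close>, and Montel's theorem supplies such sequences.

  Conversely, let \<open>1/p < \<gamma> < (\<alpha> + 2)/p\<close>. The normalised functions \<open>z ^ k * (1 - z) powr (- \<gamma>)\<close> are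
  bounded and their images tend to \<open>0\<close> pointwise, so by compactness in norm. The image is a fractional
  integral of \<open>z ^ k * g'\<close> of order \<open>1 - \<gamma>\<close>; the fractional integral of order \<open>\<gamma>\<close> completes it to an
  integral of order one, and one differentiation at the radius \<open>1 - 1/k\<close> then bounds \<open>M\<^sub>p(1 - 1/k, g')\<close>.
\<close>

section \<open>Jensen and Minkowski inequalities\<close>

text \<open>Fatou's theorem enters because the Lipschitz condition concerns pointwise radial limits,
  whereas every estimate is made on circles of radius r < 1. In the converse, z^k localises the test
  function near |z| = 1 - 1/k and turns the radial integrals into Beta integrals, so that the
  inversion is an identity without error term. The bounds on \<gamma> come from the norm of the test
  function: 1/p < \<gamma> makes the circle integral of |1 - z|^(-\<gamma> p) a power of 1 - |z|,
  and \<gamma> < (\<alpha> + 2)/p makes the remaining radial integral converge. The powers of k then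
  balance: (\<alpha> + 1)/p for the passage from the Bergman norm to a circle mean, -\<gamma> for
  the fractional integral, 1 for the derivative, and \<gamma> - (\<alpha> + 2)/p for the
  normalisation. Their sum is the critical exponent 1 - 1/p, whatever \<gamma> is.\<close>

lemma powr_tangent_le:
  fixes x l p :: real
  assumes "1 < p" "0 \<le> x" "0 < l"
  shows "x \<le> (x powr p + (p - 1) * l powr p) / (p * l powr (p - 1))"
proof -
  have "(x / l) * 1 \<le> (x / l) powr p / p + 1 powr (p / (p - 1)) / (p / (p - 1))"
    using assms by (intro Youngs_inequality) (auto simp: field_simps)
  hence "x / l \<le> (x powr p / l powr p + (p - 1)) / p"
    using assms by (simp add: powr_divide add_divide_distrib)
  hence "x \<le> l * ((x powr p / l powr p + (p - 1)) / p)"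
    using assms by (simp add: field_simps)
  also have "\<dots> = (x powr p + (p - 1) * l powr p) / (p * l powr (p - 1))"
    using assms by (simp add: powr_diff field_simps)
  finally show ?thesis .
qed

text \<open>Jensen's inequality for |h|/m and the measure with density k m: the tangent line of x
  powr p at a level l is integrated, and l is then optimised. The right side is
  \<open>ennreal\<close>-valued, so the statement covers the case where it is infinite.\<close>

lemma weighted_jensen:
  fixes h :: "'a \<Rightarrow> complex" and k m :: "'a \<Rightarrow> real"
  assumes p: "1 < p" and [measurable]: "k \<in> borel_measurable M" "m \<in> borel_measurable M"
      "h \<in> borel_measurable M"
    and k: "\<And>t. 0 \<le> k t" and m: "\<And>t. 0 < m t" and int: "integrable M (\<lambda>t. k t * m t)"
  shows "ennreal (norm (LINT t|M. k t *\<^sub>R h t) powr p) \<le>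
     ennreal ((LINT t|M. k t * m t) powr (p - 1)) *
       (\<integral>\<^sup>+t. ennreal (k t * m t powr (1 - p) * norm (h t) powr p) \<partial>M)"
proof -
  define W where "W = (LINT t|M. k t * m t)"
  define A where "A = (\<integral>\<^sup>+t. ennreal (k t * m t powr (1 - p) * norm (h t) powr p) \<partial>M)"
  define N where "N = norm (LINT t|M. k t *\<^sub>R h t)"
  have km: "0 \<le> k t * m t" for t using k m by (simp add: less_imp_le)
  have W0: "0 \<le> W" unfolding W_def using km by (intro integral_nonneg_AE) auto
  consider "W = 0" | "W > 0" "A = \<infinity>" | "W > 0" "A < \<infinity>"
    using W0 by (metis antisym_conv1 infinity_ennreal_def top.not_eq_extremum)
  thus ?thesis
  proof cases
    case 1
    have "AE t in M. k t * m t = 0"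
      using 1 int km unfolding W_def by (subst (asm) integral_nonneg_eq_0_iff_AE) auto
    hence "AE t in M. k t *\<^sub>R h t = 0" using m by (auto simp: less_le)
    hence "(LINT t|M. k t *\<^sub>R h t) = 0" by (subst integral_cong_AE[where g="\<lambda>_. 0"]) auto
    thus ?thesis by simp
  next
    case 2
    hence "ennreal (W powr (p - 1)) * A = \<infinity>" by (simp add: ennreal_mult_eq_top_iff)
    thus ?thesis unfolding A_def W_def by simp
  next
    case 3
    then obtain a where a: "A = ennreal a" "0 \<le> a"
      by (metis ennreal_cases infinity_ennreal_def less_irrefl)
    let ?B = "\<lambda>t. k t * m t powr (1 - p) * norm (h t) powr p"
    have B0: "0 \<le> ?B t" for t using k by simp
    have Bint: "integrable M ?B" 
      using 3 B0 unfolding A_def by (intro integrableI_bounded) auto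
    have Beq: "(LINT t|M. ?B t) = a"
    proof -
      have "A = ennreal (LINT t|M. ?B t)"
        unfolding A_def using B0 by (intro nn_integral_eq_integral[OF Bint]) auto
      moreover have "0 \<le> (LINT t|M. ?B t)" using B0 by (intro integral_nonneg_AE) auto
      ultimately show ?thesis using a by simp
    qed
    have bound: "N \<le> (a + (p - 1) * l powr p * W) / (p * l powr (p - 1))" if l: "0 < l" for l
    proof -
      let ?C = "\<lambda>t. (?B t + (p - 1) * l powr p * (k t * m t)) / (p * l powr (p - 1))"
      have Cint: "integrable M ?C" using Bint int by auto
      have pt: "norm (k t *\<^sub>R h t) \<le> ?C t" for t
      proof -
        have "norm (h t) / m t \<le> ((norm (h t) / m t) powr p + (p - 1) * l powr p) / (p * l powr (p - 1))"
          using p l m[of t] by (intro powr_tangent_le) auto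
        hence "(k t * m t) * (norm (h t) / m t) \<le> (k t * m t) * (((norm (h t) / m t) powr p + (p - 1) * l powr p) / (p * l powr (p - 1)))"
          using km by (intro mult_left_mono)
        also have "(k t * m t) * (norm (h t) / m t) = norm (k t *\<^sub>R h t)"
          using m[of t] k[of t] by simp
        also have "(k t * m t) * (((norm (h t) / m t) powr p + (p - 1) * l powr p) / (p * l powr (p - 1))) = ?C t"
          using m[of t] by (simp add: powr_divide powr_diff field_simps)
        finally show ?thesis .
      qed
      have "N \<le> (LINT t|M. norm (k t *\<^sub>R h t))" unfolding N_def by (rule integral_norm_bound)
      also have "\<dots> \<le> (LINT t|M. ?C t)"
        using order.trans[OF norm_ge_zero pt] by (intro integral_mono'[OF Cint pt])
      also have "\<dots> = (a + (p - 1) * l powr p * W) / (p * l powr (p - 1))"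
        using Bint int by (simp add: Beq W_def)
      finally show ?thesis .
    qed
    have "N powr p \<le> W powr (p - 1) * a + e" if e: "0 < e" for e
    proof -
      define b where "b = a + e / W powr (p - 1)"
      have b: "b > 0" "a \<le> b" "W powr (p - 1) * a + e = W powr (p - 1) * b"
        using 3 e a by (auto simp: b_def distrib_left intro!: add_nonneg_pos divide_pos_pos)
      \<comment> \<open>The optimal level: \<open>l powr p\<close> is the mean of (|h|/m) powr p for
        the normalised measure, with \<open>a\<close> enlarged to \<open>b\<close> so that l is
        positive even if \<open>a = 0\<close>.\<close>
      define l where "l = (b / W) powr (1 / p)"
      have l: "l > 0" "l powr p * W = b" using b 3 p by (auto simp: l_def powr_powr)
      have "N \<le> (a + (p - 1) * l powr p * W) / (p * l powr (p - 1))" by (rule bound[OF l(1)])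
      also have "\<dots> \<le> (b + (p - 1) * b) / (p * l powr (p - 1))"
        using b p l by (intro divide_right_mono) (auto simp: mult.assoc)
      also have "\<dots> = b / l powr (p - 1)" using p by (simp add: field_simps)
      also have "\<dots> = l * W" using l by (simp add: powr_diff field_simps)
      finally have "N powr p \<le> (l * W) powr p" using p by (intro powr_mono2) (auto simp: N_def)
      also have "\<dots> = (l powr p * W) * W powr (p - 1)"
        using l(1) 3 by (simp add: powr_mult powr_diff)
      finally show ?thesis using b l by (simp add: mult.commute)
    qed
    hence "N powr p \<le> W powr (p - 1) * a" by (rule field_le_epsilon)
    thus ?thesis using a unfolding A_def[symmetric] W_def[symmetric] N_def[symmetric]
      by (simp add: ennreal_mult[symmetric] ennreal_leI)
  qed
qed

text \<open>Minkowski's integral inequality with a positive majorant m of the norms of the slices.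
  Jensen with weight m at each x, followed by Tonelli, leaves k m^(1-p) times c m^p for each slice,
  that is c k m. Working with a majorant avoids any discussion of the slice norm as a function of
  t.\<close>

lemma minkowski_integral:
  fixes F :: "real \<Rightarrow> real \<Rightarrow> complex" and k m :: "real \<Rightarrow> real"
  assumes p: "1 < p" and [measurable]: "S \<in> sets lborel" "k \<in> borel_measurable lborel"
      "m \<in> borel_measurable lborel" "(\<lambda>(x, t). F x t) \<in> borel_measurable (lborel \<Otimes>\<^sub>M lborel)"
    and k: "\<And>t. 0 \<le> k t" and m: "\<And>t. 0 < m t" and int: "integrable lborel (\<lambda>t. k t * m t)"
    and le: "\<And>t. k t \<noteq> 0 \<Longrightarrow>
       (\<integral>\<^sup>+x\<in>S. ennreal (norm (F x t) powr p) \<partial>lborel) \<le> ennreal (c * m t powr p)"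
    and c: "0 \<le> c"
  shows "(\<integral>\<^sup>+x\<in>S. ennreal (norm (LINT t|lborel. k t *\<^sub>R F x t) powr p) \<partial>lborel)
     \<le> ennreal (c * (LINT t|lborel. k t * m t) powr p)"
proof -
  define W where "W = (LINT t|lborel. k t * m t)"
  have km: "0 \<le> k t * m t" for t using k m by (simp add: less_imp_le)
  have W0: "0 \<le> W" unfolding W_def using km by (intro integral_nonneg_AE) auto
  have [measurable]: "(\<lambda>t. F x t) \<in> borel_measurable lborel" for x by measurable
  have "(\<integral>\<^sup>+x\<in>S. ennreal (norm (LINT t|lborel. k t *\<^sub>R F x t) powr p) \<partial>lborel)
    \<le> (\<integral>\<^sup>+x. ennreal (W powr (p - 1)) * (\<integral>\<^sup>+t. ennreal (k t * m t powr (1 - p) * norm (F x t) powr p) * indicator S x \<partial>lborel) \<partial>lborel)"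
  proof (rule nn_integral_mono)
    fix x :: real
    show "ennreal (norm (LINT t|lborel. k t *\<^sub>R F x t) powr p) * indicator S x \<le>
       ennreal (W powr (p - 1)) * (\<integral>\<^sup>+t. ennreal (k t * m t powr (1 - p) * norm (F x t) powr p) * indicator S x \<partial>lborel)"
      using weighted_jensen[OF p _ _ _ k m int, of "F x"]
      by (auto simp: W_def indicator_def)
  qed
  also have "\<dots> = ennreal (W powr (p - 1)) * (\<integral>\<^sup>+x. (\<integral>\<^sup>+t. ennreal (k t * m t powr (1 - p) * norm (F x t) powr p) * indicator S x \<partial>lborel) \<partial>lborel)"
    by (rule nn_integral_cmult) measurable
  also have "(\<integral>\<^sup>+x. (\<integral>\<^sup>+t. ennreal (k t * m t powr (1 - p) * norm (F x t) powr p) * indicator S x \<partial>lborel) \<partial>lborel)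
     = (\<integral>\<^sup>+t. (\<integral>\<^sup>+x. ennreal (k t * m t powr (1 - p) * norm (F x t) powr p) * indicator S x \<partial>lborel) \<partial>lborel)"
    by (rule lborel_pair.Fubini'[symmetric]) measurable
  also have "\<dots> \<le> (\<integral>\<^sup>+t. ennreal (c * (k t * m t)) \<partial>lborel)"
  proof (rule nn_integral_mono)
    fix t :: real
    have "(\<integral>\<^sup>+x. ennreal (k t * m t powr (1 - p) * norm (F x t) powr p) * indicator S x \<partial>lborel)
      = (\<integral>\<^sup>+x. ennreal (k t * m t powr (1 - p)) * (ennreal (norm (F x t) powr p) * indicator S x) \<partial>lborel)"
      using k by (intro nn_integral_cong) (simp add: ennreal_mult mult.assoc)
    also have "\<dots> = ennreal (k t * m t powr (1 - p)) * (\<integral>\<^sup>+x\<in>S. ennreal (norm (F x t) powr p) \<partial>lborel)"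
      by (rule nn_integral_cmult) measurable
    also have "\<dots> \<le> ennreal (k t * m t powr (1 - p)) * ennreal (c * m t powr p)"
      by (cases "k t = 0") (auto intro!: mult_left_mono le)
    also have "\<dots> = ennreal (c * (k t * m t))"
      using k[of t] m[of t] c by (simp add: ennreal_mult[symmetric] powr_diff field_simps)
    finally show "(\<integral>\<^sup>+x. ennreal (k t * m t powr (1 - p) * norm (F x t) powr p) * indicator S x \<partial>lborel)
      \<le> ennreal (c * (k t * m t))" .
  qed
  also have "(\<integral>\<^sup>+t. ennreal (c * (k t * m t)) \<partial>lborel) = ennreal (c * W)"
    unfolding W_def using int km c
    by (subst nn_integral_eq_integral) (auto intro!: integrable_mult_right)
  also have "ennreal (W powr (p - 1)) * ennreal (c * W) = ennreal (c * W powr p)"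
    using W0 c by (cases "W = 0") (auto simp: ennreal_mult[symmetric] powr_diff)
  finally show ?thesis by (simp add: W_def mult_left_mono)
qed

section \<open>Circle means and the Poisson integral\<close>

text \<open>Functions are constrained only on the disc. The extension by zero is Borel on the whole
  plane, as the measurability side conditions of Tonelli's theorem demand.\<close>

definition disc_ext :: "(complex \<Rightarrow> complex) \<Rightarrow> complex \<Rightarrow> complex" where
  "disc_ext f z = (if norm z < 1 then f z else 0)"

lemma disc_ext_eq [simp]: "norm z < 1 \<Longrightarrow> disc_ext f z = f z"
  by (simp add: disc_ext_def)

lemma disc_ext_measurable:
  assumes "continuous_on unit_disc f"
  shows "disc_ext f \<in> borel_measurable borel"
proof -
  have "(\<lambda>z. indicator unit_disc z *\<^sub>R f z) \<in> borel_measurable borel"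
    by (intro borel_measurable_continuous_on_indicator assms) auto
  moreover have "(\<lambda>z. indicator unit_disc z *\<^sub>R f z) = disc_ext f"
    by (auto simp: disc_ext_def indicator_def fun_eq_iff)
  ultimately show ?thesis by simp
qed

text \<open>The p-th power of the circle mean without the factor 1/(2 pi). Values in
  \<open>ennreal\<close> let it be combined with other nonnegative integrals without integrability
  conditions.\<close>

definition circle_power :: "real \<Rightarrow> real \<Rightarrow> (complex \<Rightarrow> complex) \<Rightarrow> ennreal" where
  "circle_power p r f =
     (\<integral>\<^sup>+t\<in>{0..2*pi}. ennreal (norm (f (complex_of_real r * cis t)) powr p) \<partial>lborel)"

lemma continuous_on_circle:
  assumes "continuous_on unit_disc f" "0 \<le> r" "r < 1"
  shows "continuous_on A (\<lambda>t. f (complex_of_real r * cis t))"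
  using assms by (intro continuous_on_compose2[OF assms(1)] continuous_intros) (auto simp: norm_mult)

lemma integral_mean_nonneg [simp]: "0 \<le> integral_mean p r f"
  by (simp add: integral_mean_def)

lemma circle_power_eq:
  assumes f: "continuous_on unit_disc f" and r: "0 \<le> r" "r < 1" and p: "0 < p"
  shows "circle_power p r f = ennreal (2 * pi * integral_mean p r f powr p)"
proof -
  let ?g = "\<lambda>t. norm (f (complex_of_real r * cis t)) powr p"
  have "continuous_on {0..2*pi} ?g"
    using p by (intro continuous_on_powr' continuous_on_norm continuous_on_circle f r continuous_intros) auto
  hence int: "set_integrable lborel {0..2*pi} ?g" by (intro borel_integrable_atLeastAtMost')
  have "circle_power p r f = (\<integral>\<^sup>+t. ennreal (indicator {0..2*pi} t *\<^sub>R ?g t) \<partial>lborel)"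
    unfolding circle_power_def by (intro nn_integral_cong) (auto simp: indicator_def)
  also have "\<dots> = ennreal (LINT t:{0..2*pi}|lborel. ?g t)"
    using int unfolding set_lebesgue_integral_def set_integrable_def
    by (intro nn_integral_eq_integral) auto
  also have "(LINT t:{0..2*pi}|lborel. ?g t) = 2 * pi * integral_mean p r f powr p"
  proof -
    have "0 \<le> (LINT t:{0..2*pi}|lborel. ?g t)"
      unfolding set_lebesgue_integral_def by (intro integral_nonneg_AE) auto
    thus ?thesis using p by (simp add: integral_mean_def powr_powr)
  qed
  finally show ?thesis .
qed

text \<open>The bridge between real means and extended integrals: estimates are proved for
  \<open>circle_power\<close> and read off through this equivalence.\<close>

lemma integral_mean_le_iff:
  assumes f: "continuous_on unit_disc f" and r: "0 \<le> r" "r < 1" and p: "0 < p" and m: "0 \<le> m"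
  shows "integral_mean p r f \<le> m \<longleftrightarrow> circle_power p r f \<le> ennreal (2 * pi * m powr p)"
  using m p by (simp add: circle_power_eq[OF f r p] powr_mono2 ennreal_le_iff)
    (meson integral_mean_nonneg not_le powr_less_mono2 powr_mono2 less_imp_le)

lemma circle_power_cong:
  assumes "\<And>z. norm z = \<bar>r\<bar> \<Longrightarrow> norm (f z) = norm (g z)"
  shows "circle_power p r f = circle_power p r g"
  unfolding circle_power_def
  by (intro nn_integral_cong arg_cong2[of _ _ _ _ "(*)"] refl) (simp add: assms norm_mult)

lemma nn_integral_shift_interval:
  fixes h :: "real \<Rightarrow> ennreal"
  assumes [measurable]: "h \<in> borel_measurable borel"
  shows "(\<integral>\<^sup>+x\<in>{u..v}. h (x + a) \<partial>lborel) = (\<integral>\<^sup>+x\<in>{u+a..v+a}. h x \<partial>lborel)"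
  by (subst (2) nn_integral_real_affine[where c=1 and t=a])
     (auto intro!: nn_integral_cong simp: indicator_def add.commute)

lemma nn_integral_split_interval:
  fixes h :: "real \<Rightarrow> ennreal"
  assumes [measurable]: "h \<in> borel_measurable borel" and "u \<le> v" "v \<le> w"
  shows "(\<integral>\<^sup>+x\<in>{u..w}. h x \<partial>lborel) = (\<integral>\<^sup>+x\<in>{u..v}. h x \<partial>lborel) + (\<integral>\<^sup>+x\<in>{v..w}. h x \<partial>lborel)"
proof -
  have "(\<integral>\<^sup>+x\<in>{u..w}. h x \<partial>lborel) = (\<integral>\<^sup>+x. h x * indicator {u..v} x + h x * indicator {v..w} x \<partial>lborel)"
    using AE_lborel_singleton[of v] assms(2,3)
    by (intro nn_integral_cong_AE) (auto elim!: eventually_mono simp: indicator_def)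
  thus ?thesis by (simp add: nn_integral_add)
qed

lemma nn_integral_periodic_shift:
  fixes h :: "real \<Rightarrow> ennreal"
  assumes [measurable]: "h \<in> borel_measurable borel" and per: "\<And>x. h (x + 2 * pi) = h x"
  shows "(\<integral>\<^sup>+x\<in>{0..2*pi}. h (x + a) \<partial>lborel) = (\<integral>\<^sup>+x\<in>{0..2*pi}. h x \<partial>lborel)"
proof -
  have pern: "h (x + 2 * pi * real n) = h x" for x n
  proof (induction n)
    case (Suc n)
    have "h (x + 2 * pi * real (Suc n)) = h ((x + 2 * pi * real n) + 2 * pi)" by (simp add: algebra_simps)
    thus ?case using Suc per by simp
  qed simp
  have peri: "h (x + 2 * pi * of_int n) = h x" for x n
  proof (cases "n \<ge> 0")
    case True thus ?thesis using pern[of x "nat n"] by simp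
  next
    case False thus ?thesis using pern[of "x + 2 * pi * of_int n" "nat (-n)"] by simp
  qed
  \<comment> \<open>The shift is reduced to one period, so that the shifted interval is cut only
    once, at 2 pi.\<close>
  define b where "b = a - 2 * pi * of_int \<lfloor>a / (2 * pi)\<rfloor>"
  have b: "0 \<le> b" "b \<le> 2 * pi"
    using floor_divide_lower[of "2*pi" a] floor_divide_upper[of "2*pi" a]
    by (auto simp: b_def algebra_simps)
  have hab: "h (x + a) = h (x + b)" for x
    using peri[of "x + b" "\<lfloor>a / (2 * pi)\<rfloor>"] by (simp add: b_def)
  have "(\<integral>\<^sup>+x\<in>{0..2*pi}. h (x + b) \<partial>lborel) = (\<integral>\<^sup>+x\<in>{b..2*pi+b}. h x \<partial>lborel)"
    by (simp add: nn_integral_shift_interval)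
  also have "\<dots> = (\<integral>\<^sup>+x\<in>{b..2*pi}. h x \<partial>lborel) + (\<integral>\<^sup>+x\<in>{0+2*pi..b+2*pi}. h x \<partial>lborel)"
    using b by (subst nn_integral_split_interval[of h b "2*pi"]) (auto simp: add.commute)
  also have "(\<integral>\<^sup>+x\<in>{0+2*pi..b+2*pi}. h x \<partial>lborel) = (\<integral>\<^sup>+x\<in>{0..b}. h x \<partial>lborel)"
    by (subst nn_integral_shift_interval[symmetric]) (simp_all add: per)
  also have "(\<integral>\<^sup>+x\<in>{b..2*pi}. h x \<partial>lborel) + (\<integral>\<^sup>+x\<in>{0..b}. h x \<partial>lborel) = (\<integral>\<^sup>+x\<in>{0..2*pi}. h x \<partial>lborel)"
    using b by (subst nn_integral_split_interval[of h 0 b]) (auto simp: add.commute)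
  finally show ?thesis by (simp add: hab)
qed

lemma cis_measurable [measurable]: "cis \<in> borel_measurable borel"
  by (intro borel_measurable_continuous_onI continuous_intros)

lemma circle_power_rotate:
  assumes f: "continuous_on unit_disc f" and r: "0 \<le> r" "r < 1"
  shows "circle_power p r (\<lambda>z. f (cis a * z)) = circle_power p r f"
proof -
  have [measurable]: "disc_ext f \<in> borel_measurable borel" using f by (rule disc_ext_measurable)
  define h where "h = (\<lambda>t. ennreal (norm (disc_ext f (complex_of_real r * cis t)) powr p))"
  have eq: "circle_power p r (\<lambda>z. f (cis a * z)) = (\<integral>\<^sup>+x\<in>{0..2*pi}. h (x + a) \<partial>lborel)"
    unfolding circle_power_def h_def using r
    by (intro nn_integral_cong) (simp add: norm_mult cis_mult[symmetric] mult_ac)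
  have "h \<in> borel_measurable borel" unfolding h_def by measurable
  moreover have "h (x + 2 * pi) = h x" for x by (simp add: h_def cis_mult[symmetric])
  ultimately have "(\<integral>\<^sup>+x\<in>{0..2*pi}. h (x + a) \<partial>lborel) = (\<integral>\<^sup>+x\<in>{0..2*pi}. h x \<partial>lborel)"
    by (rule nn_integral_periodic_shift)
  also have "\<dots> = circle_power p r f"
    unfolding circle_power_def h_def using r by (intro nn_integral_cong) (simp add: norm_mult)
  finally show ?thesis using eq by simp
qed

section \<open>The Poisson kernel and Cauchy's formula on circles\<close>

definition poisson :: "real \<Rightarrow> real \<Rightarrow> real" where
  "poisson r t = (1 - r\<^sup>2) / (norm (1 - complex_of_real r * cis t))\<^sup>2"

lemma one_minus_cis_nonzero:
  assumes "0 \<le> r" "r < 1" shows "1 - complex_of_real r * cis t \<noteq> 0"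
proof
  assume "1 - complex_of_real r * cis t = 0"
  hence "norm (complex_of_real r * cis t) = norm (1::complex)" by simp
  thus False using assms by (simp add: norm_mult)
qed

lemma norm_one_minus_cis_sq:
  "complex_of_real ((norm (1 - complex_of_real r * cis t))\<^sup>2) =
     (1 - complex_of_real r * cis t) * (1 - complex_of_real r * cis (-t))"
  by (simp only: complex_norm_square) (simp add: cis_cnj)

lemma set_lebesgue_integral_of_has_integral:
  fixes f :: "real \<Rightarrow> complex"
  assumes "continuous_on {a..b} f" "(f has_integral I) {a..b}"
  shows "(LINT t:{a..b}|lborel. f t) = I"
proof -
  have "set_integrable lborel {a..b} f" using assms(1) by (intro borel_integrable_atLeastAtMost')
  thus ?thesis using assms(2) set_borel_integral_eq_integral(2) integral_unique by metis
qed

lemma scaled_circle_continuous: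
  assumes "f holomorphic_on unit_disc" "0 < R" "R < 1"
  shows "continuous_on (cball 0 1) (\<lambda>w. f (complex_of_real R * w))"
    "(\<lambda>w. f (complex_of_real R * w)) holomorphic_on ball 0 1"
proof -
  have *: "norm (complex_of_real R * w) < 1" if "norm w \<le> 1" for w
  proof -
    have "R * norm w \<le> R * 1" using that assms by (intro mult_left_mono) auto
    hence "R * norm w < 1" using assms by linarith
    thus ?thesis using assms by (simp add: norm_mult)
  qed
  have "f holomorphic_on (*) (complex_of_real R) ` cball 0 1"
    using * by (intro holomorphic_on_subset[OF assms(1)]) auto
  hence "(f \<circ> (*) (complex_of_real R)) holomorphic_on cball 0 1"
    by (intro holomorphic_on_compose holomorphic_intros)
  thus "(\<lambda>w. f (complex_of_real R * w)) holomorphic_on ball 0 1" 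
    "continuous_on (cball 0 1) (\<lambda>w. f (complex_of_real R * w))"
    by (auto simp: o_def intro: holomorphic_on_imp_continuous_on holomorphic_on_subset)
qed

lemma minus_ii_cancel: "(- \<i>) * (a * \<i> * c) = a * c" for a c :: complex
  by (simp add: complex_eq_iff)

lemma holomorphic_on_rotate:
  assumes "f holomorphic_on unit_disc"
  shows "(\<lambda>z. f (cis a * z)) holomorphic_on unit_disc"
proof -
  have "(f \<circ> (*) (cis a)) holomorphic_on unit_disc"
    by (rule holomorphic_on_compose_gen[OF _ assms]) (auto simp: norm_mult intro!: holomorphic_intros)
  thus ?thesis by (simp add: o_def)
qed

text \<open>Cauchy's formula at the point r for u(w) = f(R w) (1 - r^2)/(1 - r w): the additional
  factor is 1 at w = r and turns the Cauchy kernel into the Poisson kernel on the unit circle.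
  Dilating by R < 1 gives continuity up to the circle. A point on the positive axis is enough, since
  f can be rotated.\<close>

lemma poisson_formula:
  fixes f :: "complex \<Rightarrow> complex"
  assumes f: "f holomorphic_on unit_disc" and R: "0 < R" "R < 1" and r: "0 \<le> r" "r < 1"
  shows "(LINT t:{0..2*pi}|lborel. poisson r t *\<^sub>R f (complex_of_real R * cis t)) = 2 * pi * f (R * r)"
proof -
  define u where "u = (\<lambda>w. f (complex_of_real R * w) * (1 - complex_of_real r ^ 2) / (1 - complex_of_real r * w))"
  have nz: "1 - complex_of_real r * w \<noteq> 0" if "norm w \<le> 1" for w
  proof
    assume "1 - complex_of_real r * w = 0"
    hence "norm (complex_of_real r * w) = norm (1::complex)" by simp
    thus False using that r mult_left_le[of "norm w" r] by (simp add: norm_mult)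
  qed
  have "continuous_on (cball 0 1) u" "u holomorphic_on ball 0 1" unfolding u_def
    using nz scaled_circle_continuous[OF f R]
    by (auto intro!: continuous_intros holomorphic_intros)
  hence "((\<lambda>w. u w / (w - of_real r)) has_contour_integral (2 * of_real pi * \<i> * u (of_real r))) (circlepath 0 1)"
    using r by (intro Cauchy_integral_circlepath) auto
  hence "((\<lambda>t. u (cis t) / (cis t - of_real r) * \<i> * cis t) has_integral (2 * of_real pi * \<i> * u (of_real r))) {0..2*pi}"
    unfolding circlepath_def by (subst (asm) has_contour_integral_part_circlepath_iff) auto
  hence "((\<lambda>t. (-\<i>) * (u (cis t) / (cis t - of_real r) * \<i> * cis t)) has_integral (-\<i>) * (2 * of_real pi * \<i> * u (of_real r))) {0..2*pi}"
    by (rule has_integral_mult_right)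
  moreover have "(-\<i>) * (u (cis t) / (cis t - of_real r) * \<i> * cis t) = poisson r t *\<^sub>R f (of_real R * cis t)" for t
  proof -
    have c: "cis t - of_real r = cis t * (1 - of_real r * cis (-t))"
      by (simp add: algebra_simps cis_mult)
    have "complex_of_real (poisson r t) = (1 - of_real r ^ 2) / ((1 - complex_of_real r * cis t) * (1 - complex_of_real r * cis (-t)))"
      unfolding poisson_def using norm_one_minus_cis_sq[of r t] by simp
    moreover have "1 - complex_of_real r * cis t \<noteq> 0" "1 - complex_of_real r * cis (-t) \<noteq> 0"
      using one_minus_cis_nonzero[OF r] by blast+
    moreover have gen: "(-\<i>) * (F * q / A / (c * B) * \<i> * c) = q / (A * B) * F"
      if "A \<noteq> 0" "B \<noteq> 0" "c \<noteq> 0" for F q A B c :: complex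
      using that by (simp add: field_simps)
    ultimately show ?thesis
      unfolding u_def c scaleR_conv_of_real by (simp only:) (rule gen, auto)
  qed
  moreover have "(-\<i>) * (2 * of_real pi * \<i> * u (of_real r)) = 2 * pi * f (R * r)"
  proof -
    have "u (of_real r) = f (R * r)" using nz[of "of_real r"] r unfolding u_def
      by (simp add: power2_eq_square)
    thus ?thesis by (simp add: algebra_simps)
  qed
  ultimately have "((\<lambda>t. poisson r t *\<^sub>R f (of_real R * cis t)) has_integral (2 * pi * f (R * r))) {0..2*pi}"
    by (simp only:)
  moreover have "continuous_on {0..2*pi} (\<lambda>t. poisson r t *\<^sub>R f (of_real R * cis t))"
    unfolding poisson_def using f R one_minus_cis_nonzero[OF r]
    by (intro continuous_intros continuous_on_circle holomorphic_on_imp_continuous_on) auto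
  ultimately show ?thesis by (intro set_lebesgue_integral_of_has_integral) simp_all
qed

text \<open>Cauchy's formula for the first derivative of w -> f(R w); the factor R comes from the
  chain rule.\<close>

lemma deriv_kernel_formula:
  fixes f :: "complex \<Rightarrow> complex"
  assumes f: "f holomorphic_on unit_disc" and R: "0 < R" "R < 1" and r: "0 \<le> r" "r < 1"
  shows "(LINT t:{0..2*pi}|lborel. cis t / (cis t - of_real r)\<^sup>2 * f (complex_of_real R * cis t)) = 2 * pi * (R * deriv f (R * r))"
proof -
  define u where "u = (\<lambda>w. f (complex_of_real R * w))"
  have "((\<lambda>w. u w / (w - of_real r) ^ Suc 1) has_contour_integral (2 * of_real pi * \<i> * deriv u (of_real r))) (circlepath 0 1)"
    using Cauchy_has_contour_integral_higher_derivative_circlepath[OF scaled_circle_continuous[OF f R], of "of_real r" 1] r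
    by (simp add: u_def)
  hence "((\<lambda>t. u (cis t) / (cis t - of_real r) ^ Suc 1 * \<i> * cis t) has_integral (2 * of_real pi * \<i> * deriv u (of_real r))) {0..2*pi}"
    unfolding circlepath_def by (subst (asm) has_contour_integral_part_circlepath_iff) auto
  hence "((\<lambda>t. (-\<i>) * (u (cis t) / (cis t - of_real r) ^ Suc 1 * \<i> * cis t)) has_integral (-\<i>) * (2 * of_real pi * \<i> * deriv u (of_real r))) {0..2*pi}"
    by (rule has_integral_mult_right)
  moreover have "(-\<i>) * (u (cis t) / (cis t - of_real r) ^ Suc 1 * \<i> * cis t) = cis t / (cis t - of_real r)\<^sup>2 * f (of_real R * cis t)" for t
    unfolding minus_ii_cancel by (simp add: u_def power2_eq_square)
  moreover have "deriv u (of_real r) = R * deriv f (R * r)"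
  proof -
    have "R * r < 1" using R r by (smt (verit) mult_left_le)
    hence "f field_differentiable at (of_real R * of_real r)"
      using f R r by (intro holomorphic_on_imp_differentiable_at[OF f]) (auto simp: norm_mult)
    hence "(f has_field_derivative deriv f (of_real R * of_real r)) (at (of_real R * of_real r))"
      by (simp add: field_differentiable_derivI)
    hence "((\<lambda>w. f (complex_of_real R * w)) has_field_derivative deriv f (of_real R * of_real r) * of_real R) (at (of_real r))"
      by (rule DERIV_chain2) (auto intro!: derivative_eq_intros)
    thus ?thesis unfolding u_def by (simp add: DERIV_imp_deriv mult.commute)
  qed
  ultimately have "((\<lambda>t. cis t / (cis t - of_real r)\<^sup>2 * f (of_real R * cis t)) has_integral (2 * pi * (R * deriv f (R * r)))) {0..2*pi}"
    by (simp add: algebra_simps)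
  moreover have "cis t - of_real r \<noteq> 0" for t
  proof
    assume "cis t - of_real r = 0"
    hence "norm (cis t) = norm (complex_of_real r)" by simp
    thus False using r by simp
  qed
  hence "continuous_on {0..2*pi} (\<lambda>t. cis t / (cis t - of_real r)\<^sup>2 * f (of_real R * cis t))"
    using f R by (intro continuous_intros continuous_on_circle holomorphic_on_imp_continuous_on) auto
  ultimately show ?thesis by (intro set_lebesgue_integral_of_has_integral) simp_all
qed

lemma poisson_nonneg: "0 \<le> r \<Longrightarrow> r < 1 \<Longrightarrow> 0 \<le> poisson r t"
  by (auto simp: poisson_def intro!: divide_nonneg_nonneg power_le_one)

lemma poisson_continuous:
  assumes "0 \<le> r" "r < 1" shows "continuous_on A (poisson r)"
  unfolding poisson_def using one_minus_cis_nonzero[OF assms] by (intro continuous_intros) auto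

lemma poisson_measurable [measurable]: "poisson r \<in> borel_measurable borel"
  unfolding poisson_def by measurable

lemma poisson_integrable:
  assumes "0 \<le> r" "r < 1" shows "set_integrable lborel {a..b} (poisson r)"
  by (intro borel_integrable_atLeastAtMost' poisson_continuous assms)

lemma poisson_integral:
  assumes "0 \<le> r" "r < 1" shows "(LINT t:{0..2*pi}|lborel. poisson r t) = 2 * pi"
proof -
  have "complex_of_real (LINT t:{0..2*pi}|lborel. poisson r t) = (LINT t:{0..2*pi}|lborel. complex_of_real (poisson r t))"
    by (rule set_integral_complex_of_real[symmetric])
  also have "\<dots> = 2 * pi" using poisson_formula[of "\<lambda>_. 1" "1/2" r] assms
    by (simp add: scaleR_conv_of_real)
  finally show ?thesis using of_real_eq_iff by blast
qed

section \<open>Means of integrals over rotations and dilations\<close>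

lemma circle_minkowski:
  fixes K :: "real \<Rightarrow> complex" and F :: "real \<Rightarrow> real \<Rightarrow> complex" and m :: "real \<Rightarrow> real"
  assumes p: "1 < p" and [measurable]: "S \<in> sets lborel" "T \<in> sets lborel" "K \<in> borel_measurable borel"
      "m \<in> borel_measurable borel" "(\<lambda>(x, t). F x t) \<in> borel_measurable (lborel \<Otimes>\<^sub>M lborel)"
    and m: "\<And>t. 0 < m t" and int: "set_integrable lborel T (\<lambda>t. norm (K t) * m t)"
    and le: "\<And>t. t \<in> T \<Longrightarrow> (\<integral>\<^sup>+x\<in>S. ennreal (norm (F x t) powr p) \<partial>lborel) \<le> ennreal (c * m t powr p)"
    and c: "0 \<le> c"
  shows "(\<integral>\<^sup>+x\<in>S. ennreal (norm (LINT t:T|lborel. K t * F x t) powr p) \<partial>lborel)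
     \<le> ennreal (c * (LINT t:T|lborel. norm (K t) * m t) powr p)"
proof -
  define k where "k = (\<lambda>t. indicator T t * norm (K t))"
  \<comment> \<open>The phase of the kernel is moved into F, which leaves a nonnegative weight;
    where K vanishes both sides are 0.\<close>
  define F' where "F' = (\<lambda>x t. sgn (K t) * F x t)"
  have [measurable]: "k \<in> borel_measurable lborel" unfolding k_def by measurable
  have [measurable]: "sgn \<in> borel_measurable (borel :: complex measure)"
    unfolding sgn_div_norm[abs_def] by measurable
  have eq: "k t *\<^sub>R F' x t = indicator T t *\<^sub>R (K t * F x t)" for x t
    unfolding k_def F'_def sgn_div_norm by (cases "K t = 0") (auto simp: indicator_def scaleR_conv_of_real)
  have "(\<integral>\<^sup>+x\<in>S. ennreal (norm (LINT t|lborel. k t *\<^sub>R F' x t) powr p) \<partial>lborel)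
     \<le> ennreal (c * (LINT t|lborel. k t * m t) powr p)"
  proof (rule minkowski_integral[OF p])
    show "(\<lambda>(x, t). F' x t) \<in> borel_measurable (lborel \<Otimes>\<^sub>M lborel)" unfolding F'_def by measurable
    show "integrable lborel (\<lambda>t. k t * m t)"
      using int by (simp add: set_integrable_def k_def mult.assoc)
    show "0 \<le> k t" for t by (simp add: k_def)
    fix t assume t: "k t \<noteq> 0"
    hence "t \<in> T" "K t \<noteq> 0" by (auto simp: k_def indicator_def split: if_splits)
    thus "(\<integral>\<^sup>+x\<in>S. ennreal (norm (F' x t) powr p) \<partial>lborel) \<le> ennreal (c * m t powr p)"
      using le[of t] by (simp add: F'_def norm_mult norm_sgn)
  qed (use assms in simp_all)
  thus ?thesis unfolding eq by (simp add: set_lebesgue_integral_def k_def mult.assoc)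
qed

lemma circle_power_scale_rotate:
  assumes f: "continuous_on unit_disc f" and R: "0 \<le> R" "R < 1" and w: "norm w \<le> 1"
  shows "(\<integral>\<^sup>+x\<in>{0..2*pi}. ennreal (norm (f (cis x * (R * w))) powr p) \<partial>lborel) = circle_power p (R * norm w) f"
proof -
  obtain a where a: "w = of_real (norm w) * cis a"
    using rcis_cmod_Arg[of w] unfolding rcis_def by metis
  have "R * norm w \<le> R * 1" using w R by (intro mult_left_mono) auto
  hence "circle_power p (R * norm w) f = circle_power p (R * norm w) (\<lambda>z. f (cis a * z))"
    using R by (intro circle_power_rotate[symmetric] f) auto
  also have "\<dots> = (\<integral>\<^sup>+x\<in>{0..2*pi}. ennreal (norm (f (cis x * (R * w))) powr p) \<partial>lborel)"
    unfolding circle_power_def by (subst (2) a) (simp add: mult_ac)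
  finally show ?thesis by simp
qed

text \<open>The Poisson formula writes f on the circle of radius r as an average of rotations of f
  on the circle of radius R. All rotations have the same mean, and the kernel has total mass 1 after
  division by 2 pi, so Minkowski's inequality gives the claim.\<close>

lemma integral_mean_mono:
  assumes f: "f holomorphic_on unit_disc" and p: "1 < p" and r: "0 \<le> r" "r \<le> R" "R < 1"
  shows "integral_mean p r f \<le> integral_mean p R f"
proof (cases "R = 0 \<or> r = R")
  case True thus ?thesis using r by auto
next
  case False
  hence R: "0 < R" "R < 1" and q: "0 \<le> r / R" "r / R < 1" using r by auto
  have cf: "continuous_on unit_disc f" using f by (rule holomorphic_on_imp_continuous_on)
  have [measurable]: "disc_ext f \<in> borel_measurable borel" using cf by (rule disc_ext_measurable)
  show ?thesis
  proof (rule field_le_epsilon)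
    fix e :: real assume e: "0 < e"
    \<comment> \<open>Minkowski's inequality asks for a positive majorant, hence the slack
      e.\<close>
    define m where "m = integral_mean p R f + e"
    have m: "0 < m" using e by (simp add: m_def add_nonneg_pos)
    define K where "K = (\<lambda>t. complex_of_real (poisson (r/R) t / (2 * pi)))"
    define F where "F = (\<lambda>x t. disc_ext f (cis x * (R * cis t)))"
    have nK: "norm (K t) = poisson (r/R) t / (2 * pi)" for t
      unfolding K_def norm_of_real using poisson_nonneg[OF q, of t] by simp
    have [measurable]: "K \<in> borel_measurable borel" unfolding K_def by measurable
    have "(\<integral>\<^sup>+x\<in>{0..2*pi}. ennreal (norm (LINT t:{0..2*pi}|lborel. K t * F x t) powr p) \<partial>lborel)
       \<le> ennreal (2 * pi * (LINT t:{0..2*pi}|lborel. norm (K t) * m) powr p)"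
    proof (rule circle_minkowski[OF p])
      show "(\<lambda>(x, t). F x t) \<in> borel_measurable (lborel \<Otimes>\<^sub>M lborel)" unfolding F_def by measurable
      show "set_integrable lborel {0..2*pi} (\<lambda>t. norm (K t) * m)"
        unfolding nK using poisson_integrable[OF q] by (intro set_integrable_mult_left) simp
      fix t :: real
      have "(\<integral>\<^sup>+x\<in>{0..2*pi}. ennreal (norm (F x t) powr p) \<partial>lborel) = 
         (\<integral>\<^sup>+x\<in>{0..2*pi}. ennreal (norm (f (cis x * (R * cis t))) powr p) \<partial>lborel)"
        using R unfolding F_def by (intro nn_integral_cong) (simp add: norm_mult)
      also have "\<dots> = circle_power p R f"
        using circle_power_scale_rotate[OF cf, of R "cis t"] R by simp
      also have "\<dots> \<le> ennreal (2 * pi * m powr p)"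
        using integral_mean_le_iff[OF cf, of R p m] R p m e by (simp add: m_def)
      finally show "(\<integral>\<^sup>+x\<in>{0..2*pi}. ennreal (norm (F x t) powr p) \<partial>lborel) \<le> ennreal (2 * pi * m powr p)" .
    qed (use m in auto)
    also have "(LINT t:{0..2*pi}|lborel. norm (K t) * m) = m"
      unfolding nK using poisson_integral[OF q] by simp
    also have "(\<integral>\<^sup>+x\<in>{0..2*pi}. ennreal (norm (LINT t:{0..2*pi}|lborel. K t * F x t) powr p) \<partial>lborel) = circle_power p r f"
      unfolding circle_power_def
    proof (intro nn_integral_cong arg_cong2[of _ _ _ _ "(*)"] refl)
      fix x :: real
      have "(\<lambda>z. f (cis x * z)) holomorphic_on unit_disc"
        by (rule holomorphic_on_rotate[OF f])
      from poisson_formula[OF this R q]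
      have "f (cis x * of_real r) = (1 / (2 * pi)) * (LINT t:{0..2*pi}|lborel. poisson (r/R) t *\<^sub>R f (cis x * (R * cis t)))"
        using R by simp
      also have "\<dots> = (LINT t:{0..2*pi}|lborel. (1 / (2 * pi)) * (poisson (r/R) t *\<^sub>R f (cis x * (R * cis t))))"
        by (rule set_integral_mult_right[symmetric])
      also have "\<dots> = (LINT t:{0..2*pi}|lborel. K t * F x t)"
        using R by (intro set_lebesgue_integral_cong) (auto simp: K_def F_def norm_mult scaleR_conv_of_real)
      finally show "ennreal (norm (LINT t:{0..2*pi}|lborel. K t * F x t) powr p) = ennreal (norm (f (of_real r * cis x)) powr p)"
        by (simp add: mult.commute)
    qed
    finally show "integral_mean p r f \<le> integral_mean p R f + e"
      using integral_mean_le_iff[OF cf, of r p m] r p m by (simp add: m_def)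
  qed
qed

lemma norm_cis_minus: "norm (cis t - of_real r) = norm (1 - complex_of_real r * cis t)"
proof -
  have "cis t - of_real r = cis t * cnj (1 - complex_of_real r * cis t)"
    by (simp add: algebra_simps cis_cnj cis_mult)
  thus ?thesis by (simp only: norm_mult norm_cis complex_mod_cnj mult_1)
qed

text \<open>Minkowski's inequality for Cauchy's derivative formula, whose kernel has modulus |1 - r
  e^(it)|^(-2). Subtracting the constant b f(R e^(ix)) leaves the derivative unchanged. With b = 0
  this is the plain Cauchy estimate; with b = 1 differences of rotations appear, and their smallness
  near t = 0 compensates the singularity of the kernel.\<close>

lemma deriv_mean_bound:
  fixes b :: complex
  assumes f: "f holomorphic_on unit_disc" and p: "1 < p" and R: "0 < R" "R < 1" and r: "0 \<le> r" "r < 1"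
    and [measurable]: "m \<in> borel_measurable borel" and m: "\<And>t. 0 < m t"
    and int: "set_integrable lborel {0..2*pi} (\<lambda>t. m t / (norm (1 - complex_of_real r * cis t))\<^sup>2)"
    and b: "b = 0 \<or> b = 1"
    and le: "\<And>t. t \<in> {0..2*pi} \<Longrightarrow> integral_mean p R (\<lambda>z. f (cis t * z) - b * f z) \<le> m t"
  shows "R * integral_mean p (R * r) (deriv f) \<le>
    (LINT t:{0..2*pi}|lborel. m t / (norm (1 - complex_of_real r * cis t))\<^sup>2) / (2 * pi)"
proof -
  have cf: "continuous_on unit_disc f" using f by (rule holomorphic_on_imp_continuous_on)
  have [measurable]: "disc_ext f \<in> borel_measurable borel" using cf by (rule disc_ext_measurable)
  define K where "K = (\<lambda>t. cis t / (cis t - of_real r)\<^sup>2 / of_real (2 * pi))"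
  define F where "F = (\<lambda>x t. disc_ext f (cis x * (R * cis t)) - b * disc_ext f (cis x * of_real R))"
  have nK: "norm (K t) * m t = m t / (norm (1 - complex_of_real r * cis t))\<^sup>2 / (2 * pi)" for t
    unfolding K_def by (simp add: norm_divide norm_mult norm_power norm_cis_minus)
  have [measurable]: "K \<in> borel_measurable borel" unfolding K_def by measurable
  have KI: "set_integrable lborel {0..2*pi} (\<lambda>t. norm (K t) * m t)"
    unfolding nK using int by (intro set_integrable_divide) simp
  define W where "W = (LINT t:{0..2*pi}|lborel. norm (K t) * m t)"
  have W0: "0 \<le> W" unfolding W_def set_lebesgue_integral_def using m
    by (intro integral_nonneg_AE) (auto intro!: AE_I2 mult_nonneg_nonneg simp: less_imp_le)
  have "(\<integral>\<^sup>+x\<in>{0..2*pi}. ennreal (norm (LINT t:{0..2*pi}|lborel. K t * F x t) powr p) \<partial>lborel)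
       \<le> ennreal (2 * pi * W powr p)" unfolding W_def
  proof (rule circle_minkowski[OF p])
    show "(\<lambda>(x, t). F x t) \<in> borel_measurable (lborel \<Otimes>\<^sub>M lborel)" unfolding F_def by measurable
    show "set_integrable lborel {0..2*pi} (\<lambda>t. norm (K t) * m t)" by (rule KI)
    fix t :: real assume t: "t \<in> {0..2*pi}"
    have c: "continuous_on unit_disc (\<lambda>z. f (cis t * z) - b * f z)"
      using holomorphic_on_rotate[OF f, of t] f
      by (intro continuous_intros holomorphic_on_imp_continuous_on)
    have "(\<integral>\<^sup>+x\<in>{0..2*pi}. ennreal (norm (F x t) powr p) \<partial>lborel) = circle_power p R (\<lambda>z. f (cis t * z) - b * f z)"
      using R unfolding F_def circle_power_def
      by (intro nn_integral_cong) (simp add: norm_mult mult_ac)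
    also have "\<dots> \<le> ennreal (2 * pi * m t powr p)"
      using integral_mean_le_iff[OF c, of R p "m t"] R p m[of t] le[OF t] by simp
    finally show "(\<integral>\<^sup>+x\<in>{0..2*pi}. ennreal (norm (F x t) powr p) \<partial>lborel) \<le> ennreal (2 * pi * m t powr p)" .
  qed (use m in auto)
  moreover have "norm (LINT t:{0..2*pi}|lborel. K t * F x t) = R * norm (deriv f (of_real (R * r) * cis x))" for x
  proof -
    let ?f = "\<lambda>z. f (cis x * z) - b * f (cis x * of_real R)"
    have h: "?f holomorphic_on unit_disc"
      using holomorphic_on_rotate[OF f, of x] by (intro holomorphic_intros)
    have Rr: "R * r < 1" using R r by (smt (verit) mult_left_le)
    have "f field_differentiable at (cis x * of_real (R * r))"
      using Rr R r by (intro holomorphic_on_imp_differentiable_at[OF f]) (auto simp: norm_mult)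
    hence "(f has_field_derivative deriv f (cis x * of_real (R * r))) (at (cis x * of_real (R * r)))"
      by (simp add: field_differentiable_derivI)
    hence "((\<lambda>z. f (cis x * z)) has_field_derivative deriv f (cis x * of_real (R * r)) * cis x) (at (of_real (R * r)))"
      by (rule DERIV_chain2) (auto intro!: derivative_eq_intros)
    hence "(?f has_field_derivative deriv f (cis x * of_real (R * r)) * cis x) (at (of_real (R * r)))"
      by (auto intro!: derivative_eq_intros)
    hence d: "deriv ?f (of_real (R * r)) = deriv f (cis x * of_real (R * r)) * cis x"
      by (rule DERIV_imp_deriv)
    have "(LINT t:{0..2*pi}|lborel. K t * F x t) = (LINT t:{0..2*pi}|lborel. (1 / of_real (2 * pi)) * (cis t / (cis t - of_real r)\<^sup>2 * ?f (complex_of_real R * cis t)))"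
      using R by (intro set_lebesgue_integral_cong) (auto simp: K_def F_def norm_mult)
    also have "\<dots> = (1 / of_real (2 * pi)) * (LINT t:{0..2*pi}|lborel. cis t / (cis t - of_real r)\<^sup>2 * ?f (complex_of_real R * cis t))"
      by (rule set_integral_mult_right)
    also have "(LINT t:{0..2*pi}|lborel. cis t / (cis t - of_real r)\<^sup>2 * ?f (complex_of_real R * cis t)) = 2 * pi * (R * deriv ?f (R * r))"
      using deriv_kernel_formula[OF h R r] by simp
    also have "(1 / of_real (2 * pi)) * (2 * pi * (R * deriv ?f (R * r))) = R * deriv ?f (of_real (R * r))" by simp
    finally have "norm (LINT t:{0..2*pi}|lborel. K t * F x t) = norm (R * deriv ?f (of_real (R * r)))"
      by (rule arg_cong)
    thus ?thesis using R unfolding d by (simp add: norm_mult mult_ac)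
  qed
  ultimately have "circle_power p (R * r) (\<lambda>z. R * deriv f z) \<le> ennreal (2 * pi * W powr p)"
    using R by (simp add: circle_power_def norm_mult)
  moreover have c: "continuous_on unit_disc (\<lambda>z. R * deriv f z)"
    using f by (intro continuous_intros holomorphic_on_imp_continuous_on holomorphic_deriv) auto
  moreover have "R * r < 1" using R r by (smt (verit) mult_left_le)
  ultimately have "integral_mean p (R * r) (\<lambda>z. R * deriv f z) \<le> W"
    using integral_mean_le_iff[OF c, of "R*r" p W] R r p W0 by simp
  moreover have "integral_mean p (R * r) (\<lambda>z. R * deriv f z) = R * integral_mean p (R * r) (deriv f)"
  proof -
    have "(1 / (2 * pi) * (LINT t:{0..2*pi}|lborel. R powr p * norm (deriv f (complex_of_real (R*r) * cis t)) powr p)) powr (1 / p)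
       = (R powr p * (1 / (2 * pi) * (LINT t:{0..2*pi}|lborel. norm (deriv f (complex_of_real (R*r) * cis t)) powr p))) powr (1 / p)"
      by simp
    also have "\<dots> = R * integral_mean p (R * r) (deriv f)"
      unfolding integral_mean_def
      by (subst powr_mult) (use R p in \<open>auto simp: powr_powr set_lebesgue_integral_def intro!: mult_nonneg_nonneg divide_nonneg_nonneg integral_nonneg_AE\<close>)
    finally show ?thesis using R by (simp add: integral_mean_def norm_mult powr_mult)
  qed
  moreover have "W = (LINT t:{0..2*pi}|lborel. m t / (norm (1 - complex_of_real r * cis t))\<^sup>2) / (2 * pi)"
    unfolding W_def nK by (rule set_integral_divide_zero)
  ultimately show ?thesis by simp
qed

text \<open>For q = r/R the kernel |1 - q e^(it)|^(-2) is the Poisson kernel divided by 1 - q^2, so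
  its integral is known exactly; and R (1 - q^2) >= R (1 - q) = R - r.\<close>

lemma deriv_mean_cauchy:
  assumes f: "f holomorphic_on unit_disc" and p: "1 < p" and r: "0 \<le> r" "r < R" "R < 1"
  shows "integral_mean p r (deriv f) \<le> integral_mean p R f / (R - r)"
proof -
  define q where "q = r / R"
  have R: "0 < R" "R < 1" and q: "0 \<le> q" "q < 1" "R * q = r" using r by (auto simp: q_def)
  have cf: "continuous_on unit_disc f" using f by (rule holomorphic_on_imp_continuous_on)
  have eq: "c / (norm (1 - complex_of_real q * cis t))\<^sup>2 = (c / (1 - q\<^sup>2)) * poisson q t" for t c
    using q by (auto simp: poisson_def power_less_one_iff abs_square_eq_1)
  have 1: "integral_mean p r (deriv f) \<le> (integral_mean p R f + e) / (R - r)" if e: "0 < e" for e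
  proof -
    define m where "m = integral_mean p R f + e"
    have m: "0 < m" using e by (simp add: m_def add_nonneg_pos)
    have "R * integral_mean p (R * q) (deriv f) \<le>
      (LINT t:{0..2*pi}|lborel. m / (norm (1 - complex_of_real q * cis t))\<^sup>2) / (2 * pi)"
    proof (rule deriv_mean_bound[OF f p R q(1,2), where b=0])
      show "set_integrable lborel {0..2*pi} (\<lambda>t. m / (norm (1 - complex_of_real q * cis t))\<^sup>2)"
        unfolding eq using poisson_integrable[OF q(1,2)] by (intro set_integrable_mult_right) simp
      fix t
      have c: "continuous_on unit_disc (\<lambda>z. f (cis t * z) - 0 * f z)"
        using holomorphic_on_rotate[OF f, of t] by (auto intro: holomorphic_on_imp_continuous_on)
      have "circle_power p R (\<lambda>z. f (cis t * z) - 0 * f z) = circle_power p R f"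
        using circle_power_rotate[OF cf, of R p t] R by simp
      thus "integral_mean p R (\<lambda>z. f (cis t * z) - 0 * f z) \<le> m"
        using integral_mean_le_iff[OF c, of R p m] integral_mean_le_iff[OF cf, of R p m] R p m e
        by (simp add: m_def)
    qed (use m in auto)
    also have "\<dots> = m / (1 - q\<^sup>2)" unfolding eq using poisson_integral[OF q(1,2)] by simp
    finally have *: "R * integral_mean p r (deriv f) \<le> m / (1 - q\<^sup>2)" using q by simp
    have "q\<^sup>2 < 1" using q by (auto simp: power2_eq_square intro: le_less_trans[OF mult_left_le])
    with * have "integral_mean p r (deriv f) \<le> m / (R * (1 - q\<^sup>2))"
      using R by (simp add: pos_le_divide_eq mult_ac)
    also have "\<dots> \<le> m / (R - r)"
    proof (rule divide_left_mono)
      have "q\<^sup>2 \<le> q" using q by (simp add: power2_eq_square mult_left_le)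
      hence "R * q\<^sup>2 \<le> R * q" using R by simp
      thus "R - r \<le> R * (1 - q\<^sup>2)" using q by (simp add: algebra_simps)
      hence "0 < R * (1 - q\<^sup>2)" using r by linarith
      thus "0 < R * (1 - q\<^sup>2) * (R - r)" by (rule mult_pos_pos) (use r in auto)
    qed (use m in auto)
    finally show ?thesis by (simp add: m_def)
  qed
  have "integral_mean p r (deriv f) * (R - r) \<le> integral_mean p R f + e" if "0 < e" for e
    using 1[OF that] r by (simp add: field_simps)
  hence "integral_mean p r (deriv f) * (R - r) \<le> integral_mean p R f" by (rule field_le_epsilon)
  thus ?thesis using r by (simp add: field_simps)
qed

text \<open>Radial differences, the generalized Hilbert operator and its fractional inverse are all
  integrals of dilations z -> G(t z) against a kernel in t; this is their common estimate.\<close>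

lemma radial_minkowski:
  assumes G: "continuous_on unit_disc G" and p: "1 < p" and r: "0 \<le> r" "r < 1"
    and T: "T \<subseteq> {0..1}" and [measurable]: "T \<in> sets borel" "K \<in> borel_measurable borel" "m \<in> borel_measurable borel"
    and m: "\<And>t. 0 < m t" and int: "set_integrable lborel T (\<lambda>t. norm (K t) * m t)"
    and le: "\<And>t. t \<in> T \<Longrightarrow> integral_mean p (r * t) G \<le> m t"
  shows "circle_power p r (\<lambda>z. LINT t:T|lborel. K t * G (complex_of_real t * z)) \<le>
     ennreal (2 * pi * (LINT t:T|lborel. norm (K t) * m t) powr p)"
proof -
  have [measurable]: "disc_ext G \<in> borel_measurable borel" using G by (rule disc_ext_measurable)
  have rt: "0 \<le> r * t" "r * t < 1" if "t \<in> T" for t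
    using that T r mult_left_le[of t r] by auto
  define F where "F = (\<lambda>x t. disc_ext G (of_real (r * t) * cis x))"
  have "(\<integral>\<^sup>+x\<in>{0..2*pi}. ennreal (norm (LINT t:T|lborel. K t * F x t) powr p) \<partial>lborel)
       \<le> ennreal (2 * pi * (LINT t:T|lborel. norm (K t) * m t) powr p)"
  proof (rule circle_minkowski[OF p])
    show "(\<lambda>(x, t). F x t) \<in> borel_measurable (lborel \<Otimes>\<^sub>M lborel)" unfolding F_def by measurable
    fix t assume t: "t \<in> T"
    have "(\<integral>\<^sup>+x\<in>{0..2*pi}. ennreal (norm (F x t) powr p) \<partial>lborel) = circle_power p (r * t) G"
      using rt[OF t] unfolding F_def circle_power_def
      by (intro nn_integral_cong) (simp add: norm_mult flip: of_real_mult)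
    also have "\<dots> \<le> ennreal (2 * pi * m t powr p)"
      using integral_mean_le_iff[OF G, of "r*t" p "m t"] rt[OF t] p m[of t] le[OF t] by simp
    finally show "(\<integral>\<^sup>+x\<in>{0..2*pi}. ennreal (norm (F x t) powr p) \<partial>lborel) \<le> ennreal (2 * pi * m t powr p)" .
  qed (use m int in auto)
  moreover have "(LINT t:T|lborel. K t * F x t) = (LINT t:T|lborel. K t * G (of_real t * (of_real r * cis x)))" for x
  proof (intro set_lebesgue_integral_cong allI impI)
    fix t assume t: "t \<in> T"
    have "norm (complex_of_real (r * t) * cis x) = \<bar>r * t\<bar>" by (simp add: norm_mult abs_mult)
    hence "norm (complex_of_real (r * t) * cis x) < 1" using rt[OF t] by simp
    hence "F x t = G (complex_of_real (r * t) * cis x)" unfolding F_def by (rule disc_ext_eq)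
    thus "K t * F x t = K t * G (of_real t * (of_real r * cis x))" by (simp add: mult_ac)
  qed auto
  ultimately show ?thesis by (simp add: circle_power_def)
qed

text \<open>Integrating dilations against K multiplies the n-th Taylor coefficient by the n-th
  moment of K. This yields holomorphy of such integrals and, in \<open>abel_inversion\<close>,
  reduces the composition of two of them to a product of moments.\<close>

lemma integral_dilation_sums:
  fixes K :: "real \<Rightarrow> complex" and G :: "complex \<Rightarrow> complex"
  assumes bs: "\<And>w. norm w < 1 \<Longrightarrow> (\<lambda>n. b n * w ^ n) sums G w"
    and int: "set_integrable lborel {0..<1} K" and z: "norm z < 1"
  shows "(\<lambda>n. b n * (LINT t:{0..<1}|lborel. K t * of_real t ^ n) * z ^ n) sums
           (LINT t:{0..<1}|lborel. K t * G (complex_of_real t * z))"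
proof -
  have [measurable]: "(\<lambda>t. indicator {0..<1} t *\<^sub>R K t) \<in> borel_measurable lborel"
    using int unfolding set_integrable_def by measurable
  \<comment> \<open>Convergence at the larger radius x makes the series at z absolutely
    convergent.\<close>
  obtain x where x: "norm z < x" "x < 1" using z dense by blast
  hence x0: "0 < x" using norm_ge_zero[of z] by linarith
  have sn: "summable (\<lambda>n. norm (b n * z ^ n))"
    using bs[of "of_real x"] x x0 by (intro powser_insidea[where x="of_real x"]) (auto simp: sums_iff)
  let ?f = "\<lambda>n t. indicator {0..<1} t *\<^sub>R (K t * (b n * (of_real t * z) ^ n))"
  have eq: "?f n t = (indicator {0..<1} t *\<^sub>R K t) * (b n * (of_real t * z) ^ n)" for n t by simp
  have bd: "norm (?f n t) \<le> norm (b n * z ^ n) * norm (indicator {0..<1} t *\<^sub>R K t)" for n t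
  proof (cases "t \<in> {0..<1}")
    case True
    hence "\<bar>t\<bar> ^ n \<le> 1" by (auto intro: power_le_one)
    hence "\<bar>t\<bar> ^ n * (norm (K t) * norm (b n * z ^ n)) \<le> 1 * (norm (K t) * norm (b n * z ^ n))"
      by (intro mult_right_mono) auto
    thus ?thesis using True by (simp add: norm_mult norm_power power_mult_distrib mult_ac)
  qed auto
  have i: "integrable lborel (\<lambda>t. norm (b n * z ^ n) * norm (indicator {0..<1} t *\<^sub>R K t))" for n
    using int unfolding set_integrable_def by (intro integrable_mult_right integrable_norm) 
  have ii: "integrable lborel (?f n)" for n
  proof (rule Bochner_Integration.integrable_bound[OF i[of n]])
    show "?f n \<in> borel_measurable lborel" unfolding eq by measurable
    show "AE t in lborel. norm (?f n t) \<le> norm (norm (b n * z ^ n) * norm (indicator {0..<1} t *\<^sub>R K t))"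
      unfolding real_norm_def using order.trans[OF bd abs_ge_self] by (intro AE_I2)
  qed
  have "(\<lambda>n. LINT t|lborel. ?f n t) sums (LINT t|lborel. (\<Sum>n. ?f n t))"
  proof (rule sums_integral)
    show "integrable lborel (?f n)" for n by (rule ii)
    show "AE t in lborel. summable (\<lambda>n. norm (?f n t))"
    proof (rule AE_I2)
      fix t
      show "summable (\<lambda>n. norm (?f n t))"
        by (rule summable_comparison_test'[where N=0, OF summable_mult2[OF sn]]) (use bd in auto)
    qed
    show "summable (\<lambda>n. LINT t|lborel. norm (?f n t))"
    proof (rule summable_comparison_test'[where N=0, OF summable_mult2[OF sn]])
      fix n
      have "(LINT t|lborel. norm (?f n t)) \<le> (LINT t|lborel. norm (b n * z ^ n) * norm (indicator {0..<1} t *\<^sub>R K t))"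
        by (intro integral_mono integrable_norm ii i bd)
      thus "norm (LINT t|lborel. norm (?f n t)) \<le> norm (b n * z ^ n) * (LINT t|lborel. norm (indicator {0..<1} t *\<^sub>R K t))"
        by simp
    qed
  qed
  moreover have "(LINT t|lborel. ?f n t) = b n * (LINT t:{0..<1}|lborel. K t * of_real t ^ n) * z ^ n" for n
  proof -
    have "(LINT t|lborel. ?f n t) = (LINT t:{0..<1}|lborel. (b n * z ^ n) * (K t * of_real t ^ n))"
      unfolding set_lebesgue_integral_def by (intro Bochner_Integration.integral_cong) (auto simp: power_mult_distrib mult_ac)
    also have "\<dots> = (b n * z ^ n) * (LINT t:{0..<1}|lborel. K t * of_real t ^ n)" by (rule set_integral_mult_right)
    finally show ?thesis by (simp add: mult_ac)
  qed
  moreover have "(LINT t|lborel. (\<Sum>n. ?f n t)) = (LINT t:{0..<1}|lborel. K t * G (complex_of_real t * z))"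
    unfolding set_lebesgue_integral_def
  proof (intro Bochner_Integration.integral_cong refl)
    fix t :: real
    show "(\<Sum>n. ?f n t) = indicator {0..<1} t *\<^sub>R (K t * G (of_real t * z))"
    proof (cases "t \<in> {0..<1}")
      case True
      hence "\<bar>t\<bar> * norm z < 1" using z by (smt (verit) mult_left_le atLeastLessThan_iff norm_ge_zero)
      hence "(\<lambda>n. K t * (b n * (of_real t * z) ^ n)) sums (K t * G (of_real t * z))"
        by (intro sums_mult bs) (auto simp: norm_mult)
      thus ?thesis using True by (simp add: sums_iff)
    qed auto
  qed
  ultimately show ?thesis by simp
qed

lemma holomorphic_power_series_disc:
  assumes "G holomorphic_on unit_disc" "norm w < 1"
  shows "(\<lambda>n. (deriv ^^ n) G 0 / fact n * w ^ n) sums G w"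
  using holomorphic_power_series[OF assms(1), of w] assms(2) by simp

lemma holomorphic_integral_dilation:
  fixes K :: "real \<Rightarrow> complex" and G :: "complex \<Rightarrow> complex"
  assumes G: "G holomorphic_on unit_disc" and int: "set_integrable lborel {0..<1} K"
  shows "(\<lambda>z. LINT t:{0..<1}|lborel. K t * G (complex_of_real t * z)) holomorphic_on unit_disc"
proof (rule power_series_holomorphic)
  fix w :: complex assume "w \<in> ball 0 1"
  thus "(\<lambda>n. ((deriv ^^ n) G 0 / fact n * (LINT t:{0..<1}|lborel. K t * of_real t ^ n)) * (w - 0) ^ n) sums
      (LINT t:{0..<1}|lborel. K t * G (complex_of_real t * w))"
    using integral_dilation_sums[OF holomorphic_power_series_disc[OF G] int, of w] by simp
qed

section \<open>Polar coordinates\<close>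

text \<open>The change of variables formula with a determinant is applied on \<open>real^2\<close>.
  These linear maps carry Lebesgue measure there from the complex plane and from
  \<open>real * real\<close>, where iterated integrals live.\<close>

definition c2v :: "complex \<Rightarrow> real^2" where "c2v z = vector [Re z, Im z]"
definition v2c :: "real^2 \<Rightarrow> complex" where "v2c x = Complex (x$1) (x$2)"
definition p2v :: "real \<times> real \<Rightarrow> real^2" where "p2v z = vector [fst z, snd z]"

lemma linear_plane_maps: "linear c2v" "linear v2c" "linear p2v"
  unfolding c2v_def v2c_def p2v_def 
  by (auto intro!: linearI simp: vec_eq_iff forall_2 complex_eq_iff)

lemma plane_maps_measurable [measurable]:
  "c2v \<in> borel_measurable borel" "v2c \<in> borel_measurable borel" "p2v \<in> borel_measurable borel"
  using linear_plane_maps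
  by (auto intro!: borel_measurable_continuous_onI linear_continuous_on simp: linear_conv_bounded_linear)

lemma v2c_c2v [simp]: "v2c (c2v z) = z" by (simp add: c2v_def v2c_def)
lemma c2v_v2c [simp]: "c2v (v2c z) = z" by (simp add: c2v_def v2c_def vec_eq_iff forall_2)

lemma p2v_nth: "p2v z $ 1 = fst z" "p2v z $ 2 = snd z" by (simp_all add: p2v_def)

lemma Basis_vec2: "(Basis :: (real^2) set) = {axis 1 1, axis 2 1}"
  unfolding Basis_vec_def by (auto simp: UNIV_2)

lemma axis_ne: "axis 1 (1::real) \<noteq> (axis 2 1 :: real^2)"
  by (simp add: axis_eq_axis)

lemma lborel_distr_c2v: "distr lborel borel c2v = (lborel :: (real^2) measure)"
proof (rule lborel_eqI[symmetric])
  fix l u :: "real^2" assume le: "\<And>b. b \<in> Basis \<Longrightarrow> l \<bullet> b \<le> u \<bullet> b"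
  have le': "l $ 1 \<le> u $ 1" "l $ 2 \<le> u $ 2"
    using le[of "axis 1 1"] le[of "axis 2 1"] by (simp_all add: Basis_vec2 inner_axis)
  have eq: "c2v -` box l u = box (v2c l) (v2c u)"
    by (auto simp: box_def Basis_vec2 Basis_complex_def c2v_def v2c_def inner_axis)
  have "emeasure (distr lborel borel c2v) (box l u) = emeasure lborel (box (v2c l) (v2c u))"
    by (simp add: emeasure_distr eq)
  also have "\<dots> = (\<Prod>b\<in>Basis. (v2c u - v2c l) \<bullet> b)"
    using le' by (intro emeasure_lborel_box) (auto simp: Basis_vec2 Basis_complex_def v2c_def inner_axis)
  also have "(\<Prod>b\<in>Basis. (v2c u - v2c l) \<bullet> b) = (\<Prod>b\<in>Basis. (u - l) \<bullet> b)"
    using axis_ne by (simp add: Basis_vec2 Basis_complex_def v2c_def inner_axis complex_eq_iff)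
  finally show "emeasure (distr lborel borel c2v) (box l u) = (\<Prod>b\<in>Basis. (u - l) \<bullet> b)" .
qed simp

lemma lborel_distr_p2v: "distr lborel borel p2v = (lborel :: (real^2) measure)"
proof (rule lborel_eqI[symmetric])
  fix l u :: "real^2" assume le: "\<And>b. b \<in> Basis \<Longrightarrow> l \<bullet> b \<le> u \<bullet> b"
  have le': "l $ 1 \<le> u $ 1" "l $ 2 \<le> u $ 2"
    using le[of "axis 1 1"] le[of "axis 2 1"] by (simp_all add: Basis_vec2 inner_axis)
  have eq: "p2v -` box l u = box (l$1, l$2) (u$1, u$2)"
    by (auto simp: box_def Basis_vec2 Basis_prod_def p2v_def inner_axis)
  have "emeasure (distr lborel borel p2v) (box l u) = emeasure lborel (box (l$1, l$2) (u$1, u$2))"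
    by (simp add: emeasure_distr eq)
  also have "\<dots> = (\<Prod>b\<in>Basis. ((u$1, u$2) - (l$1, l$2)) \<bullet> b)"
    using le' by (intro emeasure_lborel_box) (auto simp: Basis_vec2 Basis_prod_def inner_axis)
  also have "(\<Prod>b\<in>Basis. ((u$1, u$2) - (l$1, l$2)) \<bullet> b) = (\<Prod>b\<in>Basis. (u - l) \<bullet> b)"
    using axis_ne by (simp add: Basis_vec2 Basis_prod_def inner_axis)
  finally show "emeasure (distr lborel borel p2v) (box l u) = (\<Prod>b\<in>Basis. (u - l) \<bullet> b)" .
qed simp

definition polar :: "real^2 \<Rightarrow> real^2" where
  "polar x = vector [x$1 * cos (x$2), x$1 * sin (x$2)]"

definition polar' :: "real^2 \<Rightarrow> real^2 \<Rightarrow> real^2" where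
  "polar' x h = vector [h$1 * cos (x$2) - x$1 * sin (x$2) * h$2, h$1 * sin (x$2) + x$1 * cos (x$2) * h$2]"

lemma polar_has_derivative: "(polar has_derivative polar' x) (at x within S)"
proof (rule has_derivative_componentwise_within[THEN iffD2], rule ballI)
  fix i :: "real^2" assume "i \<in> Basis"
  have 1: "((\<lambda>x. x$1 * cos (x$2)) has_derivative (\<lambda>h. h$1 * cos (x$2) - x$1 * sin (x$2) * h$2)) (at x within S)"
    and 2: "((\<lambda>x. x$1 * sin (x$2)) has_derivative (\<lambda>h. h$1 * sin (x$2) + x$1 * cos (x$2) * h$2)) (at x within S)"
    by (auto intro!: derivative_eq_intros bounded_linear_vec_nth[THEN bounded_linear_imp_has_derivative])
  show "((\<lambda>x. polar x \<bullet> i) has_derivative (\<lambda>h. polar' x h \<bullet> i)) (at x within S)"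
    using \<open>i \<in> Basis\<close> 1 2 unfolding Basis_vec2
    by (auto simp: polar_def polar'_def inner_axis)
qed

lemma polar_det: "det (matrix (polar' x)) = x$1"
proof -
  have "x$1 * (cos (x$2))\<^sup>2 + x$1 * (sin (x$2))\<^sup>2 = x$1"
    by (simp flip: distrib_left)
  thus ?thesis
    by (simp add: det_2 matrix_def polar'_def axis_def power2_eq_square algebra_simps)
qed

text \<open>With angles strictly between 0 and 2 pi the domain is open and \<open>polar\<close> is
  injective on it. The image misses only the half line of angle 0 with the origin, a null
  set.\<close>

definition polar_strip :: "(real^2) set" where
  "polar_strip = {x. 0 < x$1 \<and> 0 < x$2 \<and> x$2 < 2 * pi}"

lemma polar_strip_open: "open polar_strip"
  unfolding polar_strip_def by (intro open_Collect_conj open_Collect_less continuous_intros)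

lemma v2c_polar: "v2c (polar x) = of_real (x$1) * exp (\<i> * of_real (x$2))"
  by (simp add: v2c_def polar_def complex_eq_iff Re_exp Im_exp)

lemma polar_inj: "inj_on polar polar_strip"
proof (rule inj_onI)
  fix x y assume *: "x \<in> polar_strip" "y \<in> polar_strip" "polar x = polar y"
  have e: "of_real (x$1) * exp (\<i> * of_real (x$2)) = of_real (y$1) * exp (\<i> * of_real (y$2))"
    using *(3) by (simp flip: v2c_polar)
  hence "norm (of_real (x$1) * exp (\<i> * of_real (x$2))) = norm (of_real (y$1) * exp (\<i> * of_real (y$2)))" by simp
  hence 1: "x$1 = y$1" using * by (simp add: norm_mult polar_strip_def)
  have "Arg2pi (of_real (x$1) * exp (\<i> * of_real (x$2))) = x$2"
    using * by (intro Arg2pi_unique[OF refl]) (auto simp: polar_strip_def)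
  moreover have "Arg2pi (of_real (y$1) * exp (\<i> * of_real (y$2))) = y$2"
    using * by (intro Arg2pi_unique[OF refl]) (auto simp: polar_strip_def)
  ultimately have "x$2 = y$2" using e by simp
  with 1 show "x = y" by (simp add: vec_eq_iff forall_2)
qed

lemma polar_image: "polar ` polar_strip = - {y. y$2 = 0 \<and> 0 \<le> y$1}"
proof (intro equalityI subsetI)
  fix y assume "y \<in> polar ` polar_strip"
  then obtain x where x: "x \<in> polar_strip" "y = polar x" by blast
  have "\<not> (y$2 = 0 \<and> 0 \<le> y$1)"
  proof
    assume "y$2 = 0 \<and> 0 \<le> y$1"
    hence "Arg2pi (v2c y) = 0" by (auto simp: Arg2pi_eq_0 v2c_def complex_is_Real_iff)
    moreover have "Arg2pi (v2c y) = x$2"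
      unfolding x v2c_polar using x(1) by (intro Arg2pi_unique[OF refl]) (auto simp: polar_strip_def)
    ultimately show False using x(1) by (auto simp: polar_strip_def)
  qed
  thus "y \<in> - {y. y$2 = 0 \<and> 0 \<le> y$1}" by simp
next
  fix y :: "real^2" assume y: "y \<in> - {y. y$2 = 0 \<and> 0 \<le> y$1}"
  let ?x = "vector [norm (v2c y), Arg2pi (v2c y)] :: real^2"
  have "Arg2pi (v2c y) \<noteq> 0" "v2c y \<noteq> 0" using y by (auto simp: Arg2pi_eq_0 v2c_def complex_is_Real_iff complex_eq_iff)
  hence "?x \<in> polar_strip"
    using Arg2pi_ge_0[of "v2c y"] Arg2pi_lt_2pi[of "v2c y"] by (simp add: polar_strip_def)
  moreover have "v2c (polar ?x) = v2c y"
    unfolding v2c_polar using Arg2pi_eq[of "v2c y"] by simp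
  hence "polar ?x = y" by (metis c2v_v2c)
  ultimately show "y \<in> polar ` polar_strip" by (metis imageI)
qed

lemma polar_measurable [measurable]: "polar \<in> borel_measurable borel"
  using polar_has_derivative[of _ UNIV]
  by (intro borel_measurable_continuous_onI has_derivative_continuous_on) auto

lemma polar_strip_measurable [measurable]: "polar_strip \<in> sets borel"
  using polar_strip_open by simp

text \<open>As an identity of measures it has to be checked on boxes only, and then serves all Borel
  integrands at once. For a box it is the change of variables theorem for the indicator function,
  with determinant equal to the radius.\<close>

lemma lborel_polar:
  "distr (density lborel (\<lambda>x. ennreal (x$1) * indicator polar_strip x)) borel polar = lborel"
proof (rule lborel_eqI[symmetric])
  fix l u :: "real^2" assume le: "\<And>b. b \<in> Basis \<Longrightarrow> l \<bullet> b \<le> u \<bullet> b"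
  let ?T = "polar ` polar_strip" and ?B = "box l u"
  \<comment> \<open>The indicator takes values in \<open>real^1\<close> because the change of
    variables theorem is stated for vector-valued integrands.\<close>
  let ?f = "\<lambda>y. indicator ?B y *\<^sub>R (1 :: real^1)"
  let ?h = "\<lambda>x. \<bar>det (matrix (polar' x))\<bar> *\<^sub>R ?f (polar x)"
  have Tm [measurable]: "?T \<in> sets borel" unfolding polar_image by measurable
  have [measurable]: "?B \<in> sets borel" by simp
  have negl: "negligible (-?T)"
  proof (rule negligible_subset)
    show "negligible {y::real^2. y \<bullet> axis 2 1 = 0}" by (rule negligible_standard_hyperplane) (simp add: Basis_vec2)
    show "- ?T \<subseteq> {y::real^2. y \<bullet> axis 2 1 = 0}" unfolding polar_image by (auto simp: inner_axis)
  qed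
  have fin: "emeasure lborel ?B < \<infinity>" by (rule emeasure_bounded_finite[OF bounded_box])
  have int: "?f absolutely_integrable_on ?T"
    unfolding set_integrable_def
  proof (rule integrableI_bounded_set[where A="?B" and B="norm (1::real^1)"])
    show "emeasure lebesgue ?B < \<infinity>" using fin by simp
    show "(\<lambda>x. indicator ?T x *\<^sub>R ?f x) \<in> borel_measurable lebesgue"
      by (intro measurable_completion) measurable
  qed (auto simp: indicator_def)
  have "integral ?T ?f = (LINT x:?T|lebesgue. ?f x)"
    by (rule set_lebesgue_integral_eq_integral(2)[OF int, symmetric])
  also have "\<dots> = (LINT x|lebesgue. indicator (?T \<inter> ?B) x *\<^sub>R (1::real^1))"
    unfolding set_lebesgue_integral_def by (intro Bochner_Integration.integral_cong) (auto simp: indicator_def)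
  also have "\<dots> = measure lebesgue (?T \<inter> ?B) *\<^sub>R 1"
  proof -
    have "emeasure lebesgue (?T \<inter> ?B) \<le> emeasure lebesgue ?B" using Tm by (intro emeasure_mono) auto
    hence "integrable lebesgue (indicator (?T \<inter> ?B) :: real^2 \<Rightarrow> real)" using fin Tm
      by (intro integrable_real_indicator) (auto simp: less_top[symmetric] top_unique)
    thus ?thesis by (subst Bochner_Integration.integral_scaleR_left) auto
  qed
  also have "measure lebesgue (?T \<inter> ?B) = measure lborel ?B"
  proof -
    have "emeasure lebesgue (?T \<inter> ?B) = emeasure lebesgue ?B"
    proof (rule emeasure_eq_AE)
      have "AE x in lebesgue. x \<notin> - ?T" using negl by (intro AE_not_in) (simp add: negligible_iff_null_sets)
      thus "AE x in lebesgue. (x \<in> ?T \<inter> ?B) = (x \<in> ?B)" by eventually_elim auto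
    qed (use Tm in auto)
    thus ?thesis by (simp add: measure_def)
  qed
  finally have I: "integral ?T ?f = measure lborel ?B *\<^sub>R 1" .
  have "?h absolutely_integrable_on polar_strip \<and> integral polar_strip ?h = measure lborel ?B *\<^sub>R 1"
    using has_absolute_integral_change_of_variables[of polar_strip polar polar' ?f "measure lborel ?B *\<^sub>R 1"]
      polar_has_derivative polar_inj polar_strip_open int I by (auto simp: lmeasurable_iff_has_integral borel_open)
  hence "(?h has_integral measure lborel ?B *\<^sub>R 1) polar_strip"
    by (metis (no_types, lifting) has_integral_integral set_lebesgue_integral_eq_integral(1))
  hence "((\<lambda>x. ?h x \<bullet> 1) has_integral (measure lborel ?B *\<^sub>R (1::real^1)) \<bullet> 1) polar_strip"
    by (rule has_integral_linear[OF _ bounded_linear_inner_left, unfolded o_def])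
  hence hi: "((\<lambda>x. \<bar>x$1\<bar> * indicator ?B (polar x)) has_integral measure lborel ?B) polar_strip"
    by (simp add: polar_det inner_vec_def)
  have "emeasure (distr (density lborel (\<lambda>x. ennreal (x$1) * indicator polar_strip x)) borel polar) ?B
     = (\<integral>\<^sup>+x. ennreal (x$1) * indicator polar_strip x * indicator (polar -` ?B) x \<partial>lborel)"
    using measurable_sets[OF polar_measurable, of ?B]
    by (simp add: emeasure_distr emeasure_density)
  also have "\<dots> = (\<integral>\<^sup>+x. indicator polar_strip x * (\<bar>x$1\<bar> * indicator ?B (polar x)) \<partial>lborel)"
    by (intro nn_integral_cong) (auto simp: indicator_def polar_strip_def)
  also have "\<dots> = ennreal (measure lborel ?B)"
    by (rule nn_integral_has_integral_lebesgue[OF _ hi]) auto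
  also have "\<dots> = emeasure lborel ?B" using fin by (simp add: emeasure_eq_ennreal_measure less_top)
  also have "\<dots> = (\<Prod>b\<in>Basis. (u - l) \<bullet> b)" using le by (rule emeasure_lborel_box)
  finally show "emeasure (distr (density lborel (\<lambda>x. ennreal (x$1) * indicator polar_strip x)) borel polar) ?B
     = (\<Prod>b\<in>Basis. (u - l) \<bullet> b)" .
qed simp

theorem nn_integral_polar:
  assumes [measurable]: "F \<in> borel_measurable borel"
  shows "(\<integral>\<^sup>+z. F z \<partial>lborel) =
    (\<integral>\<^sup>+r\<in>{0<..}. ennreal r * (\<integral>\<^sup>+t\<in>{0..2*pi}. F (complex_of_real r * cis t) \<partial>lborel) \<partial>lborel)"
proof -
  have [measurable]: "fst \<in> borel_measurable (borel :: (real \<times> real) measure)"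
    by (intro borel_measurable_continuous_onI continuous_intros)
  have "(\<integral>\<^sup>+z. F z \<partial>lborel) = (\<integral>\<^sup>+x. F (v2c x) \<partial>(distr lborel borel c2v))"
    by (subst nn_integral_distr) auto
  also have "\<dots> = (\<integral>\<^sup>+x. F (v2c x) \<partial>(distr (density lborel (\<lambda>x. ennreal (x$1) * indicator polar_strip x)) borel polar))"
    unfolding lborel_distr_c2v lborel_polar ..
  also have "\<dots> = (\<integral>\<^sup>+x. ennreal (x$1) * indicator polar_strip x * F (v2c (polar x)) \<partial>lborel)"
    by (simp add: nn_integral_distr nn_integral_density)
  also have "\<dots> = (\<integral>\<^sup>+x. ennreal (x$1) * indicator polar_strip x * F (v2c (polar x)) \<partial>(distr lborel borel p2v))"
    unfolding lborel_distr_p2v ..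
  also have "\<dots> = (\<integral>\<^sup>+z. ennreal (fst z) * indicator polar_strip (p2v z) * F (v2c (polar (p2v z))) \<partial>(lborel \<Otimes>\<^sub>M lborel))"
    by (subst nn_integral_distr) (auto simp: lborel_prod p2v_nth)
  also have "\<dots> = (\<integral>\<^sup>+r. (\<integral>\<^sup>+t. ennreal r * indicator polar_strip (p2v (r, t)) * F (v2c (polar (p2v (r, t)))) \<partial>lborel) \<partial>lborel)"
    by (subst lborel.nn_integral_fst[symmetric]) (auto simp: lborel_prod)
  also have "\<dots> = (\<integral>\<^sup>+r\<in>{0<..}. ennreal r * (\<integral>\<^sup>+t\<in>{0..2*pi}. F (complex_of_real r * cis t) \<partial>lborel) \<partial>lborel)"
  proof (intro nn_integral_cong)
    fix r :: real
    show "(\<integral>\<^sup>+t. ennreal r * indicator polar_strip (p2v (r, t)) * F (v2c (polar (p2v (r, t)))) \<partial>lborel)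
      = ennreal r * (\<integral>\<^sup>+t\<in>{0..2*pi}. F (complex_of_real r * cis t) \<partial>lborel) * indicator {0<..} r"
    proof (cases "0 < r")
      case True
      have "(\<integral>\<^sup>+t. ennreal r * indicator polar_strip (p2v (r, t)) * F (v2c (polar (p2v (r, t)))) \<partial>lborel)
        = (\<integral>\<^sup>+t. ennreal r * (F (complex_of_real r * cis t) * indicator {0..2*pi} t) \<partial>lborel)"
        using AE_lborel_singleton[of 0] AE_lborel_singleton[of "2*pi"]
        by (intro nn_integral_cong_AE, eventually_elim)
           (use True in \<open>auto simp: indicator_def polar_strip_def p2v_def v2c_polar cis_conv_exp\<close>)
      also have "\<dots> = ennreal r * (\<integral>\<^sup>+t\<in>{0..2*pi}. F (complex_of_real r * cis t) \<partial>lborel)"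
        by (rule nn_integral_cmult) (simp add: cis_conv_exp)
      finally show ?thesis using True by simp
    next
      case False
      thus ?thesis by (auto simp: indicator_def polar_strip_def p2v_def)
    qed
  qed
  finally show ?thesis .
qed

section \<open>Weighted Bergman spaces\<close>

text \<open>The p-th power of the Bergman norm up to the factor pi/(\<alpha> + 1); it is infinite
  for holomorphic functions outside the space.\<close>

definition bergman_nn :: "real \<Rightarrow> real \<Rightarrow> (complex \<Rightarrow> complex) \<Rightarrow> ennreal" where
  "bergman_nn p \<alpha> f =
     (\<integral>\<^sup>+z\<in>unit_disc. ennreal (norm (f z) powr p * (1 - (norm z)\<^sup>2) powr \<alpha>) \<partial>lborel)"

lemma complex_ball_measurable [measurable]: "ball (z :: complex) d \<in> sets borel"
  by simp

lemma bergman_nn_polar: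
  assumes f: "continuous_on unit_disc f"
  shows "bergman_nn p \<alpha> f =
    (\<integral>\<^sup>+r\<in>{0<..<1}. ennreal (r * (1 - r\<^sup>2) powr \<alpha>) * circle_power p r f \<partial>lborel)"
proof -
  have [measurable]: "disc_ext f \<in> borel_measurable borel" using f by (rule disc_ext_measurable)
  define F where "F = (\<lambda>z. ennreal (norm (disc_ext f z) powr p * (1 - (norm z)\<^sup>2) powr \<alpha>) * indicator unit_disc z)"
  have [measurable]: "F \<in> borel_measurable borel" unfolding F_def by measurable
  have "bergman_nn p \<alpha> f = (\<integral>\<^sup>+z. F z \<partial>lborel)"
    unfolding bergman_nn_def F_def by (intro nn_integral_cong) (simp add: indicator_def)
  also have "\<dots> = (\<integral>\<^sup>+r\<in>{0<..}. ennreal r * (\<integral>\<^sup>+t\<in>{0..2*pi}. F (complex_of_real r * cis t) \<partial>lborel) \<partial>lborel)"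
    by (rule nn_integral_polar) measurable
  also have "\<dots> = (\<integral>\<^sup>+r\<in>{0<..<1}. ennreal (r * (1 - r\<^sup>2) powr \<alpha>) * circle_power p r f \<partial>lborel)"
  proof (intro nn_integral_cong)
    fix r :: real
    show "ennreal r * (\<integral>\<^sup>+t\<in>{0..2*pi}. F (complex_of_real r * cis t) \<partial>lborel) * indicator {0<..} r =
      ennreal (r * (1 - r\<^sup>2) powr \<alpha>) * circle_power p r f * indicator {0<..<1} r"
    proof (cases "0 < r \<and> r < 1")
      case True
      have "(\<integral>\<^sup>+t\<in>{0..2*pi}. F (complex_of_real r * cis t) \<partial>lborel) =
        (\<integral>\<^sup>+t. ennreal ((1 - r\<^sup>2) powr \<alpha>) * (ennreal (norm (disc_ext f (complex_of_real r * cis t)) powr p) * indicator {0..2*pi} t) \<partial>lborel)"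
        using True unfolding F_def
        by (intro nn_integral_cong) (simp add: norm_mult ennreal_mult mult_ac)
      also have "\<dots> = ennreal ((1 - r\<^sup>2) powr \<alpha>) * (\<integral>\<^sup>+t\<in>{0..2*pi}. ennreal (norm (disc_ext f (complex_of_real r * cis t)) powr p) \<partial>lborel)"
        by (rule nn_integral_cmult) measurable
      also have "(\<integral>\<^sup>+t\<in>{0..2*pi}. ennreal (norm (disc_ext f (complex_of_real r * cis t)) powr p) \<partial>lborel) = circle_power p r f"
        using True unfolding circle_power_def by (intro nn_integral_cong) (simp add: norm_mult)
      finally show ?thesis using True by (simp add: ennreal_mult mult_ac)
    next
      case False
      hence "r \<le> 0 \<or> 1 \<le> r" by auto
      moreover have "F (complex_of_real r * cis t) = 0" if "1 \<le> r" for t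
        using that by (simp add: F_def norm_mult)
      ultimately show ?thesis by auto
    qed
  qed
  finally show ?thesis .
qed

lemma set_integrable_iff_nn_integral:
  fixes u :: "'a \<Rightarrow> real"
  assumes "(\<lambda>x. indicator S x *\<^sub>R u x) \<in> borel_measurable M" "\<And>x. x \<in> S \<Longrightarrow> 0 \<le> u x"
  shows "set_integrable M S u \<longleftrightarrow> (\<integral>\<^sup>+x\<in>S. ennreal (u x) \<partial>M) < \<infinity>"
    and "set_integrable M S u \<Longrightarrow> (\<integral>\<^sup>+x\<in>S. ennreal (u x) \<partial>M) = ennreal (LINT x:S|M. u x)"
proof -
  have eq: "(\<integral>\<^sup>+x\<in>S. ennreal (u x) \<partial>M) = (\<integral>\<^sup>+x. ennreal (norm (indicator S x *\<^sub>R u x)) \<partial>M)"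
    using assms(2) by (intro nn_integral_cong) (auto simp: indicator_def)
  show 1: "set_integrable M S u \<longleftrightarrow> (\<integral>\<^sup>+x\<in>S. ennreal (u x) \<partial>M) < \<infinity>"
    unfolding set_integrable_def integrable_iff_bounded eq using assms(1) by auto
  have eq': "(\<integral>\<^sup>+x\<in>S. ennreal (u x) \<partial>M) = (\<integral>\<^sup>+x. ennreal (indicator S x *\<^sub>R u x) \<partial>M)"
    by (intro nn_integral_cong) (auto simp: indicator_def)
  show "(\<integral>\<^sup>+x\<in>S. ennreal (u x) \<partial>M) = ennreal (LINT x:S|M. u x)" if "set_integrable M S u"
    unfolding eq' set_lebesgue_integral_def using that assms(2)
    by (intro nn_integral_eq_integral) (auto simp: set_integrable_def indicator_def)
qed

lemma bergman_integrand_measurable: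
  fixes f :: "complex \<Rightarrow> complex"
  assumes f: "continuous_on unit_disc f"
  shows "(\<lambda>z. indicator unit_disc z *\<^sub>R (norm (f z) powr p * (1 - (norm z)\<^sup>2) powr \<alpha>)) \<in> borel_measurable lborel"
proof -
  have [measurable]: "disc_ext f \<in> borel_measurable borel" using f by (rule disc_ext_measurable)
  have "(\<lambda>z. indicator unit_disc z *\<^sub>R (norm (disc_ext f z) powr p * (1 - (norm z)\<^sup>2) powr \<alpha>)) \<in> borel_measurable lborel"
    by measurable
  also have "(\<lambda>z. indicator unit_disc z *\<^sub>R (norm (disc_ext f z) powr p * (1 - (norm z)\<^sup>2) powr \<alpha>)) =
    (\<lambda>z. indicator unit_disc z *\<^sub>R (norm (f z) powr p * (1 - (norm z)\<^sup>2) powr \<alpha>))"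
    by (auto simp: fun_eq_iff indicator_def)
  finally show ?thesis .
qed

lemma bergman_space_iff:
  "f \<in> bergman_space p \<alpha> \<longleftrightarrow> f holomorphic_on unit_disc \<and> bergman_nn p \<alpha> f < \<infinity>"
proof (cases "f holomorphic_on unit_disc")
  case True
  hence "continuous_on unit_disc f" by (rule holomorphic_on_imp_continuous_on)
  from set_integrable_iff_nn_integral(1)[OF bergman_integrand_measurable[OF this]] True
  show ?thesis by (simp add: bergman_space_def bergman_nn_def)
qed (simp add: bergman_space_def)

lemma bergman_norm_nonneg [simp]: "0 \<le> bergman_norm p \<alpha> f"
  by (simp add: bergman_norm_def)

lemma bergman_nn_eq:
  assumes f: "f \<in> bergman_space p \<alpha>" and p: "0 < p" and a: "-1 < \<alpha>"
  shows "bergman_nn p \<alpha> f = ennreal (pi / (\<alpha> + 1) * bergman_norm p \<alpha> f powr p)"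
proof -
  have "continuous_on unit_disc f" using f by (auto simp: bergman_space_def intro: holomorphic_on_imp_continuous_on)
  from set_integrable_iff_nn_integral(2)[OF bergman_integrand_measurable[OF this], of p \<alpha>] f
  have "bergman_nn p \<alpha> f = ennreal (LINT z:unit_disc|lborel. norm (f z) powr p * (1 - (norm z)\<^sup>2) powr \<alpha>)"
    by (simp add: bergman_space_def bergman_nn_def)
  also have "(LINT z:unit_disc|lborel. norm (f z) powr p * (1 - (norm z)\<^sup>2) powr \<alpha>) = pi / (\<alpha> + 1) * bergman_norm p \<alpha> f powr p"
  proof -
    have "0 \<le> (LINT z:unit_disc|lborel. norm (f z) powr p * (1 - (norm z)\<^sup>2) powr \<alpha>)"
      unfolding set_lebesgue_integral_def by (intro integral_nonneg_AE) auto
    thus ?thesis unfolding bergman_norm_def using p a by (simp add: powr_powr)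
  qed
  finally show ?thesis .
qed

lemma nn_integral_radial_weight:
  assumes R: "0 \<le> R" "R < 1" and a: "-1 < \<alpha>"
  shows "(\<integral>\<^sup>+r\<in>{R<..<1}. ennreal (r * (1 - r\<^sup>2) powr \<alpha>) \<partial>lborel) = ennreal ((1 - R\<^sup>2) powr (\<alpha> + 1) / (2 * (\<alpha> + 1)))"
proof -
  define G where "G = (\<lambda>r. - ((1 - r\<^sup>2) powr (\<alpha> + 1)) / (2 * (\<alpha> + 1)))"
  have "((\<lambda>r. r * (1 - r\<^sup>2) powr \<alpha>) has_integral G 1 - G R) {R..1}"
  proof (rule fundamental_theorem_of_calculus_interior)
    show "continuous_on {R..1} G" unfolding G_def using a R
      by (intro continuous_intros continuous_on_powr') (auto simp: power_le_one)
    fix r assume r: "r \<in> {R<..<1}"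
    hence "0 < 1 - r\<^sup>2" using R by (simp add: power_less_one_iff abs_square_less_1)
    hence "((\<lambda>r. (1 - r\<^sup>2) powr (\<alpha> + 1)) has_real_derivative (\<alpha> + 1) * (1 - r\<^sup>2) powr \<alpha> * (- 2 * r)) (at r)"
      by (auto intro!: derivative_eq_intros)
    hence "(G has_real_derivative - ((\<alpha> + 1) * (1 - r\<^sup>2) powr \<alpha> * (- 2 * r)) / (2 * (\<alpha> + 1))) (at r)"
      unfolding G_def by (intro DERIV_cdivide DERIV_minus)
    moreover have *: "- (b * c * (- 2 * r)) / (2 * b) = r * c" if "b \<noteq> 0" for b c :: real
      using that by (simp add: field_simps)
    have "- ((\<alpha> + 1) * (1 - r\<^sup>2) powr \<alpha> * (- 2 * r)) / (2 * (\<alpha> + 1)) = r * (1 - r\<^sup>2) powr \<alpha>"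
      by (rule *) (use a in simp)
    ultimately have "(G has_real_derivative r * (1 - r\<^sup>2) powr \<alpha>) (at r)" by (simp only:)
    thus "(G has_vector_derivative r * (1 - r\<^sup>2) powr \<alpha>) (at r)"
      by (simp add: has_real_derivative_iff_has_vector_derivative)
  qed (use R in simp)
  hence "((\<lambda>r. r * (1 - r\<^sup>2) powr \<alpha>) has_integral (1 - R\<^sup>2) powr (\<alpha> + 1) / (2 * (\<alpha> + 1))) {R<..<1}"
    using a by (simp add: G_def has_integral_Icc_iff_Ioo)
  hence "((\<lambda>r. \<bar>r\<bar> * (1 - r\<^sup>2) powr \<alpha>) has_integral (1 - R\<^sup>2) powr (\<alpha> + 1) / (2 * (\<alpha> + 1))) {R<..<1}"
    by (rule has_integral_eq[rotated]) (use R in auto)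
  from nn_integral_has_integral_lebesgue[OF _ this]
  have "(\<integral>\<^sup>+r. ennreal (indicator {R<..<1} r * (\<bar>r\<bar> * (1 - r\<^sup>2) powr \<alpha>)) \<partial>lborel) = ennreal ((1 - R\<^sup>2) powr (\<alpha> + 1) / (2 * (\<alpha> + 1)))"
    by simp
  moreover have "(\<integral>\<^sup>+r\<in>{R<..<1}. ennreal (r * (1 - r\<^sup>2) powr \<alpha>) \<partial>lborel) = (\<integral>\<^sup>+r. ennreal (indicator {R<..<1} r * (\<bar>r\<bar> * (1 - r\<^sup>2) powr \<alpha>)) \<partial>lborel)"
    using R by (intro nn_integral_cong) (auto simp: indicator_def)
  ultimately show ?thesis by simp
qed

text \<open>In polar coordinates only the radii between R and 1 are kept; there the means are at
  least the mean at R, and the weight has an explicit antiderivative.\<close>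

lemma bergman_nn_ge_mean:
  assumes f: "f holomorphic_on unit_disc" and p: "1 < p" and a: "-1 < \<alpha>" and R: "0 \<le> R" "R < 1"
  shows "ennreal (pi / (\<alpha> + 1) * (integral_mean p R f powr p * (1 - R\<^sup>2) powr (\<alpha> + 1))) \<le> bergman_nn p \<alpha> f"
proof -
  have cf: "continuous_on unit_disc f" using f by (rule holomorphic_on_imp_continuous_on)
  let ?c = "2 * pi * integral_mean p R f powr p"
  have "ennreal (pi / (\<alpha> + 1) * (integral_mean p R f powr p * (1 - R\<^sup>2) powr (\<alpha> + 1)))
      = ennreal ?c * ennreal ((1 - R\<^sup>2) powr (\<alpha> + 1) / (2 * (\<alpha> + 1)))"
    using a by (subst ennreal_mult[symmetric]) (auto simp: field_simps)
  also have "\<dots> = ennreal ?c * (\<integral>\<^sup>+r\<in>{R<..<1}. ennreal (r * (1 - r\<^sup>2) powr \<alpha>) \<partial>lborel)"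
    using nn_integral_radial_weight[OF R a] by simp
  also have "\<dots> = (\<integral>\<^sup>+r. ennreal ?c * (ennreal (r * (1 - r\<^sup>2) powr \<alpha>) * indicator {R<..<1} r) \<partial>lborel)"
    by (rule nn_integral_cmult[symmetric]) measurable
  also have "\<dots> \<le> (\<integral>\<^sup>+r\<in>{0<..<1}. ennreal (r * (1 - r\<^sup>2) powr \<alpha>) * circle_power p r f \<partial>lborel)"
  proof (rule nn_integral_mono)
    fix r :: real
    show "ennreal ?c * (ennreal (r * (1 - r\<^sup>2) powr \<alpha>) * indicator {R<..<1} r) \<le>
      ennreal (r * (1 - r\<^sup>2) powr \<alpha>) * circle_power p r f * indicator {0<..<1} r"
    proof (cases "r \<in> {R<..<1}")
      case True
      have "integral_mean p R f \<le> integral_mean p r f"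
        using True R by (intro integral_mean_mono f p) auto
      hence "integral_mean p R f powr p \<le> integral_mean p r f powr p"
        using p by (intro powr_mono2) auto
      hence "ennreal ?c \<le> circle_power p r f"
        using True R p by (subst circle_power_eq[OF cf]) (auto intro!: ennreal_leI)
      thus ?thesis using True R by (auto simp: mult.commute[of "ennreal ?c"] intro!: mult_left_mono)
    qed auto
  qed
  also have "\<dots> = bergman_nn p \<alpha> f" by (rule bergman_nn_polar[OF cf, symmetric])
  finally show ?thesis .
qed

lemma mean_le_bergman_norm:
  assumes f: "f \<in> bergman_space p \<alpha>" and p: "1 < p" and a: "-1 < \<alpha>" and R: "0 \<le> R" "R < 1"
  shows "integral_mean p R f \<le> (1 - R\<^sup>2) powr (- (\<alpha> + 1) / p) * bergman_norm p \<alpha> f"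
proof -
  have h: "f holomorphic_on unit_disc" using f by (simp add: bergman_space_def)
  have q: "0 < 1 - R\<^sup>2" using R by (simp add: abs_square_less_1)
  have "pi / (\<alpha> + 1) * (integral_mean p R f powr p * (1 - R\<^sup>2) powr (\<alpha> + 1)) \<le> pi / (\<alpha> + 1) * bergman_norm p \<alpha> f powr p"
    using bergman_nn_ge_mean[OF h p a R] p a
    by (subst (asm) bergman_nn_eq[OF f]) (auto simp: ennreal_le_iff)
  hence "integral_mean p R f powr p * (1 - R\<^sup>2) powr (\<alpha> + 1) \<le> bergman_norm p \<alpha> f powr p"
    using a by (subst (asm) mult_le_cancel_left_pos) auto
  hence "(integral_mean p R f powr p * (1 - R\<^sup>2) powr (\<alpha> + 1)) powr (1/p) \<le> (bergman_norm p \<alpha> f powr p) powr (1/p)"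
    using p by (intro powr_mono2) auto
  hence "integral_mean p R f * (1 - R\<^sup>2) powr ((\<alpha> + 1) / p) \<le> bergman_norm p \<alpha> f"
    using p by (simp add: powr_mult powr_powr)
  hence "integral_mean p R f \<le> bergman_norm p \<alpha> f / (1 - R\<^sup>2) powr ((\<alpha> + 1) / p)"
    using q by (simp add: field_simps)
  also have "\<dots> = (1 - R\<^sup>2) powr (- (\<alpha> + 1) / p) * bergman_norm p \<alpha> f"
  proof -
    have "- (\<alpha> + 1) / p = - ((\<alpha> + 1) / p)" by (rule minus_divide_left[symmetric])
    thus ?thesis by (simp only: powr_minus) (simp add: field_simps)
  qed
  finally show ?thesis .
qed

section \<open>Pointwise and radial bounds for Bergman functions\<close>

lemma nn_integral_complex_affine:
  fixes z :: complex and u :: "complex \<Rightarrow> ennreal"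
  assumes [measurable]: "u \<in> borel_measurable borel" and d: "0 < d"
  shows "(\<integral>\<^sup>+w. u w \<partial>lborel) = ennreal (d\<^sup>2) * (\<integral>\<^sup>+w. u (z + d *\<^sub>R w) \<partial>lborel)"
proof -
  have "(\<integral>\<^sup>+w. u w \<partial>lborel) = (\<integral>\<^sup>+w. u w \<partial>density (distr lborel borel (\<lambda>x. z + d *\<^sub>R x)) (\<lambda>_. ennreal (\<bar>d\<bar> ^ DIM(complex))))"
    using lborel_affine[of d z] d by (intro arg_cong[of _ _ "\<lambda>M. integral\<^sup>N M u"]) auto
  thus ?thesis by (simp add: nn_integral_density nn_integral_distr nn_integral_cmult power2_eq_square)
qed

text \<open>Subharmonicity of |f|^p, obtained from \<open>bergman_nn_ge_mean\<close> with R = 0 and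
  weight exponent 0 for the function w -> f(z + d w): its mean at radius 0 is |f(z)|.\<close>

lemma area_mean_value:
  assumes f: "f holomorphic_on unit_disc" and p: "1 < p" and d: "0 < d" "norm z + d \<le> 1"
  shows "ennreal (norm (f z) powr p) \<le>
    ennreal (1 / (pi * d\<^sup>2)) * (\<integral>\<^sup>+w\<in>ball z d. ennreal (norm (f w) powr p) \<partial>lborel)"
proof -
  have [measurable]: "disc_ext f \<in> borel_measurable borel"
    using f by (intro disc_ext_measurable holomorphic_on_imp_continuous_on)
  have in_disc: "norm (z + d *\<^sub>R w) < 1" if "norm w < 1" for w
  proof -
    have "d * norm w < d * 1" using that d by (intro mult_strict_left_mono) auto
    moreover have "norm (d *\<^sub>R w) = d * norm w" using d by simp
    ultimately show ?thesis using norm_triangle_ineq[of z "d *\<^sub>R w"] d by linarith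
  qed
  define h where "h = (\<lambda>w. f (z + d *\<^sub>R w))"
  have "(f \<circ> (\<lambda>w. z + d *\<^sub>R w)) holomorphic_on unit_disc"
    by (rule holomorphic_on_compose_gen[OF _ f])
       (use in_disc in \<open>auto simp: scaleR_conv_of_real intro!: holomorphic_intros\<close>)
  hence h: "h holomorphic_on unit_disc" by (simp add: h_def o_def)
  have im0: "integral_mean p 0 h = norm (f z)"
    using p by (simp add: integral_mean_def h_def set_lebesgue_integral_def powr_powr)
  have "ennreal (pi * norm (f z) powr p) \<le> bergman_nn p 0 h"
    using bergman_nn_ge_mean[OF h p, of 0 0] by (simp add: im0)
  also have "bergman_nn p 0 h = (\<integral>\<^sup>+w. ennreal (norm (disc_ext f (z + d *\<^sub>R w)) powr p) * indicator (ball z d) (z + d *\<^sub>R w) \<partial>lborel)"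
    unfolding bergman_nn_def
  proof (intro nn_integral_cong)
    fix w :: complex
    have "z + d *\<^sub>R w \<in> ball z d \<longleftrightarrow> norm w < 1" using d by (simp add: dist_norm)
    moreover have "(1 - (norm w)\<^sup>2) powr 0 = 1" if "norm w < 1"
      using that by (simp add: abs_square_eq_1 power_eq_1_iff)
    ultimately show "ennreal (norm (h w) powr p * (1 - (norm w)\<^sup>2) powr 0) * indicator unit_disc w =
      ennreal (norm (disc_ext f (z + d *\<^sub>R w)) powr p) * indicator (ball z d) (z + d *\<^sub>R w)"
      using in_disc[of w] by (auto simp: indicator_def h_def)
  qed
  also have "ennreal (d\<^sup>2) * \<dots> = (\<integral>\<^sup>+w. ennreal (norm (disc_ext f w) powr p) * indicator (ball z d) w \<partial>lborel)"
    using d by (intro nn_integral_complex_affine[symmetric]) measurable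
  also have "\<dots> = (\<integral>\<^sup>+w\<in>ball z d. ennreal (norm (f w) powr p) \<partial>lborel)"
  proof (intro nn_integral_cong)
    fix w
    have "norm w < 1" if "w \<in> ball z d"
      using that d norm_triangle_ineq2[of w z] by (simp add: dist_norm norm_minus_commute)
    thus "ennreal (norm (disc_ext f w) powr p) * indicator (ball z d) w = ennreal (norm (f w) powr p) * indicator (ball z d) w"
      by (auto simp: indicator_def)
  qed
  finally have "ennreal (d\<^sup>2) * ennreal (pi * norm (f z) powr p) \<le> (\<integral>\<^sup>+w\<in>ball z d. ennreal (norm (f w) powr p) \<partial>lborel)"
    by (simp add: mult_left_mono)
  hence "ennreal (1 / (pi * d\<^sup>2)) * (ennreal (d\<^sup>2) * ennreal (pi * norm (f z) powr p)) \<le>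
     ennreal (1 / (pi * d\<^sup>2)) * (\<integral>\<^sup>+w\<in>ball z d. ennreal (norm (f w) powr p) \<partial>lborel)"
    by (rule mult_left_mono) simp
  thus ?thesis using d by (simp add: ennreal_mult[symmetric])
qed

text \<open>The exponent \<alpha> may have either sign, hence the minimum of both end
  values.\<close>

lemma powr_between:
  fixes u a b \<alpha> :: real
  assumes "0 < a" "a \<le> u" "u \<le> b"
  shows "min (a powr \<alpha>) (b powr \<alpha>) \<le> u powr \<alpha>"
proof (cases "0 \<le> \<alpha>")
  case True
  have "a powr \<alpha> \<le> u powr \<alpha>" using assms True by (intro powr_mono2) auto
  thus ?thesis by linarith
next
  case False
  have "b powr \<alpha> \<le> u powr \<alpha>" using assms False by (intro powr_mono2') auto
  thus ?thesis by linarith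
qed

text \<open>The disc of radius (1 - \<rho>)/2 about z stays in a smaller concentric disc, where the
  weight is at least a positive constant, so the area mean value inequality applies. The bound
  provides normal families and makes point evaluation continuous.\<close>

lemma bergman_pointwise:
  assumes p: "1 < p" and a: "-1 < \<alpha>" and rho: "0 \<le> \<rho>" "\<rho> < 1"
  obtains C where "0 < C" "\<And>f (z :: complex). f \<in> bergman_space p \<alpha> \<Longrightarrow> norm z \<le> \<rho> \<Longrightarrow> norm (f z) \<le> C * bergman_norm p \<alpha> f"
proof -
  define d where "d = (1 - \<rho>) / 2"
  define c where "c = min ((1 - ((1 + \<rho>) / 2)\<^sup>2) powr \<alpha>) (1 powr \<alpha>)"
  have d: "0 < d" using rho by (simp add: d_def)
  have q: "0 < 1 - ((1 + \<rho>) / 2)\<^sup>2" using rho by (simp add: abs_square_less_1)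
  have c: "0 < c" using q by (simp add: c_def)
  define C where "C = (1 / (pi * d\<^sup>2) * (1 / c) * (pi / (\<alpha> + 1))) powr (1 / p)"
  show ?thesis
  proof (rule that[of C])
    have "0 < 1 / (pi * d\<^sup>2) * (1 / c) * (pi / (\<alpha> + 1))" using c d a
      by (intro mult_pos_pos divide_pos_pos) auto
    thus "0 < C" using c d a by (simp add: C_def)
  next
    fix f and z :: complex assume f: "f \<in> bergman_space p \<alpha>" and z: "norm z \<le> \<rho>"
    have hf: "f holomorphic_on unit_disc" using f by (simp add: bergman_space_def)
    have "ennreal (norm (f z) powr p) \<le> ennreal (1 / (pi * d\<^sup>2)) * (\<integral>\<^sup>+w\<in>ball z d. ennreal (norm (f w) powr p) \<partial>lborel)"
      using z rho by (intro area_mean_value hf p d) (simp add: d_def field_simps)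
    also have "(\<integral>\<^sup>+w\<in>ball z d. ennreal (norm (f w) powr p) \<partial>lborel) \<le> (\<integral>\<^sup>+w. ennreal (1 / c) * (ennreal (norm (disc_ext f w) powr p * (1 - (norm w)\<^sup>2) powr \<alpha>) * indicator unit_disc w) \<partial>lborel)"
    proof (intro nn_integral_mono)
      fix w :: complex
      show "ennreal (norm (f w) powr p) * indicator (ball z d) w \<le> ennreal (1 / c) * (ennreal (norm (disc_ext f w) powr p * (1 - (norm w)\<^sup>2) powr \<alpha>) * indicator unit_disc w)"
      proof (cases "w \<in> ball z d")
        case True
        have "norm w \<le> norm z + norm (z - w)" using norm_triangle_ineq2[of w z] by (simp add: norm_minus_commute)
        hence w: "norm w \<le> (1 + \<rho>) / 2" using True z by (simp add: dist_norm d_def field_simps)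
        hence w1: "norm w < 1" using rho by simp
        have "(norm w)\<^sup>2 \<le> ((1 + \<rho>) / 2)\<^sup>2" using w by (intro power_mono) auto
        hence "c \<le> (1 - (norm w)\<^sup>2) powr \<alpha>" unfolding c_def using q by (intro powr_between) auto
        hence "norm (f w) powr p * c \<le> norm (f w) powr p * (1 - (norm w)\<^sup>2) powr \<alpha>"
          by (intro mult_left_mono) auto
        hence "norm (f w) powr p \<le> 1 / c * (norm (f w) powr p * (1 - (norm w)\<^sup>2) powr \<alpha>)"
          using c by (simp add: field_simps)
        thus ?thesis using True w1 c by (simp add: ennreal_mult[symmetric] ennreal_leI)
      qed auto
    qed
    also have "\<dots> = ennreal (1 / c) * (\<integral>\<^sup>+w. ennreal (norm (disc_ext f w) powr p * (1 - (norm w)\<^sup>2) powr \<alpha>) * indicator unit_disc w \<partial>lborel)"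
    proof (rule nn_integral_cmult)
      have [measurable]: "disc_ext f \<in> borel_measurable borel"
        using hf by (intro disc_ext_measurable holomorphic_on_imp_continuous_on)
      show "(\<lambda>w. ennreal (norm (disc_ext f w) powr p * (1 - (norm w)\<^sup>2) powr \<alpha>) * indicator unit_disc w) \<in> borel_measurable lborel"
        by measurable
    qed
    also have "(\<integral>\<^sup>+w. ennreal (norm (disc_ext f w) powr p * (1 - (norm w)\<^sup>2) powr \<alpha>) * indicator unit_disc w \<partial>lborel) = bergman_nn p \<alpha> f"
      unfolding bergman_nn_def by (intro nn_integral_cong) (auto simp: indicator_def)
    also have "\<dots> = ennreal (pi / (\<alpha> + 1) * bergman_norm p \<alpha> f powr p)"
      using p by (intro bergman_nn_eq f a) auto
    finally have "ennreal (norm (f z) powr p) \<le> ennreal (1 / (pi * d\<^sup>2)) * (ennreal (1 / c) * ennreal (pi / (\<alpha> + 1) * bergman_norm p \<alpha> f powr p))"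
      by (simp add: mult_left_mono)
    hence "ennreal (norm (f z) powr p) \<le> ennreal (1 / (pi * d\<^sup>2) * (1 / c * (pi / (\<alpha> + 1) * bergman_norm p \<alpha> f powr p)))"
      using c d by (subst ennreal_mult', simp, subst ennreal_mult', simp, simp)
    hence "norm (f z) powr p \<le> 1 / (pi * d\<^sup>2) * (1 / c * (pi / (\<alpha> + 1) * bergman_norm p \<alpha> f powr p))"
      using c d a by (subst (asm) ennreal_le_iff) auto
    hence "norm (f z) powr p \<le> 1 / (pi * d\<^sup>2) * (1 / c) * (pi / (\<alpha> + 1)) * bergman_norm p \<alpha> f powr p"
      by (simp only: mult.assoc)
    hence "(norm (f z) powr p) powr (1/p) \<le> (1 / (pi * d\<^sup>2) * (1 / c) * (pi / (\<alpha> + 1)) * bergman_norm p \<alpha> f powr p) powr (1/p)"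
      using p by (intro powr_mono2) auto
    thus "norm (f z) \<le> C * bergman_norm p \<alpha> f"
      using p c d a unfolding C_def by (subst (asm) powr_mult) (auto simp: powr_powr)
  qed
qed

text \<open>A Carleson embedding for the radius. The area mean value over the disc about t of radius
  (1 - t)/2, where the weight is comparable to (1 - t)^\<alpha>, bounds the integrand by a multiple
  of 1/(1 - t) times the Bergman integral over that disc. Tonelli then leaves, for each w, the
  integral of dt/(1 - t) over those t whose disc contains w, and this is bounded.\<close>

lemma bergman_radius_carleson:
  assumes p: "1 < p"
  obtains C where "0 < C" "\<And>f. f holomorphic_on unit_disc \<Longrightarrow>
    (\<integral>\<^sup>+t\<in>{0..<1}. ennreal (norm (f (complex_of_real t)) powr p * (1 - t) powr (\<alpha> + 1)) \<partial>lborel)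
      \<le> ennreal C * bergman_nn p \<alpha> f"
proof -
  \<comment> \<open>On the disc about t the quotient (1 - |w|^2)/(1 - t) lies between 1/2 and
    3.\<close>
  define c where "c = min ((1/2) powr \<alpha>) (3 powr \<alpha> :: real)"
  have c: "0 < c" by (simp add: c_def)
  \<comment> \<open>4/pi comes from the area of a disc of radius (1 - t)/2, c from the weight, and 3
    is the length 2 y of the interval of admissible t times the bound 3/(2 y) for 1/(1 - t), where y
    = 1 - |w|.\<close>
  define C where "C = 4 / (pi * c) * 3"
  show ?thesis
  proof (rule that[of C])
    show "0 < C" using c by (simp add: C_def)
    fix f assume hf: "f holomorphic_on unit_disc"
    have [measurable]: "disc_ext f \<in> borel_measurable borel"
      using hf by (intro disc_ext_measurable holomorphic_on_imp_continuous_on)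
    define u where "u = (\<lambda>w. ennreal (norm (disc_ext f w) powr p * (1 - (norm w)\<^sup>2) powr \<alpha>) * indicator unit_disc w)"
    have [measurable]: "u \<in> borel_measurable borel" unfolding u_def by measurable
    define k where "k = (\<lambda>t w. ennreal (4 / (pi * c) / (1 - t)) * (if norm (w - complex_of_real t) < (1 - t) / 2 then u w else 0) * indicator {0..<1} t)"
    have [measurable]: "(\<lambda>(t, w). k t w) \<in> borel_measurable (lborel \<Otimes>\<^sub>M lborel)" unfolding k_def by measurable
    have le1: "ennreal (norm (f (complex_of_real t)) powr p * (1 - t) powr (\<alpha> + 1)) * indicator {0..<1} t \<le> (\<integral>\<^sup>+w. k t w \<partial>lborel)" for t
    proof (cases "t \<in> {0..<1}")
      case True
      define d where "d = (1 - t) / 2"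
      have d: "0 < d" "t + d \<le> 1" using True by (auto simp: d_def field_simps)
      have "ennreal ((1 - t) powr (\<alpha> + 1)) * ennreal (norm (f (complex_of_real t)) powr p) \<le>
        ennreal ((1 - t) powr (\<alpha> + 1)) * (ennreal (1 / (pi * d\<^sup>2)) * (\<integral>\<^sup>+w\<in>ball (of_real t) d. ennreal (norm (f w) powr p) \<partial>lborel))"
        using True d by (intro mult_left_mono area_mean_value hf p) auto
      also have "\<dots> = (ennreal ((1 - t) powr (\<alpha> + 1)) * ennreal (1 / (pi * d\<^sup>2))) * (\<integral>\<^sup>+w. ennreal (norm (disc_ext f w) powr p) * indicator (ball (of_real t) d) w \<partial>lborel)"
      proof -
        have "norm w < 1" if "w \<in> ball (complex_of_real t) d" for w
          using that d True norm_triangle_ineq2[of w "complex_of_real t"] by (simp add: dist_norm norm_minus_commute)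
        hence "(\<integral>\<^sup>+w\<in>ball (of_real t) d. ennreal (norm (f w) powr p) \<partial>lborel) = (\<integral>\<^sup>+w. ennreal (norm (disc_ext f w) powr p) * indicator (ball (of_real t) d) w \<partial>lborel)"
          by (intro nn_integral_cong) (auto simp: indicator_def)
        thus ?thesis by (simp add: mult.assoc)
      qed
      also have "\<dots> = (\<integral>\<^sup>+w. (ennreal ((1 - t) powr (\<alpha> + 1)) * ennreal (1 / (pi * d\<^sup>2))) * (ennreal (norm (disc_ext f w) powr p) * indicator (ball (of_real t) d) w) \<partial>lborel)"
        by (rule nn_integral_cmult[symmetric]) measurable
      also have "\<dots> \<le> (\<integral>\<^sup>+w. k t w \<partial>lborel)"
      proof (rule nn_integral_mono)
        fix w
        show "(ennreal ((1 - t) powr (\<alpha> + 1)) * ennreal (1 / (pi * d\<^sup>2))) * (ennreal (norm (disc_ext f w) powr p) * indicator (ball (of_real t) d) w) \<le> k t w"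
        proof (cases "w \<in> ball (complex_of_real t) d")
          case T2: True
          hence nd: "norm (w - complex_of_real t) < d" by (simp add: dist_norm norm_minus_commute)
          have n1: "norm w < t + d" "t - d < norm w"
            using nd True norm_triangle_ineq2[of w "complex_of_real t"] norm_triangle_ineq2[of "complex_of_real t" w]
            by (simp_all add: norm_minus_commute)
          define x where "x = 1 - t"
          define y where "y = 1 - (norm w)\<^sup>2"
          have w1: "norm w < 1" using n1 d by simp
          have "y = (1 - norm w) * (1 + norm w)" by (simp add: y_def power2_eq_square algebra_simps)
          moreover have "(1 - norm w) * 1 \<le> (1 - norm w) * (1 + norm w)" "(1 - norm w) * (1 + norm w) \<le> (1 - norm w) * 2"
            by (rule mult_left_mono; use w1 in simp)+
          ultimately have y: "x / 2 \<le> y" "y \<le> 3 * x" using n1 by (auto simp: x_def d_def field_simps)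
          have x: "0 < x" using True by (simp add: x_def)
          have "c \<le> (y / x) powr \<alpha>" unfolding c_def using x y by (intro powr_between) (auto simp: field_simps)
          hence "c * x powr \<alpha> \<le> y powr \<alpha>" using x y by (simp add: powr_divide field_simps)
          hence xy: "x powr \<alpha> \<le> y powr \<alpha> / c" using c by (simp add: field_simps)
          have "x powr (\<alpha> + 1) * (1 / (pi * d\<^sup>2)) = 4 / pi / x * x powr \<alpha>"
            using x unfolding d_def x_def[symmetric] by (simp add: powr_add power2_eq_square field_simps)
          also have "\<dots> \<le> 4 / pi / x * (y powr \<alpha> / c)" using xy x by (intro mult_left_mono) auto
          finally have "x powr (\<alpha> + 1) * (1 / (pi * d\<^sup>2)) * norm (disc_ext f w) powr p \<le> 4 / pi / x * (y powr \<alpha> / c) * norm (disc_ext f w) powr p"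
            by (rule mult_right_mono) simp
          also have "\<dots> = 4 / (pi * c) / x * (norm (disc_ext f w) powr p * y powr \<alpha>)" by (simp add: mult_ac)
          finally have main: "x powr (\<alpha> + 1) * (1 / (pi * d\<^sup>2)) * norm (disc_ext f w) powr p \<le> 4 / (pi * c) / x * (norm (disc_ext f w) powr p * y powr \<alpha>)" .
          have "k t w = ennreal (4 / (pi * c) / x) * ennreal (norm (disc_ext f w) powr p * y powr \<alpha>)"
            using True nd w1 by (simp add: k_def u_def d_def x_def y_def)
          also have "\<dots> = ennreal (4 / (pi * c) / x * (norm (disc_ext f w) powr p * y powr \<alpha>))"
            using c x by (intro ennreal_mult[symmetric]) auto
          finally have "k t w = \<dots>" .
          moreover have "(ennreal ((1 - t) powr (\<alpha> + 1)) * ennreal (1 / (pi * d\<^sup>2))) * (ennreal (norm (disc_ext f w) powr p) * indicator (ball (of_real t) d) w)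
            = ennreal (x powr (\<alpha> + 1) * (1 / (pi * d\<^sup>2)) * norm (disc_ext f w) powr p)"
            using T2 d by (simp add: x_def ennreal_mult[symmetric])
          ultimately show ?thesis using main by (simp add: ennreal_leI)
        qed auto
      qed
      finally show ?thesis using True by (simp add: ennreal_mult mult.commute)
    qed auto
    \<comment> \<open>For fixed w only those t matter for which 1 - t lies between 2/3 and 2 times 1
      - |w|.\<close>
    have le2: "(\<integral>\<^sup>+t. k t w \<partial>lborel) \<le> ennreal C * u w" for w
    proof (cases "norm w < 1")
      case True
      define y where "y = 1 - norm w"
      have y: "0 < y" using True by (simp add: y_def)
      have "(\<integral>\<^sup>+t. k t w \<partial>lborel) \<le> (\<integral>\<^sup>+t. (ennreal (4 / (pi * c) * (3 / (2 * y))) * u w) * indicator {1 - 2 * y..1} t \<partial>lborel)"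
      proof (rule nn_integral_mono)
        fix t
        show "k t w \<le> (ennreal (4 / (pi * c) * (3 / (2 * y))) * u w) * indicator {1 - 2 * y..1} t"
        proof (cases "t \<in> {0..<1} \<and> norm (w - complex_of_real t) < (1 - t) / 2")
          case T2: True
          moreover from T2 have "norm (complex_of_real t) = t" by simp
          ultimately have "norm w < t + (1 - t) / 2" "t - (1 - t) / 2 < norm w"
            using norm_triangle_ineq2[of w "complex_of_real t"] norm_triangle_ineq2[of "complex_of_real t" w]
            unfolding norm_minus_commute[of "complex_of_real t" w] by linarith+
          hence b: "1 - t \<le> 2 * y" "2 / 3 * y \<le> 1 - t" by (auto simp: y_def field_simps)
          have "1 / (1 - t) \<le> 1 / (2 / 3 * y)" using b y T2 by (intro divide_left_mono) auto
          hence "4 / (pi * c) * (1 / (1 - t)) \<le> 4 / (pi * c) * (3 / (2 * y))"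
            using c by (intro mult_left_mono) auto
          hence "ennreal (4 / (pi * c) / (1 - t)) * u w \<le> ennreal (4 / (pi * c) * (3 / (2 * y))) * u w"
            by (intro mult_right_mono ennreal_leI) auto
          thus ?thesis using T2 b by (simp add: k_def)
        qed (auto simp: k_def)
      qed
      also have "\<dots> = (ennreal (4 / (pi * c) * (3 / (2 * y))) * u w) * ennreal (2 * y)"
        using y by (subst nn_integral_cmult_indicator) auto
      also have "\<dots> = (ennreal (4 / (pi * c) * (3 / (2 * y))) * ennreal (2 * y)) * u w" by (simp add: mult_ac)
      also have "ennreal (4 / (pi * c) * (3 / (2 * y))) * ennreal (2 * y) = ennreal C"
        using y c by (subst ennreal_mult[symmetric]) (auto simp: C_def)
      finally show ?thesis .
    next
      case False
      hence "u w = 0" by (simp add: u_def)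
      thus ?thesis by (simp add: k_def cong: if_cong)
    qed
    have "(\<integral>\<^sup>+t\<in>{0..<1}. ennreal (norm (f (complex_of_real t)) powr p * (1 - t) powr (\<alpha> + 1)) \<partial>lborel)
      \<le> (\<integral>\<^sup>+t. (\<integral>\<^sup>+w. k t w \<partial>lborel) \<partial>lborel)"
      by (intro nn_integral_mono le1)
    also have "\<dots> = (\<integral>\<^sup>+w. (\<integral>\<^sup>+t. k t w \<partial>lborel) \<partial>lborel)"
      by (rule pair_sigma_finite.Fubini'[symmetric]) (auto simp: pair_sigma_finite_def sigma_finite_lborel)
    also have "\<dots> \<le> (\<integral>\<^sup>+w. ennreal C * u w \<partial>lborel)" by (intro nn_integral_mono le2)
    also have "\<dots> = ennreal C * (\<integral>\<^sup>+w. u w \<partial>lborel)" by (rule nn_integral_cmult) measurable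
    also have "(\<integral>\<^sup>+w. u w \<partial>lborel) = bergman_nn p \<alpha> f"
      unfolding bergman_nn_def u_def by (intro nn_integral_cong) (auto simp: indicator_def)
    finally show "(\<integral>\<^sup>+t\<in>{0..<1}. ennreal (norm (f (complex_of_real t)) powr p * (1 - t) powr (\<alpha> + 1)) \<partial>lborel)
      \<le> ennreal C * bergman_nn p \<alpha> f" .
  qed
qed

section \<open>Boundary values of Hardy functions\<close>

lemma powr_midpoint_strict:
  fixes x y p :: real
  assumes p: "1 < p" and xy: "0 \<le> x" "x < y"
  shows "((x + y) / 2) powr p < (x powr p + y powr p) / 2"
proof -
  define m where "m = (x + y) / 2"
  have m: "x < m" "m < y" "0 < m" using xy by (auto simp: m_def)
  have d: "((\<lambda>t. t powr p) has_derivative (\<lambda>h. p * t powr (p - 1) * h)) (at t)" if "0 < t" for t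
    using that by (intro has_field_derivative_imp_has_derivative) (auto intro!: derivative_eq_intros)
  have cont: "continuous_on {a..b} (\<lambda>t. t powr p)" if "0 \<le> a" for a b :: real
    using p that by (intro continuous_on_powr' continuous_intros) auto
  obtain u where u: "x < u" "u < m" "m powr p - x powr p = p * u powr (p - 1) * (m - x)"
    by (rule mvt[OF m(1) cont[of x m] d]) (use xy in auto)
  obtain v where v: "m < v" "v < y" "y powr p - m powr p = p * v powr (p - 1) * (y - m)"
    by (rule mvt[OF m(2) cont[of m y] d]) (use m in auto)
  have "u powr (p - 1) < v powr (p - 1)" using u v xy p by (intro powr_less_mono2) auto
  moreover have mx: "m - x = y - m" and "0 < y - m" using m by (auto simp: m_def field_simps)
  ultimately have "p * u powr (p - 1) * (m - x) < p * v powr (p - 1) * (y - m)"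
    unfolding mx using p by (intro mult_strict_right_mono mult_strict_left_mono) auto
  thus ?thesis using u(3) v(3) unfolding m_def by simp
qed

lemma powr_midpoint_le:
  fixes x y p :: real
  assumes p: "1 < p" and xy: "0 \<le> x" "0 \<le> y"
  shows "((x + y) / 2) powr p \<le> (x powr p + y powr p) / 2"
  using powr_midpoint_strict[OF p, of x y] powr_midpoint_strict[OF p, of y x] xy
  by (cases x y rule: linorder_cases) (auto simp: add.commute)

text \<open>In the equality case strict convexity forces equal moduli, and equality in the triangle
  inequality forces equal directions.\<close>

lemma norm_powr_midpoint:
  fixes a b :: complex
  assumes p: "1 < p"
  shows "norm ((a + b) / 2) powr p \<le> (norm a powr p + norm b powr p) / 2"
    and "norm ((a + b) / 2) powr p = (norm a powr p + norm b powr p) / 2 \<Longrightarrow> a = b"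
proof -
  have 1: "norm ((a + b) / 2) powr p \<le> ((norm a + norm b) / 2) powr p"
    using p norm_triangle_ineq[of a b] by (intro powr_mono2) (auto simp: norm_divide)
  have 2: "((norm a + norm b) / 2) powr p \<le> (norm a powr p + norm b powr p) / 2"
    using p by (intro powr_midpoint_le) auto
  show "norm ((a + b) / 2) powr p \<le> (norm a powr p + norm b powr p) / 2" using 1 2 by simp
  assume eq: "norm ((a + b) / 2) powr p = (norm a powr p + norm b powr p) / 2"
  have nab: "norm a = norm b"
    using 1 2 eq powr_midpoint_strict[OF p, of "norm a" "norm b"] powr_midpoint_strict[OF p, of "norm b" "norm a"]
    by (cases "norm a" "norm b" rule: linorder_cases) (auto simp: add.commute)
  have "norm ((a + b) / 2) powr p = ((norm a + norm b) / 2) powr p" using 1 2 eq by simp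
  hence "(norm ((a + b) / 2) powr p) powr (1/p) = (((norm a + norm b) / 2) powr p) powr (1/p)" by (rule arg_cong)
  hence "norm ((a + b) / 2) = (norm a + norm b) / 2" using p unfolding powr_powr by simp
  hence "norm (a + b) = norm a + norm b" by (simp add: norm_divide)
  hence "norm a *\<^sub>R b = norm b *\<^sub>R a" by (simp add: norm_triangle_eq)
  thus "a = b" using nab by (cases "norm a = 0") auto
qed

text \<open>A compactness substitute for Clarkson's inequalities.\<close>

lemma power_uniform_convexity:
  assumes p: "1 < p" and e: "0 < e"
  obtains C where "0 < C" "\<And>a b :: complex. norm (a - b) powr p \<le>
     e * (norm a powr p + norm b powr p) + C * ((norm a powr p + norm b powr p) / 2 - norm ((a + b) / 2) powr p)"
proof -
  \<comment> \<open>The inequality is homogeneous of degree p, so normalised pairs suffice. On those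
    with |a - b|^p >= e, a compact set, the midpoint defect \<open>E\<close> is continuous and
    positive, hence bounded below.\<close>
  define S where "S = {z :: complex \<times> complex. norm (fst z) powr p + norm (snd z) powr p = 1 \<and> e \<le> norm (fst z - snd z) powr p}"
  define E where "E = (\<lambda>z :: complex \<times> complex. (norm (fst z) powr p + norm (snd z) powr p) / 2 - norm ((fst z + snd z) / 2) powr p)"
  have contE: "continuous_on A E" for A
    unfolding E_def using p by (intro continuous_intros continuous_on_powr') auto
  have le1: "norm a \<le> 1 \<and> norm b \<le> 1" if "norm a powr p + norm b powr p = 1" for a b :: complex
  proof -
    have "norm a powr p \<le> 1 powr p" "norm b powr p \<le> 1 powr p" using that by (auto simp: add_nonneg_eq_0_iff) (smt (verit) powr_ge_zero)+
    thus ?thesis using p by (meson powr_less_mono2 not_le norm_ge_zero zero_le_one less_trans zero_less_one)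
  qed
  have "compact S"
  proof (rule compact_eq_bounded_closed[THEN iffD2], intro conjI)
    have "norm z \<le> 2" if "z \<in> S" for z
      using that le1[of "fst z" "snd z"] norm_Pair_le[of "fst z" "snd z"] by (auto simp: S_def)
    thus "bounded S" unfolding bounded_iff by blast
    have "S = {z. norm (fst z) powr p + norm (snd z) powr p = 1} \<inter> {z. e \<le> norm (fst z - snd z) powr p}"
      by (auto simp: S_def)
    moreover have "closed {z :: complex \<times> complex. norm (fst z) powr p + norm (snd z) powr p = 1}"
      using p by (intro closed_Collect_eq continuous_intros continuous_on_powr') auto
    moreover have "closed {z :: complex \<times> complex. e \<le> norm (fst z - snd z) powr p}"
      using p by (intro closed_Collect_le continuous_intros continuous_on_powr') auto
    ultimately show "closed S" by auto
  qed
  obtain \<delta> where \<delta>: "0 < \<delta>" "\<And>z. z \<in> S \<Longrightarrow> \<delta> \<le> E z"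
  proof (cases "S = {}")
    case True thus ?thesis using that[of 1] by simp
  next
    case False
    obtain z where z: "z \<in> S" "\<And>y. y \<in> S \<Longrightarrow> E z \<le> E y"
      using continuous_attains_inf[OF \<open>compact S\<close> False contE] by blast
    have "0 \<le> E z" using norm_powr_midpoint(1)[OF p] by (auto simp: E_def)
    moreover have "E z \<noteq> 0"
    proof
      assume "E z = 0"
      hence "fst z = snd z" using norm_powr_midpoint(2)[OF p, of "fst z" "snd z"] by (auto simp: E_def)
      thus False using z(1) e by (auto simp: S_def)
    qed
    ultimately show ?thesis using that[of "E z"] z by simp
  qed
  \<comment> \<open>On \<open>S\<close> one has |a - b|^p <= 2^p = C \<delta> <= C E.\<close>
  define C where "C = 2 powr p / \<delta>"
  show ?thesis
  proof (rule that[of C])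
    show "0 < C" using \<delta> by (simp add: C_def)
    fix a b :: complex
    define s where "s = (norm a powr p + norm b powr p) powr (1 / p)"
    show "norm (a - b) powr p \<le>
     e * (norm a powr p + norm b powr p) + C * ((norm a powr p + norm b powr p) / 2 - norm ((a + b) / 2) powr p)"
    proof (cases "a = 0 \<and> b = 0")
      case False
      have "0 < norm a powr p + norm b powr p" using False by (auto intro: add_pos_nonneg add_nonneg_pos)
      hence s: "0 < s" "s powr p = norm a powr p + norm b powr p" using p by (auto simp: s_def powr_powr)
      define a' where "a' = a / of_real s"
      define b' where "b' = b / of_real s"
      have n: "norm a powr p = s powr p * norm a' powr p" "norm b powr p = s powr p * norm b' powr p"
        "norm (a - b) powr p = s powr p * norm (a' - b') powr p" "norm ((a + b) / 2) powr p = s powr p * norm ((a' + b') / 2) powr p"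
        using s(1) by (auto simp: a'_def b'_def powr_divide powr_mult norm_divide simp flip: diff_divide_distrib add_divide_distrib)
      have n1: "norm a' powr p + norm b' powr p = 1" using s n by (simp add: distrib_left[symmetric])
      have "norm (a' - b') powr p \<le> e + C * E (a', b')"
      proof (cases "e \<le> norm (a' - b') powr p")
        case True
        have "norm (a' - b') powr p \<le> 2 powr p"
          using le1[OF n1] norm_triangle_ineq4[of a' b'] p by (intro powr_mono2) auto
        also have "\<dots> \<le> C * E (a', b')"
          using \<delta>(2)[of "(a', b')"] \<delta>(1) True n1 by (simp add: C_def S_def field_simps)
        finally show ?thesis using e by simp
      next
        case False
        have "0 \<le> C * E (a', b')" using \<delta> norm_powr_midpoint(1)[OF p, of a' b'] by (auto simp: C_def E_def)
        thus ?thesis using False by simp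
      qed
      hence "s powr p * norm (a' - b') powr p \<le> s powr p * (e * (norm a' powr p + norm b' powr p) + C * E (a', b'))"
        using n1 by (intro mult_left_mono) auto
      thus ?thesis unfolding n E_def by (simp add: algebra_simps)
    qed (use p in auto)
  qed
qed

lemma circle_LINT_eq:
  assumes p: "0 < p"
  shows "(LINT t:{0..2*pi}|lborel. norm (f (complex_of_real r * cis t)) powr p) = 2 * pi * integral_mean p r f powr p"
proof -
  have "0 \<le> (LINT t:{0..2*pi}|lborel. norm (f (complex_of_real r * cis t)) powr p)"
    unfolding set_lebesgue_integral_def by (intro integral_nonneg_AE) auto
  thus ?thesis using p by (simp add: integral_mean_def powr_powr)
qed

lemma circle_power_integrable:
  fixes u :: "real \<Rightarrow> complex"
  assumes "continuous_on {0..2*pi} u" "0 < p"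
  shows "set_integrable lborel {0..2*pi} (\<lambda>t. norm (u t) powr p)"
  using assms by (intro borel_integrable_atLeastAtMost' continuous_on_powr' continuous_intros) auto

text \<open>The means increase to a finite limit, so two large radii r <= s have almost equal means;
  by uniform convexity it remains to see that the midpoint of the two circle functions has almost
  the same mean. This midpoint is the circle function at radius s of a holomorphic function, so its
  mean is at least that at a fixed smaller radius \<rho>, where continuity gives the lower
  bound.\<close>

lemma hardy_Lp_cauchy:
  assumes G: "G holomorphic_on unit_disc" and p: "1 < p"
    and bd: "\<And>r. 0 < r \<Longrightarrow> r < 1 \<Longrightarrow> integral_mean p r G \<le> M" and \<eta>: "0 < \<eta>"
  obtains r0 where "0 < r0" "r0 < 1" "\<And>r s. r0 \<le> r \<Longrightarrow> r \<le> s \<Longrightarrow> s < 1 \<Longrightarrow>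
    (LINT t:{0..2*pi}|lborel. norm (G (complex_of_real r * cis t) - G (complex_of_real s * cis t)) powr p) \<le> \<eta>"
proof -
  have cG: "continuous_on unit_disc G" using G by (rule holomorphic_on_imp_continuous_on)
  let ?J = "\<lambda>u :: real \<Rightarrow> complex. LINT t:{0..2*pi}|lborel. norm (u t) powr p"
  define A where "A = (\<lambda>r. 2 * pi * integral_mean p r G powr p)"
  define B where "B = 2 * pi * \<bar>M\<bar> powr p"
  have AB: "A r \<le> B" if "0 < r" "r < 1" for r
    using bd[OF that] p unfolding A_def B_def by (auto intro!: powr_mono2)
  define L where "L = Sup (A ` {0<..<1})"
  have bddA: "bdd_above (A ` {0<..<1})" using AB by (auto intro!: bdd_aboveI[where M=B])
  have AL: "A r \<le> L" if "0 < r" "r < 1" for r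
    unfolding L_def using that bddA by (intro cSUP_upper) auto
  have B0: "0 \<le> B" by (simp add: B_def)
  \<comment> \<open>With this e and the \<kappa> chosen next, the two terms of the convexity
    inequality contribute \<eta>/2 each.\<close>
  define e where "e = \<eta> / (4 * (B + 1))"
  have e: "0 < e" "e * (2 * B) \<le> \<eta> / 2" using \<eta> B0 by (auto simp: e_def field_simps)
  obtain C where C: "0 < C" "\<And>a b :: complex. norm (a - b) powr p \<le>
     e * (norm a powr p + norm b powr p) + C * ((norm a powr p + norm b powr p) / 2 - norm ((a + b) / 2) powr p)"
    using power_uniform_convexity[OF p e(1)] by blast
  define \<kappa> where "\<kappa> = \<eta> / (4 * C)"
  have \<kappa>: "0 < \<kappa>" using \<eta> C by (simp add: \<kappa>_def)
  have "L - \<kappa> < Sup (A ` {0<..<1})" using \<kappa> by (simp add: L_def)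
  then obtain \<rho> where \<rho>: "0 < \<rho>" "\<rho> < 1" "L - \<kappa> < A \<rho>"
    by (subst (asm) less_cSUP_iff[OF _ bddA]) auto
  \<comment> \<open>The first coordinate is the ratio q = r/s. At q = 1 this is |G|^p on the circle
    of radius \<rho>; uniform continuity on the compact rectangle makes the approach uniform in the
    angle.\<close>
  define h where "h = (\<lambda>x. norm ((G (complex_of_real \<rho> * cis (snd x)) + G (complex_of_real (fst x * \<rho>) * cis (snd x))) / 2) powr p)"
  have "continuous_on ({0..1} \<times> {0..2*pi}) h"
    unfolding h_def
  proof (intro continuous_on_powr' continuous_intros continuous_on_compose2[OF cG])
    have "t * \<rho> < 1" if "t \<in> {0..1}" for t
    proof -
      have "t * \<rho> \<le> 1 * \<rho>" using that \<rho> by (intro mult_right_mono) auto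
      thus ?thesis using \<rho> by linarith
    qed
    thus "(\<lambda>x. complex_of_real (fst x * \<rho>) * cis (snd x)) ` ({0..1} \<times> {0..2 * pi}) \<subseteq> unit_disc"
      using \<rho> by (auto simp: norm_mult abs_mult)
    show "(\<lambda>x. complex_of_real \<rho> * cis (snd x)) ` ({0..1} \<times> {0..2 * pi}) \<subseteq> unit_disc"
      using \<rho> by (auto simp: norm_mult)
  qed (use p in auto)
  hence "uniformly_continuous_on ({0..1} \<times> {0..2*pi}) h"
    by (intro compact_uniformly_continuous compact_Times) auto
  then obtain d where d: "0 < d" "\<And>x y. x \<in> {0..1} \<times> {0..2*pi} \<Longrightarrow> y \<in> {0..1} \<times> {0..2*pi} \<Longrightarrow> dist x y < d \<Longrightarrow> dist (h x) (h y) < \<kappa> / (2 * pi)"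
    unfolding uniformly_continuous_on_def using \<kappa> by (metis divide_pos_pos mult_pos_pos pi_gt_zero zero_less_numeral)
  define r0 where "r0 = max \<rho> (1 - d / 2)"
  show ?thesis
  proof (rule that[of r0])
    show "0 < r0" "r0 < 1" using \<rho> d by (auto simp: r0_def)
    fix r s assume rs: "r0 \<le> r" "r \<le> s" "s < 1"
    have r: "0 < r" "\<rho> \<le> r" "1 - d / 2 \<le> r" "r < 1" using rs \<rho> by (auto simp: r0_def)
    define q where "q = r / s"
    have q: "0 < q" "q \<le> 1" "q * s = r" "1 - q < d"
    proof -
      show "0 < q" "q \<le> 1" "q * s = r" using rs r by (auto simp: q_def)
      have "r * 1 \<le> r / s" using r rs by (auto simp: field_simps mult_left_le)
      thus "1 - q < d" using r d by (simp add: q_def)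
    qed
    have qs: "norm (complex_of_real q * z) < 1" if "norm z < 1" for z
      using that q mult_left_le_one_le[of "norm z" q] by (simp add: norm_mult)
    \<comment> \<open>On the circle of radius s this is the midpoint of the values of G at radii s
      and r; on the circle of radius \<rho> its p-th power is \<open>h\<close> at q.\<close>
    define u where "u = (\<lambda>z. (G z + G (complex_of_real q * z)) / 2)"
    have "(G \<circ> (*) (complex_of_real q)) holomorphic_on unit_disc"
      by (rule holomorphic_on_compose_gen[OF _ G]) (use qs in \<open>auto intro!: holomorphic_intros\<close>)
    hence u: "u holomorphic_on unit_disc" using G unfolding u_def o_def by (intro holomorphic_intros) auto
    hence cu: "continuous_on unit_disc u" by (rule holomorphic_on_imp_continuous_on)
    have c: "continuous_on {0..2*pi} (\<lambda>t. G (complex_of_real x * cis t))" "continuous_on {0..2*pi} (\<lambda>t. u (complex_of_real x * cis t))"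
      if "0 \<le> x" "x < 1" for x using that by (auto intro: continuous_on_circle cG cu)
    have JA: "?J (\<lambda>t. G (complex_of_real x * cis t)) = A x" for x
      using p by (simp add: circle_LINT_eq A_def)
    have "A \<rho> - \<kappa> \<le> ?J (\<lambda>t. u (complex_of_real \<rho> * cis t))"
    proof -
      have "A \<rho> - ?J (\<lambda>t. u (complex_of_real \<rho> * cis t)) = (LINT t:{0..2*pi}|lborel. norm (G (complex_of_real \<rho> * cis t)) powr p - norm (u (complex_of_real \<rho> * cis t)) powr p)"
        using p \<rho> c[of \<rho>] by (subst set_integral_diff) (auto simp: JA intro!: circle_power_integrable)
      also have "\<dots> \<le> (LINT t:{0..2*pi}|lborel. \<kappa> / (2 * pi))"
      proof (rule set_integral_mono)
        show "set_integrable lborel {0..2*pi} (\<lambda>t. norm (G (complex_of_real \<rho> * cis t)) powr p - norm (u (complex_of_real \<rho> * cis t)) powr p)"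
          using p \<rho> c[of \<rho>] by (intro set_integral_diff circle_power_integrable) auto
        show "set_integrable lborel {0..2*pi} (\<lambda>t. \<kappa> / (2 * pi))" by (intro borel_integrable_atLeastAtMost' continuous_intros)
        fix t assume t: "t \<in> {0..2*pi}"
        have "dist (h (1, t)) (h (q, t)) < \<kappa> / (2 * pi)" using t q by (intro d(2)) (auto simp: dist_prod_def dist_real_def)
        thus "norm (G (complex_of_real \<rho> * cis t)) powr p - norm (u (complex_of_real \<rho> * cis t)) powr p \<le> \<kappa> / (2 * pi)"
          by (auto simp: h_def u_def dist_real_def mult_ac)
      qed
      also have "\<dots> = \<kappa>" by (simp add: set_lebesgue_integral_def)
      finally show ?thesis by simp
    qed
    also have "?J (\<lambda>t. u (complex_of_real \<rho> * cis t)) \<le> ?J (\<lambda>t. u (complex_of_real s * cis t))"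
      using p \<rho> r rs by (auto simp: circle_LINT_eq intro!: powr_mono2 integral_mean_mono u)
    finally have ulow: "L - 2 * \<kappa> \<le> ?J (\<lambda>t. u (complex_of_real s * cis t))" using \<rho> by simp
    have i: "set_integrable lborel {0..2*pi} (\<lambda>t. norm (G (complex_of_real r * cis t)) powr p)"
      "set_integrable lborel {0..2*pi} (\<lambda>t. norm (G (complex_of_real s * cis t)) powr p)"
      "set_integrable lborel {0..2*pi} (\<lambda>t. norm (u (complex_of_real s * cis t)) powr p)"
      "set_integrable lborel {0..2*pi} (\<lambda>t. norm (G (complex_of_real r * cis t) - G (complex_of_real s * cis t)) powr p)"
      using p r rs c[of r] c[of s] by (auto intro!: circle_power_integrable continuous_intros)
    let ?R = "\<lambda>t. e * (norm (G (complex_of_real r * cis t)) powr p + norm (G (complex_of_real s * cis t)) powr p) +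
       C * ((norm (G (complex_of_real r * cis t)) powr p + norm (G (complex_of_real s * cis t)) powr p) / 2 - norm (u (complex_of_real s * cis t)) powr p)"
    have "?J (\<lambda>t. G (complex_of_real r * cis t) - G (complex_of_real s * cis t)) \<le> (LINT t:{0..2*pi}|lborel. ?R t)"
    proof (rule set_integral_mono)
      show "set_integrable lborel {0..2*pi} ?R" using i by (intro set_integral_add set_integral_diff set_integrable_mult_right set_integrable_divide) auto
      fix t
      have "u (complex_of_real s * cis t) = (G (complex_of_real r * cis t) + G (complex_of_real s * cis t)) / 2"
        using q(3) by (simp add: u_def mult.assoc[symmetric] add.commute flip: of_real_mult)
      thus "norm (G (complex_of_real r * cis t) - G (complex_of_real s * cis t)) powr p \<le> ?R t"
        using C(2)[of "G (complex_of_real r * cis t)" "G (complex_of_real s * cis t)"] by (simp only:)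
    qed (rule i(4))
    also have "\<dots> = e * (A r + A s) + C * ((A r + A s) / 2 - ?J (\<lambda>t. u (complex_of_real s * cis t)))"
      unfolding JA[symmetric] using i
      by (simp add: set_integral_add set_integral_diff)
    also have "\<dots> \<le> e * (2 * B) + C * (L - (L - 2 * \<kappa>))"
      using ulow AB[of r] AB[of s] AL[of r] AL[of s] r rs e C by (intro add_mono mult_left_mono diff_mono) auto
    also have "\<dots> \<le> \<eta>" using e C by (simp add: \<kappa>_def field_simps)
    finally show "(LINT t:{0..2*pi}|lborel. norm (G (complex_of_real r * cis t) - G (complex_of_real s * cis t)) powr p) \<le> \<eta>" .
  qed
qed

text \<open>If x > e then (x/e)^(p-1) > 1. This converts smallness in L^p into smallness in L^1 on a
  set of finite measure.\<close>

lemma le_add_powr: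
  fixes x e p :: real
  assumes "0 \<le> x" "0 < e" "1 < p"
  shows "x \<le> e + e powr (1 - p) * x powr p"
proof (cases "x \<le> e")
  case False
  have "x powr (1 - p) \<le> e powr (1 - p)" using False assms by (intro powr_mono2') auto
  hence "x powr (1 - p) * x powr p \<le> e powr (1 - p) * x powr p" by (intro mult_right_mono) auto
  moreover have "x powr (1 - p) * x powr p = x" using False assms by (simp add: powr_add[symmetric])
  ultimately show ?thesis using assms by linarith
qed (use assms in \<open>simp add: add_increasing2\<close>)

section \<open>Radial limits of Poisson integrals\<close>

lemma set_integrable_continuous_scaleR:
  fixes P :: "real \<Rightarrow> real" and u :: "real \<Rightarrow> complex"
  assumes P: "continuous_on {a..b} P" and u: "set_integrable lborel {a..b} u"
  shows "set_integrable lborel {a..b} (\<lambda>t. P t *\<^sub>R u t)"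
proof -
  have "bounded (P ` {a..b})" by (intro compact_imp_bounded compact_continuous_image P compact_Icc)
  then obtain B where B: "\<And>t. t \<in> {a..b} \<Longrightarrow> norm (P t) \<le> B" unfolding bounded_iff by blast
  have i: "integrable lborel (\<lambda>t. indicator {a..b} t *\<^sub>R u t)" using u by (simp add: set_integrable_def)
  hence [measurable]: "(\<lambda>t. indicator {a..b} t *\<^sub>R u t) \<in> borel_measurable borel" by auto
  have [measurable]: "(\<lambda>t. indicator {a..b} t *\<^sub>R P t) \<in> borel_measurable borel"
    by (intro borel_measurable_continuous_on_indicator P) auto
  have eq: "(indicator {a..b} t *\<^sub>R P t) *\<^sub>R (indicator {a..b} t *\<^sub>R u t) = indicator {a..b} t *\<^sub>R (P t *\<^sub>R u t)" for t
    by (simp add: indicator_def)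
  have "integrable lborel (\<lambda>t. (indicator {a..b} t *\<^sub>R P t) *\<^sub>R (indicator {a..b} t *\<^sub>R u t))"
  proof (rule Bochner_Integration.integrable_bound)
    show "integrable lborel (\<lambda>t. B * norm (indicator {a..b} t *\<^sub>R u t))"
      using i by (intro integrable_mult_right integrable_norm)
    have "norm ((indicator {a..b} t *\<^sub>R P t) *\<^sub>R (indicator {a..b} t *\<^sub>R u t)) \<le> B * norm (indicator {a..b} t *\<^sub>R u t)" for t
      using B[of t] by (auto simp: indicator_def intro: mult_right_mono)
    thus "AE t in lborel. norm ((indicator {a..b} t *\<^sub>R P t) *\<^sub>R (indicator {a..b} t *\<^sub>R u t)) \<le> norm (B * norm (indicator {a..b} t *\<^sub>R u t))"
      unfolding real_norm_def using abs_ge_self order.trans by (intro AE_I2) blast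
  qed measurable
  thus ?thesis unfolding eq by (simp add: set_integrable_def)
qed

text \<open>Integration by parts for a merely integrable \<open>a\<close>: P(t) - P(b) is the
  integral of Q over [t, b], and the order of integration is exchanged on the triangle t <=
  s.\<close>

lemma integral_parts_antimono:
  fixes P Q :: "real \<Rightarrow> real" and a :: "real \<Rightarrow> complex"
  assumes b: "0 \<le> b" and der: "\<And>x. x \<in> {0..b} \<Longrightarrow> (P has_real_derivative - Q x) (at x)"
    and Qc: "continuous_on {0..b} Q" and a: "set_integrable lborel {0..b} a"
  shows "(LINT t:{0..b}|lborel. P t *\<^sub>R a t) =
    P b *\<^sub>R (LINT t:{0..b}|lborel. a t) + (LINT s:{0..b}|lborel. Q s *\<^sub>R (LINT t:{0..s}|lborel. a t))"
    and "set_integrable lborel {0..b} (\<lambda>s. Q s *\<^sub>R (LINT t:{0..s}|lborel. a t))"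
proof -
  define a' where "a' = (\<lambda>t. indicator {0..b} t *\<^sub>R a t)"
  define Q' where "Q' = (\<lambda>t. indicator {0..b} t *\<^sub>R Q t)"
  have ia: "integrable lborel a'" using a by (simp add: a'_def set_integrable_def)
  hence [measurable]: "a' \<in> borel_measurable borel" by auto
  have [measurable]: "Q' \<in> borel_measurable borel"
    unfolding Q'_def by (intro borel_measurable_continuous_on_indicator Qc) auto
  have iQ: "integrable lborel Q'"
    using borel_integrable_atLeastAtMost'[OF Qc] by (simp add: Q'_def set_integrable_def)
  define K where "K = (\<lambda>t s :: real. indicator {t..} s *\<^sub>R (Q' s *\<^sub>R a' t))"
  have K_measurable [measurable]: "(\<lambda>(t, s). K t s) \<in> borel_measurable (lborel \<Otimes>\<^sub>M lborel)"
  proof -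
    have "K = (\<lambda>t s. if t \<le> s then Q' s *\<^sub>R a' t else 0)" by (auto simp: K_def fun_eq_iff indicator_def)
    thus ?thesis by simp
  qed
  have normK: "norm (K t s) \<le> norm (Q' s) * norm (a' t)" for t s by (simp add: K_def indicator_def)
  have iKt: "integrable lborel (\<lambda>s. K t s)" for t
  proof (rule Bochner_Integration.integrable_bound)
    show "integrable lborel (\<lambda>s. norm (Q' s) * norm (a' t))" using iQ by (intro integrable_mult_left integrable_norm)
    show "AE s in lborel. norm (K t s) \<le> norm (norm (Q' s) * norm (a' t))" using normK by simp
  qed measurable
  have iK: "integrable (lborel \<Otimes>\<^sub>M lborel) (\<lambda>(t, s). K t s)"
  proof (rule lborel_pair.Fubini_integrable)
    show "AE t in lborel. integrable lborel (\<lambda>s. (case (t, s) of (t, s) \<Rightarrow> K t s))" using iKt by simp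
    show "integrable lborel (\<lambda>t. LINT s|lborel. norm (case (t, s) of (t, s) \<Rightarrow> K t s))"
    proof (rule Bochner_Integration.integrable_bound)
      show "integrable lborel (\<lambda>t. (LINT s|lborel. norm (Q' s)) * norm (a' t))"
        using ia by (intro integrable_mult_right integrable_norm)
      have "(LINT s|lborel. norm (K t s)) \<le> (LINT s|lborel. norm (Q' s) * norm (a' t))" for t
        using iKt iQ normK by (intro integral_mono integrable_norm integrable_mult_left) auto
      moreover have "0 \<le> (LINT s|lborel. norm (K t s))" for t by (intro integral_nonneg_AE) auto
      ultimately show "AE t in lborel. norm (LINT s|lborel. norm (case (t, s) of (t, s) \<Rightarrow> K t s)) \<le> norm ((LINT s|lborel. norm (Q' s)) * norm (a' t))"
        by (auto intro!: AE_I2 order.trans[OF _ abs_ge_self])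
    qed measurable
  qed measurable
  have swap: "(LINT s|lborel. (LINT t|lborel. K t s)) = (LINT t|lborel. (LINT s|lborel. K t s))"
    by (rule lborel_pair.Fubini_integral[OF iK])
  have "integrable lborel (\<lambda>s. LINT t|lborel. K t s)"
    using lborel_pair.integrable_snd[OF iK] by simp
  moreover have r: "(LINT t|lborel. K t s) = indicator {0..b} s *\<^sub>R (Q s *\<^sub>R (LINT t:{0..s}|lborel. a t))" for s
  proof (cases "s \<in> {0..b}")
    case True
    have "(LINT t|lborel. K t s) = (LINT t:{0..s}|lborel. Q s *\<^sub>R a t)"
      unfolding set_lebesgue_integral_def K_def Q'_def a'_def using True
      by (intro Bochner_Integration.integral_cong) (auto simp: indicator_def)
    thus ?thesis using True by simp
  qed (simp add: K_def Q'_def)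
  ultimately show "set_integrable lborel {0..b} (\<lambda>s. Q s *\<^sub>R (LINT t:{0..s}|lborel. a t))"
    by (simp add: set_integrable_def)
  have l: "(LINT s|lborel. K t s) = indicator {0..b} t *\<^sub>R ((P t - P b) *\<^sub>R a t)" for t
  proof (cases "t \<in> {0..b}")
    case True
    have "(LINT s|lborel. K t s) = (LINT s:{t..b}|lborel. Q s) *\<^sub>R a t"
    proof -
      have "(LINT s|lborel. K t s) = (LINT s:{t..b}|lborel. Q s *\<^sub>R a t)"
        unfolding set_lebesgue_integral_def K_def Q'_def a'_def using True
        by (intro Bochner_Integration.integral_cong) (auto simp: indicator_def)
      moreover have "set_integrable lborel {t..b} Q"
        using True by (intro borel_integrable_atLeastAtMost' continuous_on_subset[OF Qc]) auto
      ultimately show ?thesis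
        using integral_scaleR_left[of "a t" lborel "\<lambda>s. indicator {t..b} s *\<^sub>R Q s"]
        by (simp add: set_lebesgue_integral_def set_integrable_def)
    qed
    also have "(LINT s:{t..b}|lborel. Q s) = P t - P b"
    proof -
      have "(Q has_integral (- P b) - (- P t)) {t..b}"
      proof (rule fundamental_theorem_of_calculus)
        fix x assume "x \<in> {t..b}"
        hence "(P has_real_derivative - Q x) (at x)" using True by (intro der) auto
        hence "((\<lambda>x. - P x) has_real_derivative Q x) (at x)" by (auto intro!: derivative_eq_intros)
        thus "((\<lambda>x. - P x) has_vector_derivative Q x) (at x within {t..b})"
          by (simp add: has_real_derivative_iff_has_vector_derivative has_vector_derivative_at_within)
      qed (use True in auto)
      moreover have "set_integrable lborel {t..b} Q"
        using True by (intro borel_integrable_atLeastAtMost' continuous_on_subset[OF Qc]) auto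
      ultimately show ?thesis
        using set_borel_integral_eq_integral(2)[of "{t..b}" Q] integral_unique[of Q _ "{t..b}"] by simp
    qed
    finally show ?thesis using True by simp
  qed (simp add: K_def a'_def)
  have Pc: "continuous_on {0..b} P"
    using DERIV_isCont[OF der] by (intro continuous_at_imp_continuous_on) auto
  have iP: "set_integrable lborel {0..b} (\<lambda>t. P t *\<^sub>R a t)"
    by (rule set_integrable_continuous_scaleR[OF Pc a])
  have "(LINT s:{0..b}|lborel. Q s *\<^sub>R (LINT t:{0..s}|lborel. a t)) = (LINT t:{0..b}|lborel. (P t - P b) *\<^sub>R a t)"
    using swap unfolding l r set_lebesgue_integral_def .
  also have "\<dots> = (LINT t:{0..b}|lborel. P t *\<^sub>R a t) - (LINT t:{0..b}|lborel. P b *\<^sub>R a t)"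
    using iP a unfolding scaleR_diff_left by (intro set_integral_diff) auto
  finally show "(LINT t:{0..b}|lborel. P t *\<^sub>R a t) =
    P b *\<^sub>R (LINT t:{0..b}|lborel. a t) + (LINT s:{0..b}|lborel. Q s *\<^sub>R (LINT t:{0..s}|lborel. a t))" by simp
qed

lemma set_integral_shift:
  fixes u :: "real \<Rightarrow> complex"
  shows "(LINT t:{x..x+h}|lborel. u t) = (LINT t:{0..h}|lborel. u (x + t))"
    and "(LINT t:{x-h..x}|lborel. u t) = (LINT t:{0..h}|lborel. u (x - t))"
proof -
  show "(LINT t:{x..x+h}|lborel. u t) = (LINT t:{0..h}|lborel. u (x + t))"
    unfolding set_lebesgue_integral_def
    by (subst lborel_integral_real_affine[where c=1 and t=x])
       (auto intro!: Bochner_Integration.integral_cong simp: indicator_def)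
  show "(LINT t:{x-h..x}|lborel. u t) = (LINT t:{0..h}|lborel. u (x - t))"
    unfolding set_lebesgue_integral_def
    by (subst lborel_integral_real_affine[where c="-1" and t=x])
       (auto intro!: Bochner_Integration.integral_cong simp: indicator_def)
qed

lemma negligible_imp_AE:
  fixes N :: "real set"
  assumes "negligible N" shows "AE x in lborel. x \<notin> N"
proof -
  have "AE x in lebesgue. x \<notin> N" using assms by (intro AE_not_in) (simp add: negligible_iff_null_sets)
  thus ?thesis by (simp add: AE_completion_iff)
qed

text \<open>Lebesgue differentiation is applied on intervals that start at the point, so the left
  half comes from the reflected function at -x; the exceptional set is reflected
  accordingly.\<close>

lemma AE_symmetric_derivative:
  fixes \<phi> :: "real \<Rightarrow> complex"
  assumes \<phi>: "\<And>a b. set_integrable lborel {a..b} \<phi>"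
  shows "AE x in lborel. \<forall>e>0. \<exists>d>0. \<forall>h. 0 < h \<longrightarrow> h < d \<longrightarrow>
    norm (LINT t:{0..h}|lborel. \<phi> (x + t) + \<phi> (x - t) - 2 * \<phi> x) \<le> e * h"
proof -
  have 1: "\<phi> integrable_on cbox a b" for a b
    using set_borel_integral_eq_integral(1)[OF \<phi>] by simp
  have 2: "(\<lambda>t. \<phi> (- t)) integrable_on cbox a b" for a b
    using integrable_reflect[of \<phi> "-a" "-b"] 1[of "-b" "-a"] by simp
  obtain N1 where N1: "negligible N1"
    "\<And>x e. \<lbrakk>x \<notin> N1; 0 < e\<rbrakk> \<Longrightarrow> \<exists>d>0. \<forall>h. 0 < h \<and> h < d \<longrightarrow> norm (integral (cbox x (x + h *\<^sub>R One)) \<phi> /\<^sub>R h ^ DIM(real) - \<phi> x) < e"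
    using integrable_ccontinuous_explicit[OF 1] by blast
  obtain N2 where N2: "negligible N2"
    "\<And>x e. \<lbrakk>x \<notin> N2; 0 < e\<rbrakk> \<Longrightarrow> \<exists>d>0. \<forall>h. 0 < h \<and> h < d \<longrightarrow> norm (integral (cbox x (x + h *\<^sub>R One)) (\<lambda>t. \<phi> (- t)) /\<^sub>R h ^ DIM(real) - \<phi> (- x)) < e"
    using integrable_ccontinuous_explicit[OF 2] by blast
  have "negligible (uminus ` N2)" by (rule negligible_differentiable_image_negligible[OF _ N2(1)]) (auto intro!: derivative_intros)
  from negligible_imp_AE[OF this] negligible_imp_AE[OF N1(1)]
  show ?thesis
  proof eventually_elim
    fix x assume x: "x \<notin> uminus ` N2" "x \<notin> N1"
    have x': "- x \<notin> N2" using x(1) by (metis imageI minus_minus)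
    have sh: "set_integrable lborel {0..h} (\<lambda>t. \<phi> (x + t))" "set_integrable lborel {0..h} (\<lambda>t. \<phi> (x - t))" for h
    proof -
      have "integrable lborel (\<lambda>t. indicator {x..x+h} (x + 1 * t) *\<^sub>R \<phi> (x + 1 * t))"
        using \<phi>[of x "x+h"] unfolding set_integrable_def by (intro lborel_integrable_real_affine) auto
      thus "set_integrable lborel {0..h} (\<lambda>t. \<phi> (x + t))" by (simp add: set_integrable_def indicator_def)
      have "integrable lborel (\<lambda>t. indicator {x-h..x} (x + (-1) * t) *\<^sub>R \<phi> (x + (-1) * t))"
        using \<phi>[of "x-h" x] unfolding set_integrable_def by (intro lborel_integrable_real_affine) auto
      moreover have "indicator {x-h..x} (x + (-1) * t) = (indicator {0..h} t :: real)" for t by (auto simp: indicator_def)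
      ultimately show "set_integrable lborel {0..h} (\<lambda>t. \<phi> (x - t))" by (simp add: set_integrable_def)
    qed
    show "\<forall>e>0. \<exists>d>0. \<forall>h. 0 < h \<longrightarrow> h < d \<longrightarrow>
      norm (LINT t:{0..h}|lborel. \<phi> (x + t) + \<phi> (x - t) - 2 * \<phi> x) \<le> e * h"
    proof (intro allI impI)
      fix e :: real assume e: "0 < e"
      obtain d1 where d1: "d1 > 0" "\<And>h. 0 < h \<Longrightarrow> h < d1 \<Longrightarrow> norm (integral {x..x + h} \<phi> /\<^sub>R h - \<phi> x) < e / 2"
        using N1(2)[OF x(2), of "e/2"] e by auto
      obtain d2 where d2: "d2 > 0" "\<And>h. 0 < h \<Longrightarrow> h < d2 \<Longrightarrow> norm (integral {-x..-x + h} (\<lambda>t. \<phi> (- t)) /\<^sub>R h - \<phi> x) < e / 2"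
        using N2(2)[OF x', of "e/2"] e by auto
      show "\<exists>d>0. \<forall>h. 0 < h \<longrightarrow> h < d \<longrightarrow> norm (LINT t:{0..h}|lborel. \<phi> (x + t) + \<phi> (x - t) - 2 * \<phi> x) \<le> e * h"
      proof (intro exI[of _ "min d1 d2"] conjI allI impI)
        fix h assume h: "0 < h" "h < min d1 d2"
        have I1: "(LINT t:{0..h}|lborel. \<phi> (x + t)) = integral {x..x + h} \<phi>"
          using set_borel_integral_eq_integral(2)[OF \<phi>[of x "x+h"]] by (simp add: set_integral_shift(1))
        have I2: "(LINT t:{0..h}|lborel. \<phi> (x - t)) = integral {-x..-x + h} (\<lambda>t. \<phi> (- t))"
          using set_borel_integral_eq_integral(2)[OF \<phi>[of "x-h" x]] Henstock_Kurzweil_Integration.integral_reflect_real[of x "x-h" \<phi>]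
          by (simp add: set_integral_shift(2))
        have c: "set_integrable lborel {0..h} (\<lambda>t. 2 * \<phi> x)" by (intro borel_integrable_atLeastAtMost' continuous_intros)
        have "(LINT t:{0..h}|lborel. \<phi> (x + t) + \<phi> (x - t) - 2 * \<phi> x) = 
          (LINT t:{0..h}|lborel. \<phi> (x + t)) + (LINT t:{0..h}|lborel. \<phi> (x - t)) - (LINT t:{0..h}|lborel. 2 * \<phi> x)"
          using sh c by (simp add: set_integral_diff set_integral_add)
        also have "(LINT t:{0..h}|lborel. \<phi> (x + t)) = integral {x..x + h} \<phi>" by (rule I1)
        also have "(LINT t:{0..h}|lborel. \<phi> (x - t)) = integral {-x..-x + h} (\<lambda>t. \<phi> (- t))" by (rule I2)
        also have "(LINT t:{0..h}|lborel. 2 * \<phi> x) = h *\<^sub>R (2 * \<phi> x)"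
          using h by (simp add: set_lebesgue_integral_def)
        also have "integral {x..x + h} \<phi> + integral {-x..-x + h} (\<lambda>t. \<phi> (- t)) - h *\<^sub>R (2 * \<phi> x)
          = h *\<^sub>R ((integral {x..x + h} \<phi> /\<^sub>R h - \<phi> x) + (integral {-x..-x + h} (\<lambda>t. \<phi> (- t)) /\<^sub>R h - \<phi> x))"
          using h by (simp add: algebra_simps scaleR_2 mult_2)
        finally have "norm (LINT t:{0..h}|lborel. \<phi> (x + t) + \<phi> (x - t) - 2 * \<phi> x)
          = h * norm ((integral {x..x + h} \<phi> /\<^sub>R h - \<phi> x) + (integral {-x..-x + h} (\<lambda>t. \<phi> (- t)) /\<^sub>R h - \<phi> x))"
          using h by simp
        also have "\<dots> \<le> h * (e / 2 + e / 2)"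
          using h d1(2)[of h] d2(2)[of h] by (intro mult_left_mono norm_triangle_le) auto
        finally show "norm (LINT t:{0..h}|lborel. \<phi> (x + t) + \<phi> (x - t) - 2 * \<phi> x) \<le> e * h" by (simp add: mult.commute)
      qed (use d1 d2 in auto)
    qed
  qed
qed

lemma poisson_eq: "poisson r t = (1 - r\<^sup>2) / (1 - 2 * r * cos t + r\<^sup>2)"
proof -
  have "(norm (1 - complex_of_real r * cis t))\<^sup>2 = (1 - r * cos t)\<^sup>2 + (r * sin t)\<^sup>2"
    by (simp add: cmod_power2)
  also have "\<dots> = 1 - 2 * r * cos t + r\<^sup>2 * ((cos t)\<^sup>2 + (sin t)\<^sup>2)"
  proof -
    have "(1 - r * c)\<^sup>2 + (r * s)\<^sup>2 = 1 - 2 * r * c + r\<^sup>2 * (c\<^sup>2 + s\<^sup>2)" for c s :: real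
      by (simp add: power2_eq_square algebra_simps)
    thus ?thesis .
  qed
  finally show ?thesis by (simp add: poisson_def)
qed

text \<open>Minus the derivative of the Poisson kernel in t; with this sign it is nonnegative on
  [0, pi], where the kernel decreases.\<close>

definition poisson_slope :: "real \<Rightarrow> real \<Rightarrow> real" where
  "poisson_slope r t = (1 - r\<^sup>2) * (2 * r * sin t) / (1 - 2 * r * cos t + r\<^sup>2)\<^sup>2"

lemma poisson_denominator_pos:
  fixes r t :: real
  assumes "0 \<le> r" "r < 1" shows "0 < 1 - 2 * r * cos t + r\<^sup>2"
proof -
  have "2 * r * cos t \<le> 2 * r * 1" using assms by (intro mult_left_mono) auto
  moreover have "0 < (1 - r)\<^sup>2" using assms by simp
  ultimately show ?thesis by (simp add: power2_diff)
qed

lemma poisson_deriv: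
  assumes "0 \<le> r" "r < 1"
  shows "(poisson r has_real_derivative - poisson_slope r t) (at t)"
proof -
  have "((\<lambda>t. (1 - r\<^sup>2) / (1 - 2 * r * cos t + r\<^sup>2)) has_real_derivative - poisson_slope r t) (at t)"
    using poisson_denominator_pos[OF assms, of t] unfolding poisson_slope_def
    by (auto intro!: derivative_eq_intros simp: power2_eq_square)
  thus ?thesis by (simp add: poisson_eq[abs_def])
qed

lemma poisson_slope_continuous:
  assumes "0 \<le> r" "r < 1" shows "continuous_on A (poisson_slope r)"
  unfolding poisson_slope_def using poisson_denominator_pos[OF assms]
  by (intro continuous_intros) (metis less_irrefl power_not_zero)

lemma poisson_slope_nonneg:
  assumes "0 \<le> r" "r < 1" "0 \<le> t" "t \<le> pi" shows "0 \<le> poisson_slope r t"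
  unfolding poisson_slope_def using assms
  by (intro divide_nonneg_nonneg mult_nonneg_nonneg) (auto simp: power_le_one sin_ge_zero)

text \<open>The kernel is even and periodic, so it sees only u(t) + u(-t). For this reason symmetric
  differentiability at 0 is enough for the radial limit.\<close>

lemma poisson_half_circle:
  fixes u :: "real \<Rightarrow> complex"
  assumes r: "0 \<le> r" "r < 1" and u: "set_integrable lborel {0..2*pi} u" and per: "\<And>t. u (t + 2 * pi) = u t"
  shows "(LINT t:{0..2*pi}|lborel. poisson r t *\<^sub>R u t) = (LINT t:{0..pi}|lborel. poisson r t *\<^sub>R (u t + u (- t)))"
    and "set_integrable lborel {0..pi} (\<lambda>t. u (- t))"
proof -
  have iP: "set_integrable lborel {0..2*pi} (\<lambda>t. poisson r t *\<^sub>R u t)"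
    by (rule set_integrable_continuous_scaleR[OF poisson_continuous[OF r] u])
  have sub: "set_integrable lborel {0..pi} v" "set_integrable lborel {pi..2*pi} v" if "set_integrable lborel {0..2*pi} v" for v :: "real \<Rightarrow> complex"
    using that by (auto intro: set_integrable_subset)
  have refl: "(LINT t:{pi..2*pi}|lborel. v t) = (LINT t:{0..pi}|lborel. v (2 * pi - t))" for v :: "real \<Rightarrow> complex"
    using set_integral_shift(2)[of "2*pi" pi v] by simp
  have irefl: "set_integrable lborel {0..pi} (\<lambda>t. v (2 * pi - t))" if "set_integrable lborel {pi..2*pi} v" for v :: "real \<Rightarrow> complex"
  proof -
    have "integrable lborel (\<lambda>t. indicator {pi..2*pi} (2 * pi + (-1) * t) *\<^sub>R v (2 * pi + (-1) * t))"
      using that unfolding set_integrable_def by (intro lborel_integrable_real_affine) auto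
    moreover have "indicator {pi..2*pi} (2 * pi + (-1) * t) = (indicator {0..pi} t :: real)" for t by (auto simp: indicator_def)
    ultimately show ?thesis by (simp add: set_integrable_def)
  qed
  have un: "u (2 * pi - t) = u (- t)" for t using per[of "- t"] by (simp add: add.commute)
  have pn: "poisson r (2 * pi - t) = poisson r t" for t by (simp add: poisson_eq cos_diff)
  show "set_integrable lborel {0..pi} (\<lambda>t. u (- t))"
    using irefl[OF sub(2)[OF u]] by (simp add: un)
  have "(LINT t:{0..2*pi}|lborel. poisson r t *\<^sub>R u t) = (LINT t:{0..pi} \<union> {pi..2*pi}|lborel. poisson r t *\<^sub>R u t)"
    by (intro arg_cong[of _ _ "\<lambda>A. set_lebesgue_integral lborel A _"]) auto
  also have "\<dots> = (LINT t:{0..pi}|lborel. poisson r t *\<^sub>R u t) + (LINT t:{pi..2*pi}|lborel. poisson r t *\<^sub>R u t)"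
  proof (rule set_integral_Un_AE)
    show "AE x in lborel. \<not> (x \<in> {0..pi} \<and> x \<in> {pi..2*pi})"
      using AE_lborel_singleton[of pi] by eventually_elim auto
  qed (use sub[OF iP] in auto)
  also have "(LINT t:{pi..2*pi}|lborel. poisson r t *\<^sub>R u t) = (LINT t:{0..pi}|lborel. poisson r t *\<^sub>R u (- t))"
    by (simp add: refl un pn)
  also have "(LINT t:{0..pi}|lborel. poisson r t *\<^sub>R u t) + (LINT t:{0..pi}|lborel. poisson r t *\<^sub>R u (- t)) = (LINT t:{0..pi}|lborel. poisson r t *\<^sub>R (u t + u (- t)))"
    using sub(1)[OF iP] irefl[OF sub(2)[OF iP]] by (simp add: un pn set_integral_add scaleR_right_distrib)
  finally show "(LINT t:{0..2*pi}|lborel. poisson r t *\<^sub>R u t) = (LINT t:{0..pi}|lborel. poisson r t *\<^sub>R (u t + u (- t)))" .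
qed

lemma poisson_integral_half:
  assumes r: "0 \<le> r" "r < 1" shows "(LINT t:{0..pi}|lborel. poisson r t) = pi"
proof -
  have "(LINT t:{0..2*pi}|lborel. poisson r t *\<^sub>R (1::complex)) = (LINT t:{0..pi}|lborel. poisson r t *\<^sub>R (1 + 1 :: complex))"
    by (rule poisson_half_circle(1)[OF r]) (auto intro!: borel_integrable_atLeastAtMost' continuous_intros)
  hence "complex_of_real (LINT t:{0..2*pi}|lborel. poisson r t) = complex_of_real (LINT t:{0..pi}|lborel. poisson r t * 2)"
    by (simp add: scaleR_conv_of_real flip: set_integral_complex_of_real)
  thus ?thesis using poisson_integral[OF r] by (simp only: of_real_eq_iff) simp
qed

lemma poisson_tendsto_0:
  assumes "0 < t" "t < 2 * pi" shows "((\<lambda>r. poisson r t) \<longlongrightarrow> 0) (at_left 1)"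
proof -
  have "cos t \<noteq> 1"
  proof
    assume "cos t = 1"
    then obtain n :: int where n: "t = of_int n * 2 * pi" by (auto simp: cos_one_2pi_int)
    have "0 < n" "n < 1" using assms unfolding n by (auto simp: zero_less_mult_iff)
    thus False by simp
  qed
  hence "((\<lambda>r. (1 - r\<^sup>2) / (1 - 2 * r * cos t + r\<^sup>2)) \<longlongrightarrow> (1 - 1\<^sup>2) / (1 - 2 * 1 * cos t + 1\<^sup>2)) (at_left 1)"
    by (intro tendsto_intros) auto
  thus ?thesis by (simp add: poisson_eq)
qed

text \<open>The local form of Fatou's theorem. Integration by parts replaces the symmetric
  difference by its primitive, which is at most e s near 0. Against this bound the slope of the
  kernel has first moment at most pi, and away from 0 its mass tends to 0 with r.\<close>

lemma poisson_radial_limit: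
  fixes u :: "real \<Rightarrow> complex"
  assumes u: "set_integrable lborel {0..2*pi} u" and per: "\<And>t. u (t + 2 * pi) = u t"
    and der: "\<And>e. 0 < e \<Longrightarrow> \<exists>d>0. \<forall>h. 0 < h \<longrightarrow> h < d \<longrightarrow> norm (LINT t:{0..h}|lborel. u t + u (- t) - 2 * u 0) \<le> e * h"
  shows "((\<lambda>r. LINT t:{0..2*pi}|lborel. poisson r t *\<^sub>R u t) \<longlongrightarrow> 2 * pi * u 0) (at_left 1)"
proof (rule tendstoI)
  fix \<epsilon> :: real assume "0 < \<epsilon>"
  define e where "e = \<epsilon> / (pi + 3)"
  have e: "0 < e" "e * (pi + 3) = \<epsilon>" 
  proof -
    have "0 < pi + 3" using pi_gt_zero by linarith
    thus "0 < e" "e * (pi + 3) = \<epsilon>" using \<open>0 < \<epsilon>\<close> by (auto simp: e_def)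
  qed
  define a where "a = (\<lambda>t. u t + u (- t) - 2 * u 0)"
  have iu: "set_integrable lborel {0..pi} u" using u by (rule set_integrable_subset) auto
  have iu2: "set_integrable lborel {0..pi} (\<lambda>t. u t + u (- t))"
    using iu poisson_half_circle(2)[of 0, OF _ _ u per] by (intro set_integral_add) auto
  have c: "set_integrable lborel {0..pi} (\<lambda>t. 2 * u 0)" by (intro borel_integrable_atLeastAtMost' continuous_intros)
  have ia: "set_integrable lborel {0..pi} a" unfolding a_def using iu2 c by (intro set_integral_diff)
  obtain d0 where d0: "d0 > 0" "\<And>h. 0 < h \<Longrightarrow> h < d0 \<Longrightarrow> norm (LINT t:{0..h}|lborel. a t) \<le> e * h"
    using der[OF e(1)] unfolding a_def by blast
  define d where "d = min (d0 / 2) pi"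
  have d: "0 < d" "d < d0" "d \<le> pi" using d0 by (auto simp: d_def min_less_iff_disj)
  define M where "M = (LINT t:{0..pi}|lborel. norm (a t))"
  have M0: "0 \<le> M" unfolding M_def set_lebesgue_integral_def by (intro integral_nonneg_AE) auto
  have AM: "norm (LINT t:{0..s}|lborel. a t) \<le> M" if "s \<in> {0..pi}" for s
  proof -
    have iS: "set_integrable lborel {0..s} a" using that by (intro set_integrable_subset[OF ia]) auto
    have "norm (LINT t:{0..s}|lborel. a t) \<le> (LINT t:{0..s}|lborel. norm (a t))"
      using iS by (rule set_integral_norm_bound)
    also have "\<dots> \<le> M" unfolding M_def set_lebesgue_integral_def
    proof (rule integral_mono)
      show "integrable lborel (\<lambda>t. indicator {0..s} t *\<^sub>R norm (a t))" "integrable lborel (\<lambda>t. indicator {0..pi} t *\<^sub>R norm (a t))"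
        using set_integrable_norm[OF iS] set_integrable_norm[OF ia] by (simp_all add: set_integrable_def)
      show "indicator {0..s} t *\<^sub>R norm (a t) \<le> indicator {0..pi} t *\<^sub>R norm (a t)" for t
        using that by (auto simp: indicator_def)
    qed
    finally show ?thesis .
  qed
  \<comment> \<open>Below d the hypothesis on differentiation applies. Beyond d there is only the
    crude bound M, but the slope has mass P(d) - P(pi) there, where P is the kernel.\<close>
  have As: "norm (LINT t:{0..s}|lborel. a t) \<le> e * s + M * indicator {d..} s" if "s \<in> {0..pi}" for s
  proof (cases "s < d")
    case True
    show ?thesis
    proof (cases "s = 0")
      case True
      have "(LINT t:{0..0}|lborel. a t) = 0"
        unfolding set_lebesgue_integral_def
      proof (rule integral_eq_zero_AE)
        show "AE t in lborel. indicator {0..0} t *\<^sub>R a t = 0"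
          using AE_lborel_singleton[of "0::real"] by eventually_elim (auto simp: indicator_def)
      qed
      thus ?thesis using True M0 by simp
    qed (use True d0(2)[of s] d that in auto)
  next
    case False
    thus ?thesis using AM[OF that] e that by (auto simp: add_increasing)
  qed
  have bound: "norm ((LINT t:{0..2*pi}|lborel. poisson r t *\<^sub>R u t) - 2 * pi * u 0) \<le> poisson r pi * M + e * pi + M * poisson r d"
    if r: "0 \<le> r" "r < 1" for r
  proof -
    note parts = integral_parts_antimono[OF _ poisson_deriv[OF r] poisson_slope_continuous[OF r]]
    have iQ: "set_integrable lborel {x..y} (poisson_slope r)" for x y
      by (intro borel_integrable_atLeastAtMost' poisson_slope_continuous r)
    have iQd: "set_integrable lborel {0..pi} (\<lambda>s. indicator {d..pi} s *\<^sub>R poisson_slope r s)"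
    proof -
      have "(\<lambda>s. indicator {0..pi} s *\<^sub>R (indicator {d..pi} s *\<^sub>R poisson_slope r s)) = (\<lambda>s. indicator {d..pi} s *\<^sub>R poisson_slope r s)"
        using d by (auto simp: indicator_def)
      thus ?thesis unfolding set_integrable_def using iQ[of d pi] by (simp add: set_integrable_def)
    qed
    have iQs: "set_integrable lborel {x..y} (\<lambda>s. poisson_slope r s * s)" for x y
      by (intro borel_integrable_atLeastAtMost' continuous_intros poisson_slope_continuous r)
    have iPu: "set_integrable lborel {0..pi} (\<lambda>t. poisson r t *\<^sub>R v)" for v :: complex
      by (intro borel_integrable_atLeastAtMost' continuous_intros poisson_continuous r)
    have ipi: "(LINT t:{0..pi}|lborel. poisson r t *\<^sub>R (2 * u 0)) = 2 * pi * u 0"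
    proof -
      have "(LINT t:{0..pi}|lborel. poisson r t *\<^sub>R (2 * u 0)) = (LINT t:{0..pi}|lborel. poisson r t) *\<^sub>R (2 * u 0)"
        unfolding set_lebesgue_integral_def scaleR_scaleR[symmetric]
        using poisson_integrable[OF r, of 0 pi] by (subst integral_scaleR_left[symmetric]) (auto simp: set_integrable_def)
      thus ?thesis by (simp add: poisson_integral_half[OF r] scaleR_conv_of_real)
    qed
    have "(LINT t:{0..pi}|lborel. poisson r t *\<^sub>R a t) = poisson r pi *\<^sub>R (LINT t:{0..pi}|lborel. a t) +
        (LINT s:{0..pi}|lborel. poisson_slope r s *\<^sub>R (LINT t:{0..s}|lborel. a t))"
      by (rule parts(1)) (use ia in auto)
    moreover have "(LINT t:{0..pi}|lborel. poisson r t *\<^sub>R a t) = (LINT t:{0..2*pi}|lborel. poisson r t *\<^sub>R u t) - 2 * pi * u 0"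
    proof -
      have "set_integrable lborel {0..pi} (\<lambda>t. poisson r t *\<^sub>R a t)"
        by (rule set_integrable_continuous_scaleR[OF poisson_continuous[OF r] ia])
      hence "(LINT t:{0..pi}|lborel. poisson r t *\<^sub>R a t + poisson r t *\<^sub>R (2 * u 0)) = (LINT t:{0..pi}|lborel. poisson r t *\<^sub>R a t) + 2 * pi * u 0"
        using iPu by (subst set_integral_add) (auto simp: ipi)
      moreover have "poisson r t *\<^sub>R a t + poisson r t *\<^sub>R (2 * u 0) = poisson r t *\<^sub>R (u t + u (- t))" for t
        by (simp add: a_def flip: scaleR_right_distrib)
      ultimately show ?thesis using poisson_half_circle(1)[OF r u per] by simp
    qed
    ultimately have X: "(LINT t:{0..2*pi}|lborel. poisson r t *\<^sub>R u t) - 2 * pi * u 0 =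
       poisson r pi *\<^sub>R (LINT t:{0..pi}|lborel. a t) + (LINT s:{0..pi}|lborel. poisson_slope r s *\<^sub>R (LINT t:{0..s}|lborel. a t))"
      by (simp only:)
    have "norm ((LINT t:{0..2*pi}|lborel. poisson r t *\<^sub>R u t) - 2 * pi * u 0) \<le>
       norm (poisson r pi *\<^sub>R (LINT t:{0..pi}|lborel. a t)) + norm (LINT s:{0..pi}|lborel. poisson_slope r s *\<^sub>R (LINT t:{0..s}|lborel. a t))"
      unfolding X by (rule norm_triangle_ineq)
    also have "norm (poisson r pi *\<^sub>R (LINT t:{0..pi}|lborel. a t)) \<le> poisson r pi * M"
      using AM[of pi] poisson_nonneg[OF r, of pi] by (simp add: mult_left_mono)
    also have "norm (LINT s:{0..pi}|lborel. poisson_slope r s *\<^sub>R (LINT t:{0..s}|lborel. a t)) \<le>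
      (LINT s:{0..pi}|lborel. norm (poisson_slope r s *\<^sub>R (LINT t:{0..s}|lborel. a t)))"
      by (rule set_integral_norm_bound, rule parts(2)) (use ia in auto)
    also have "\<dots> \<le> (LINT s:{0..pi}|lborel. e * (poisson_slope r s * s) + M * (indicator {d..pi} s *\<^sub>R poisson_slope r s))"
    proof (rule set_integral_mono)
      show "set_integrable lborel {0..pi} (\<lambda>s. norm (poisson_slope r s *\<^sub>R (LINT t:{0..s}|lborel. a t)))"
        by (rule set_integrable_norm, rule parts(2)) (use ia in auto)
      show "set_integrable lborel {0..pi} (\<lambda>s. e * (poisson_slope r s * s) + M * (indicator {d..pi} s *\<^sub>R poisson_slope r s))"
        using iQs iQd by (intro set_integral_add set_integrable_mult_right) auto
      fix s assume s: "s \<in> {0..pi}"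
      have "norm (poisson_slope r s *\<^sub>R (LINT t:{0..s}|lborel. a t)) \<le> poisson_slope r s * (e * s + M * indicator {d..} s)"
        using poisson_slope_nonneg[OF r, of s] As[OF s] s by (simp add: mult_left_mono)
      also have "\<dots> = e * (poisson_slope r s * s) + M * (indicator {d..pi} s *\<^sub>R poisson_slope r s)"
        using s by (auto simp: indicator_def algebra_simps)
      finally show "norm (poisson_slope r s *\<^sub>R (LINT t:{0..s}|lborel. a t)) \<le> e * (poisson_slope r s * s) + M * (indicator {d..pi} s *\<^sub>R poisson_slope r s)" .
    qed
    also have "\<dots> = e * (LINT s:{0..pi}|lborel. poisson_slope r s * s) + M * (LINT s:{d..pi}|lborel. poisson_slope r s)"
    proof -
      have 1: "(\<lambda>s. indicator {0..pi} s *\<^sub>R (indicator {d..pi} s *\<^sub>R poisson_slope r s)) = (\<lambda>s. indicator {d..pi} s *\<^sub>R poisson_slope r s)"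
        using d by (auto simp: indicator_def)
      note iQd
      moreover have "(LINT s:{0..pi}|lborel. indicator {d..pi} s *\<^sub>R poisson_slope r s) = (LINT s:{d..pi}|lborel. poisson_slope r s)"
        unfolding set_lebesgue_integral_def 1 ..
      ultimately show ?thesis using iQs[of 0 pi] by (subst set_integral_add) auto
    qed
    also have "(LINT s:{d..pi}|lborel. poisson_slope r s) = poisson r d - poisson r pi"
    proof -
      have "(poisson_slope r has_integral (- poisson r pi) - (- poisson r d)) {d..pi}"
      proof (rule fundamental_theorem_of_calculus)
        fix x
        have "((\<lambda>x. - poisson r x) has_real_derivative poisson_slope r x) (at x)"
          using poisson_deriv[OF r, of x] by (auto intro!: derivative_eq_intros)
        thus "((\<lambda>x. - poisson r x) has_vector_derivative poisson_slope r x) (at x within {d..pi})"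
          by (simp add: has_real_derivative_iff_has_vector_derivative has_vector_derivative_at_within)
      qed (use d in auto)
      thus ?thesis using set_borel_integral_eq_integral(2)[OF iQ[of d pi]] by (simp add: integral_unique)
    qed
    also have "(LINT s:{0..pi}|lborel. poisson_slope r s * s) = pi - poisson r pi * pi"
    proof -
      have "((\<lambda>s. poisson_slope r s * s) has_integral (- poisson r pi * pi + pi)) {0..pi}"
      proof -
        \<comment> \<open>The derivative of -P(s) s is the slope times s minus P(s), so the first
          moment of the slope follows from the mass pi of the kernel on [0, pi].\<close>
        have "((\<lambda>s. poisson_slope r s * s - poisson r s) has_integral (- poisson r pi * pi) - (- poisson r 0 * 0)) {0..pi}"
        proof (rule fundamental_theorem_of_calculus)
          fix x
          have "((\<lambda>x. - poisson r x * x) has_real_derivative poisson_slope r x * x - poisson r x) (at x)"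
            using poisson_deriv[OF r, of x] by (auto intro!: derivative_eq_intros)
          thus "((\<lambda>x. - poisson r x * x) has_vector_derivative poisson_slope r x * x - poisson r x) (at x within {0..pi})"
            by (simp add: has_real_derivative_iff_has_vector_derivative has_vector_derivative_at_within)
        qed simp
        moreover have "(poisson r has_integral integral {0..pi} (poisson r)) {0..pi}"
          by (intro integrable_integral set_borel_integral_eq_integral(1) poisson_integrable[OF r])
        hence "(poisson r has_integral pi) {0..pi}"
          using set_borel_integral_eq_integral(2)[OF poisson_integrable[OF r, of 0 pi]] poisson_integral_half[OF r] by simp
        ultimately have "((\<lambda>s. poisson_slope r s * s - poisson r s + poisson r s) has_integral (- poisson r pi * pi) - (- poisson r 0 * 0) + pi) {0..pi}"
          by (intro has_integral_add)
        thus ?thesis by simp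
      qed
      thus ?thesis using set_borel_integral_eq_integral(2)[OF iQs[of 0 pi]] by (simp add: integral_unique)
    qed
    also have "poisson r pi * M + (e * (pi - poisson r pi * pi) + M * (poisson r d - poisson r pi)) \<le> poisson r pi * M + e * pi + M * poisson r d"
      using e M0 poisson_nonneg[OF r, of pi] by (simp add: algebra_simps add_increasing)
    finally show ?thesis by simp
  qed
  have "((\<lambda>r. poisson r pi * M + e * pi + M * poisson r d) \<longlongrightarrow> 0 * M + e * pi + M * 0) (at_left 1)"
    using d pi_gt_zero by (intro tendsto_intros poisson_tendsto_0) auto
  moreover have "0 * M + e * pi + M * 0 < \<epsilon>" using e by (simp add: algebra_simps)
  ultimately have "\<forall>\<^sub>F r in at_left 1. poisson r pi * M + e * pi + M * poisson r d < \<epsilon>"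
    by (rule order_tendstoD)
  moreover have "\<forall>\<^sub>F r in at_left (1::real). 0 \<le> r \<and> r < 1"
    using eventually_at_left_real[of 0 "1::real"] by (auto elim!: eventually_mono)
  ultimately show "\<forall>\<^sub>F r in at_left 1. dist (LINT t:{0..2*pi}|lborel. poisson r t *\<^sub>R u t) (2 * pi * u 0) < \<epsilon>"
  proof eventually_elim
    fix r assume "poisson r pi * M + e * pi + M * poisson r d < \<epsilon>" "0 \<le> r \<and> r < 1"
    thus "dist (LINT t:{0..2*pi}|lborel. poisson r t *\<^sub>R u t) (2 * pi * u 0) < \<epsilon>"
      unfolding dist_norm using bound[of r] by linarith
  qed
qed

section \<open>Boundary functions of Hardy functions\<close>

lemma nn_integral_le_of_AE_limit:
  fixes u :: "nat \<Rightarrow> 'a \<Rightarrow> ennreal"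
  assumes [measurable]: "\<And>n. u n \<in> borel_measurable M"
    and lim: "AE x in M. (\<lambda>n. u n x) \<longlonglongrightarrow> v x"
    and le: "\<And>n. n \<ge> N \<Longrightarrow> (\<integral>\<^sup>+x. u n x \<partial>M) \<le> c"
  shows "(\<integral>\<^sup>+x. v x \<partial>M) \<le> c"
proof -
  have "(\<integral>\<^sup>+x. v x \<partial>M) = (\<integral>\<^sup>+x. liminf (\<lambda>n. u n x) \<partial>M)"
    using lim by (intro nn_integral_cong_AE) (auto elim!: eventually_mono simp: lim_imp_Liminf)
  also have "\<dots> \<le> liminf (\<lambda>n. \<integral>\<^sup>+x. u n x \<partial>M)" by (rule nn_integral_liminf) measurable
  also have "\<dots> \<le> limsup (\<lambda>n. \<integral>\<^sup>+x. u n x \<partial>M)" by (rule Liminf_le_Limsup) simp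
  also have "\<dots> \<le> c" using le by (intro Limsup_bounded) (auto simp: eventually_sequentially)
  finally show ?thesis .
qed

text \<open>A fixed sequence that increases from 1/2 to 1. It makes the limits along radii
  countable, for subsequences and for measurability.\<close>

definition radius :: "nat \<Rightarrow> real" where "radius n = 1 - 1 / (real n + 2)"

lemma radius_bounds: "0 < radius n" "radius n < 1"
  by (auto simp: radius_def field_simps)

lemma radius_mono: "m \<le> n \<Longrightarrow> radius m \<le> radius n"
  by (auto simp: radius_def field_simps)

lemma radius_tendsto: "radius \<longlonglongrightarrow> 1"
proof -
  have "(\<lambda>n. 1 - 1 / real (n + 2)) \<longlonglongrightarrow> 1 - 0"
    by (intro tendsto_diff tendsto_const LIMSEQ_ignore_initial_segment lim_inverse_n')
  thus ?thesis by (simp add: radius_def[abs_def] add.commute)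
qed

text \<open>The L^p Cauchy property becomes an L^1 Cauchy property on the circle, and a subsequence
  converges almost everywhere. Fatou's lemma then gives both the L^p bound for the limit and the L^1
  convergence.\<close>

lemma hardy_L1_limit:
  fixes G :: "complex \<Rightarrow> complex"
  assumes G: "G holomorphic_on unit_disc" and p: "1 < p"
    and bd: "\<And>r. 0 < r \<Longrightarrow> r < 1 \<Longrightarrow> integral_mean p r G \<le> M"
  obtains \<phi> :: "real \<Rightarrow> complex" and \<rho> :: "nat \<Rightarrow> real"
  where "\<phi> \<in> borel_measurable borel" "\<And>t. \<phi> (t + 2 * pi) = \<phi> t" "\<And>i. 0 < \<rho> i" "\<And>i. \<rho> i < 1" "\<rho> \<longlonglongrightarrow> 1"
    "(\<integral>\<^sup>+t\<in>{0..2*pi}. ennreal (norm (\<phi> t) powr p) \<partial>lborel) \<le> ennreal (2 * pi * M powr p)"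
    "\<And>e. 0 < e \<Longrightarrow> \<exists>N. \<forall>i\<ge>N. (\<integral>\<^sup>+t\<in>{0..2*pi}. ennreal (norm (G (complex_of_real (\<rho> i) * cis t) - \<phi> t)) \<partial>lborel) \<le> ennreal e"
proof -
  have cG: "continuous_on unit_disc G" using G by (rule holomorphic_on_imp_continuous_on)
  have [measurable]: "disc_ext G \<in> borel_measurable borel" using cG by (rule disc_ext_measurable)
  have M: "0 \<le> M" using bd[of "1/2"] order.trans[OF integral_mean_nonneg] by auto
  define g where "g = (\<lambda>n t. disc_ext G (complex_of_real (radius n) * cis t))"
  have g_eq: "g n t = G (complex_of_real (radius n) * cis t)" for n t
    using radius_bounds[of n] by (simp add: g_def norm_mult)
  have [measurable]: "g n \<in> borel_measurable borel" for n unfolding g_def by measurable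
  define s where "s = (\<lambda>n t. indicator {0..2*pi} t *\<^sub>R g n t)"
  have cg: "continuous_on A (g n)" for n A
    unfolding g_eq[abs_def] using radius_bounds[of n] by (intro continuous_on_circle cG) auto
  have si: "integrable lborel (s n)" for n
    using borel_integrable_atLeastAtMost'[OF cg] by (simp add: s_def set_integrable_def)
  have L1: "\<exists>N. \<forall>i\<ge>N. \<forall>j\<ge>N. (LINT x|lborel. norm (s i x - s j x)) < e" if e: "0 < e" for e :: real
  proof -
    \<comment> \<open>The values of \<epsilon> and \<eta> make both terms of
      \<open>le_add_powr\<close>, integrated over a period, equal to e/4.\<close>
    define \<epsilon> where "\<epsilon> = e / (8 * pi)"
    have \<epsilon>: "0 < \<epsilon>" using e by (simp add: \<epsilon>_def)
    define \<eta> where "\<eta> = e / (4 * \<epsilon> powr (1 - p))"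
    have \<eta>: "0 < \<eta>" using e \<epsilon> by (simp add: \<eta>_def)
    obtain r0 where r0: "0 < r0" "r0 < 1" "\<And>r s. r0 \<le> r \<Longrightarrow> r \<le> s \<Longrightarrow> s < 1 \<Longrightarrow>
      (LINT t:{0..2*pi}|lborel. norm (G (complex_of_real r * cis t) - G (complex_of_real s * cis t)) powr p) \<le> \<eta>"
      using hardy_Lp_cauchy[OF G p bd \<eta>] by blast
    obtain N where N: "\<And>n. n \<ge> N \<Longrightarrow> r0 < radius n"
      using order_tendstoD(1)[OF radius_tendsto r0(2)] by (auto simp: eventually_sequentially)
    have le: "(LINT x|lborel. norm (s i x - s j x)) < e" if ij: "N \<le> i" "i \<le> j" for i j
    proof -
      have iij: "set_integrable lborel {0..2*pi} (\<lambda>t. norm (g i t - g j t) powr p)"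
        using p by (intro circle_power_integrable continuous_intros cg) auto
      have ic: "set_integrable lborel {0..2*pi} (\<lambda>t. \<epsilon>)" by (intro borel_integrable_atLeastAtMost' continuous_intros)
      have "(LINT x|lborel. norm (s i x - s j x)) = (LINT t:{0..2*pi}|lborel. norm (g i t - g j t))"
        unfolding set_lebesgue_integral_def s_def by (intro Bochner_Integration.integral_cong) (auto simp: indicator_def)
      also have "\<dots> \<le> (LINT t:{0..2*pi}|lborel. \<epsilon> + \<epsilon> powr (1 - p) * norm (g i t - g j t) powr p)"
      proof (rule set_integral_mono)
        show "set_integrable lborel {0..2*pi} (\<lambda>t. norm (g i t - g j t))"
          by (intro borel_integrable_atLeastAtMost' continuous_intros cg)
        show "set_integrable lborel {0..2*pi} (\<lambda>t. \<epsilon> + \<epsilon> powr (1 - p) * norm (g i t - g j t) powr p)"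
          using iij ic by (intro set_integral_add set_integrable_mult_right) auto
        show "norm (g i t - g j t) \<le> \<epsilon> + \<epsilon> powr (1 - p) * norm (g i t - g j t) powr p" for t
          by (rule le_add_powr[OF norm_ge_zero \<epsilon> p])
      qed
      also have "\<dots> = 2 * pi * \<epsilon> + \<epsilon> powr (1 - p) * (LINT t:{0..2*pi}|lborel. norm (g i t - g j t) powr p)"
        using iij ic by (subst set_integral_add) (auto simp: set_lebesgue_integral_def)
      also have "\<dots> \<le> 2 * pi * \<epsilon> + \<epsilon> powr (1 - p) * \<eta>"
        using r0(3)[of "radius i" "radius j"] N[of i] radius_mono[OF ij(2)] radius_bounds[of j] ij unfolding g_eq
        by (intro add_left_mono mult_left_mono) auto
      also have "\<dots> = e / 4 + e / 4" using \<epsilon> by (simp add: \<eta>_def) (simp add: \<epsilon>_def)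
      also have "\<dots> < e" using e by simp
      finally show ?thesis .
    qed
    show ?thesis
    proof (intro exI allI impI)
      fix i j assume "N \<le> i" "N \<le> j"
      thus "(LINT x|lborel. norm (s i x - s j x)) < e"
        using le[of i j] le[of j i] by (cases "i \<le> j") (simp_all add: norm_minus_commute[of "s j _"])
    qed
  qed
  obtain \<sigma> where \<sigma>: "strict_mono \<sigma>" "AE t in lborel. Cauchy (\<lambda>i. s (\<sigma> i) t)"
    using cauchy_L1_AE_cauchy_subseq[of lborel s, OF si L1] by blast
  define \<rho> where "\<rho> = radius \<circ> \<sigma>"
  \<comment> \<open>Taking the limit of the periodic functions at every real t makes \<phi> periodic
    and Borel everywhere, not just almost everywhere.\<close>
  define \<phi> where "\<phi> = (\<lambda>t. lim (\<lambda>i. g (\<sigma> i) t))"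
  have \<phi>m [measurable]: "\<phi> \<in> borel_measurable borel" unfolding \<phi>_def by measurable
  have AE1: "AE t in lborel. t \<in> {0..2*pi} \<longrightarrow> (\<lambda>i. g (\<sigma> i) t) \<longlonglongrightarrow> \<phi> t"
    using \<sigma>(2)
  proof eventually_elim
    fix t assume t: "Cauchy (\<lambda>i. s (\<sigma> i) t)"
    show "t \<in> {0..2*pi} \<longrightarrow> (\<lambda>i. g (\<sigma> i) t) \<longlonglongrightarrow> \<phi> t"
    proof
      assume "t \<in> {0..2*pi}"
      hence "Cauchy (\<lambda>i. g (\<sigma> i) t)" using t by (simp add: s_def)
      hence "convergent (\<lambda>i. g (\<sigma> i) t)" by (rule Cauchy_convergent)
      thus "(\<lambda>i. g (\<sigma> i) t) \<longlonglongrightarrow> \<phi> t" unfolding \<phi>_def by (simp only: convergent_LIMSEQ_iff)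
    qed
  qed
  show ?thesis
  proof (rule that[of \<phi> \<rho>])
    show "\<phi> \<in> borel_measurable borel" by measurable
    show "\<phi> (t + 2 * pi) = \<phi> t" for t by (simp add: \<phi>_def g_def cis_mult[symmetric])
    show "0 < \<rho> i" "\<rho> i < 1" for i using radius_bounds by (auto simp: \<rho>_def)
    show "\<rho> \<longlonglongrightarrow> 1" unfolding \<rho>_def by (rule LIMSEQ_subseq_LIMSEQ[OF radius_tendsto \<sigma>(1)])
    show "(\<integral>\<^sup>+t\<in>{0..2*pi}. ennreal (norm (\<phi> t) powr p) \<partial>lborel) \<le> ennreal (2 * pi * M powr p)"
    proof (rule nn_integral_le_of_AE_limit[where u="\<lambda>i t. ennreal (norm (g (\<sigma> i) t) powr p) * indicator {0..2*pi} t" and N=0])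
      show "AE t in lborel. (\<lambda>i. ennreal (norm (g (\<sigma> i) t) powr p) * indicator {0..2*pi} t) \<longlonglongrightarrow> ennreal (norm (\<phi> t) powr p) * indicator {0..2*pi} t"
        using AE1
      proof eventually_elim
        fix t assume t: "t \<in> {0..2*pi} \<longrightarrow> (\<lambda>i. g (\<sigma> i) t) \<longlonglongrightarrow> \<phi> t"
        show "(\<lambda>i. ennreal (norm (g (\<sigma> i) t) powr p) * indicator {0..2*pi} t) \<longlonglongrightarrow> ennreal (norm (\<phi> t) powr p) * indicator {0..2*pi} t"
        proof (cases "t \<in> {0..2*pi}")
          case True
          have "(\<lambda>i. norm (g (\<sigma> i) t) powr p) \<longlonglongrightarrow> norm (\<phi> t) powr p"
            using t True p by (intro tendsto_powr' tendsto_norm tendsto_const) auto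
          thus ?thesis using True by simp
        qed simp
      qed
      show "(\<integral>\<^sup>+t\<in>{0..2*pi}. ennreal (norm (g (\<sigma> i) t) powr p) \<partial>lborel) \<le> ennreal (2 * pi * M powr p)" for i
        using integral_mean_le_iff[OF cG, of "radius (\<sigma> i)" p M] bd[of "radius (\<sigma> i)"] radius_bounds[of "\<sigma> i"] p M
        by (simp add: g_eq circle_power_def)
    qed measurable
    fix e :: real assume e: "0 < e"
    obtain N where N: "\<And>i j. i \<ge> N \<Longrightarrow> j \<ge> N \<Longrightarrow> (LINT x|lborel. norm (s i x - s j x)) < e"
      using L1[OF e] by blast
    have "(\<integral>\<^sup>+t\<in>{0..2*pi}. ennreal (norm (G (complex_of_real (\<rho> i) * cis t) - \<phi> t)) \<partial>lborel) \<le> ennreal e" if i: "i \<ge> N" for i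
    \<comment> \<open>Fatou's lemma in j with i fixed: the L^1 distance to the limit inherits the
      bound of the L^1 distances to the later terms.\<close>
    proof (rule nn_integral_le_of_AE_limit[where u="\<lambda>j t. ennreal (norm (s (\<sigma> i) t - s (\<sigma> j) t))" and N=N])
      show "(\<lambda>t. ennreal (norm (s (\<sigma> i) t - s (\<sigma> j) t))) \<in> borel_measurable lborel" for j unfolding s_def by measurable
      show "AE t in lborel. (\<lambda>j. ennreal (norm (s (\<sigma> i) t - s (\<sigma> j) t))) \<longlonglongrightarrow>
          ennreal (norm (G (complex_of_real (\<rho> i) * cis t) - \<phi> t)) * indicator {0..2*pi} t"
        using AE1
      proof eventually_elim
        fix t assume t: "t \<in> {0..2*pi} \<longrightarrow> (\<lambda>i. g (\<sigma> i) t) \<longlonglongrightarrow> \<phi> t"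
        show "(\<lambda>j. ennreal (norm (s (\<sigma> i) t - s (\<sigma> j) t))) \<longlonglongrightarrow>
          ennreal (norm (G (complex_of_real (\<rho> i) * cis t) - \<phi> t)) * indicator {0..2*pi} t"
        proof (cases "t \<in> {0..2*pi}")
          case True
          have "(\<lambda>j. norm (g (\<sigma> i) t - g (\<sigma> j) t)) \<longlonglongrightarrow> norm (g (\<sigma> i) t - \<phi> t)"
            using t True by (intro tendsto_intros) auto
          thus ?thesis using True by (simp add: s_def g_eq \<rho>_def)
        qed (simp add: s_def)
      qed
      fix j assume j: "j \<ge> N"
      have "(\<integral>\<^sup>+t. ennreal (norm (s (\<sigma> i) t - s (\<sigma> j) t)) \<partial>lborel) = ennreal (LINT t|lborel. norm (s (\<sigma> i) t - s (\<sigma> j) t))"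
        using si by (intro nn_integral_eq_integral) auto
      also have "\<dots> \<le> ennreal e"
        using N[of "\<sigma> i" "\<sigma> j"] seq_suble[OF \<sigma>(1), of i] seq_suble[OF \<sigma>(1), of j] i j by (intro ennreal_leI) auto
      finally show "(\<integral>\<^sup>+t. ennreal (norm (s (\<sigma> i) t - s (\<sigma> j) t)) \<partial>lborel) \<le> ennreal e" .
    qed
    thus "\<exists>N. \<forall>i\<ge>N. (\<integral>\<^sup>+t\<in>{0..2*pi}. ennreal (norm (G (complex_of_real (\<rho> i) * cis t) - \<phi> t)) \<partial>lborel) \<le> ennreal e"
      by blast
  qed
qed

lemma periodic_set_integrable:
  fixes \<phi> :: "real \<Rightarrow> complex"
  assumes [measurable]: "\<phi> \<in> borel_measurable borel" and per: "\<And>t. \<phi> (t + 2 * pi) = \<phi> t"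
    and fin: "(\<integral>\<^sup>+t\<in>{0..2*pi}. ennreal (norm (\<phi> t)) \<partial>lborel) < \<infinity>"
  shows "set_integrable lborel {a..b} \<phi>"
proof -
  define I where "I = (\<lambda>a b. \<integral>\<^sup>+t\<in>{a..b}. ennreal (norm (\<phi> t)) \<partial>lborel)"
  have one: "I c (c + 2 * pi) < \<infinity>" for c
  proof -
    have "I (0 + c) (2 * pi + c) = (\<integral>\<^sup>+t\<in>{0..2*pi}. ennreal (norm (\<phi> (t + c))) \<partial>lborel)"
      unfolding I_def by (rule nn_integral_shift_interval[symmetric]) measurable
    also have "\<dots> = (\<integral>\<^sup>+t\<in>{0..2*pi}. ennreal (norm (\<phi> t)) \<partial>lborel)"
      by (rule nn_integral_periodic_shift) (auto simp: per)
    finally show ?thesis using fin by (simp add: add.commute)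
  qed
  have many: "I a (a + 2 * pi * real n) < \<infinity>" for n
  proof (induction n)
    case 0
    have "I a a = 0" unfolding I_def using AE_lborel_singleton[of a]
      by (intro nn_integral_0_iff_AE[THEN iffD2]) (auto simp: indicator_def elim!: eventually_mono)
    thus ?case by simp
  next
    case (Suc n)
    define c where "c = a + 2 * pi * real n"
    have eq: "a + 2 * pi * real (Suc n) = c + 2 * pi" by (simp add: c_def algebra_simps)
    have "I a (c + 2 * pi) = I a c + I c (c + 2 * pi)"
      unfolding I_def by (rule nn_integral_split_interval) (auto simp: c_def)
    thus ?case unfolding eq using Suc[folded c_def] one[of c] by simp
  qed
  obtain n where n: "b \<le> a + 2 * pi * real n"
  proof -
    obtain n where "(b - a) / (2 * pi) \<le> real n" using real_arch_simple by blast
    hence "b \<le> a + 2 * pi * real n" by (simp add: field_simps)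
    thus ?thesis by (rule that)
  qed
  have "(\<integral>\<^sup>+t. ennreal (norm (indicator {a..b} t *\<^sub>R \<phi> t)) \<partial>lborel) \<le> I a (a + 2 * pi * real n)"
    unfolding I_def using n by (intro nn_integral_mono) (auto simp: indicator_def)
  thus ?thesis unfolding set_integrable_def using many[of n] by (intro integrableI_bounded) auto
qed

text \<open>The Poisson formula holds for the dilates with factor \<rho> i. For fixed r the kernel
  is bounded, so L^1 convergence on the circle permits the passage to the limit; on the other side G
  is continuous inside the disc.\<close>

lemma hardy_poisson:
  fixes G :: "complex \<Rightarrow> complex"
  assumes G: "G holomorphic_on unit_disc"
    and [measurable]: "\<phi> \<in> borel_measurable borel" and per: "\<And>t. \<phi> (t + 2 * pi) = \<phi> t"
    and i\<phi>: "\<And>a b. set_integrable lborel {a..b} \<phi>"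
    and \<rho>: "\<And>i. 0 < \<rho> i" "\<And>i. \<rho> i < 1" "\<rho> \<longlonglongrightarrow> 1"
    and L1: "\<And>e. 0 < e \<Longrightarrow> \<exists>N. \<forall>i\<ge>N. (\<integral>\<^sup>+t\<in>{0..2*pi}. ennreal (norm (G (complex_of_real (\<rho> i) * cis t) - \<phi> t)) \<partial>lborel) \<le> ennreal e"
    and r: "0 \<le> r" "r < 1"
  shows "(LINT t:{0..2*pi}|lborel. poisson r t *\<^sub>R \<phi> (x + t)) = 2 * pi * G (complex_of_real r * cis x)"
proof (rule LIMSEQ_unique)
  have cG: "continuous_on unit_disc G" using G by (rule holomorphic_on_imp_continuous_on)
  have [measurable]: "disc_ext G \<in> borel_measurable borel" using cG by (rule disc_ext_measurable)
  define g where "g = (\<lambda>n t. disc_ext G (complex_of_real (\<rho> n) * cis t))"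
  have g_eq: "g n t = G (complex_of_real (\<rho> n) * cis t)" for n t
    using \<rho>(1)[of n] \<rho>(2)[of n] by (simp add: g_def norm_mult)
  have [measurable]: "g n \<in> borel_measurable borel" for n unfolding g_def by measurable
  have cg: "continuous_on A (g n)" for n A
    unfolding g_eq[abs_def] using \<rho>(1)[of n] \<rho>(2)[of n] by (intro continuous_on_circle cG) auto
  have eq: "(LINT t:{0..2*pi}|lborel. poisson r t *\<^sub>R g n (x + t)) = 2 * pi * G (\<rho> n * complex_of_real r * cis x)" for n
    using poisson_formula[OF holomorphic_on_rotate[OF G, of x] \<rho>(1)[of n] \<rho>(2)[of n] r]
    by (simp add: g_eq cis_mult[symmetric] mult_ac)
  have isCont: "isCont G (complex_of_real r * cis x)"
    using cG r by (intro continuous_on_interior) (auto simp: interior_open norm_mult)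
  have "(\<lambda>n. complex_of_real (\<rho> n) * complex_of_real r * cis x) \<longlonglongrightarrow> complex_of_real 1 * complex_of_real r * cis x"
    by (intro tendsto_intros \<rho>(3))
  hence lim: "(\<lambda>n. complex_of_real (\<rho> n) * complex_of_real r * cis x) \<longlonglongrightarrow> complex_of_real r * cis x"
    by (simp only: of_real_1 mult_1)
  have "(\<lambda>n. G (\<rho> n * complex_of_real r * cis x)) \<longlonglongrightarrow> G (complex_of_real r * cis x)"
    by (rule isCont_tendsto_compose[OF isCont lim])
  thus "(\<lambda>n. LINT t:{0..2*pi}|lborel. poisson r t *\<^sub>R g n (x + t)) \<longlonglongrightarrow> 2 * pi * G (complex_of_real r * cis x)"
    unfolding eq by (intro tendsto_intros)
  \<comment> \<open>A bound for the kernel, whose maximum is (1 + r)/(1 - r).\<close>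
  define B where "B = 2 / (1 - r)"
  have B: "0 < B" using r by (simp add: B_def)
  have PB: "\<bar>poisson r t\<bar> \<le> B" for t
  proof -
    have n: "1 - r \<le> norm (1 - complex_of_real r * cis t)"
      using norm_triangle_ineq2[of 1 "complex_of_real r * cis t"] r by (simp add: norm_mult)
    have "poisson r t \<le> (1 - r\<^sup>2) / (1 - r)\<^sup>2"
      unfolding poisson_def using n r by (intro divide_left_mono power_mono mult_pos_pos) (auto simp: power_le_one one_minus_cis_nonzero[OF r])
    also have "\<dots> = (1 + r) / (1 - r)"
    proof -
      have "1 - r\<^sup>2 = (1 - r) * (1 + r)" by (simp add: power2_eq_square algebra_simps)
      thus ?thesis using r by (simp add: power2_eq_square)
    qed
    also have "\<dots> \<le> B" unfolding B_def using r by (intro divide_right_mono) auto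
    finally show ?thesis using poisson_nonneg[OF r] by simp
  qed
  have i\<phi>x: "set_integrable lborel {0..2*pi} (\<lambda>t. \<phi> (x + t))"
  proof -
    have "integrable lborel (\<lambda>t. indicator {x..x+2*pi} (x + 1 * t) *\<^sub>R \<phi> (x + 1 * t))"
      using i\<phi>[of x "x+2*pi"] unfolding set_integrable_def by (intro lborel_integrable_real_affine) auto
    thus ?thesis by (simp add: set_integrable_def indicator_def)
  qed
  have igx: "set_integrable lborel {0..2*pi} (\<lambda>t. g n (x + t))" for n
    by (intro borel_integrable_atLeastAtMost' continuous_on_compose2[OF cg] continuous_intros) auto
  show "(\<lambda>n. LINT t:{0..2*pi}|lborel. poisson r t *\<^sub>R g n (x + t)) \<longlonglongrightarrow> (LINT t:{0..2*pi}|lborel. poisson r t *\<^sub>R \<phi> (x + t))"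
  proof (rule LIMSEQ_I)
    fix e :: real assume e: "0 < e"
    obtain N where N: "\<And>i. i \<ge> N \<Longrightarrow> (\<integral>\<^sup>+t\<in>{0..2*pi}. ennreal (norm (G (complex_of_real (\<rho> i) * cis t) - \<phi> t)) \<partial>lborel) \<le> ennreal (e / (2 * B))"
      using L1[of "e / (2 * B)"] e B by auto
    have "norm ((LINT t:{0..2*pi}|lborel. poisson r t *\<^sub>R g n (x + t)) - (LINT t:{0..2*pi}|lborel. poisson r t *\<^sub>R \<phi> (x + t))) < e" if n: "n \<ge> N" for n
    proof -
      let ?d = "\<lambda>t. g n (x + t) - \<phi> (x + t)"
      have id: "set_integrable lborel {0..2*pi} ?d" using igx i\<phi>x by (intro set_integral_diff)
      have "(LINT t:{0..2*pi}|lborel. poisson r t *\<^sub>R g n (x + t)) - (LINT t:{0..2*pi}|lborel. poisson r t *\<^sub>R \<phi> (x + t))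
          = (LINT t:{0..2*pi}|lborel. poisson r t *\<^sub>R ?d t)"
        unfolding scaleR_diff_right
        by (intro set_integral_diff(2)[symmetric] set_integrable_continuous_scaleR poisson_continuous r igx i\<phi>x)
      also have "norm \<dots> \<le> (LINT t:{0..2*pi}|lborel. norm (poisson r t *\<^sub>R ?d t))"
        by (intro set_integral_norm_bound set_integrable_continuous_scaleR poisson_continuous r id)
      also have "\<dots> \<le> (LINT t:{0..2*pi}|lborel. B * norm (?d t))"
        using PB by (intro set_integral_mono set_integrable_norm set_integrable_mult_right set_integrable_continuous_scaleR poisson_continuous r id)
          (auto intro!: mult_right_mono)
      also have "\<dots> = B * (LINT t:{0..2*pi}|lborel. norm (?d t))" by simp
      also have "(LINT t:{0..2*pi}|lborel. norm (?d t)) \<le> e / (2 * B)"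
      proof -
        have "ennreal (LINT t:{0..2*pi}|lborel. norm (?d t)) = (\<integral>\<^sup>+t\<in>{0..2*pi}. ennreal (norm (g n (t + x) - \<phi> (t + x))) \<partial>lborel)"
          using set_integrable_norm[OF id]
          by (subst set_integrable_iff_nn_integral(2)[symmetric]) (auto simp: add.commute)
        also have "\<dots> = (\<integral>\<^sup>+t\<in>{0..2*pi}. ennreal (norm (g n t - \<phi> t)) \<partial>lborel)"
          by (rule nn_integral_periodic_shift) (auto simp: per g_def cis_mult[symmetric])
        also have "\<dots> \<le> ennreal (e / (2 * B))" using N[OF n] by (simp add: g_eq)
        finally show ?thesis using e B by (subst (asm) ennreal_le_iff) auto
      qed
      hence "B * (LINT t:{0..2*pi}|lborel. norm (?d t)) \<le> e / 2" using B by (simp add: field_simps)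
      also have "e / 2 < e" using e by simp
      finally show ?thesis .
    qed
    thus "\<exists>N. \<forall>n\<ge>N. norm ((LINT t:{0..2*pi}|lborel. poisson r t *\<^sub>R g n (x + t)) - (LINT t:{0..2*pi}|lborel. poisson r t *\<^sub>R \<phi> (x + t))) < e"
      by blast
  qed
qed

lemma AE_shift:
  fixes P :: "real \<Rightarrow> bool"
  assumes "AE x in lborel. P x" shows "AE x in lborel. P (x + a)"
proof -
  obtain N where N: "{x. \<not> P x} \<subseteq> N" "N \<in> null_sets lborel"
    using assms by (auto simp: eventually_ae_filter)
  have "{x. x - (- a) \<in> N} \<in> null_sets lborel" by (rule null_sets_translation[OF N(2)])
  moreover have "{x. \<not> P (x + a)} \<subseteq> {x. x - (- a) \<in> N}" using N(1) by auto
  ultimately show ?thesis by (intro AE_I'[where N="{x. x - (- a) \<in> N}"]) auto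
qed

lemma boundary_function_eq:
  assumes "((\<lambda>r::real. g (complex_of_real r * \<zeta>)) \<longlongrightarrow> l) (at_left 1)"
  shows "boundary_function g \<zeta> = l"
  unfolding boundary_function_def by (rule tendsto_Lim[OF _ assms]) simp

text \<open>Off the set of convergence \<^const>\<open>Lim\<close> is one fixed complex number, so the boundary
  function is Borel measurable without any completion.\<close>

lemma boundary_function_measurable:
  assumes cG: "continuous_on unit_disc G"
  shows "(\<lambda>\<theta>. boundary_function G (cis \<theta>)) \<in> borel_measurable borel"
proof -
  have [measurable]: "disc_ext G \<in> borel_measurable borel" using cG by (rule disc_ext_measurable)
  \<comment> \<open>Cauchy's criterion for the radial limit with countably many parameters k and m.
    Although all real radii occur, each set is an intersection of closed sets, hence Borel.\<close>
  define S where "S = (\<lambda>k m :: nat. {\<theta>. \<forall>r\<in>{radius m<..<1}. \<forall>s\<in>{radius m<..<1}.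
     norm (G (complex_of_real r * cis \<theta>) - G (complex_of_real s * cis \<theta>)) \<le> 1 / real (Suc k)})"
  have "closed (S k m)" for k m
  proof -
    have "S k m = (\<Inter>r\<in>{radius m<..<1}. \<Inter>s\<in>{radius m<..<1}. {\<theta>. norm (G (complex_of_real r * cis \<theta>) - G (complex_of_real s * cis \<theta>)) \<le> 1 / real (Suc k)})"
      by (auto simp: S_def)
    moreover have "closed {\<theta>. norm (G (complex_of_real r * cis \<theta>) - G (complex_of_real s * cis \<theta>)) \<le> 1 / real (Suc k)}"
      if "r \<in> {radius m<..<1}" "s \<in> {radius m<..<1}" for r s
      using that radius_bounds[of m]
      by (intro closed_Collect_le continuous_intros continuous_on_circle cG) auto
    ultimately show ?thesis by (auto intro!: closed_INT)
  qed
  hence [measurable]: "S k m \<in> sets borel" for k m by simp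
  define E where "E = (\<Inter>k. \<Union>m. S k m)"
  have [measurable]: "E \<in> sets borel" unfolding E_def by measurable
  have lim: "((\<lambda>r. G (complex_of_real r * cis \<theta>)) \<longlongrightarrow> lim (\<lambda>n. disc_ext G (complex_of_real (radius n) * cis \<theta>))) (at_left 1)"
    if \<theta>: "\<theta> \<in> E" for \<theta>
  proof -
    have eq: "disc_ext G (complex_of_real (radius n) * cis \<theta>) = G (complex_of_real (radius n) * cis \<theta>)" for n
      using radius_bounds[of n] by (simp add: norm_mult)
    have S: "\<exists>m. \<theta> \<in> S k m" for k using \<theta> by (auto simp: E_def)
    have rm: "\<exists>N. \<forall>n\<ge>N. radius n \<in> {radius m<..<1}" for m
      using order_tendstoD(1)[OF radius_tendsto radius_bounds(2)[of m]] radius_bounds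
      by (auto simp: eventually_sequentially)
    have "Cauchy (\<lambda>n. G (complex_of_real (radius n) * cis \<theta>))"
    proof (rule CauchyI)
      fix e :: real assume "0 < e"
      then obtain k where k: "1 / real (Suc k) < e" using nat_approx_posE by blast
      obtain m where m: "\<theta> \<in> S k m" using S by blast
      obtain N where N: "\<And>n. n \<ge> N \<Longrightarrow> radius n \<in> {radius m<..<1}" using rm[of m] by blast
      show "\<exists>M. \<forall>n\<ge>M. \<forall>n'\<ge>M. norm (G (complex_of_real (radius n) * cis \<theta>) - G (complex_of_real (radius n') * cis \<theta>)) < e"
      proof (intro exI allI impI)
        fix n n' assume "N \<le> n" "N \<le> n'"
        hence "norm (G (complex_of_real (radius n) * cis \<theta>) - G (complex_of_real (radius n') * cis \<theta>)) \<le> 1 / real (Suc k)"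
          using m N unfolding S_def by blast
        thus "norm (G (complex_of_real (radius n) * cis \<theta>) - G (complex_of_real (radius n') * cis \<theta>)) < e" using k by linarith
      qed
    qed
    hence "convergent (\<lambda>n. G (complex_of_real (radius n) * cis \<theta>))" by (rule Cauchy_convergent)
    hence L: "(\<lambda>n. G (complex_of_real (radius n) * cis \<theta>)) \<longlonglongrightarrow> lim (\<lambda>n. disc_ext G (complex_of_real (radius n) * cis \<theta>))"
      unfolding eq by (simp only: convergent_LIMSEQ_iff)
    show ?thesis
    proof (rule tendstoI)
      fix e :: real assume "0 < e"
      then obtain k where k: "1 / real (Suc k) < e" using nat_approx_posE by blast
      obtain m where m: "\<theta> \<in> S k m" using S by blast
      obtain N where N: "\<And>n. n \<ge> N \<Longrightarrow> radius n \<in> {radius m<..<1}" using rm[of m] by blast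
      have "\<forall>\<^sub>F r in at_left 1. r \<in> {radius m<..<1}" by (rule eventually_at_left_real[OF radius_bounds(2)])
      thus "\<forall>\<^sub>F r in at_left 1. dist (G (complex_of_real r * cis \<theta>)) (lim (\<lambda>n. disc_ext G (complex_of_real (radius n) * cis \<theta>))) < e"
      proof eventually_elim
        fix r assume r: "r \<in> {radius m<..<1}"
        have "norm (G (complex_of_real r * cis \<theta>) - lim (\<lambda>n. disc_ext G (complex_of_real (radius n) * cis \<theta>))) \<le> 1 / real (Suc k)"
        proof (rule Lim_norm_ubound[OF _ tendsto_diff[OF tendsto_const L]])
          show "\<forall>\<^sub>F n in sequentially. norm (G (complex_of_real r * cis \<theta>) - G (complex_of_real (radius n) * cis \<theta>)) \<le> 1 / real (Suc k)"
            unfolding eventually_sequentially using m N r unfolding S_def by blast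
        qed simp
        thus "dist (G (complex_of_real r * cis \<theta>)) (lim (\<lambda>n. disc_ext G (complex_of_real (radius n) * cis \<theta>))) < e"
          unfolding dist_norm using k by linarith
      qed
    qed
  qed
  have nolim: "\<not> ((\<lambda>r. G (complex_of_real r * cis \<theta>)) \<longlongrightarrow> l) (at_left 1)" if \<theta>: "\<theta> \<notin> E" for \<theta> l
  proof
    assume l: "((\<lambda>r. G (complex_of_real r * cis \<theta>)) \<longlongrightarrow> l) (at_left 1)"
    have "\<exists>m. \<theta> \<in> S k m" for k
    proof -
      have "\<forall>\<^sub>F r in at_left 1. dist (G (complex_of_real r * cis \<theta>)) l < 1 / real (Suc k) / 2"
        by (rule tendstoD[OF l]) simp
      then obtain b where b: "b < 1" "\<And>r. b < r \<Longrightarrow> r < 1 \<Longrightarrow> dist (G (complex_of_real r * cis \<theta>)) l < 1 / real (Suc k) / 2"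
        unfolding eventually_at_left_field by blast
      obtain m where m: "b < radius m"
        using order_tendstoD(1)[OF radius_tendsto b(1)] by (auto simp: eventually_sequentially)
      have "norm (G (complex_of_real r * cis \<theta>) - G (complex_of_real s * cis \<theta>)) \<le> 1 / real (Suc k)"
        if "r \<in> {radius m<..<1}" "s \<in> {radius m<..<1}" for r s
      proof -
        have "dist (G (complex_of_real r * cis \<theta>)) l < 1 / real (Suc k) / 2" "dist (G (complex_of_real s * cis \<theta>)) l < 1 / real (Suc k) / 2"
          by (rule b(2); use that m in simp)+
        hence "dist (G (complex_of_real r * cis \<theta>)) (G (complex_of_real s * cis \<theta>)) < 1 / real (Suc k)"
          by (rule dist_triangle_half_l)
        thus ?thesis by (simp add: dist_norm)
      qed
      thus ?thesis unfolding S_def mem_Collect_eq by blast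
    qed
    thus False using \<theta> by (auto simp: E_def)
  qed
  have "(\<lambda>\<theta>. boundary_function G (cis \<theta>)) = (\<lambda>\<theta>. if \<theta> \<in> E then lim (\<lambda>n. disc_ext G (complex_of_real (radius n) * cis \<theta>)) else (THE l. False))"
  proof
    fix \<theta>
    show "boundary_function G (cis \<theta>) = (if \<theta> \<in> E then lim (\<lambda>n. disc_ext G (complex_of_real (radius n) * cis \<theta>)) else (THE l. False))"
    proof (cases "\<theta> \<in> E")
      case True
      thus ?thesis using boundary_function_eq[OF lim[OF True]] by simp
    next
      case False
      have "(\<lambda>l. ((\<lambda>r. G (complex_of_real r * cis \<theta>)) \<longlongrightarrow> l) (at_left 1)) = (\<lambda>l. False)"
        using nolim[OF False] by blast
      thus ?thesis using False by (simp add: boundary_function_def Topological_Spaces.Lim_def)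
    qed
  qed
  also have "\<dots> \<in> borel_measurable borel" by measurable
  finally show ?thesis .
qed

text \<open>The L^1 limit \<phi> represents G by a Poisson integral, so its points of symmetric
  differentiability are points of radial convergence and the boundary function equals \<phi> almost
  everywhere. The second claim is Minkowski's inequality for this Poisson integral, the third the
  L^p bound for \<phi>.\<close>

theorem hardy_boundary:
  fixes G :: "complex \<Rightarrow> complex"
  assumes G: "G holomorphic_on unit_disc" and p: "1 < p"
    and bd: "\<And>r. 0 < r \<Longrightarrow> r < 1 \<Longrightarrow> integral_mean p r G \<le> M"
  shows "AE \<theta> in lborel. ((\<lambda>r. G (complex_of_real r * cis \<theta>)) \<longlongrightarrow> boundary_function G (cis \<theta>)) (at_left 1)"
    and "0 \<le> r \<Longrightarrow> r < 1 \<Longrightarrow> circle_power p r G \<le> (\<integral>\<^sup>+\<theta>\<in>{0..2*pi}. ennreal (norm (boundary_function G (cis \<theta>)) powr p) \<partial>lborel)"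
    and "(\<integral>\<^sup>+\<theta>\<in>{0..2*pi}. ennreal (norm (boundary_function G (cis \<theta>)) powr p) \<partial>lborel) \<le> ennreal (2 * pi * M powr p)"
proof -
  obtain \<phi> \<rho> where \<phi> [measurable]: "\<phi> \<in> borel_measurable borel" and per: "\<And>t. \<phi> (t + 2 * pi) = \<phi> t"
    and \<rho>: "\<And>i. 0 < \<rho> i" "\<And>i. \<rho> i < 1" "\<rho> \<longlonglongrightarrow> 1"
    and fin: "(\<integral>\<^sup>+t\<in>{0..2*pi}. ennreal (norm (\<phi> t) powr p) \<partial>lborel) \<le> ennreal (2 * pi * M powr p)"
    and L1: "\<And>e. 0 < e \<Longrightarrow> \<exists>N. \<forall>i\<ge>N. (\<integral>\<^sup>+t\<in>{0..2*pi}. ennreal (norm (G (complex_of_real (\<rho> i) * cis t) - \<phi> t)) \<partial>lborel) \<le> ennreal e"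
    by (rule hardy_L1_limit[OF G p bd]) (assumption | rule that)+
  have "(\<integral>\<^sup>+t\<in>{0..2*pi}. ennreal (norm (\<phi> t)) \<partial>lborel) \<le> (\<integral>\<^sup>+t. indicator {0..2*pi} t + ennreal (norm (\<phi> t) powr p) * indicator {0..2*pi} t \<partial>lborel)"
  proof (intro nn_integral_mono)
    fix t
    have "norm (\<phi> t) \<le> 1 + norm (\<phi> t) powr p" using le_add_powr[of "norm (\<phi> t)" 1 p] p by simp
    hence "ennreal (norm (\<phi> t)) \<le> ennreal (1 + norm (\<phi> t) powr p)" by (rule ennreal_leI)
    also have "\<dots> = 1 + ennreal (norm (\<phi> t) powr p)" by (subst ennreal_plus) auto
    finally show "ennreal (norm (\<phi> t)) * indicator {0..2*pi} t \<le> indicator {0..2*pi} t + ennreal (norm (\<phi> t) powr p) * indicator {0..2*pi} t"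
      by (auto simp: indicator_def)
  qed
  also have "\<dots> = ennreal (2 * pi) + (\<integral>\<^sup>+t\<in>{0..2*pi}. ennreal (norm (\<phi> t) powr p) \<partial>lborel)"
    by (subst nn_integral_add) auto
  also have "\<dots> < \<infinity>" using fin by (auto simp: less_top[symmetric] top_unique)
  finally have fin1: "(\<integral>\<^sup>+t\<in>{0..2*pi}. ennreal (norm (\<phi> t)) \<partial>lborel) < \<infinity>" .
  have i\<phi>: "set_integrable lborel {a..b} \<phi>" for a b by (rule periodic_set_integrable[OF \<phi> per fin1])
  have pois: "(LINT t:{0..2*pi}|lborel. poisson r t *\<^sub>R \<phi> (x + t)) = 2 * pi * G (complex_of_real r * cis x)"
    if "0 \<le> r" "r < 1" for r x
    by (rule hardy_poisson[OF G \<phi> per i\<phi> \<rho> L1 that])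
  have AE: "AE \<theta> in lborel. ((\<lambda>r. G (complex_of_real r * cis \<theta>)) \<longlongrightarrow> \<phi> \<theta>) (at_left 1)"
    using AE_symmetric_derivative[OF i\<phi>]
  proof eventually_elim
    fix \<theta> assume der: "\<forall>e>0. \<exists>d>0. \<forall>h. 0 < h \<longrightarrow> h < d \<longrightarrow> norm (LINT t:{0..h}|lborel. \<phi> (\<theta> + t) + \<phi> (\<theta> - t) - 2 * \<phi> \<theta>) \<le> e * h"
    have iu: "set_integrable lborel {0..2*pi} (\<lambda>t. \<phi> (\<theta> + t))"
    proof -
      have "integrable lborel (\<lambda>t. indicator {\<theta>..\<theta>+2*pi} (\<theta> + 1 * t) *\<^sub>R \<phi> (\<theta> + 1 * t))"
        using i\<phi>[of \<theta> "\<theta>+2*pi"] unfolding set_integrable_def by (intro lborel_integrable_real_affine) auto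
      thus ?thesis by (simp add: set_integrable_def indicator_def)
    qed
    have "((\<lambda>r. LINT t:{0..2*pi}|lborel. poisson r t *\<^sub>R \<phi> (\<theta> + t)) \<longlongrightarrow> 2 * pi * \<phi> (\<theta> + 0)) (at_left 1)"
      by (rule poisson_radial_limit[OF iu]) (use der per in \<open>simp_all add: add.assoc[symmetric]\<close>)
    hence "((\<lambda>r. (1 / (2 * pi)) * (LINT t:{0..2*pi}|lborel. poisson r t *\<^sub>R \<phi> (\<theta> + t))) \<longlongrightarrow> (1 / (2 * pi)) * (2 * pi * \<phi> (\<theta> + 0))) (at_left 1)"
      by (intro tendsto_mult tendsto_const)
    hence "((\<lambda>r. (1 / (2 * pi)) * (LINT t:{0..2*pi}|lborel. poisson r t *\<^sub>R \<phi> (\<theta> + t))) \<longlongrightarrow> \<phi> \<theta>) (at_left 1)" by simp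
    moreover have "\<forall>\<^sub>F r in at_left (1::real). (1 / (2 * pi)) * (LINT t:{0..2*pi}|lborel. poisson r t *\<^sub>R \<phi> (\<theta> + t)) = G (complex_of_real r * cis \<theta>)"
      using eventually_at_left_real[of 0 "1::real"] by (auto elim!: eventually_mono simp: pois)
    ultimately show "((\<lambda>r. G (complex_of_real r * cis \<theta>)) \<longlongrightarrow> \<phi> \<theta>) (at_left 1)"
      by (rule Lim_transform_eventually)
  qed
  have bf: "AE \<theta> in lborel. boundary_function G (cis \<theta>) = \<phi> \<theta>"
    using AE by eventually_elim (rule boundary_function_eq)
  show "AE \<theta> in lborel. ((\<lambda>r. G (complex_of_real r * cis \<theta>)) \<longlongrightarrow> boundary_function G (cis \<theta>)) (at_left 1)"
    using AE bf by eventually_elim simp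
  have I: "(\<integral>\<^sup>+\<theta>\<in>{0..2*pi}. ennreal (norm (boundary_function G (cis \<theta>)) powr p) \<partial>lborel) = (\<integral>\<^sup>+t\<in>{0..2*pi}. ennreal (norm (\<phi> t) powr p) \<partial>lborel)"
    using bf by (intro nn_integral_cong_AE) (auto elim!: eventually_mono)
  show "(\<integral>\<^sup>+\<theta>\<in>{0..2*pi}. ennreal (norm (boundary_function G (cis \<theta>)) powr p) \<partial>lborel) \<le> ennreal (2 * pi * M powr p)"
    unfolding I by (rule fin)
  show "circle_power p r G \<le> (\<integral>\<^sup>+\<theta>\<in>{0..2*pi}. ennreal (norm (boundary_function G (cis \<theta>)) powr p) \<partial>lborel)"
    if r: "0 \<le> r" "r < 1" unfolding I
  proof -
    let ?I = "\<integral>\<^sup>+t\<in>{0..2*pi}. ennreal (norm (\<phi> t) powr p) \<partial>lborel"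
    have "?I \<noteq> top" using fin by (auto simp: top_unique)
    then obtain A where A: "?I = ennreal A" "0 \<le> A" by (cases ?I) auto
    define K where "K = (\<lambda>t. complex_of_real (poisson r t / (2 * pi)))"
    have nK: "norm (K t) = poisson r t / (2 * pi)" for t
      unfolding K_def norm_of_real using poisson_nonneg[OF r, of t] by simp
    have [measurable]: "K \<in> borel_measurable borel" unfolding K_def by measurable
    have le: "circle_power p r G \<le> ennreal (A + e)" if e: "0 < e" for e
    proof -
      \<comment> \<open>The slack e again serves to make the majorant positive, in case the boundary
        norm \<open>A\<close> is 0.\<close>
      define m where "m = (A + e) powr (1 / p)"
      have m: "0 < m" "m powr p = A + e" using A e p by (auto simp: m_def powr_powr)
      have "(\<integral>\<^sup>+x\<in>{0..2*pi}. ennreal (norm (LINT t:{0..2*pi}|lborel. K t * \<phi> (x + t)) powr p) \<partial>lborel)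
         \<le> ennreal (1 * (LINT t:{0..2*pi}|lborel. norm (K t) * m) powr p)"
      proof (rule circle_minkowski[OF p])
        show "(\<lambda>(x, t). \<phi> (x + t)) \<in> borel_measurable (lborel \<Otimes>\<^sub>M lborel)" by measurable
        show "set_integrable lborel {0..2*pi} (\<lambda>t. norm (K t) * m)"
          unfolding nK using poisson_integrable[OF r] by (intro set_integrable_mult_left) simp
        fix t
        have "(\<integral>\<^sup>+x\<in>{0..2*pi}. ennreal (norm (\<phi> (x + t)) powr p) \<partial>lborel) = ?I"
          by (rule nn_integral_periodic_shift[where h="\<lambda>x. ennreal (norm (\<phi> x) powr p)"]) (auto simp: per)
        thus "(\<integral>\<^sup>+x\<in>{0..2*pi}. ennreal (norm (\<phi> (x + t)) powr p) \<partial>lborel) \<le> ennreal (1 * m powr p)"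
          using A m e by (simp add: ennreal_leI)
      qed (use m in auto)
      also have "(LINT t:{0..2*pi}|lborel. norm (K t) * m) = m"
        unfolding nK using poisson_integral[OF r] by simp
      also have "(\<integral>\<^sup>+x\<in>{0..2*pi}. ennreal (norm (LINT t:{0..2*pi}|lborel. K t * \<phi> (x + t)) powr p) \<partial>lborel) = circle_power p r G"
        unfolding circle_power_def
      proof (intro nn_integral_cong arg_cong2[of _ _ _ _ "(*)"] refl)
        fix x :: real
        have "(LINT t:{0..2*pi}|lborel. K t * \<phi> (x + t)) = (LINT t:{0..2*pi}|lborel. (1 / (2 * pi)) * (poisson r t *\<^sub>R \<phi> (x + t)))"
          by (intro set_lebesgue_integral_cong) (auto simp: K_def scaleR_conv_of_real)
        also have "\<dots> = (1 / (2 * pi)) * (LINT t:{0..2*pi}|lborel. poisson r t *\<^sub>R \<phi> (x + t))"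
          by (rule set_integral_mult_right)
        also have "\<dots> = G (complex_of_real r * cis x)" by (simp add: pois[OF r])
        finally show "ennreal (norm (LINT t:{0..2*pi}|lborel. K t * \<phi> (x + t)) powr p) = ennreal (norm (G (complex_of_real r * cis x)) powr p)"
          by simp
      qed
      finally show ?thesis using m by simp
    qed
    show "circle_power p r G \<le> ?I"
    proof (rule ennreal_le_epsilon)
      fix e :: real assume "?I < top" "0 < e"
      thus "circle_power p r G \<le> ?I + ennreal e" using le[of e] A by (simp add: ennreal_plus)
    qed
  qed
qed

section \<open>The mean Lipschitz condition and the growth of the derivative\<close>

text \<open>\<open>M\<^sub>p(r, g')\<close> is little-oh of \<open>(1 - r) powr (1/p - 1)\<close> as \<open>r\<close> tends to \<open>1\<close>; the constant \<open>C\<close>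
  takes care of the radii away from \<open>1\<close>.\<close>

definition small_growth :: "real \<Rightarrow> (complex \<Rightarrow> complex) \<Rightarrow> bool" where
  "small_growth p g \<longleftrightarrow> (\<forall>e>0. \<exists>C\<ge>0. \<forall>r. 0 \<le> r \<longrightarrow> r < 1 \<longrightarrow>
     integral_mean p r (deriv g) \<le> e * (1 - r) powr (1 / p - 1) + C)"

lemma integral_one_minus_powr:
  fixes a \<beta> :: real
  assumes b: "-1 < \<beta>" and a: "a \<le> 1"
  shows "set_integrable lborel {a..<1} (\<lambda>t. (1 - t) powr \<beta>)"
    and "(LINT t:{a..<1}|lborel. (1 - t) powr \<beta>) = (1 - a) powr (\<beta> + 1) / (\<beta> + 1)"
    and "(\<integral>\<^sup>+t\<in>{a..<1}. ennreal ((1 - t) powr \<beta>) \<partial>lborel) = ennreal ((1 - a) powr (\<beta> + 1) / (\<beta> + 1))"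
proof -
  define F where "F = (\<lambda>t. - ((1 - t) powr (\<beta> + 1)) / (\<beta> + 1))"
  have "((\<lambda>t. (1 - t) powr \<beta>) has_integral F 1 - F a) {a..1}"
  proof (rule fundamental_theorem_of_calculus_interior[OF a])
    show "continuous_on {a..1} F" unfolding F_def using b
      by (intro continuous_intros continuous_on_powr') auto
    fix t assume "t \<in> {a<..<1}"
    hence "((\<lambda>t. (1 - t) powr (\<beta> + 1)) has_real_derivative (\<beta> + 1) * (1 - t) powr \<beta> * (- 1)) (at t)"
      by (auto intro!: derivative_eq_intros)
    hence "(F has_real_derivative - ((\<beta> + 1) * (1 - t) powr \<beta> * (- 1)) / (\<beta> + 1)) (at t)"
      unfolding F_def by (intro DERIV_cdivide DERIV_minus)
    thus "(F has_vector_derivative (1 - t) powr \<beta>) (at t)"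
      using b by (simp add: has_real_derivative_iff_has_vector_derivative)
  qed
  hence h: "((\<lambda>t. (1 - t) powr \<beta>) has_integral (1 - a) powr (\<beta> + 1) / (\<beta> + 1)) {a..1}"
    using b by (simp add: F_def)
  have "(\<integral>\<^sup>+t. ennreal (indicator {a..1} t * (1 - t) powr \<beta>) \<partial>lborel) = ennreal ((1 - a) powr (\<beta> + 1) / (\<beta> + 1))"
    by (rule nn_integral_has_integral_lebesgue[OF _ h]) simp
  moreover have "(\<integral>\<^sup>+t\<in>{a..<1}. ennreal ((1 - t) powr \<beta>) \<partial>lborel) = (\<integral>\<^sup>+t. ennreal (indicator {a..1} t * (1 - t) powr \<beta>) \<partial>lborel)"
    by (intro nn_integral_cong) (auto simp: indicator_def)
  ultimately show nn: "(\<integral>\<^sup>+t\<in>{a..<1}. ennreal ((1 - t) powr \<beta>) \<partial>lborel) = ennreal ((1 - a) powr (\<beta> + 1) / (\<beta> + 1))"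
    by simp
  have m: "(\<lambda>t. indicator {a..<1} t *\<^sub>R (1 - t) powr \<beta>) \<in> borel_measurable lborel" by measurable
  show i: "set_integrable lborel {a..<1} (\<lambda>t. (1 - t) powr \<beta>)"
    using set_integrable_iff_nn_integral(1)[OF m] nn by simp
  have "0 \<le> (LINT t:{a..<1}|lborel. (1 - t) powr \<beta>)"
    unfolding set_lebesgue_integral_def by (intro integral_nonneg_AE) auto
  thus "(LINT t:{a..<1}|lborel. (1 - t) powr \<beta>) = (1 - a) powr (\<beta> + 1) / (\<beta> + 1)"
    using set_integrable_iff_nn_integral(2)[OF m _ i] nn b by simp
qed

lemma powr_add_le:
  fixes x y p :: real
  assumes "0 \<le> x" "0 \<le> y" "0 < p"
  shows "(x + y) powr p \<le> 2 powr p * (x powr p + y powr p)"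
proof -
  have "(x + y) powr p \<le> (2 * max x y) powr p" using assms by (intro powr_mono2) auto
  also have "\<dots> = 2 powr p * max x y powr p" using assms by (simp add: powr_mult)
  also have "max x y powr p \<le> x powr p + y powr p" by (simp add: max_def)
  finally show ?thesis by simp
qed

text \<open>A crude triangle inequality for means: one factor 2 comes from
  \<open>powr_add_le\<close>, a second one from a^p + b^p <= 2 (a + b)^p <= 2^p (a + b)^p.\<close>

lemma circle_power_add:
  assumes f: "continuous_on unit_disc f" and h: "continuous_on unit_disc h" and r: "0 \<le> r" "r < 1" and p: "1 \<le> p"
    and a: "0 \<le> a" "circle_power p r f \<le> ennreal (2 * pi * a powr p)"
    and b: "0 \<le> b" "circle_power p r h \<le> ennreal (2 * pi * b powr p)"
  shows "circle_power p r (\<lambda>z. f z + h z) \<le> ennreal (2 * pi * (4 * (a + b)) powr p)"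
proof -
  have [measurable]: "disc_ext f \<in> borel_measurable borel" "disc_ext h \<in> borel_measurable borel"
    using f h by (auto intro: disc_ext_measurable)
  let ?F = "\<lambda>t. ennreal (norm (disc_ext f (complex_of_real r * cis t)) powr p) * indicator {0..2*pi} t"
  let ?H = "\<lambda>t. ennreal (norm (disc_ext h (complex_of_real r * cis t)) powr p) * indicator {0..2*pi} t"
  have "circle_power p r (\<lambda>z. f z + h z) \<le> (\<integral>\<^sup>+t. ennreal (2 powr p) * (?F t + ?H t) \<partial>lborel)"
    unfolding circle_power_def
  proof (rule nn_integral_mono)
    fix t
    let ?z = "complex_of_real r * cis t"
    have z: "norm ?z < 1" using r by (simp add: norm_mult)
    have "norm (f ?z + h ?z) powr p \<le> (norm (f ?z) + norm (h ?z)) powr p"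
      using p by (intro powr_mono2 norm_triangle_ineq) auto
    also have "\<dots> \<le> 2 powr p * (norm (f ?z) powr p + norm (h ?z) powr p)" using p by (intro powr_add_le) auto
    finally have "ennreal (norm (f ?z + h ?z) powr p) \<le> ennreal (2 powr p * (norm (f ?z) powr p + norm (h ?z) powr p))"
      by (rule ennreal_leI)
    also have "\<dots> = ennreal (2 powr p) * (ennreal (norm (f ?z) powr p) + ennreal (norm (h ?z) powr p))"
      by (simp add: ennreal_mult)
    finally show "ennreal (norm (f ?z + h ?z) powr p) * indicator {0..2*pi} t \<le> ennreal (2 powr p) * (?F t + ?H t)"
      using z by (auto simp: indicator_def)
  qed
  also have "\<dots> = ennreal (2 powr p) * ((\<integral>\<^sup>+t. ?F t \<partial>lborel) + (\<integral>\<^sup>+t. ?H t \<partial>lborel))"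
    by (simp add: nn_integral_cmult nn_integral_add)
  also have "(\<integral>\<^sup>+t. ?F t \<partial>lborel) = circle_power p r f"
    using r unfolding circle_power_def by (intro nn_integral_cong) (simp add: norm_mult)
  also have "(\<integral>\<^sup>+t. ?H t \<partial>lborel) = circle_power p r h"
    using r unfolding circle_power_def by (intro nn_integral_cong) (simp add: norm_mult)
  also have "ennreal (2 powr p) * (circle_power p r f + circle_power p r h) \<le> ennreal (2 powr p) * (ennreal (2 * pi * a powr p) + ennreal (2 * pi * b powr p))"
    by (intro mult_left_mono add_mono a b) auto
  also have "\<dots> = ennreal (2 * pi * (2 powr p * (a powr p + b powr p)))"
    by (simp add: ennreal_mult[symmetric] ennreal_plus[symmetric] algebra_simps del: ennreal_plus)
  also have "\<dots> \<le> ennreal (2 * pi * (4 * (a + b)) powr p)"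
  proof (intro ennreal_leI mult_left_mono)
    have "a powr p \<le> (a + b) powr p" "b powr p \<le> (a + b) powr p" using a b p by (auto intro!: powr_mono2)
    hence "a powr p + b powr p \<le> 2 * (a + b) powr p" by linarith
    also have "\<dots> \<le> 2 powr p * (a + b) powr p" using powr_mono[of 1 p 2] p by (intro mult_right_mono) auto
    finally have "2 powr p * (a powr p + b powr p) \<le> 2 powr p * (2 powr p * (a + b) powr p)" by (intro mult_left_mono) auto
    also have "\<dots> = (2 * (2 * (a + b))) powr p" using a b by (simp only: powr_mult)
    finally show "2 powr p * (a powr p + b powr p) \<le> (4 * (a + b)) powr p" by simp
  qed auto
  finally show ?thesis .
qed

text \<open>The constant is 4 (M + M) from \<open>circle_power_add\<close>. The bound guarantees
  that the supremum in \<open>integral_modulus\<close> is taken over a bounded set.\<close>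

lemma hardy_rotation_difference:
  fixes g :: "complex \<Rightarrow> complex"
  assumes g: "g holomorphic_on unit_disc" and p: "1 < p"
    and bd: "\<And>r. 0 < r \<Longrightarrow> r < 1 \<Longrightarrow> integral_mean p r g \<le> M" and r: "0 < r" "r < 1"
  shows "integral_mean p r (\<lambda>z. g (cis h * z) - g z) \<le> 8 * M"
proof -
  have cg: "continuous_on unit_disc g" using g by (rule holomorphic_on_imp_continuous_on)
  have cgr: "continuous_on unit_disc (\<lambda>z. g (cis h * z))"
    using holomorphic_on_rotate[OF g] by (rule holomorphic_on_imp_continuous_on)
  have M: "0 \<le> M" by (rule order.trans[OF integral_mean_nonneg bd[OF r]])
  have 1: "circle_power p r g \<le> ennreal (2 * pi * M powr p)"
    using integral_mean_le_iff[OF cg, of r p M] bd[OF r] r p M by simp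
  have "circle_power p r (\<lambda>z. g (cis h * z) + - g z) \<le> ennreal (2 * pi * (4 * (M + M)) powr p)"
  proof (rule circle_power_add)
    show "circle_power p r (\<lambda>z. g (cis h * z)) \<le> ennreal (2 * pi * M powr p)"
      using 1 circle_power_rotate[OF cg, of r p h] r by simp
    show "circle_power p r (\<lambda>z. - g z) \<le> ennreal (2 * pi * M powr p)"
      using 1 by (simp add: circle_power_def)
  qed (use cg cgr r p M in \<open>auto intro: continuous_intros\<close>)
  moreover have "continuous_on unit_disc (\<lambda>z. g (cis h * z) - g z)" using cg cgr by (intro continuous_intros)
  ultimately show ?thesis
    using integral_mean_le_iff[of "\<lambda>z. g (cis h * z) - g z" r p "8 * M"] r p M by simp
qed

text \<open>The quantity under the supremum in \<open>integral_modulus\<close>.\<close>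

definition boundary_difference :: "real \<Rightarrow> (complex \<Rightarrow> complex) \<Rightarrow> real \<Rightarrow> real" where
  "boundary_difference p G h = (1 / (2 * pi) * (LINT \<theta>:{0..2*pi}|lborel. norm (G (cis (\<theta> + h)) - G (cis \<theta>)) powr p)) powr (1 / p)"

text \<open>\<open>hardy_boundary\<close> is applied to G(z) = g(e^(ih) z) - g(z), whose boundary
  function is almost everywhere the difference of the translated boundary functions of g. The
  boundary difference is thus the least upper bound of the interior means of G, and both halves of
  that fact are used, one in each direction of the Hardy-Littlewood theorem.\<close>

lemma boundary_difference_bound:
  fixes g :: "complex \<Rightarrow> complex"
  assumes g: "g holomorphic_on unit_disc" and p: "1 < p"
    and bd: "\<And>r. 0 < r \<Longrightarrow> r < 1 \<Longrightarrow> integral_mean p r g \<le> M"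
  shows "0 \<le> r \<Longrightarrow> r < 1 \<Longrightarrow> integral_mean p r (\<lambda>z. g (cis h * z) - g z) \<le> boundary_difference p (boundary_function g) h"
    and "(\<And>r. 0 < r \<Longrightarrow> r < 1 \<Longrightarrow> integral_mean p r (\<lambda>z. g (cis h * z) - g z) \<le> B) \<Longrightarrow> boundary_difference p (boundary_function g) h \<le> B"
proof -
  define G where "G = (\<lambda>z. g (cis h * z) - g z)"
  have G: "G holomorphic_on unit_disc" unfolding G_def using g holomorphic_on_rotate[OF g] by (intro holomorphic_intros)
  have cG: "continuous_on unit_disc G" using G by (rule holomorphic_on_imp_continuous_on)
  have cg: "continuous_on unit_disc g" using g by (rule holomorphic_on_imp_continuous_on)
  have bG: "integral_mean p r G \<le> 8 * M" if "0 < r" "r < 1" for r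
    unfolding G_def by (rule hardy_rotation_difference[OF g p bd that])
  let ?D = "\<lambda>\<theta>. norm (boundary_function g (cis (\<theta> + h)) - boundary_function g (cis \<theta>)) powr p"
  have AEg: "AE \<theta> in lborel. ((\<lambda>r. g (complex_of_real r * cis \<theta>)) \<longlongrightarrow> boundary_function g (cis \<theta>)) (at_left 1)"
    by (rule hardy_boundary(1)[OF g p bd])
  have AEG: "AE \<theta> in lborel. boundary_function G (cis \<theta>) = boundary_function g (cis (\<theta> + h)) - boundary_function g (cis \<theta>)"
    using AEg AE_shift[OF AEg, of h]
  proof eventually_elim
    fix \<theta> assume 1: "((\<lambda>r. g (complex_of_real r * cis \<theta>)) \<longlongrightarrow> boundary_function g (cis \<theta>)) (at_left 1)"
      and 2: "((\<lambda>r. g (complex_of_real r * cis (\<theta> + h))) \<longlongrightarrow> boundary_function g (cis (\<theta> + h))) (at_left 1)"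
    have "G (complex_of_real r * cis \<theta>) = g (complex_of_real r * cis (\<theta> + h)) - g (complex_of_real r * cis \<theta>)" for r
      by (simp add: G_def cis_mult[symmetric] mult_ac)
    thus "boundary_function G (cis \<theta>) = boundary_function g (cis (\<theta> + h)) - boundary_function g (cis \<theta>)"
      using tendsto_diff[OF 2 1] by (intro boundary_function_eq) simp
  qed
  have I: "(\<integral>\<^sup>+\<theta>\<in>{0..2*pi}. ennreal (norm (boundary_function G (cis \<theta>)) powr p) \<partial>lborel) = (\<integral>\<^sup>+\<theta>\<in>{0..2*pi}. ennreal (?D \<theta>) \<partial>lborel)"
    using AEG by (intro nn_integral_cong_AE) (auto elim!: eventually_mono)
  have [measurable]: "(\<lambda>\<theta>. boundary_function g (cis \<theta>)) \<in> borel_measurable borel" by (rule boundary_function_measurable[OF cg])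
  have [measurable]: "(\<lambda>\<theta>. boundary_function g (cis (\<theta> + h))) \<in> borel_measurable borel"
    using measurable_compose[of "\<lambda>\<theta>. \<theta> + h" borel borel "\<lambda>\<theta>. boundary_function g (cis \<theta>)" borel] by simp
  have m: "(\<lambda>\<theta>. indicator {0..2*pi} \<theta> *\<^sub>R ?D \<theta>) \<in> borel_measurable lborel" by measurable
  have "(\<integral>\<^sup>+\<theta>\<in>{0..2*pi}. ennreal (?D \<theta>) \<partial>lborel) \<le> ennreal (2 * pi * (8 * M) powr p)"
    using hardy_boundary(3)[OF G p bG] by (simp only: I)
  hence si: "set_integrable lborel {0..2*pi} ?D"
    by (subst set_integrable_iff_nn_integral(1)[OF m]) (auto simp: less_top[symmetric] top_unique)
  have eq: "(\<integral>\<^sup>+\<theta>\<in>{0..2*pi}. ennreal (?D \<theta>) \<partial>lborel) = ennreal (2 * pi * boundary_difference p (boundary_function g) h powr p)"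
  proof -
    have "0 \<le> (LINT \<theta>:{0..2*pi}|lborel. ?D \<theta>)" unfolding set_lebesgue_integral_def by (intro integral_nonneg_AE) auto
    hence "2 * pi * boundary_difference p (boundary_function g) h powr p = (LINT \<theta>:{0..2*pi}|lborel. ?D \<theta>)"
      using p by (simp add: boundary_difference_def powr_powr)
    thus ?thesis using set_integrable_iff_nn_integral(2)[OF m _ si] by simp
  qed
  have S0: "0 \<le> boundary_difference p (boundary_function g) h" by (simp add: boundary_difference_def)
  show "integral_mean p r (\<lambda>z. g (cis h * z) - g z) \<le> boundary_difference p (boundary_function g) h" if r: "0 \<le> r" "r < 1"
  proof -
    have "circle_power p r G \<le> ennreal (2 * pi * boundary_difference p (boundary_function g) h powr p)"
      using hardy_boundary(2)[OF G p bG r] by (simp only: I eq)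
    thus ?thesis using integral_mean_le_iff[OF cG r _ S0] p by (simp add: G_def)
  qed
  show "boundary_difference p (boundary_function g) h \<le> B" if B: "\<And>r. 0 < r \<Longrightarrow> r < 1 \<Longrightarrow> integral_mean p r (\<lambda>z. g (cis h * z) - g z) \<le> B"
  proof -
    have B0: "0 \<le> B" by (rule order.trans[OF integral_mean_nonneg B[of "1/2"]]) auto
    have "ennreal (2 * pi * boundary_difference p (boundary_function g) h powr p) \<le> ennreal (2 * pi * B powr p)"
      using hardy_boundary(3)[OF G p B[folded G_def]] by (simp only: I eq)
    hence "boundary_difference p (boundary_function g) h powr p \<le> B powr p"
      by (subst (asm) ennreal_le_iff) auto
    hence "(boundary_difference p (boundary_function g) h powr p) powr (1/p) \<le> (B powr p) powr (1/p)"
      by (rule powr_mono2[rotated 2]) (use p in auto)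
    thus ?thesis using p S0 B0 by (simp add: powr_powr)
  qed
qed

section \<open>Size and integrals of |1 - r e^(it)|\<close>

lemma norm_one_minus_cis_symmetric:
  "norm (1 - complex_of_real r * cis (2 * pi - t)) = norm (1 - complex_of_real r * cis t)"
proof -
  have "1 - complex_of_real r * cis (2 * pi - t) = cnj (1 - complex_of_real r * cis t)"
    by (simp add: cis_cnj cis_divide[symmetric] divide_inverse cis_inverse)
  thus ?thesis by (simp only: complex_mod_cnj)
qed

lemma x_cos_le_sin:
  fixes x :: real
  assumes "0 \<le> x" "x \<le> pi" shows "x * cos x \<le> sin x"
proof -
  have "sin 0 - 0 * cos 0 \<le> sin x - x * cos x"
  proof (rule DERIV_nonneg_imp_nondecreasing[OF assms(1), of "\<lambda>x. sin x - x * cos x"])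
    fix y assume y: "0 \<le> y" "y \<le> x"
    have "((\<lambda>x. sin x - x * cos x) has_real_derivative y * sin y) (at y)"
      by (auto intro!: derivative_eq_intros)
    moreover have "0 \<le> y * sin y" using y assms by (intro mult_nonneg_nonneg sin_ge_zero) auto
    ultimately show "\<exists>d. ((\<lambda>x. sin x - x * cos x) has_real_derivative d) (at y) \<and> 0 \<le> d" by blast
  qed
  thus ?thesis by simp
qed

text \<open>|1 - e^(it)| = 2 sin(t/2) = 4 sin(t/4) cos(t/4), which is at least t cos(t/4)^2 by x cos
  x <= sin x, and cos(t/4)^2 >= 1/2 on [0, pi].\<close>

lemma norm_one_minus_cis_lower:
  assumes t: "0 \<le> t" "t \<le> pi" shows "t / 2 \<le> norm (1 - cis t)"
proof -
  have c: "1 / 2 \<le> (cos (t / 4))\<^sup>2"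
  proof -
    have "0 \<le> cos (2 * (t / 4))" using t by (intro cos_ge_zero) auto
    thus ?thesis by (simp only: cos_double_cos)
  qed
  have "(norm (1 - cis t))\<^sup>2 = (1 - cos t)\<^sup>2 + (sin t)\<^sup>2" by (simp add: cmod_power2)
  also have "\<dots> = 1 - 2 * cos t + ((cos t)\<^sup>2 + (sin t)\<^sup>2)"
  proof -
    have "(1 - c)\<^sup>2 + s\<^sup>2 = 1 - 2 * c + (c\<^sup>2 + s\<^sup>2)" for c s :: real
      by (simp add: power2_eq_square algebra_simps)
    thus ?thesis .
  qed
  also have "\<dots> = 2 - 2 * cos t" by simp
  also have "\<dots> = (2 * sin (t / 2))\<^sup>2"
    using cos_double_sin[of "t / 2"] by (simp add: power_mult_distrib)
  finally have n: "norm (1 - cis t) = 2 * sin (t / 2)"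
    using t by (subst (asm) power2_eq_iff_nonneg) (auto intro: sin_ge_zero)
  have c0: "0 \<le> cos (t / 4)" using t by (intro cos_ge_zero) auto
  have "t / 2 \<le> t * (cos (t / 4))\<^sup>2" using mult_left_mono[OF c t(1)] by simp
  also have "\<dots> = 4 * (t / 4 * cos (t / 4)) * cos (t / 4)" by (simp add: power2_eq_square)
  also have "\<dots> \<le> 4 * sin (t / 4) * cos (t / 4)"
    using t c0 x_cos_le_sin[of "t / 4"] by (intro mult_right_mono) auto
  also have "\<dots> = 2 * sin (t / 2)" using sin_double[of "t / 4"] by simp
  finally show ?thesis by (simp add: n)
qed

lemma norm_one_minus_cis_ge:
  assumes r: "0 \<le> r" "r < 1"
  shows "1 - r \<le> norm (1 - complex_of_real r * cis t)"
    and "0 \<le> t \<Longrightarrow> t \<le> pi \<Longrightarrow> t \<le> 4 * norm (1 - complex_of_real r * cis t)"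
proof -
  show 1: "1 - r \<le> norm (1 - complex_of_real r * cis t)"
    using norm_triangle_ineq2[of 1 "complex_of_real r * cis t"] r by (simp add: norm_mult)
  assume t: "0 \<le> t" "t \<le> pi"
  have "t / 2 \<le> norm (1 - cis t)" by (rule norm_one_minus_cis_lower[OF t])
  also have "\<dots> \<le> norm (1 - complex_of_real r * cis t) + norm (complex_of_real (r - 1) * cis t)"
    using norm_triangle_ineq[of "1 - complex_of_real r * cis t" "complex_of_real (r - 1) * cis t"]
    by (simp add: algebra_simps)
  also have "norm (complex_of_real (r - 1) * cis t) = 1 - r" using r by (simp add: norm_mult del: of_real_diff)
  finally show "t \<le> 4 * norm (1 - complex_of_real r * cis t)" using 1 by simp
qed

lemma nn_integral_reflect_interval:
  fixes u :: "real \<Rightarrow> ennreal"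
  assumes [measurable]: "u \<in> borel_measurable borel"
  shows "(\<integral>\<^sup>+t\<in>{pi..2*pi}. u t \<partial>lborel) = (\<integral>\<^sup>+t\<in>{0..pi}. u (2 * pi - t) \<partial>lborel)"
  by (subst nn_integral_real_affine[where c="-1" and t="2*pi"])
     (auto intro!: nn_integral_cong simp: indicator_def)

text \<open>On each half circle the integral is cut at the distance 1 - r: below it |1 - r e^(it)|
  >= 1 - r is used, above it |1 - r e^(it)| >= t/4. Since b > 1, the second part may be extended to
  infinity.\<close>

lemma circle_kernel_integral:
  fixes b :: real
  assumes b: "1 < b"
  obtains K where "0 < K" "\<And>r. 0 \<le> r \<Longrightarrow> r < 1 \<Longrightarrow>
    (\<integral>\<^sup>+t\<in>{0..2*pi}. ennreal (norm (1 - complex_of_real r * cis t) powr (- b)) \<partial>lborel) \<le> ennreal (K * (1 - r) powr (1 - b))"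
proof -
  define K where "K = 2 * (1 + 4 powr b / (b - 1))"
  show ?thesis
  proof (rule that[of K])
    show "0 < K" using b by (auto simp: K_def intro!: add_pos_nonneg)
    fix r :: real assume r: "0 \<le> r" "r < 1"
    define d where "d = (\<lambda>t. norm (1 - complex_of_real r * cis t))"
    define u where "u = (\<lambda>t. ennreal (d t powr (- b)))"
    have [measurable]: "u \<in> borel_measurable borel" unfolding u_def d_def by measurable
    define q where "q = 1 - r"
    have q: "0 < q" using r by (simp add: q_def)
    have half: "(\<integral>\<^sup>+t\<in>{0..pi}. u t \<partial>lborel) \<le> ennreal (K / 2 * q powr (1 - b))"
    proof -
      have "(\<integral>\<^sup>+t\<in>{0..pi}. u t \<partial>lborel) \<le> (\<integral>\<^sup>+t. ennreal (q powr (- b)) * indicator {0..q} t + ennreal (4 powr b * t powr (- b)) * indicator {q..} t \<partial>lborel)"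
      proof (intro nn_integral_mono)
        fix t
        have 1: "d t powr (- b) \<le> q powr (- b)"
          using norm_one_minus_cis_ge(1)[OF r, of t] q b unfolding d_def q_def by (intro powr_mono2') auto
        have 2: "d t powr (- b) \<le> 4 powr b * t powr (- b)" if "0 < t" "t \<le> pi"
        proof -
          have "t / 4 \<le> d t" using norm_one_minus_cis_ge(2)[OF r, of t] that by (simp add: d_def)
          hence "d t powr (- b) \<le> (t / 4) powr (- b)" using that b by (intro powr_mono2') auto
          also have "\<dots> = 4 powr b * t powr (- b)" using that by (simp add: powr_divide powr_minus field_simps)
          finally show ?thesis .
        qed
        show "u t * indicator {0..pi} t \<le> ennreal (q powr (- b)) * indicator {0..q} t + ennreal (4 powr b * t powr (- b)) * indicator {q..} t"
          using 1 2 q by (cases "t \<le> q") (auto simp: u_def indicator_def intro!: ennreal_leI add_increasing2)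
      qed
      also have "\<dots> = (\<integral>\<^sup>+t. ennreal (q powr (- b)) * indicator {0..q} t \<partial>lborel) + (\<integral>\<^sup>+t. ennreal (4 powr b * t powr (- b)) * indicator {q..} t \<partial>lborel)"
        by (rule nn_integral_add) measurable
      also have "(\<integral>\<^sup>+t. ennreal (q powr (- b)) * indicator {0..q} t \<partial>lborel) = ennreal (q powr (1 - b))"
        using q by (subst nn_integral_cmult_indicator) (auto simp: ennreal_mult[symmetric] powr_diff powr_minus field_simps)
      also have "(\<integral>\<^sup>+t. ennreal (4 powr b * t powr (- b)) * indicator {q..} t \<partial>lborel) = ennreal (4 powr b / (b - 1) * q powr (1 - b))"
      proof -
        define F where "F = (\<lambda>t. 4 powr b * (- (t powr (1 - b)) / (b - 1)))"
        have "(\<integral>\<^sup>+t. ennreal (4 powr b * t powr (- b)) * indicator {q..} t \<partial>lborel) = 0 - F q"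
        proof (rule nn_integral_FTC_atLeast)
          fix t assume t: "q \<le> t"
          hence "((\<lambda>t. t powr (1 - b)) has_real_derivative (1 - b) * t powr (1 - b - 1)) (at t)"
            using q by (auto intro!: derivative_eq_intros)
          hence "(F has_real_derivative 4 powr b * (- ((1 - b) * t powr (1 - b - 1)) / (b - 1))) (at t)"
            unfolding F_def by (intro DERIV_cmult DERIV_cdivide DERIV_minus)
          moreover have "4 powr b * (- ((1 - b) * t powr (1 - b - 1)) / (b - 1)) = 4 powr b * t powr (- b)"
          proof -
            have "- ((1 - b) * x) / (b - 1) = x" for x using b by (simp add: field_simps)
            thus ?thesis by simp
          qed
          ultimately show "(F has_real_derivative 4 powr b * t powr (- b)) (at t)" by (simp only:)
        next
          have "((\<lambda>t. t powr (1 - b)) \<longlongrightarrow> 0) at_top" using b by (intro tendsto_neg_powr filterlim_ident) auto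
          hence "(F \<longlongrightarrow> 4 powr b * (- 0 / (b - 1))) at_top" unfolding F_def using b by (intro tendsto_intros) auto
          thus "(F \<longlongrightarrow> 0) at_top" by simp
        qed auto
        thus ?thesis by (simp add: F_def)
      qed
      also have "ennreal (q powr (1 - b)) + ennreal (4 powr b / (b - 1) * q powr (1 - b)) = ennreal (K / 2 * q powr (1 - b))"
      proof -
        have *: "K / 2 * q powr (1 - b) = q powr (1 - b) + 4 powr b / (b - 1) * q powr (1 - b)"
          by (simp add: K_def distrib_right)
        show ?thesis unfolding * by (subst ennreal_plus) (use b in auto)
      qed
      finally show ?thesis .
    qed
    have "(\<integral>\<^sup>+t\<in>{0..2*pi}. u t \<partial>lborel) = (\<integral>\<^sup>+t\<in>{0..pi}. u t \<partial>lborel) + (\<integral>\<^sup>+t\<in>{pi..2*pi}. u t \<partial>lborel)"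
      by (rule nn_integral_split_interval) auto
    also have "(\<integral>\<^sup>+t\<in>{pi..2*pi}. u t \<partial>lborel) = (\<integral>\<^sup>+t\<in>{0..pi}. u t \<partial>lborel)"
      by (subst nn_integral_reflect_interval) (auto simp: u_def d_def norm_one_minus_cis_symmetric)
    also have "(\<integral>\<^sup>+t\<in>{0..pi}. u t \<partial>lborel) + (\<integral>\<^sup>+t\<in>{0..pi}. u t \<partial>lborel) \<le> ennreal (K / 2 * q powr (1 - b)) + ennreal (K / 2 * q powr (1 - b))"
      by (intro add_mono half)
    also have "\<dots> = ennreal (K * q powr (1 - b))"
      using b by (subst ennreal_plus[symmetric]) (auto simp: K_def)
    finally show "(\<integral>\<^sup>+t\<in>{0..2*pi}. ennreal (norm (1 - complex_of_real r * cis t) powr (- b)) \<partial>lborel) \<le> ennreal (K * (1 - r) powr (1 - b))"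
      by (simp add: u_def d_def q_def)
  qed
qed

text \<open>The difference for the angle 2 pi - t is minus the difference for t, composed with a
  rotation. It reduces angles to [0, pi].\<close>

lemma integral_mean_neg_rotation:
  fixes g :: "complex \<Rightarrow> complex"
  assumes g: "g holomorphic_on unit_disc" and r: "0 \<le> r" "r < 1" and p: "0 < p"
  shows "integral_mean p r (\<lambda>z. g (cis (2 * pi - t) * z) - g z) = integral_mean p r (\<lambda>z. g (cis t * z) - g z)"
proof -
  define G where "G = (\<lambda>z. g (cis t * z) - g z)"
  define H where "H = (\<lambda>z. g (cis (2 * pi - t) * z) - g z)"
  have c: "continuous_on unit_disc G" "continuous_on unit_disc H" unfolding G_def H_def using g holomorphic_on_rotate[OF g]
    by (intro continuous_intros holomorphic_on_imp_continuous_on; simp)+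
  have "circle_power p r H = circle_power p r (\<lambda>z. G (cis (2 * pi - t) * z))"
    by (intro circle_power_cong) (simp add: H_def G_def mult.assoc[symmetric] cis_mult norm_minus_commute)
  also have "\<dots> = circle_power p r G" by (rule circle_power_rotate[OF c(1) r])
  finally have eq: "circle_power p r H = circle_power p r G" .
  have "integral_mean p r H \<le> integral_mean p r G" "integral_mean p r G \<le> integral_mean p r H"
    using integral_mean_le_iff[OF c(1) r p, of "integral_mean p r H"] integral_mean_le_iff[OF c(2) r p, of "integral_mean p r G"]
      integral_mean_le_iff[OF c(1) r p, of "integral_mean p r G"] integral_mean_le_iff[OF c(2) r p, of "integral_mean p r H"]
    unfolding eq by simp_all
  thus ?thesis unfolding G_def H_def by simp
qed

text \<open>In \<open>deriv_mean_bound\<close> with b = 1 the modulus of continuity at t meets the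
  kernel |1 - r e^(it)|^(-2). The modulus is majorised by \<epsilon> t^(1/p) + c t^2 and t by 4 |1 -
  r e^(it)|; the first term then integrates to the critical power of 1 - r, the second to a
  constant.\<close>

lemma lipschitz_imp_small_growth:
  fixes g :: "complex \<Rightarrow> complex"
  assumes g: "g holomorphic_on unit_disc" and p: "1 < p" and lip: "g \<in> little_mean_lipschitz p (1 / p)"
  shows "small_growth p g"
proof -
  define \<omega> where "\<omega> = integral_modulus p (boundary_function g)"
  have hardy: "g \<in> hardy_space p" and o: "\<omega> \<in> o[at_right 0](\<lambda>t. t powr (1 / p))"
    using lip by (auto simp: little_mean_lipschitz_def \<omega>_def)
  obtain M where "\<forall>r\<in>{0<..<1}. integral_mean p r g \<le> M"
    using hardy unfolding hardy_space_def bdd_above_def by auto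
  hence M: "\<And>r. 0 < r \<Longrightarrow> r < 1 \<Longrightarrow> integral_mean p r g \<le> M" by auto
  have M0: "0 \<le> M" by (rule order.trans[OF integral_mean_nonneg M[of "1/2"]]) auto
  let ?S = "boundary_difference p (boundary_function g)"
  have S8: "?S h \<le> 8 * M" for h
    by (rule boundary_difference_bound(2)[OF g p M hardy_rotation_difference[OF g p M]])
  have S\<omega>: "?S h \<le> \<omega> h" if "0 < h" for h
    unfolding \<omega>_def integral_modulus_def boundary_difference_def[symmetric]
    using that S8 by (intro cSUP_upper bdd_aboveI[where M="8*M"]) auto
  have b1: "1 < 2 - 1 / p" using p by simp
  obtain K where K: "0 < K" "\<And>r. 0 \<le> r \<Longrightarrow> r < 1 \<Longrightarrow>
    (\<integral>\<^sup>+t\<in>{0..2*pi}. ennreal (norm (1 - complex_of_real r * cis t) powr (- (2 - 1 / p))) \<partial>lborel) \<le> ennreal (K * (1 - r) powr (1 - (2 - 1 / p)))"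
    using circle_kernel_integral[OF b1] by blast
  show ?thesis unfolding small_growth_def
  proof (intro allI impI)
    fix e :: real assume e: "0 < e"
    \<comment> \<open>The three factors are lost later: 4^(1/p) through t <= 4 |1 - r e^(it)|, K in
      the kernel integral, and the power of 2 when 1 - q is replaced by (1 - r)/2.\<close>
    define \<epsilon> where "\<epsilon> = e / (4 powr (1/p) * K * 2 powr (1 - 1/p))"
    have \<epsilon>: "0 < \<epsilon>" using e K by (simp add: \<epsilon>_def)
    have "\<forall>\<^sub>F t in at_right 0. norm (\<omega> t) \<le> \<epsilon> * norm (t powr (1 / p))"
      using landau_o.smallD[OF o \<epsilon>] .
    then obtain \<delta> where \<delta>: "0 < \<delta>" "\<And>t. 0 < t \<Longrightarrow> t < \<delta> \<Longrightarrow> norm (\<omega> t) \<le> \<epsilon> * norm (t powr (1 / p))"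
      unfolding eventually_at_right_field by auto
    \<comment> \<open>For t >= \<delta> only the trivial bound 8 M is available; it is at most c
      t^2, and the square cancels against the kernel.\<close>
    define c where "c = 8 * M / \<delta>\<^sup>2"
    have c: "0 \<le> c" using M0 by (simp add: c_def)
    have D1: "integral_mean p R (\<lambda>z. g (cis t * z) - g z) \<le> \<epsilon> * t powr (1/p) + c * t\<^sup>2" if R: "0 < R" "R < 1" and t: "0 \<le> t" for R t
    proof -
      have "integral_mean p R (\<lambda>z. g (cis t * z) - g z) \<le> ?S t"
        using R by (intro boundary_difference_bound(1)[OF g p M]) auto
      also have "\<dots> \<le> \<epsilon> * t powr (1/p) + c * t\<^sup>2"
      proof (cases "t < \<delta>")
        case True
        show ?thesis
        proof (cases "t = 0")
          case True
          thus ?thesis by (simp add: boundary_difference_def set_lebesgue_integral_def)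
        next
          case False
          hence "?S t \<le> \<epsilon> * t powr (1/p)" using S\<omega>[of t] \<delta>(2)[of t] True t by auto
          thus ?thesis using c by (simp add: add_increasing2)
        qed
      next
        case False
        hence "\<delta>\<^sup>2 \<le> t\<^sup>2" using \<delta> by (intro power_mono) auto
        hence "8 * M * \<delta>\<^sup>2 \<le> 8 * M * t\<^sup>2" using M0 by (intro mult_left_mono) auto
        hence "8 * M \<le> c * t\<^sup>2" using \<delta> by (simp add: c_def field_simps)
        thus ?thesis using S8[of t] \<epsilon> by (smt (verit) mult_nonneg_nonneg powr_ge_zero)
      qed
      finally show ?thesis .
    qed
    define d where "d = (\<lambda>r t. norm (1 - complex_of_real r * cis t))"
    \<comment> \<open>Written in terms of \<open>d\<close> rather than t, the majorant is positive
      also at t = 0, symmetric under t -> 2 pi - t, and its quotient by d^2 is a pure power plus a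
      constant.\<close>
    define m where "m = (\<lambda>r t. \<epsilon> * 4 powr (1/p) * d r t powr (1/p) + 16 * c * (d r t)\<^sup>2)"
    have d0: "0 < d r t" if "0 \<le> r" "r < 1" for r t
      using one_minus_cis_nonzero[OF that] by (simp add: d_def)
    have D2: "integral_mean p R (\<lambda>z. g (cis t * z) - g z) \<le> m r t" if R: "0 < R" "R < 1" and r: "0 \<le> r" "r < 1" and t: "t \<in> {0..2*pi}" for R r t
    proof -
      have *: "integral_mean p R (\<lambda>z. g (cis s * z) - g z) \<le> m r s" if s: "0 \<le> s" "s \<le> pi" for s
      proof -
        have l: "s \<le> 4 * d r s" using norm_one_minus_cis_ge(2)[OF r s] by (simp add: d_def)
        have "s powr (1/p) \<le> (4 * d r s) powr (1/p)" using l s p by (intro powr_mono2) auto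
        also have "\<dots> = 4 powr (1/p) * d r s powr (1/p)" using d0[OF r, of s] by (simp add: powr_mult)
        finally have "\<epsilon> * s powr (1/p) \<le> \<epsilon> * (4 powr (1/p) * d r s powr (1/p))" using \<epsilon> by (intro mult_left_mono) auto
        moreover have "c * s\<^sup>2 \<le> c * (4 * d r s)\<^sup>2" using l s c by (intro mult_left_mono power_mono) auto
        ultimately show ?thesis using D1[OF R s(1)] by (simp add: m_def power_mult_distrib mult_ac)
      qed
      show ?thesis
      proof (cases "t \<le> pi")
        case False
        have "integral_mean p R (\<lambda>z. g (cis t * z) - g z) = integral_mean p R (\<lambda>z. g (cis (2 * pi - t) * z) - g z)"
          using R p by (intro integral_mean_neg_rotation[symmetric] g) auto
        also have "\<dots> \<le> m r (2 * pi - t)" using False t by (intro *) auto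
        also have "\<dots> = m r t" by (simp add: m_def d_def norm_one_minus_cis_symmetric)
        finally show ?thesis .
      qed (use * t in auto)
    qed
    have D3: "R * integral_mean p (R * r) (deriv g) \<le> \<epsilon> * 4 powr (1/p) * K * (1 - r) powr (1/p - 1) / (2 * pi) + 16 * c" if R: "0 < R" "R < 1" and r: "0 \<le> r" "r < 1" for R r
    proof -
      have dc: "continuous_on A (d r)" for A unfolding d_def by (intro continuous_intros)
      have eq: "m r t / (norm (1 - complex_of_real r * cis t))\<^sup>2 = \<epsilon> * 4 powr (1/p) * d r t powr (- (2 - 1/p)) + 16 * c" for t
      proof -
        have nd: "norm (1 - complex_of_real r * cis t) = d r t" by (simp add: d_def)
        show ?thesis using d0[OF r, of t] unfolding m_def nd by (simp add: powr_diff powr_minus field_simps)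
      qed
      have dp: "set_integrable lborel {0..2*pi} (\<lambda>t. d r t powr (- (2 - 1/p)))"
        using d0[OF r] by (intro borel_integrable_atLeastAtMost' continuous_on_powr dc continuous_intros) (auto simp: less_imp_neq[symmetric])
      have ci: "set_integrable lborel {0..2*pi} (\<lambda>t. 16 * c)" by (intro borel_integrable_atLeastAtMost' continuous_intros)
      have "R * integral_mean p (R * r) (deriv g) \<le> (LINT t:{0..2*pi}|lborel. m r t / (norm (1 - complex_of_real r * cis t))\<^sup>2) / (2 * pi)"
      proof (rule deriv_mean_bound[OF g p R r, where b=1])
        show "m r \<in> borel_measurable borel" unfolding m_def d_def by measurable
        show "0 < m r t" for t using d0[OF r, of t] \<epsilon> c by (auto simp: m_def intro!: add_pos_nonneg)
        show "set_integrable lborel {0..2*pi} (\<lambda>t. m r t / (norm (1 - complex_of_real r * cis t))\<^sup>2)"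
          unfolding eq using dp ci by (intro set_integral_add set_integrable_mult_right) auto
        fix t assume "t \<in> {0..2*pi}"
        thus "integral_mean p R (\<lambda>z. g (cis t * z) - 1 * g z) \<le> m r t" using D2[OF R r] by simp
      qed simp
      also have "(LINT t:{0..2*pi}|lborel. m r t / (norm (1 - complex_of_real r * cis t))\<^sup>2) = \<epsilon> * 4 powr (1/p) * (LINT t:{0..2*pi}|lborel. d r t powr (- (2 - 1/p))) + 2 * pi * (16 * c)"
        unfolding eq using dp ci by (subst set_integral_add) (auto simp: set_lebesgue_integral_def)
      also have "\<dots> \<le> \<epsilon> * 4 powr (1/p) * (K * (1 - r) powr (1/p - 1)) + 2 * pi * (16 * c)"
      proof (intro add_right_mono mult_left_mono)
        have m: "(\<lambda>t. indicator {0..2*pi} t *\<^sub>R d r t powr (- (2 - 1/p))) \<in> borel_measurable lborel" unfolding d_def by measurable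
        have "ennreal (LINT t:{0..2*pi}|lborel. d r t powr (- (2 - 1/p))) \<le> ennreal (K * (1 - r) powr (1 - (2 - 1 / p)))"
          using K(2)[OF r] set_integrable_iff_nn_integral(2)[OF m _ dp] by (simp add: d_def)
        thus "(LINT t:{0..2*pi}|lborel. d r t powr (- (2 - 1/p))) \<le> K * (1 - r) powr (1/p - 1)"
          using K by (subst (asm) ennreal_le_iff) auto
      qed (use \<epsilon> in auto)
      finally have "R * integral_mean p (R * r) (deriv g) \<le> (\<epsilon> * 4 powr (1/p) * (K * (1 - r) powr (1/p - 1)) + 2 * pi * (16 * c)) / (2 * pi)"
        by (simp add: divide_right_mono)
      also have "\<dots> = \<epsilon> * 4 powr (1/p) * K * (1 - r) powr (1/p - 1) / (2 * pi) + 16 * c" by (simp add: field_simps)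
      finally show ?thesis .
    qed
    show "\<exists>C\<ge>0. \<forall>r. 0 \<le> r \<longrightarrow> r < 1 \<longrightarrow> integral_mean p r (deriv g) \<le> e * (1 - r) powr (1 / p - 1) + C"
    proof (intro exI[of _ "32 * c"] conjI allI impI)
      show "0 \<le> 32 * c" using c by simp
      fix r :: real assume r: "0 \<le> r" "r < 1"
      \<comment> \<open>The derivative estimate loses the factor R and lives on the circle of radius
        R q = r. With R half-way to 1 one has R >= 1/2 and 1 - q >= (1 - r)/2.\<close>
      define R where "R = (1 + r) / 2"
      define q where "q = r / R"
      have R: "0 < R" "R < 1" "1 / 2 \<le> R" and q: "0 \<le> q" "q < 1" "R * q = r" using r by (auto simp: R_def q_def field_simps)
      have "1 - q = (1 - r) / (2 * R)" using R(1) by (simp add: q_def R_def field_simps)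
      hence "(1 - r) / 2 \<le> 1 - q" using R r by (simp only:) (intro divide_left_mono, auto)
      hence "(1 - q) powr (1/p - 1) \<le> ((1 - r) / 2) powr (1/p - 1)"
        using r p by (intro powr_mono2') auto
      also have "\<dots> = 2 powr (1 - 1/p) * (1 - r) powr (1/p - 1)"
        using r powr_minus_divide[of 2 "1 - 1/p"] by (simp add: powr_divide)
      finally have q1: "(1 - q) powr (1/p - 1) \<le> 2 powr (1 - 1/p) * (1 - r) powr (1/p - 1)" .
      have "1 / 2 * integral_mean p r (deriv g) \<le> R * integral_mean p (R * q) (deriv g)"
        unfolding q(3) using R by (intro mult_right_mono) auto
      also have "\<dots> \<le> \<epsilon> * 4 powr (1/p) * K * (1 - q) powr (1/p - 1) / (2 * pi) + 16 * c" by (rule D3[OF R(1,2) q(1,2)])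
      also have "\<dots> \<le> \<epsilon> * 4 powr (1/p) * K * (2 powr (1 - 1/p) * (1 - r) powr (1/p - 1)) / 2 + 16 * c"
        using q1 \<epsilon> K pi_gt_zero pi_gt3 by (intro add_right_mono frac_le mult_left_mono) auto
      also have "\<epsilon> * 4 powr (1/p) * K * (2 powr (1 - 1/p) * (1 - r) powr (1/p - 1)) = e * (1 - r) powr (1/p - 1)"
        using K by (simp add: \<epsilon>_def)
      finally show "integral_mean p r (deriv g) \<le> e * (1 - r) powr (1 / p - 1) + 32 * c" by simp
    qed
  qed
qed

section \<open>From the growth of the derivative to the mean Lipschitz condition\<close>

lemma radial_difference:
  fixes g :: "complex \<Rightarrow> complex"
  assumes g: "g holomorphic_on unit_disc" and a: "0 \<le> a" "a \<le> 1" and z: "norm z < 1"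
  shows "z * (LINT t:{a..<1}|lborel. deriv g (complex_of_real t * z)) = g z - g (complex_of_real a * z)"
proof -
  have tz: "norm (complex_of_real t * z) < 1" if "t \<in> {a..1}" for t
  proof -
    have "t * norm z \<le> 1 * norm z" using that by (intro mult_right_mono) auto
    thus ?thesis using that a z by (simp add: norm_mult)
  qed
  have cd: "continuous_on unit_disc (deriv g)"
    using g by (intro holomorphic_on_imp_continuous_on holomorphic_deriv) auto
  have c: "continuous_on {a..1} (\<lambda>t. deriv g (complex_of_real t * z))"
    by (intro continuous_on_compose2[OF cd] continuous_intros) (use tz in auto)
  have "((\<lambda>t. z * deriv g (complex_of_real t * z)) has_integral g (complex_of_real 1 * z) - g (complex_of_real a * z)) {a..1}"
  proof (rule fundamental_theorem_of_calculus[OF a(2)])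
    fix t assume t: "t \<in> {a..1}"
    have "g field_differentiable at (complex_of_real t * z)"
      using tz[OF t] by (intro holomorphic_on_imp_differentiable_at[OF g]) auto
    hence "(g has_field_derivative deriv g (complex_of_real t * z)) (at (complex_of_real t * z))"
      by (simp add: field_differentiable_derivI)
    hence "((\<lambda>w. g (w * z)) has_field_derivative deriv g (complex_of_real t * z) * z) (at (complex_of_real t))"
      by (rule DERIV_chain2) (auto intro!: derivative_eq_intros)
    thus "((\<lambda>t. g (complex_of_real t * z)) has_vector_derivative z * deriv g (complex_of_real t * z)) (at t within {a..1})"
      by (intro has_vector_derivative_real_field) (simp add: mult.commute)
  qed
  hence "(LINT t:{a..1}|lborel. z * deriv g (complex_of_real t * z)) = g z - g (complex_of_real a * z)"
    using set_lebesgue_integral_of_has_integral[OF continuous_on_mult[OF continuous_on_const c]] by simp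
  moreover have "(LINT t:{a..1}|lborel. z * deriv g (complex_of_real t * z)) = (LINT t:{a..<1}|lborel. z * deriv g (complex_of_real t * z))"
    unfolding set_lebesgue_integral_def
  proof (rule integral_cong_AE)
    have i: "set_integrable lborel {a..1} (\<lambda>t. z * deriv g (complex_of_real t * z))"
      by (intro borel_integrable_atLeastAtMost' continuous_intros c)
    show "(\<lambda>t. indicator {a..1} t *\<^sub>R (z * deriv g (complex_of_real t * z))) \<in> borel_measurable lborel"
      using i unfolding set_integrable_def by measurable
    have "set_integrable lborel {a..<1} (\<lambda>t. z * deriv g (complex_of_real t * z))"
      using i by (rule set_integrable_subset) auto
    thus "(\<lambda>t. indicator {a..<1} t *\<^sub>R (z * deriv g (complex_of_real t * z))) \<in> borel_measurable lborel"
      unfolding set_integrable_def by measurable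
    show "AE t in lborel. indicator {a..1} t *\<^sub>R (z * deriv g (complex_of_real t * z)) = indicator {a..<1} t *\<^sub>R (z * deriv g (complex_of_real t * z))"
      using AE_lborel_singleton[of "1::real"] by eventually_elim (auto simp: indicator_def)
  qed
  ultimately show ?thesis by simp
qed

lemma arc_difference:
  fixes g :: "complex \<Rightarrow> complex"
  assumes g: "g holomorphic_on unit_disc" and h: "0 \<le> h" and z: "norm z < 1"
  shows "z * (LINT s:{0..h}|lborel. \<i> * cis s * deriv g (cis s * z)) = g (cis h * z) - g z"
proof -
  have cd: "continuous_on unit_disc (deriv g)"
    using g by (intro holomorphic_on_imp_continuous_on holomorphic_deriv) auto
  have c: "continuous_on {0..h} (\<lambda>s. z * (\<i> * cis s * deriv g (cis s * z)))"
    by (intro continuous_intros continuous_on_compose2[OF cd]) (use z in \<open>auto simp: norm_mult\<close>)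
  have "((\<lambda>s. z * (\<i> * cis s * deriv g (cis s * z))) has_integral g (cis h * z) - g (cis 0 * z)) {0..h}"
  proof (rule fundamental_theorem_of_calculus[OF h])
    fix s
    have "g field_differentiable at (cis s * z)"
      using z by (intro holomorphic_on_imp_differentiable_at[OF g]) (auto simp: norm_mult)
    hence "(g has_field_derivative deriv g (exp (\<i> * complex_of_real s) * z)) (at (exp (\<i> * complex_of_real s) * z))"
      by (simp add: field_differentiable_derivI cis_conv_exp)
    hence "((\<lambda>w. g (exp (\<i> * w) * z)) has_field_derivative deriv g (exp (\<i> * complex_of_real s) * z) * (\<i> * exp (\<i> * complex_of_real s) * z)) (at (complex_of_real s))"
      by (rule DERIV_chain2) (auto intro!: derivative_eq_intros)
    hence "((\<lambda>s. g (exp (\<i> * complex_of_real s) * z)) has_vector_derivative deriv g (exp (\<i> * complex_of_real s) * z) * (\<i> * exp (\<i> * complex_of_real s) * z)) (at s within {0..h})"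
      by (rule has_vector_derivative_real_field)
    thus "((\<lambda>s. g (cis s * z)) has_vector_derivative z * (\<i> * cis s * deriv g (cis s * z))) (at s within {0..h})"
      by (simp add: cis_conv_exp mult_ac)
  qed
  from set_lebesgue_integral_of_has_integral[OF c this]
  show ?thesis by simp
qed

lemma circle_power_mono:
  assumes "\<And>t. norm (f (complex_of_real r * cis t)) \<le> norm (h (complex_of_real r * cis t))" "0 \<le> p"
  shows "circle_power p r f \<le> circle_power p r h"
  unfolding circle_power_def using assms
  by (intro nn_integral_mono mult_right_mono ennreal_leI powr_mono2) auto

text \<open>The derivative is integrated along the radius from a z to z; the integral of (1 -
  t)^(1/p - 1) over [a, 1) is p (1 - a)^(1/p). Monotonicity of means replaces the radius r t by
  t.\<close>

lemma radial_growth_mean: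
  fixes g :: "complex \<Rightarrow> complex"
  assumes g: "g holomorphic_on unit_disc" and p: "1 < p" and a: "0 \<le> a" "a < 1" and r: "0 \<le> r" "r < 1"
    and e: "0 < e" and C: "0 \<le> C"
    and growth: "\<And>r. 0 \<le> r \<Longrightarrow> r < 1 \<Longrightarrow> integral_mean p r (deriv g) \<le> e * (1 - r) powr (1 / p - 1) + C"
  shows "circle_power p r (\<lambda>z. g z - g (complex_of_real a * z)) \<le> ennreal (2 * pi * (e * p * (1 - a) powr (1 / p) + C * (1 - a)) powr p)"
proof -
  have hd: "deriv g holomorphic_on unit_disc" using g by (intro holomorphic_deriv) auto
  have cd: "continuous_on unit_disc (deriv g)" using hd by (rule holomorphic_on_imp_continuous_on)
  define m where "m = (\<lambda>t. if t < 1 then e * (1 - t) powr (1 / p - 1) + C else 1)"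
  have p1: "-1 < 1 / p - 1" using p by simp
  note I = integral_one_minus_powr[OF p1, of a]
  have "set_integrable lborel {a..1} (\<lambda>t. C)" by (intro borel_integrable_atLeastAtMost' continuous_intros)
  hence ci: "set_integrable lborel {a..<1} (\<lambda>t. C)" by (rule set_integrable_subset) auto
  have mi: "set_integrable lborel {a..<1} (\<lambda>t. e * (1 - t) powr (1 / p - 1) + C)"
    using I(1) a ci by (intro set_integral_add set_integrable_mult_right) auto
  have "circle_power p r (\<lambda>z. LINT t:{a..<1}|lborel. 1 * deriv g (complex_of_real t * z)) \<le>
     ennreal (2 * pi * (LINT t:{a..<1}|lborel. norm (1::complex) * m t) powr p)"
  proof (rule radial_minkowski[OF cd p r])
    show "m \<in> borel_measurable borel" unfolding m_def by measurable
    show "0 < m t" for t using e C by (auto simp: m_def intro!: add_pos_nonneg)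
    have "set_integrable lborel {a..<1} (\<lambda>t. norm (1::complex) * m t) = set_integrable lborel {a..<1} (\<lambda>t. e * (1 - t) powr (1 / p - 1) + C)"
      by (intro set_integrable_cong) (auto simp: m_def)
    thus "set_integrable lborel {a..<1} (\<lambda>t. norm (1::complex) * m t)" using mi by simp
    fix t assume t: "t \<in> {a..<1}"
    have rt: "r * t \<le> t" using t r a by (intro mult_left_le_one_le) auto
    have "integral_mean p (r * t) (deriv g) \<le> integral_mean p t (deriv g)"
      using t r a rt by (intro integral_mean_mono[OF hd p]) auto
    also have "\<dots> \<le> m t" using growth[of t] t a by (simp add: m_def)
    finally show "integral_mean p (r * t) (deriv g) \<le> m t" .
  qed (use a in auto)
  also have "(LINT t:{a..<1}|lborel. norm (1::complex) * m t) = (LINT t:{a..<1}|lborel. e * (1 - t) powr (1 / p - 1) + C)"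
    by (intro set_lebesgue_integral_cong) (auto simp: m_def)
  also have "\<dots> = e * p * (1 - a) powr (1 / p) + C * (1 - a)"
    using I(1,2) a ci p by (subst set_integral_add) (auto simp: set_lebesgue_integral_def)
  finally have "circle_power p r (\<lambda>z. LINT t:{a..<1}|lborel. 1 * deriv g (complex_of_real t * z)) \<le>
     ennreal (2 * pi * (e * p * (1 - a) powr (1 / p) + C * (1 - a)) powr p)" .
  moreover have "circle_power p r (\<lambda>z. g z - g (complex_of_real a * z)) \<le> circle_power p r (\<lambda>z. LINT t:{a..<1}|lborel. 1 * deriv g (complex_of_real t * z))"
  proof (rule circle_power_mono)
    fix t
    let ?z = "complex_of_real r * cis t"
    have z: "norm ?z < 1" using r by (simp add: norm_mult)
    have "norm (g ?z - g (complex_of_real a * ?z)) = norm ?z * norm (LINT t:{a..<1}|lborel. deriv g (complex_of_real t * ?z))"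
      using radial_difference[OF g a(1) _ z] a by (simp add: norm_mult[symmetric])
    also have "\<dots> \<le> 1 * norm (LINT t:{a..<1}|lborel. deriv g (complex_of_real t * ?z))"
      using z by (intro mult_right_mono) auto
    finally show "norm (g ?z - g (complex_of_real a * ?z)) \<le> norm (LINT t:{a..<1}|lborel. 1 * deriv g (complex_of_real t * ?z))" by simp
  qed (use p in auto)
  ultimately show ?thesis by (rule order.trans[rotated])
qed

text \<open>The derivative is integrated along an arc of angle h, and all rotated copies of it have
  the same mean.\<close>

lemma arc_growth_mean:
  fixes g :: "complex \<Rightarrow> complex"
  assumes g: "g holomorphic_on unit_disc" and p: "1 < p" and h: "0 \<le> h" and r: "0 \<le> r" "r < 1"
    and M: "0 < M" "integral_mean p r (deriv g) \<le> M"
  shows "circle_power p r (\<lambda>z. g (cis h * z) - g z) \<le> ennreal (2 * pi * (h * M) powr p)"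
proof -
  have cd: "continuous_on unit_disc (deriv g)"
    using g by (intro holomorphic_on_imp_continuous_on holomorphic_deriv) auto
  have [measurable]: "disc_ext (deriv g) \<in> borel_measurable borel" using cd by (rule disc_ext_measurable)
  have "(\<integral>\<^sup>+x\<in>{0..2*pi}. ennreal (norm (LINT s:{0..h}|lborel. (\<i> * cis s) * disc_ext (deriv g) (cis s * (complex_of_real r * cis x))) powr p) \<partial>lborel)
    \<le> ennreal (2 * pi * (LINT s:{0..h}|lborel. norm (\<i> * cis s) * M) powr p)"
  proof (rule circle_minkowski[OF p])
    show "(\<lambda>(x, t). disc_ext (deriv g) (cis t * (complex_of_real r * cis x))) \<in> borel_measurable (lborel \<Otimes>\<^sub>M lborel)" by measurable
    show "set_integrable lborel {0..h} (\<lambda>s. norm (\<i> * cis s) * M)"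
      by (intro borel_integrable_atLeastAtMost' continuous_intros)
    fix s
    have "(\<integral>\<^sup>+x\<in>{0..2*pi}. ennreal (norm (disc_ext (deriv g) (cis s * (complex_of_real r * cis x))) powr p) \<partial>lborel) = circle_power p r (\<lambda>z. deriv g (cis s * z))"
      unfolding circle_power_def using r by (intro nn_integral_cong) (simp add: norm_mult)
    also have "\<dots> = circle_power p r (deriv g)" by (rule circle_power_rotate[OF cd r])
    also have "\<dots> \<le> ennreal (2 * pi * M powr p)" using integral_mean_le_iff[OF cd r, of p M] M p by simp
    finally show "(\<integral>\<^sup>+x\<in>{0..2*pi}. ennreal (norm (disc_ext (deriv g) (cis s * (complex_of_real r * cis x))) powr p) \<partial>lborel) \<le> ennreal (2 * pi * M powr p)" .
  qed (use M in auto)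
  also have "(LINT s:{0..h}|lborel. norm (\<i> * cis s) * M) = h * M"
    using h by (simp add: norm_mult set_lebesgue_integral_def)
  finally have *: "circle_power p r (\<lambda>z. LINT s:{0..h}|lborel. (\<i> * cis s) * disc_ext (deriv g) (cis s * z)) \<le> ennreal (2 * pi * (h * M) powr p)"
    by (simp add: circle_power_def)
  have "circle_power p r (\<lambda>z. g (cis h * z) - g z) \<le> circle_power p r (\<lambda>z. LINT s:{0..h}|lborel. (\<i> * cis s) * disc_ext (deriv g) (cis s * z))"
  proof (rule circle_power_mono)
    fix t
    let ?z = "complex_of_real r * cis t"
    have z: "norm ?z < 1" using r by (simp add: norm_mult)
    have "norm (g (cis h * ?z) - g ?z) = norm ?z * norm (LINT s:{0..h}|lborel. \<i> * cis s * deriv g (cis s * ?z))"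
      using arc_difference[OF g h z] by (simp add: norm_mult[symmetric])
    also have "\<dots> \<le> 1 * norm (LINT s:{0..h}|lborel. \<i> * cis s * deriv g (cis s * ?z))"
      using z by (intro mult_right_mono) auto
    also have "(LINT s:{0..h}|lborel. \<i> * cis s * deriv g (cis s * ?z)) = (LINT s:{0..h}|lborel. (\<i> * cis s) * disc_ext (deriv g) (cis s * ?z))"
      using r by (intro set_lebesgue_integral_cong) (auto simp: norm_mult)
    finally show "norm (g (cis h * ?z) - g ?z) \<le> norm (LINT s:{0..h}|lborel. (\<i> * cis s) * disc_ext (deriv g) (cis s * ?z))" by simp
  qed (use p in auto)
  thus ?thesis using * by (rule order.trans)
qed

text \<open>From z to e^(ih) z one walks inwards along a radius to a z, along an arc, and outwards
  again. The radial pieces avoid evaluating the derivative near the boundary on the arc.\<close>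

lemma small_growth_imp_lipschitz:
  fixes g :: "complex \<Rightarrow> complex"
  assumes g: "g holomorphic_on unit_disc" and p: "1 < p" and sg: "small_growth p g"
  shows "g \<in> little_mean_lipschitz p (1 / p)"
proof -
  have cg: "continuous_on unit_disc g" using g by (rule holomorphic_on_imp_continuous_on)
  obtain C1 where C1: "0 \<le> C1" "\<And>r. 0 \<le> r \<Longrightarrow> r < 1 \<Longrightarrow> integral_mean p r (deriv g) \<le> 1 * (1 - r) powr (1 / p - 1) + C1"
    using sg unfolding small_growth_def by (metis zero_less_one)
  \<comment> \<open>p + C1 bounds the mean of g - g(0) by integrating the growth estimate from the
    centre; the factor 4 is that of \<open>circle_power_add\<close>.\<close>
  define M where "M = 4 * ((p + C1) + norm (g 0))"
  have M0: "0 \<le> M" using C1 p by (simp add: M_def)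
  have M: "integral_mean p r g \<le> M" if r: "0 < r" "r < 1" for r
  proof -
    have "circle_power p r (\<lambda>z. g z - g (complex_of_real 0 * z)) \<le> ennreal (2 * pi * (1 * p * (1 - 0) powr (1 / p) + C1 * (1 - 0)) powr p)"
      using r C1 by (intro radial_growth_mean[OF g p]) auto
    hence 1: "circle_power p r (\<lambda>z. g z - g 0) \<le> ennreal (2 * pi * (p + C1) powr p)" by simp
    have 2: "circle_power p r (\<lambda>z. g 0) \<le> ennreal (2 * pi * norm (g 0) powr p)"
      unfolding circle_power_def by (simp add: nn_integral_cmult_indicator ennreal_mult[symmetric] mult.commute)
    have "circle_power p r (\<lambda>z. (g z - g 0) + g 0) \<le> ennreal (2 * pi * (4 * ((p + C1) + norm (g 0))) powr p)"
      by (rule circle_power_add[OF _ _ _ _ _ _ 1 _ 2]) (use cg r p C1 in \<open>auto intro!: continuous_intros\<close>)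
    thus ?thesis using integral_mean_le_iff[OF cg, of r p M] r p M0 by (simp add: M_def)
  qed
  have hardy: "g \<in> hardy_space p"
    using g M by (auto simp: hardy_space_def intro!: bdd_aboveI[where M=M])
  let ?S = "boundary_difference p (boundary_function g)"
  have S0: "0 \<le> ?S h" for h by (simp add: boundary_difference_def)
  have S8: "?S h \<le> 8 * M" for h
    by (rule boundary_difference_bound(2)[OF g p M hardy_rotation_difference[OF g p M]])
  have bdd: "bdd_above (?S ` A)" for A using S8 by (intro bdd_aboveI[where M="8*M"]) auto
  have mod: "integral_modulus p (boundary_function g) t = (SUP h\<in>{0<..t}. ?S h)" for t
    by (simp add: integral_modulus_def boundary_difference_def)
  have Sle: "?S h \<le> 16 * (e * (2 * p + 1) * h powr (1 / p) + 3 * C * h)"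
    if e: "0 < e" and C: "0 \<le> C" and gr: "\<And>r. 0 \<le> r \<Longrightarrow> r < 1 \<Longrightarrow> integral_mean p r (deriv g) \<le> e * (1 - r) powr (1 / p - 1) + C"
      and h: "0 < h" "h < 1" for e C h
  proof (rule boundary_difference_bound(2)[OF g p M])
    fix r :: real assume r: "0 < r" "r < 1"
    \<comment> \<open>Stopping at depth h balances the pieces: the radial ones cost e p h^(1/p), the
      arc of length h costs h e h^(1/p - 1), up to multiples of C h.\<close>
    define a where "a = 1 - h"
    have a: "0 \<le> a" "a < 1" using h by (auto simp: a_def)
    define A where "A = e * p * h powr (1 / p) + C * h"
    define B where "B = h * (e * h powr (1 / p - 1) + C)"
    have AB0: "0 \<le> A" "0 \<le> B" using e C p h by (auto simp: A_def B_def)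
    have ar: "0 \<le> a * r" "a * r < 1" "a * r \<le> a" using a r mult_left_le[of r a] by auto
    have cm: "continuous_on unit_disc (\<lambda>z. g (complex_of_real b * z))" if "0 \<le> b" "b \<le> 1" for b
    proof (rule continuous_on_compose2[OF cg])
      have "b * norm z < 1" if "norm z < 1" for z :: complex
        using that \<open>0 \<le> b\<close> \<open>b \<le> 1\<close> mult_right_mono[of b 1 "norm z"] by simp
      thus "(*) (complex_of_real b) ` unit_disc \<subseteq> unit_disc" using that by (auto simp: norm_mult)
    qed (intro continuous_intros)
    have cgr: "continuous_on unit_disc (\<lambda>z. g (cis h * z))"
      using holomorphic_on_rotate[OF g] by (rule holomorphic_on_imp_continuous_on)
    have "(\<lambda>z. (g (complex_of_real a * z))) holomorphic_on unit_disc"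
    proof -
      have "(g \<circ> (*) (complex_of_real a)) holomorphic_on unit_disc"
      proof (rule holomorphic_on_compose_gen[OF _ g])
        show "(*) (complex_of_real a) ` unit_disc \<subseteq> unit_disc"
        proof -
          have "a * norm z < 1" if "norm z < 1" for z :: complex
            using that a mult_right_mono[of a 1 "norm z"] by simp
          thus ?thesis using a by (auto simp: norm_mult)
        qed
      qed (intro holomorphic_intros)
      thus ?thesis by (simp add: o_def)
    qed
    hence hga: "(\<lambda>z. g (complex_of_real a * (cis h * z))) holomorphic_on unit_disc"
      by (rule holomorphic_on_rotate)
    have cgar: "continuous_on unit_disc (\<lambda>z. g (complex_of_real a * (cis h * z)))"
      using hga by (rule holomorphic_on_imp_continuous_on)
    have 1: "circle_power p r (\<lambda>z. g z - g (complex_of_real a * z)) \<le> ennreal (2 * pi * A powr p)"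
      using radial_growth_mean[OF g p a _ _ e C gr, of r] r by (simp add: A_def a_def)
    have c1: "continuous_on unit_disc (\<lambda>z. g z - g (complex_of_real a * z))" using cg cm[of a] a by (intro continuous_intros) auto
    have 2: "circle_power p r (\<lambda>z. g (cis h * z) - g (complex_of_real a * (cis h * z))) \<le> ennreal (2 * pi * A powr p)"
      using circle_power_rotate[OF c1, of r p h] r 1 by simp
    have 3: "circle_power p r (\<lambda>z. g (complex_of_real a * (cis h * z)) - g (complex_of_real a * z)) \<le> ennreal (2 * pi * B powr p)"
    proof -
      have "integral_mean p (a * r) (deriv g) \<le> integral_mean p a (deriv g)"
        using ar a g by (intro integral_mean_mono p holomorphic_deriv) auto
      also have "\<dots> \<le> e * h powr (1 / p - 1) + C" using gr[OF a] by (simp add: a_def)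
      finally have "circle_power p (a * r) (\<lambda>z. g (cis h * z) - g z) \<le> ennreal (2 * pi * B powr p)"
        unfolding B_def using e C h ar by (intro arc_growth_mean[OF g p]) (auto intro!: add_pos_nonneg)
      thus ?thesis by (simp add: circle_power_def mult_ac)
    qed
    have 4: "circle_power p r (\<lambda>z. - (g z - g (complex_of_real a * z))) \<le> ennreal (2 * pi * A powr p)"
      using 1 unfolding circle_power_def norm_minus_cancel .
    have c2: "continuous_on unit_disc (\<lambda>z. g (cis h * z) - g (complex_of_real a * (cis h * z)))" using cgr cgar by (intro continuous_intros)
    have c3: "continuous_on unit_disc (\<lambda>z. g (complex_of_real a * (cis h * z)) - g (complex_of_real a * z))" using cgar cm[of a] a by (intro continuous_intros) auto
    have c4: "continuous_on unit_disc (\<lambda>z. - (g z - g (complex_of_real a * z)))" using c1 by (rule continuous_on_minus)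
    have 5: "circle_power p r (\<lambda>z. (g (cis h * z) - g (complex_of_real a * (cis h * z))) + - (g z - g (complex_of_real a * z))) \<le> ennreal (2 * pi * (4 * (A + A)) powr p)"
      by (rule circle_power_add[OF c2 c4 _ _ _ AB0(1) 2 AB0(1) 4]) (use r p in auto)
    have c5: "continuous_on unit_disc (\<lambda>z. (g (cis h * z) - g (complex_of_real a * (cis h * z))) + - (g z - g (complex_of_real a * z)))"
      by (rule continuous_on_add[OF c2 c4])
    have 6: "circle_power p r (\<lambda>z. ((g (cis h * z) - g (complex_of_real a * (cis h * z))) + - (g z - g (complex_of_real a * z))) + (g (complex_of_real a * (cis h * z)) - g (complex_of_real a * z)))
       \<le> ennreal (2 * pi * (4 * (4 * (A + A) + B)) powr p)"
      by (rule circle_power_add[OF c5 c3 _ _ _ _ 5 AB0(2) 3]) (use r p AB0 in auto)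
    have "circle_power p r (\<lambda>z. g (cis h * z) - g z) \<le> ennreal (2 * pi * (4 * (4 * (A + A) + B)) powr p)"
      using 6 by simp
    moreover have cc: "continuous_on unit_disc (\<lambda>z. g (cis h * z) - g z)" using cgr cg by (intro continuous_intros)
    ultimately have "integral_mean p r (\<lambda>z. g (cis h * z) - g z) \<le> 4 * (4 * (A + A) + B)"
      using integral_mean_le_iff[OF cc, of r p "4 * (4 * (A + A) + B)"] r p AB0 by simp
    also have "\<dots> \<le> 16 * (2 * A + B)" using AB0 by simp
    also have "B = e * h powr (1 / p) + C * h" using h by (simp add: B_def powr_diff field_simps)
    hence "2 * A + B = e * (2 * p + 1) * h powr (1 / p) + 3 * C * h" by (simp add: A_def algebra_simps)
    finally show "integral_mean p r (\<lambda>z. g (cis h * z) - g z) \<le> 16 * (e * (2 * p + 1) * h powr (1 / p) + 3 * C * h)" .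
  qed
  have "integral_modulus p (boundary_function g) \<in> o[at_right 0](\<lambda>t. t powr (1 / p))"
  proof (rule landau_o.smallI)
    fix c :: real assume c: "0 < c"
    \<comment> \<open>This makes the main term (c/2) t^(1/p). The remaining 48 C t is t^(1/p) times
      48 C t^(1 - 1/p), which falls below (c/2) t^(1/p) for small t.\<close>
    define e where "e = c / (32 * (2 * p + 1))"
    have e: "0 < e" "16 * (e * (2 * p + 1)) = c / 2" using c p by (auto simp: e_def field_simps)
    obtain C where C: "0 \<le> C" "\<And>r. 0 \<le> r \<Longrightarrow> r < 1 \<Longrightarrow> integral_mean p r (deriv g) \<le> e * (1 - r) powr (1 / p - 1) + C"
      using sg e(1) unfolding small_growth_def by blast
    have "((\<lambda>t. 48 * C * t powr (1 - 1 / p)) \<longlongrightarrow> 48 * C * 0) (at_right 0)"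
    proof -
      have "((\<lambda>t. t powr (1 - 1 / p)) \<longlongrightarrow> 0 powr (1 - 1 / p)) (at_right 0)"
        by (rule tendsto_powr'[OF tendsto_ident_at tendsto_const]) (use p in \<open>auto intro: eventually_at_right_less[THEN eventually_mono]\<close>)
      thus ?thesis by (intro tendsto_mult tendsto_const) simp
    qed
    hence "\<forall>\<^sub>F t in at_right 0. 48 * C * t powr (1 - 1 / p) < c / 2"
      by (rule order_tendstoD(2)) (use c in simp)
    moreover have "\<forall>\<^sub>F t in at_right (0::real). t \<in> {0<..<1}" by (rule eventually_at_right_real) simp
    ultimately show "\<forall>\<^sub>F t in at_right 0. norm (integral_modulus p (boundary_function g) t) \<le> c * norm (t powr (1 / p))"
    proof eventually_elim
      fix t assume tC: "48 * C * t powr (1 - 1 / p) < c / 2" and t: "t \<in> {0<..<1}"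
      have "?S h \<le> c * t powr (1 / p)" if h: "h \<in> {0<..t}" for h
      proof -
        have "?S h \<le> 16 * (e * (2 * p + 1) * h powr (1 / p) + 3 * C * h)" using h t by (intro Sle e C) auto
        also have "\<dots> \<le> 16 * (e * (2 * p + 1) * t powr (1 / p) + 3 * C * t)"
          using h t e C p by (intro mult_left_mono add_mono powr_mono2) auto
        also have "\<dots> = 16 * (e * (2 * p + 1)) * t powr (1 / p) + 48 * C * t powr (1 - 1 / p) * t powr (1 / p)"
          using t by (simp add: powr_add[symmetric] algebra_simps)
        also have "\<dots> \<le> c / 2 * t powr (1 / p) + c / 2 * t powr (1 / p)"
          unfolding e(2) using tC by (intro add_mono mult_right_mono) auto
        finally show ?thesis by simp
      qed
      hence "(SUP h\<in>{0<..t}. ?S h) \<le> c * t powr (1 / p)" using t by (intro cSUP_least) auto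
      moreover have "0 \<le> (SUP h\<in>{0<..t}. ?S h)"
        using t S0 by (intro cSUP_upper2[OF bdd, of t]) auto
      ultimately show "norm (integral_modulus p (boundary_function g) t) \<le> c * norm (t powr (1 / p))"
        by (simp add: mod)
    qed
  qed
  thus ?thesis using hardy by (simp add: little_mean_lipschitz_def)
qed

section \<open>Sufficiency\<close>

text \<open>Cut at t = r: for t >= r the kernel is at most (1 - r)^(-b) and a > -1 gives convergence
  at 1; for t <= r it is at most (1 - t)^(-b) and a + 1 < b gives growth at r.\<close>

lemma radial_kernel_integral:
  fixes a b :: real
  assumes a: "-1 < a" and b: "a + 1 < b"
  obtains C where "0 < C" "\<And>r. 0 \<le> r \<Longrightarrow> r < 1 \<Longrightarrow>
    (\<integral>\<^sup>+t\<in>{0..<1}. ennreal ((1 - t) powr a * (1 - t * r) powr (- b)) \<partial>lborel) \<le> ennreal (C * (1 - r) powr (a + 1 - b))"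
proof -
  define C where "C = 1 / (a + 1) + 1 / (b - a - 1)"
  show ?thesis
  proof (rule that[of C])
    show "0 < C" using a b by (auto simp: C_def intro!: add_pos_pos)
    fix r :: real assume r: "0 \<le> r" "r < 1"
    let ?U = "\<lambda>t. ennreal ((1 - r) powr (- b)) * (ennreal ((1 - t) powr a) * indicator {r..<1} t)"
    let ?V = "\<lambda>t. ennreal ((1 - t) powr (a - b)) * indicator {0..r} t"
    have "(\<integral>\<^sup>+t\<in>{0..<1}. ennreal ((1 - t) powr a * (1 - t * r) powr (- b)) \<partial>lborel) \<le> (\<integral>\<^sup>+t. ?U t + ?V t \<partial>lborel)"
    proof (rule nn_integral_mono)
      fix t
      show "ennreal ((1 - t) powr a * (1 - t * r) powr (- b)) * indicator {0..<1} t \<le> ?U t + ?V t"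
      proof (cases "t \<in> {0..<1}")
        case t: True
        show ?thesis
        proof (cases "r \<le> t")
          case True
          have "t * r \<le> r" using t r by (intro mult_left_le_one_le) auto
          hence "(1 - t * r) powr (- b) \<le> (1 - r) powr (- b)" using r a b by (intro powr_mono2') auto
          hence "(1 - t) powr a * (1 - t * r) powr (- b) \<le> (1 - r) powr (- b) * (1 - t) powr a"
            by (subst (2) mult.commute) (rule mult_left_mono, auto)
          hence "ennreal ((1 - t) powr a * (1 - t * r) powr (- b)) \<le> ennreal ((1 - r) powr (- b)) * ennreal ((1 - t) powr a)"
            by (simp add: ennreal_mult[symmetric] ennreal_leI)
          thus ?thesis using t True by (simp add: add_increasing2)
        next
          case False
          have "t * r \<le> t" using t r by (simp add: mult_left_le)
          hence "(1 - t * r) powr (- b) \<le> (1 - t) powr (- b)" using t a b by (intro powr_mono2') auto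
          hence "(1 - t) powr a * (1 - t * r) powr (- b) \<le> (1 - t) powr a * (1 - t) powr (- b)" by (rule mult_left_mono) simp
          also have "\<dots> = (1 - t) powr (a - b)" by (simp add: powr_add[symmetric])
          finally show ?thesis using t False by (simp add: ennreal_leI)
        qed
      qed auto
    qed
    also have "\<dots> = (\<integral>\<^sup>+t. ?U t \<partial>lborel) + (\<integral>\<^sup>+t. ?V t \<partial>lborel)" by (rule nn_integral_add) measurable
    also have "(\<integral>\<^sup>+t. ?U t \<partial>lborel) = ennreal ((1 - r) powr (- b)) * ennreal ((1 - r) powr (a + 1) / (a + 1))"
      using integral_one_minus_powr(3)[OF a, of r] r by (subst nn_integral_cmult) auto
    also have "\<dots> = ennreal ((1 - r) powr (a + 1 - b) / (a + 1))"
      using a r by (simp add: ennreal_mult[symmetric] powr_diff powr_minus field_simps)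
    also have "(\<integral>\<^sup>+t. ?V t \<partial>lborel) \<le> ennreal ((1 - r) powr (a + 1 - b) / (b - a - 1))"
    proof -
      define F where "F = (\<lambda>t. (1 - t) powr (a - b + 1) / (b - a - 1))"
      have "(\<integral>\<^sup>+t. ?V t \<partial>lborel) = ennreal (F r - F 0)"
      proof (rule nn_integral_FTC_Icc)
        fix t assume "t \<in> {0..r}"
        hence "((\<lambda>t. (1 - t) powr (a - b + 1)) has_real_derivative (a - b + 1) * (1 - t) powr (a - b + 1 - 1) * (- 1)) (at t)"
          using r by (auto intro!: derivative_eq_intros)
        hence "(F has_real_derivative ((a - b + 1) * (1 - t) powr (a - b + 1 - 1) * (- 1)) / (b - a - 1)) (at t)"
          unfolding F_def by (rule DERIV_cdivide)
        moreover have "((a - b + 1) * x * (- 1)) / (b - a - 1) = x" for x using b by (simp add: field_simps)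
        ultimately have "(F has_real_derivative (1 - t) powr (a - b)) (at t)" by simp
        thus "DERIV F t :> (1 - t) powr (a - b)" .
      qed (use r in auto)
      also have "\<dots> \<le> ennreal ((1 - r) powr (a + 1 - b) / (b - a - 1))"
        using b by (intro ennreal_leI) (simp add: F_def algebra_simps)
      finally show ?thesis .
    qed
    also have "ennreal ((1 - r) powr (a + 1 - b) / (a + 1)) + ennreal ((1 - r) powr (a + 1 - b) / (b - a - 1)) = ennreal (C * (1 - r) powr (a + 1 - b))"
    proof -
      have *: "C * (1 - r) powr (a + 1 - b) = (1 - r) powr (a + 1 - b) / (a + 1) + (1 - r) powr (a + 1 - b) / (b - a - 1)"
        by (simp add: C_def distrib_right)
      show ?thesis unfolding * by (subst ennreal_plus) (use a b in auto)
    qed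
    finally show "(\<integral>\<^sup>+t\<in>{0..<1}. ennreal ((1 - t) powr a * (1 - t * r) powr (- b)) \<partial>lborel) \<le> ennreal (C * (1 - r) powr (a + 1 - b))"
      by simp
  qed
qed

lemma weight_le:
  fixes r \<alpha> :: real
  assumes r: "0 \<le> r" "r < 1"
  shows "r * (1 - r\<^sup>2) powr \<alpha> \<le> max 1 (2 powr \<alpha>) * (1 - r) powr \<alpha>"
proof -
  have "(1 - r\<^sup>2) = (1 - r) * (1 + r)" by (simp add: power2_eq_square algebra_simps)
  hence "r * (1 - r\<^sup>2) powr \<alpha> = (r * (1 + r) powr \<alpha>) * (1 - r) powr \<alpha>" using r by (simp add: powr_mult mult_ac)
  also have "(1 + r) powr \<alpha> \<le> max 1 (2 powr \<alpha>)"
  proof (cases "0 \<le> \<alpha>")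
    case True
    have "(1 + r) powr \<alpha> \<le> 2 powr \<alpha>" using r True by (intro powr_mono2) auto
    thus ?thesis by simp
  next
    case False
    have "(1 + r) powr \<alpha> \<le> 1 powr \<alpha>" using r False by (intro powr_mono2') auto
    thus ?thesis by simp
  qed
  hence "r * (1 + r) powr \<alpha> \<le> 1 * max 1 (2 powr \<alpha>)" using r by (intro mult_mono) auto
  finally show ?thesis by (simp add: mult_right_mono)
qed

text \<open>If w x^(p-1) >= 1 the first term dominates x, otherwise the second does.\<close>

lemma young_weight:
  fixes x w p :: real
  assumes x: "0 \<le> x" and w: "0 < w" and p: "1 < p"
  shows "x \<le> w * x powr p + w powr (- 1 / (p - 1))"
proof (cases "1 \<le> w * x powr (p - 1)")
  case True
  hence "x * 1 \<le> x * (w * x powr (p - 1))" using x by (intro mult_left_mono)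
  also have "\<dots> = w * x powr p" using x p by (cases "x = 0") (auto simp: powr_diff)
  finally show ?thesis by (simp add: add_increasing2)
next
  case False
  hence "x powr (p - 1) \<le> 1 / w" using w by (simp add: field_simps)
  hence "(x powr (p - 1)) powr (1 / (p - 1)) \<le> (1 / w) powr (1 / (p - 1))" by (rule powr_mono2[rotated 2]) (use p in auto)
  hence "x \<le> (1 / w) powr (1 / (p - 1))" using x p by (simp add: powr_powr)
  also have "\<dots> = w powr (- 1 / (p - 1))" using w by (simp add: powr_divide powr_minus_divide)
  finally show ?thesis using w by (simp add: add_increasing)
qed

text \<open>Schur's test for the kernel \<open>(1 - t r) powr (1/p - 1)\<close> with the test function \<open>(1 - t) powr (- s)\<close>.\<close>

lemma gen_hilbert_bergman_estimate:
  fixes p \<alpha> :: real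
  assumes p: "1 < p" and a: "-1 < \<alpha>" "\<alpha> < p - 2"
  obtains K where "0 < K" "\<And>f g e C A I. \<lbrakk>f holomorphic_on unit_disc; g holomorphic_on unit_disc; 0 < e; 0 \<le> C;
     \<And>r. 0 \<le> r \<Longrightarrow> r < 1 \<Longrightarrow> integral_mean p r (deriv g) \<le> e * (1 - r) powr (1 / p - 1) + C;
     set_integrable lborel {0..<1} (\<lambda>t. f (complex_of_real t));
     (LINT t:{0..<1}|lborel. norm (f (complex_of_real t))) \<le> I; 0 \<le> A;
     (\<integral>\<^sup>+t\<in>{0..<1}. ennreal (norm (f (complex_of_real t)) powr p * (1 - t) powr (\<alpha> + 1)) \<partial>lborel) \<le> ennreal A\<rbrakk> \<Longrightarrow>
     bergman_nn p \<alpha> (gen_hilbert g f) \<le> ennreal (K * (e powr p * A + C powr p * I powr p))"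
proof -
  \<comment> \<open>The exponent of the test function has to lie between 1/p and 1 for the first
    kernel estimate. With this value the exponent \<open>c\<close> of the second one is (\<alpha> +
    1)/p - 1, and its conditions -1 < c and c + 1 < b amount to -1 < \<alpha> and \<alpha> < p -
    2.\<close>
  define s where "s = (\<alpha> + 2) / p"
  define b where "b = 1 - 1 / p"
  \<comment> \<open>The power of 1 - r left after Jensen: \<alpha> from the weight, and 1/p - s = -
    s + 1 - b from the first kernel integral raised to p - 1.\<close>
  define c where "c = \<alpha> + (1 / p - s) * (p - 1)"
  have s: "1 / p < s" "s < 1" using p a by (auto simp: s_def field_simps)
  have c_eq: "c = (\<alpha> + 1) / p - 1" using p by (simp add: c_def s_def field_simps)
  obtain C2 where C2: "0 < C2" "\<And>r. 0 \<le> r \<Longrightarrow> r < 1 \<Longrightarrow>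
    (\<integral>\<^sup>+t\<in>{0..<1}. ennreal ((1 - t) powr (- s) * (1 - t * r) powr (- b)) \<partial>lborel) \<le> ennreal (C2 * (1 - r) powr (- s + 1 - b))"
    using radial_kernel_integral[of "-s" b] s by (auto simp: b_def)
  have "(\<alpha> + 1) / p = (\<alpha> + 2) / p - 1 / p" by (simp add: diff_divide_distrib[symmetric])
  moreover have "(\<alpha> + 2) / p < 1" "0 < (\<alpha> + 1) / p" using p a by auto
  ultimately have "-1 < c" "c + 1 < b" unfolding c_eq b_def by linarith+
  then obtain C3 where C3: "0 < C3" "\<And>r. 0 \<le> r \<Longrightarrow> r < 1 \<Longrightarrow>
    (\<integral>\<^sup>+t\<in>{0..<1}. ennreal ((1 - t) powr c * (1 - t * r) powr (- b)) \<partial>lborel) \<le> ennreal (C3 * (1 - r) powr (c + 1 - b))"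
    using radial_kernel_integral[of c b] by auto
  define ca where "ca = max 1 (2 powr \<alpha>)"
  define K where "K = 2 * pi * 2 powr p * ca * (C2 powr (p - 1) * C3 + 1 / (\<alpha> + 1))"
  show ?thesis
  proof (rule that[of K])
    show "0 < K" using C2 C3 a by (auto simp: K_def ca_def intro!: mult_pos_pos add_pos_pos)
    fix f g :: "complex \<Rightarrow> complex" and e C A I :: real
    assume f: "f holomorphic_on unit_disc" and g: "g holomorphic_on unit_disc" and e: "0 < e" and C: "0 \<le> C"
      and gr: "\<And>r. 0 \<le> r \<Longrightarrow> r < 1 \<Longrightarrow> integral_mean p r (deriv g) \<le> e * (1 - r) powr (1 / p - 1) + C"
      and fi: "set_integrable lborel {0..<1} (\<lambda>t. f (complex_of_real t))"
      and I: "(LINT t:{0..<1}|lborel. norm (f (complex_of_real t))) \<le> I" and A0: "0 \<le> A"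
      and A: "(\<integral>\<^sup>+t\<in>{0..<1}. ennreal (norm (f (complex_of_real t)) powr p * (1 - t) powr (\<alpha> + 1)) \<partial>lborel) \<le> ennreal A"
    have [measurable]: "disc_ext f \<in> borel_measurable borel"
      using f by (intro disc_ext_measurable holomorphic_on_imp_continuous_on)
    define F where "F = (\<lambda>t. disc_ext f (complex_of_real t))"
    have [measurable]: "F \<in> borel_measurable borel" unfolding F_def by measurable
    have Feq: "F t = f (complex_of_real t)" if "t \<in> {0..<1}" for t using that by (simp add: F_def)
    have Fi: "set_integrable lborel {0..<1} F"
      using fi by (subst set_integrable_cong[OF refl refl Feq]) auto
    have I0: "0 \<le> I" using I unfolding set_lebesgue_integral_def
      by (rule order.trans[rotated]) (auto intro!: integral_nonneg_AE)
    define k where "k = (\<lambda>r t. (1 - t * r) powr (- b))"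
    have krt: "0 < 1 - t * r" if "t \<in> {0..<1}" "0 \<le> r" "r < 1" for t r :: real
      using that mult_left_le[of r t] by auto
    define T where "T = (\<lambda>r. LINT t:{0..<1}|lborel. norm (F t) * k r t)"
    have Ti: "set_integrable lborel {0..<1} (\<lambda>t. norm (F t) * k r t)" if r: "0 \<le> r" "r < 1" for r
    proof -
      have "integrable lborel (\<lambda>t. indicator {0..<1} t *\<^sub>R (norm (F t) * k r t))"
      proof (rule Bochner_Integration.integrable_bound)
        show "integrable lborel (\<lambda>t. (1 - r) powr (- b) * norm (indicator {0..<1} t *\<^sub>R F t))"
          using Fi unfolding set_integrable_def by (intro integrable_mult_right integrable_norm)
        show "(\<lambda>t. indicator {0..<1} t *\<^sub>R (norm (F t) * k r t)) \<in> borel_measurable lborel" unfolding k_def by measurable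
        have "indicator {0..<1} t *\<^sub>R (norm (F t) * k r t) \<le> (1 - r) powr (- b) * norm (indicator {0..<1} t *\<^sub>R F t)" for t
        proof (cases "t \<in> {0..<1}")
          case True
          have "t * r \<le> r" using True r by (intro mult_left_le_one_le) auto
          hence "k r t \<le> (1 - r) powr (- b)" unfolding k_def using r p by (intro powr_mono2') (auto simp: b_def)
          hence "norm (F t) * k r t \<le> norm (F t) * (1 - r) powr (- b)" by (intro mult_left_mono) auto
          thus ?thesis using True by (simp add: mult.commute)
        qed auto
        moreover have "0 \<le> indicator {0..<1} t *\<^sub>R (norm (F t) * k r t)" for t by (simp add: k_def)
        ultimately show "AE t in lborel. norm (indicator {0..<1} t *\<^sub>R (norm (F t) * k r t)) \<le> norm ((1 - r) powr (- b) * norm (indicator {0..<1} t *\<^sub>R F t))"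
          by (intro AE_I2) (smt (verit) real_norm_def)
      qed
      thus ?thesis by (simp add: set_integrable_def)
    qed
    have T0: "0 \<le> T r" for r unfolding T_def set_lebesgue_integral_def by (intro integral_nonneg_AE) (auto simp: k_def)
    have circ: "circle_power p r (gen_hilbert g f) \<le> ennreal (2 * pi * (e * T r + C * I) powr p)" if r: "0 \<le> r" "r < 1" for r
    proof -
      have cd: "continuous_on unit_disc (deriv g)" using g by (intro holomorphic_on_imp_continuous_on holomorphic_deriv) auto
      define m where "m = (\<lambda>t. if t \<in> {0..<1} then e * k r t + C else 1)"
      have mset: "set_integrable lborel {0..<1} (\<lambda>t. norm (F t) * m t) = set_integrable lborel {0..<1} (\<lambda>t. e * (norm (F t) * k r t) + C * norm (F t))"
        by (intro set_integrable_cong) (auto simp: m_def algebra_simps)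
      have "circle_power p r (\<lambda>z. LINT t:{0..<1}|lborel. F t * deriv g (complex_of_real t * z)) \<le> ennreal (2 * pi * (LINT t:{0..<1}|lborel. norm (F t) * m t) powr p)"
      proof (rule radial_minkowski[OF cd p r])
        show "m \<in> borel_measurable borel" unfolding m_def k_def by measurable
        show "0 < m t" for t using e C krt[of t r] r by (auto simp: m_def k_def intro!: add_pos_nonneg)
        show "set_integrable lborel {0..<1} (\<lambda>t. norm (F t) * m t)"
          unfolding mset using Ti[OF r] set_integrable_norm[OF Fi] by (intro set_integral_add set_integrable_mult_right) auto
        fix t :: real assume t: "t \<in> {0..<1}"
        have "integral_mean p (r * t) (deriv g) \<le> e * (1 - r * t) powr (1 / p - 1) + C"
          using krt[OF t r] t r by (intro gr) (auto simp: mult.commute)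
        thus "integral_mean p (r * t) (deriv g) \<le> m t" using t by (simp add: m_def k_def b_def mult.commute)
      qed auto
      also have "(LINT t:{0..<1}|lborel. norm (F t) * m t) = (LINT t:{0..<1}|lborel. e * (norm (F t) * k r t) + C * norm (F t))"
        by (intro set_lebesgue_integral_cong) (auto simp: m_def algebra_simps)
      also have "\<dots> = e * T r + C * (LINT t:{0..<1}|lborel. norm (F t))"
        using Ti[OF r] set_integrable_norm[OF Fi] by (subst set_integral_add) (auto simp: T_def)
      also have "(LINT t:{0..<1}|lborel. norm (F t)) = (LINT t:{0..<1}|lborel. norm (f (complex_of_real t)))"
        by (intro set_lebesgue_integral_cong) (auto simp: Feq)
      also have "ennreal (2 * pi * (e * T r + C * (LINT t:{0..<1}|lborel. norm (f (complex_of_real t)))) powr p) \<le> ennreal (2 * pi * (e * T r + C * I) powr p)"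
      proof (intro ennreal_leI mult_left_mono powr_mono2 add_left_mono I C)
        have "0 \<le> (LINT t:{0..<1}|lborel. norm (f (complex_of_real t)))" unfolding set_lebesgue_integral_def by (intro integral_nonneg_AE) auto
        thus "0 \<le> e * T r + C * (LINT t:{0..<1}|lborel. norm (f (complex_of_real t)))" using e T0[of r] C by simp
      qed (use p in auto)
      also have "circle_power p r (\<lambda>z. LINT t:{0..<1}|lborel. F t * deriv g (complex_of_real t * z)) = circle_power p r (gen_hilbert g f)"
        unfolding gen_hilbert_def
        by (intro circle_power_cong arg_cong[of _ _ norm] set_lebesgue_integral_cong) (auto simp: Feq)
      finally show ?thesis .
    qed
    have hd: "deriv g holomorphic_on unit_disc" using g by (intro holomorphic_deriv) auto
    have cH: "continuous_on unit_disc (gen_hilbert g f)"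
      unfolding gen_hilbert_def[abs_def] using holomorphic_integral_dilation[OF hd fi] by (rule holomorphic_on_imp_continuous_on)
    \<comment> \<open>What Jensen leaves under the double integral. Integrating over r first gives
      the power c + 1 - b of 1 - t, which together with s (p - 1) is exactly \<alpha> + 1.\<close>
    define L where "L = (\<lambda>r t. ennreal ((1 - r) powr c * (1 - t * r) powr (- b)) * (ennreal (norm (F t) powr p * (1 - t) powr (s * (p - 1))) * indicator {0..<1} t))"
    have [measurable]: "(\<lambda>(r, t). L r t) \<in> borel_measurable (lborel \<Otimes>\<^sub>M lborel)" unfolding L_def by measurable
    have Tp: "ennreal ((1 - r) powr \<alpha> * T r powr p) \<le> ennreal (C2 powr (p - 1)) * (\<integral>\<^sup>+t. L r t \<partial>lborel)" if r: "0 \<le> r" "r < 1" for r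
    proof -
      \<comment> \<open>Jensen's inequality requires a weight that is positive everywhere; at t = 1
        the power would be 0, hence the value 1 from there on.\<close>
      define m where "m = (\<lambda>t. if t < 1 then (1 - t) powr (- s) else 1)"
      define k' where "k' = (\<lambda>t. indicator {0..<1} t * k r t)"
      have km: "(\<lambda>t. k' t * m t) = (\<lambda>t. indicator {0..<1} t *\<^sub>R ((1 - t) powr (- s) * (1 - t * r) powr (- b)))"
        by (auto simp: k'_def m_def k_def indicator_def fun_eq_iff)
      have mm: "(\<lambda>t. indicator {0..<1} t *\<^sub>R ((1 - t) powr (- s) * (1 - t * r) powr (- b))) \<in> borel_measurable lborel" by measurable
      have si: "set_integrable lborel {0..<1} (\<lambda>t. (1 - t) powr (- s) * (1 - t * r) powr (- b))"
        using C2(2)[OF r] by (subst set_integrable_iff_nn_integral(1)[OF mm]) (auto simp: less_top[symmetric] top_unique)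
      have kmle: "(LINT t|lborel. k' t * m t) \<le> C2 * (1 - r) powr (- s + 1 - b)"
      proof -
        have "ennreal (LINT t:{0..<1}|lborel. (1 - t) powr (- s) * (1 - t * r) powr (- b)) \<le> ennreal (C2 * (1 - r) powr (- s + 1 - b))"
          using C2(2)[OF r] set_integrable_iff_nn_integral(2)[OF mm _ si] by simp
        thus ?thesis using C2 unfolding km set_lebesgue_integral_def by (subst (asm) ennreal_le_iff) auto
      qed
      have km0: "0 \<le> (LINT t|lborel. k' t * m t)" by (intro integral_nonneg_AE) (auto simp: k'_def m_def k_def)
      have "ennreal (norm (LINT t|lborel. k' t *\<^sub>R complex_of_real (norm (F t))) powr p) \<le>
        ennreal ((LINT t|lborel. k' t * m t) powr (p - 1)) * (\<integral>\<^sup>+t. ennreal (k' t * m t powr (1 - p) * norm (complex_of_real (norm (F t))) powr p) \<partial>lborel)"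
      proof (rule weighted_jensen[OF p])
        show "k' \<in> borel_measurable lborel" unfolding k'_def k_def by measurable
        show "m \<in> borel_measurable lborel" unfolding m_def by measurable
        show "0 \<le> k' t" for t by (simp add: k'_def k_def)
        show "0 < m t" for t by (simp add: m_def)
        show "integrable lborel (\<lambda>t. k' t * m t)" unfolding km using si by (simp add: set_integrable_def)
      qed measurable
      also have "(LINT t|lborel. k' t *\<^sub>R complex_of_real (norm (F t))) = complex_of_real (T r)"
        unfolding T_def set_lebesgue_integral_def
        by (subst integral_complex_of_real[symmetric]) (auto intro!: Bochner_Integration.integral_cong simp: k'_def scaleR_conv_of_real mult_ac)
      also have "norm (complex_of_real (T r)) = T r" using T0[of r] by simp
      also have "ennreal ((LINT t|lborel. k' t * m t) powr (p - 1)) * (\<integral>\<^sup>+t. ennreal (k' t * m t powr (1 - p) * norm (complex_of_real (norm (F t))) powr p) \<partial>lborel)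
         \<le> ennreal ((C2 * (1 - r) powr (- s + 1 - b)) powr (p - 1)) * (\<integral>\<^sup>+t. ennreal (k' t * m t powr (1 - p) * norm (complex_of_real (norm (F t))) powr p) \<partial>lborel)"
        using p km0 kmle by (intro mult_right_mono ennreal_leI powr_mono2) auto
      finally have 1: "ennreal (T r powr p) \<le> ennreal ((C2 * (1 - r) powr (- s + 1 - b)) powr (p - 1)) * (\<integral>\<^sup>+t. ennreal (k' t * m t powr (1 - p) * norm (complex_of_real (norm (F t))) powr p) \<partial>lborel)" .
      have "ennreal ((1 - r) powr \<alpha> * T r powr p) = ennreal ((1 - r) powr \<alpha>) * ennreal (T r powr p)" by (simp add: ennreal_mult)
      also have "\<dots> \<le> ennreal ((1 - r) powr \<alpha>) * (ennreal ((C2 * (1 - r) powr (- s + 1 - b)) powr (p - 1)) * (\<integral>\<^sup>+t. ennreal (k' t * m t powr (1 - p) * norm (complex_of_real (norm (F t))) powr p) \<partial>lborel))"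
        by (intro mult_left_mono 1) auto
      also have "\<dots> = ennreal (C2 powr (p - 1)) * (ennreal ((1 - r) powr c) * (\<integral>\<^sup>+t. ennreal (k' t * m t powr (1 - p) * norm (complex_of_real (norm (F t))) powr p) \<partial>lborel))"
      proof -
        have "(1 - r) powr \<alpha> * (C2 * (1 - r) powr (- s + 1 - b)) powr (p - 1) = C2 powr (p - 1) * (1 - r) powr c"
          using C2 r by (simp add: powr_mult powr_powr powr_add[symmetric] c_def b_def algebra_simps)
        hence "ennreal ((1 - r) powr \<alpha>) * ennreal ((C2 * (1 - r) powr (- s + 1 - b)) powr (p - 1)) = ennreal (C2 powr (p - 1)) * ennreal ((1 - r) powr c)"
          by (simp add: ennreal_mult[symmetric])
        thus ?thesis by (simp only: mult.assoc[symmetric])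
      qed
      also have "ennreal ((1 - r) powr c) * (\<integral>\<^sup>+t. ennreal (k' t * m t powr (1 - p) * norm (complex_of_real (norm (F t))) powr p) \<partial>lborel) = (\<integral>\<^sup>+t. L r t \<partial>lborel)"
      proof -
        have "ennreal ((1 - r) powr c) * (\<integral>\<^sup>+t. ennreal (k' t * m t powr (1 - p) * norm (complex_of_real (norm (F t))) powr p) \<partial>lborel)
          = (\<integral>\<^sup>+t. ennreal ((1 - r) powr c) * ennreal (k' t * m t powr (1 - p) * norm (complex_of_real (norm (F t))) powr p) \<partial>lborel)"
          by (rule nn_integral_cmult[symmetric]) (unfold k'_def k_def m_def, measurable)
        also have "\<dots> = (\<integral>\<^sup>+t. L r t \<partial>lborel)"
        proof (intro nn_integral_cong)
          fix t
          show "ennreal ((1 - r) powr c) * ennreal (k' t * m t powr (1 - p) * norm (complex_of_real (norm (F t))) powr p) = L r t"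
          proof (cases "t \<in> {0..<1}")
            case True
            have "((1 - t) powr (- s)) powr (1 - p) = (1 - t) powr (s * (p - 1))" by (simp add: powr_powr algebra_simps)
            thus ?thesis using True unfolding L_def k'_def m_def k_def by (simp add: ennreal_mult[symmetric] mult_ac)
          qed (simp add: L_def k'_def)
        qed
        finally show ?thesis .
      qed
      finally show ?thesis .
    qed
    have LL: "(\<integral>\<^sup>+r. (\<integral>\<^sup>+t. L r t \<partial>lborel) * indicator {0<..<1} r \<partial>lborel) \<le> ennreal (C3 * A)"
    proof -
      have "(\<integral>\<^sup>+r. (\<integral>\<^sup>+t. L r t \<partial>lborel) * indicator {0<..<1} r \<partial>lborel) = (\<integral>\<^sup>+r. (\<integral>\<^sup>+t. L r t * indicator {0<..<1} r \<partial>lborel) \<partial>lborel)"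
        by (intro nn_integral_cong nn_integral_multc[symmetric]) (unfold L_def, measurable)
      also have "\<dots> = (\<integral>\<^sup>+t. (\<integral>\<^sup>+r. L r t * indicator {0<..<1} r \<partial>lborel) \<partial>lborel)"
        by (rule lborel_pair.Fubini'[symmetric]) measurable
      also have "\<dots> \<le> (\<integral>\<^sup>+t. ennreal C3 * (ennreal (norm (f (complex_of_real t)) powr p * (1 - t) powr (\<alpha> + 1)) * indicator {0..<1} t) \<partial>lborel)"
      proof (intro nn_integral_mono)
        fix t
        show "(\<integral>\<^sup>+r. L r t * indicator {0<..<1} r \<partial>lborel) \<le> ennreal C3 * (ennreal (norm (f (complex_of_real t)) powr p * (1 - t) powr (\<alpha> + 1)) * indicator {0..<1} t)"
        proof (cases "t \<in> {0..<1}")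
          case t: True
          let ?x = "norm (F t) powr p * (1 - t) powr (s * (p - 1))"
          have "(\<integral>\<^sup>+r. L r t * indicator {0<..<1} r \<partial>lborel) \<le> (\<integral>\<^sup>+r. (ennreal ((1 - r) powr c * (1 - r * t) powr (- b)) * indicator {0..<1} r) * ennreal ?x \<partial>lborel)"
            using t by (intro nn_integral_mono) (auto simp: L_def indicator_def mult.commute)
          also have "\<dots> = (\<integral>\<^sup>+r\<in>{0..<1}. ennreal ((1 - r) powr c * (1 - r * t) powr (- b)) \<partial>lborel) * ennreal ?x"
            by (rule nn_integral_multc) measurable
          also have "\<dots> \<le> ennreal (C3 * (1 - t) powr (c + 1 - b)) * ennreal ?x"
            using t by (intro mult_right_mono C3) auto
          also have "\<dots> = ennreal (C3 * (norm (F t) powr p * ((1 - t) powr (c + 1 - b) * (1 - t) powr (s * (p - 1)))))"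
            using C3 by (subst ennreal_mult[symmetric]) (auto simp: mult_ac)
          also have "(1 - t) powr (c + 1 - b) * (1 - t) powr (s * (p - 1)) = (1 - t) powr (\<alpha> + 1)"
          proof -
            have "c + 1 - b + s * (p - 1) = \<alpha> + 1" using p by (simp add: c_def b_def field_simps)
            thus ?thesis unfolding powr_add[symmetric] by (simp only:)
          qed
          finally show ?thesis using t C3 by (simp add: Feq ennreal_mult)
        qed (simp add: L_def)
      qed
      also have "\<dots> = ennreal C3 * (\<integral>\<^sup>+t\<in>{0..<1}. ennreal (norm (f (complex_of_real t)) powr p * (1 - t) powr (\<alpha> + 1)) \<partial>lborel)"
      proof (rule nn_integral_cmult)
        have "(\<lambda>t. ennreal (norm (F t) powr p * (1 - t) powr (\<alpha> + 1)) * indicator {0..<1} t) \<in> borel_measurable lborel" by measurable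
        also have "(\<lambda>t. ennreal (norm (F t) powr p * (1 - t) powr (\<alpha> + 1)) * indicator {0..<1} t) = (\<lambda>t. ennreal (norm (f (complex_of_real t)) powr p * (1 - t) powr (\<alpha> + 1)) * indicator {0..<1} t)"
          by (auto simp: Feq indicator_def fun_eq_iff)
        finally show "(\<lambda>t. ennreal (norm (f (complex_of_real t)) powr p * (1 - t) powr (\<alpha> + 1)) * indicator {0..<1} t) \<in> borel_measurable lborel" .
      qed
      also have "\<dots> \<le> ennreal C3 * ennreal A" by (intro mult_left_mono A) auto
      also have "\<dots> = ennreal (C3 * A)" using C3 A0 by (simp add: ennreal_mult)
      finally show ?thesis .
    qed
    define c0 where "c0 = 2 * pi * 2 powr p * ca"
    have c0: "0 < c0" by (auto simp: c0_def ca_def intro!: mult_pos_pos)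
    have pt: "ennreal (r * (1 - r\<^sup>2) powr \<alpha>) * circle_power p r (gen_hilbert g f) * indicator {0<..<1} r \<le>
       ennreal (c0 * e powr p * C2 powr (p - 1)) * ((\<integral>\<^sup>+t. L r t \<partial>lborel) * indicator {0<..<1} r) + ennreal (c0 * (C powr p * I powr p)) * (ennreal ((1 - r) powr \<alpha>) * indicator {0..<1} r)" for r
    proof (cases "r \<in> {0<..<1}")
      case True
      hence r: "0 \<le> r" "r < 1" by auto
      have rw: "r * (1 - r\<^sup>2) powr \<alpha> \<le> (1 - r) powr \<alpha> * ca"
        using weight_le[OF r] by (simp add: ca_def mult.commute)
      have "ennreal (r * (1 - r\<^sup>2) powr \<alpha>) * circle_power p r (gen_hilbert g f) \<le> ennreal ((1 - r) powr \<alpha> * ca) * ennreal (2 * pi * (e * T r + C * I) powr p)"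
        by (rule mult_mono) (use circ[OF r] ennreal_leI[OF rw] in simp_all)
      also have "\<dots> = ennreal ((1 - r) powr \<alpha> * ca * (2 * pi * (e * T r + C * I) powr p))"
        by (intro ennreal_mult[symmetric]) (auto simp: ca_def)
      also have "\<dots> \<le> ennreal (c0 * e powr p * ((1 - r) powr \<alpha> * T r powr p) + c0 * (C powr p * I powr p) * (1 - r) powr \<alpha>)"
      proof (rule ennreal_leI)
        have "(e * T r + C * I) powr p \<le> 2 powr p * ((e * T r) powr p + (C * I) powr p)"
          using e T0[of r] C I0 p by (intro powr_add_le) auto
        also have "\<dots> = 2 powr p * (e powr p * T r powr p + C powr p * I powr p)"
          using e T0[of r] C I0 by (simp add: powr_mult)
        finally have "(1 - r) powr \<alpha> * ca * (2 * pi * (e * T r + C * I) powr p) \<le> (1 - r) powr \<alpha> * ca * (2 * pi * (2 powr p * (e powr p * T r powr p + C powr p * I powr p)))"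
          by (intro mult_left_mono) (auto simp: ca_def)
        also have "\<dots> = c0 * e powr p * ((1 - r) powr \<alpha> * T r powr p) + c0 * (C powr p * I powr p) * (1 - r) powr \<alpha>"
          by (simp add: c0_def algebra_simps)
        finally show "(1 - r) powr \<alpha> * ca * (2 * pi * (e * T r + C * I) powr p) \<le> c0 * e powr p * ((1 - r) powr \<alpha> * T r powr p) + c0 * (C powr p * I powr p) * (1 - r) powr \<alpha>" .
      qed
      also have "\<dots> = ennreal (c0 * e powr p) * ennreal ((1 - r) powr \<alpha> * T r powr p) + ennreal (c0 * (C powr p * I powr p)) * ennreal ((1 - r) powr \<alpha>)"
        using c0 by (simp add: ennreal_mult[symmetric] ennreal_plus[symmetric] del: ennreal_plus)
      also have "\<dots> \<le> ennreal (c0 * e powr p) * (ennreal (C2 powr (p - 1)) * (\<integral>\<^sup>+t. L r t \<partial>lborel)) + ennreal (c0 * (C powr p * I powr p)) * ennreal ((1 - r) powr \<alpha>)"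
        by (intro add_right_mono mult_left_mono Tp r) auto
      finally show ?thesis using True c0 by (simp add: ennreal_mult mult.assoc)
    qed auto
    have "bergman_nn p \<alpha> (gen_hilbert g f) = (\<integral>\<^sup>+r\<in>{0<..<1}. ennreal (r * (1 - r\<^sup>2) powr \<alpha>) * circle_power p r (gen_hilbert g f) \<partial>lborel)"
      by (rule bergman_nn_polar[OF cH])
    also have "\<dots> \<le> (\<integral>\<^sup>+r. ennreal (c0 * e powr p * C2 powr (p - 1)) * ((\<integral>\<^sup>+t. L r t \<partial>lborel) * indicator {0<..<1} r) + ennreal (c0 * (C powr p * I powr p)) * (ennreal ((1 - r) powr \<alpha>) * indicator {0..<1} r) \<partial>lborel)"
      by (intro nn_integral_mono pt)
    also have "\<dots> = ennreal (c0 * e powr p * C2 powr (p - 1)) * (\<integral>\<^sup>+r. (\<integral>\<^sup>+t. L r t \<partial>lborel) * indicator {0<..<1} r \<partial>lborel) + ennreal (c0 * (C powr p * I powr p)) * (\<integral>\<^sup>+r\<in>{0..<1}. ennreal ((1 - r) powr \<alpha>) \<partial>lborel)"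
      by (simp add: nn_integral_add nn_integral_cmult)
    also have "\<dots> \<le> ennreal (c0 * e powr p * C2 powr (p - 1)) * ennreal (C3 * A) + ennreal (c0 * (C powr p * I powr p)) * ennreal (1 / (\<alpha> + 1))"
      using LL integral_one_minus_powr(3)[OF a(1), of 0] by (intro add_mono mult_left_mono) auto
    also have "\<dots> = ennreal (c0 * e powr p * C2 powr (p - 1) * (C3 * A) + c0 * (C powr p * I powr p) * (1 / (\<alpha> + 1)))"
      using c0 C3 A0 a by (subst (1 2) ennreal_mult[symmetric]) (auto simp: ennreal_plus)
    also have "\<dots> \<le> ennreal (K * (e powr p * A + C powr p * I powr p))"
    proof (rule ennreal_leI)
      have 1: "c0 * (C2 powr (p - 1) * C3) \<le> K" "c0 * (1 / (\<alpha> + 1)) \<le> K"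
        unfolding K_def c0_def[symmetric] using c0 C2 C3 a by (intro mult_left_mono; simp)+
      have "c0 * (C2 powr (p - 1) * C3) * (e powr p * A) + c0 * (1 / (\<alpha> + 1)) * (C powr p * I powr p) \<le> K * (e powr p * A) + K * (C powr p * I powr p)"
        using 1 A0 by (intro add_mono mult_right_mono) auto
      thus "c0 * e powr p * C2 powr (p - 1) * (C3 * A) + c0 * (C powr p * I powr p) * (1 / (\<alpha> + 1)) \<le> K * (e powr p * A + C powr p * I powr p)"
        by (simp add: algebra_simps)
    qed
    finally show "bergman_nn p \<alpha> (gen_hilbert g f) \<le> ennreal (K * (e powr p * A + C powr p * I powr p))" .
  qed
qed

lemma radial_measurable:
  fixes f :: "complex \<Rightarrow> complex"
  assumes "f holomorphic_on unit_disc"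
  shows "(\<lambda>t. indicator {0..<1} t *\<^sub>R f (complex_of_real t)) \<in> borel_measurable borel"
proof -
  have [measurable]: "disc_ext f \<in> borel_measurable borel"
    using assms by (intro disc_ext_measurable holomorphic_on_imp_continuous_on)
  have "(\<lambda>t. indicator {0..<1} t *\<^sub>R disc_ext f (complex_of_real t)) \<in> borel_measurable borel" by measurable
  also have "(\<lambda>t. indicator {0..<1} t *\<^sub>R disc_ext f (complex_of_real t)) = (\<lambda>t. indicator {0..<1} t *\<^sub>R f (complex_of_real t))"
    by (auto simp: indicator_def fun_eq_iff)
  finally show ?thesis .
qed

text \<open>Young's inequality with the weight \<eta> (1 - t)^(\<alpha> + 1). The parameter \<eta>
  makes the norm term as small as desired; afterwards \<delta> close to 1 makes the other term
  small. This gives integrability on the radius (\<delta> = 0) and uniformly small tails.\<close>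

lemma radial_integral_tail:
  fixes f :: "complex \<Rightarrow> complex" and p \<alpha> A \<eta> \<delta> :: real
  assumes f: "f holomorphic_on unit_disc" and p: "1 < p" and a: "-1 < \<alpha>" "\<alpha> < p - 2"
    and A: "0 \<le> A" "(\<integral>\<^sup>+t\<in>{0..<1}. ennreal (norm (f (complex_of_real t)) powr p * (1 - t) powr (\<alpha> + 1)) \<partial>lborel) \<le> ennreal A"
    and \<eta>: "0 < \<eta>" and \<delta>: "0 \<le> \<delta>" "\<delta> \<le> 1"
  shows "(\<integral>\<^sup>+t\<in>{\<delta>..<1}. ennreal (norm (f (complex_of_real t))) \<partial>lborel) \<le>
    ennreal (\<eta> * A + \<eta> powr (- 1 / (p - 1)) * ((1 - \<delta>) powr (1 - (\<alpha> + 1) / (p - 1)) / (1 - (\<alpha> + 1) / (p - 1))))"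
proof -
  \<comment> \<open>The exponent of the dual weight. It exceeds -1 because \<alpha> < p - 2, the
    condition under which the operator is defined on the whole space.\<close>
  define \<beta> where "\<beta> = (\<alpha> + 1) * (- 1 / (p - 1))"
  have b: "-1 < \<beta>" using p a by (simp add: \<beta>_def field_simps)
  have [measurable]: "disc_ext f \<in> borel_measurable borel"
    using f by (intro disc_ext_measurable holomorphic_on_imp_continuous_on)
  let ?U = "\<lambda>t. ennreal (norm (disc_ext f (complex_of_real t)) powr p * (1 - t) powr (\<alpha> + 1)) * indicator {0..<1} t"
  have "(\<integral>\<^sup>+t\<in>{\<delta>..<1}. ennreal (norm (f (complex_of_real t))) \<partial>lborel) \<le>
    (\<integral>\<^sup>+t. ennreal \<eta> * ?U t + ennreal (\<eta> powr (- 1 / (p - 1))) * (ennreal ((1 - t) powr \<beta>) * indicator {\<delta>..<1} t) \<partial>lborel)"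
  proof (rule nn_integral_mono)
    fix t
    show "ennreal (norm (f (complex_of_real t))) * indicator {\<delta>..<1} t \<le> ennreal \<eta> * ?U t + ennreal (\<eta> powr (- 1 / (p - 1))) * (ennreal ((1 - t) powr \<beta>) * indicator {\<delta>..<1} t)"
    proof (cases "t \<in> {\<delta>..<1}")
      case True
      let ?x = "norm (f (complex_of_real t))"
      have w: "0 < \<eta> * (1 - t) powr (\<alpha> + 1)" using True \<eta> by simp
      have "?x \<le> \<eta> * (1 - t) powr (\<alpha> + 1) * ?x powr p + (\<eta> * (1 - t) powr (\<alpha> + 1)) powr (- 1 / (p - 1))"
        by (rule young_weight[OF _ w p]) simp
      also have "(\<eta> * (1 - t) powr (\<alpha> + 1)) powr (- 1 / (p - 1)) = \<eta> powr (- 1 / (p - 1)) * (1 - t) powr \<beta>"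
        unfolding \<beta>_def powr_powr[symmetric] using \<eta> True by (simp add: powr_mult)
      finally have "ennreal ?x \<le> ennreal (\<eta> * (?x powr p * (1 - t) powr (\<alpha> + 1)) + \<eta> powr (- 1 / (p - 1)) * (1 - t) powr \<beta>)"
        by (intro ennreal_leI) (simp add: mult_ac)
      also have "\<dots> = ennreal \<eta> * ennreal (?x powr p * (1 - t) powr (\<alpha> + 1)) + ennreal (\<eta> powr (- 1 / (p - 1))) * ennreal ((1 - t) powr \<beta>)"
        using \<eta> by (simp add: ennreal_mult ennreal_plus)
      finally show ?thesis using True \<delta> by (simp add: indicator_def)
    qed auto
  qed
  also have "\<dots> = ennreal \<eta> * (\<integral>\<^sup>+t. ?U t \<partial>lborel) + ennreal (\<eta> powr (- 1 / (p - 1))) * (\<integral>\<^sup>+t\<in>{\<delta>..<1}. ennreal ((1 - t) powr \<beta>) \<partial>lborel)"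
    by (simp add: nn_integral_add nn_integral_cmult)
  also have "(\<integral>\<^sup>+t. ?U t \<partial>lborel) = (\<integral>\<^sup>+t\<in>{0..<1}. ennreal (norm (f (complex_of_real t)) powr p * (1 - t) powr (\<alpha> + 1)) \<partial>lborel)"
    by (intro nn_integral_cong) (auto simp: indicator_def)
  also have "(\<integral>\<^sup>+t\<in>{\<delta>..<1}. ennreal ((1 - t) powr \<beta>) \<partial>lborel) = ennreal ((1 - \<delta>) powr (\<beta> + 1) / (\<beta> + 1))"
    by (rule integral_one_minus_powr(3)[OF b \<delta>(2)])
  also have "ennreal \<eta> * (\<integral>\<^sup>+t\<in>{0..<1}. ennreal (norm (f (complex_of_real t)) powr p * (1 - t) powr (\<alpha> + 1)) \<partial>lborel) + ennreal (\<eta> powr (- 1 / (p - 1))) * ennreal ((1 - \<delta>) powr (\<beta> + 1) / (\<beta> + 1))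
    \<le> ennreal \<eta> * ennreal A + ennreal (\<eta> powr (- 1 / (p - 1))) * ennreal ((1 - \<delta>) powr (\<beta> + 1) / (\<beta> + 1))"
    by (intro add_right_mono mult_left_mono A) auto
  also have "\<dots> = ennreal (\<eta> * A + \<eta> powr (- 1 / (p - 1)) * ((1 - \<delta>) powr (\<beta> + 1) / (\<beta> + 1)))"
    using \<eta> A b by (simp add: ennreal_mult[symmetric] ennreal_plus[symmetric] del: ennreal_plus)
  also have "\<beta> + 1 = 1 - (\<alpha> + 1) / (p - 1)" by (simp add: \<beta>_def)
  finally show ?thesis .
qed

lemma radial_integrable:
  fixes f :: "complex \<Rightarrow> complex" and p \<alpha> A :: real
  assumes f: "f holomorphic_on unit_disc" and p: "1 < p" and a: "-1 < \<alpha>" "\<alpha> < p - 2"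
    and A: "0 \<le> A" "(\<integral>\<^sup>+t\<in>{0..<1}. ennreal (norm (f (complex_of_real t)) powr p * (1 - t) powr (\<alpha> + 1)) \<partial>lborel) \<le> ennreal A"
  shows "set_integrable lborel {0..<1} (\<lambda>t. f (complex_of_real t))"
  unfolding set_integrable_def
proof (rule integrableI_bounded)
  show "(\<lambda>t. indicator {0..<1} t *\<^sub>R f (complex_of_real t)) \<in> borel_measurable lborel"
    using radial_measurable[OF f] by simp
  have "(\<integral>\<^sup>+t. ennreal (norm (indicator {0..<1} t *\<^sub>R f (complex_of_real t))) \<partial>lborel) = (\<integral>\<^sup>+t\<in>{0..<1}. ennreal (norm (f (complex_of_real t))) \<partial>lborel)"
    by (intro nn_integral_cong) (auto simp: indicator_def)
  also have "\<dots> < \<infinity>"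
    using radial_integral_tail[OF f p a A, of 1 0] by (auto simp: less_top[symmetric] top_unique)
  finally show "(\<integral>\<^sup>+t. ennreal (norm (indicator {0..<1} t *\<^sub>R f (complex_of_real t))) \<partial>lborel) < \<infinity>" .
qed

lemma bergman_norm_cong:
  assumes "\<And>z. norm z < 1 \<Longrightarrow> f z = h z" shows "bergman_norm p \<alpha> f = bergman_norm p \<alpha> h"
proof -
  have "(LINT z:unit_disc|lborel. norm (f z) powr p * (1 - (norm z)\<^sup>2) powr \<alpha>) = (LINT z:unit_disc|lborel. norm (h z) powr p * (1 - (norm z)\<^sup>2) powr \<alpha>)"
    using assms by (intro set_lebesgue_integral_cong) auto
  thus ?thesis by (simp add: bergman_norm_def)
qed

lemma set_integrable_mult_dilation:
  fixes G :: "complex \<Rightarrow> complex"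
  assumes cG: "continuous_on unit_disc G" and K: "set_integrable lborel {0..<1} K" and z: "norm z < 1"
  shows "set_integrable lborel {0..<1} (\<lambda>t. K t * G (complex_of_real t * z))"
proof -
  have tz: "norm (complex_of_real t * z) < 1" if "t \<in> {0..1}" for t
  proof -
    have "t * norm z \<le> 1 * norm z" using that by (intro mult_right_mono) auto
    thus ?thesis using that z by (simp add: norm_mult)
  qed
  have c: "continuous_on {0..1} (\<lambda>t. G (complex_of_real t * z))"
    by (intro continuous_on_compose2[OF cG] continuous_intros) (use tz in auto)
  have "bounded ((\<lambda>t. G (complex_of_real t * z)) ` {0..1})" by (intro compact_imp_bounded compact_continuous_image c compact_Icc)
  then obtain B where B: "\<And>t. t \<in> {0..1} \<Longrightarrow> norm (G (complex_of_real t * z)) \<le> B" unfolding bounded_iff by blast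
  have i: "integrable lborel (\<lambda>t. indicator {0..<1} t *\<^sub>R K t)" using K by (simp add: set_integrable_def)
  hence [measurable]: "(\<lambda>t. indicator {0..<1} t *\<^sub>R K t) \<in> borel_measurable borel" by auto
  have [measurable]: "(\<lambda>t. indicator {0..1} t *\<^sub>R G (complex_of_real t * z)) \<in> borel_measurable borel"
    by (intro borel_measurable_continuous_on_indicator c) auto
  have "integrable lborel (\<lambda>t. (indicator {0..<1} t *\<^sub>R K t) * (indicator {0..1} t *\<^sub>R G (complex_of_real t * z)))"
  proof (rule Bochner_Integration.integrable_bound)
    show "integrable lborel (\<lambda>t. B * norm (indicator {0..<1} t *\<^sub>R K t))" using i by (intro integrable_mult_right integrable_norm)
    have "norm ((indicator {0..<1} t *\<^sub>R K t) * (indicator {0..1} t *\<^sub>R G (complex_of_real t * z))) \<le> B * norm (indicator {0..<1} t *\<^sub>R K t)" for t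
      using B[of t] by (auto simp: indicator_def norm_mult mult.commute[of B] intro: mult_left_mono)
    thus "AE t in lborel. norm ((indicator {0..<1} t *\<^sub>R K t) * (indicator {0..1} t *\<^sub>R G (complex_of_real t * z))) \<le> norm (B * norm (indicator {0..<1} t *\<^sub>R K t))"
      unfolding real_norm_def using abs_ge_self order.trans by (intro AE_I2) blast
  qed measurable
  also have "(\<lambda>t. (indicator {0..<1} t *\<^sub>R K t) * (indicator {0..1} t *\<^sub>R G (complex_of_real t * z))) = (\<lambda>t. indicator {0..<1} t *\<^sub>R (K t * G (complex_of_real t * z)))"
    by (auto simp: indicator_def fun_eq_iff)
  finally show ?thesis by (simp add: set_integrable_def)
qed

text \<open>The limit of the images is the image of the locally uniform limit f. For the differences
  v from f the bergman estimate has a term with e^p, controlled by boundedness of v alone, and a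
  term with C and the integral of |v| over the radius, which tends to 0.\<close>

theorem small_growth_imp_compact:
  fixes p \<alpha> :: real and g :: "complex \<Rightarrow> complex"
  assumes p: "1 < p" and a: "-1 < \<alpha>" "\<alpha> < p - 2" and g: "g holomorphic_on unit_disc" and sg: "small_growth p g"
  shows "compact_operator (bergman_space p \<alpha>) (bergman_norm p \<alpha>) (bergman_space p \<alpha>) (bergman_norm p \<alpha>) (gen_hilbert g)"
proof -
  have hd: "deriv g holomorphic_on unit_disc" using g by (intro holomorphic_deriv) auto
  have cd: "continuous_on unit_disc (deriv g)" using hd by (rule holomorphic_on_imp_continuous_on)
  obtain CC where CC: "0 < CC" "\<And>f. f holomorphic_on unit_disc \<Longrightarrow>
    (\<integral>\<^sup>+t\<in>{0..<1}. ennreal (norm (f (complex_of_real t)) powr p * (1 - t) powr (\<alpha> + 1)) \<partial>lborel) \<le> ennreal CC * bergman_nn p \<alpha> f"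
    using bergman_radius_carleson[OF p, of \<alpha>] by blast
  define AA where "AA = (\<lambda>B. CC * (pi / (\<alpha> + 1) * B powr p))"
  have AA0: "0 \<le> AA B" for B using CC a by (simp add: AA_def)
  have car: "(\<integral>\<^sup>+t\<in>{0..<1}. ennreal (norm (f (complex_of_real t)) powr p * (1 - t) powr (\<alpha> + 1)) \<partial>lborel) \<le> ennreal (AA B)"
    if f: "f \<in> bergman_space p \<alpha>" and B: "bergman_norm p \<alpha> f \<le> B" for f B
  proof -
    have "(\<integral>\<^sup>+t\<in>{0..<1}. ennreal (norm (f (complex_of_real t)) powr p * (1 - t) powr (\<alpha> + 1)) \<partial>lborel) \<le> ennreal CC * bergman_nn p \<alpha> f"
      using f by (intro CC) (simp add: bergman_space_def)
    also have "bergman_nn p \<alpha> f = ennreal (pi / (\<alpha> + 1) * bergman_norm p \<alpha> f powr p)" using p by (intro bergman_nn_eq f a) auto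
    also have "ennreal CC * \<dots> \<le> ennreal CC * ennreal (pi / (\<alpha> + 1) * B powr p)"
      using B p a by (intro mult_left_mono ennreal_leI mult_left_mono powr_mono2) auto
    also have "\<dots> = ennreal (AA B)" using CC a by (subst ennreal_mult[symmetric]) (auto simp: AA_def)
    finally show ?thesis .
  qed
  have rint: "set_integrable lborel {0..<1} (\<lambda>t. f (complex_of_real t))" if f: "f \<in> bergman_space p \<alpha>" for f
    using radial_integrable[OF _ p a AA0 car[OF f order.refl]] f by (simp add: bergman_space_def)
  have Hhol: "gen_hilbert g f holomorphic_on unit_disc" if "set_integrable lborel {0..<1} (\<lambda>t. f (complex_of_real t))" for f
    unfolding gen_hilbert_def[abs_def] by (rule holomorphic_integral_dilation[OF hd that])
  obtain K where K: "0 < K" "\<And>f g e C A I. \<lbrakk>f holomorphic_on unit_disc; g holomorphic_on unit_disc; 0 < e; 0 \<le> C;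
     \<And>r. 0 \<le> r \<Longrightarrow> r < 1 \<Longrightarrow> integral_mean p r (deriv g) \<le> e * (1 - r) powr (1 / p - 1) + C;
     set_integrable lborel {0..<1} (\<lambda>t. f (complex_of_real t));
     (LINT t:{0..<1}|lborel. norm (f (complex_of_real t))) \<le> I; 0 \<le> A;
     (\<integral>\<^sup>+t\<in>{0..<1}. ennreal (norm (f (complex_of_real t)) powr p * (1 - t) powr (\<alpha> + 1)) \<partial>lborel) \<le> ennreal A\<rbrakk> \<Longrightarrow>
     bergman_nn p \<alpha> (gen_hilbert g f) \<le> ennreal (K * (e powr p * A + C powr p * I powr p))"
    by (rule gen_hilbert_bergman_estimate[OF p a]) blast
  have maps: "gen_hilbert g f \<in> bergman_space p \<alpha>" if f: "f \<in> bergman_space p \<alpha>" for f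
  proof -
    obtain C where C: "0 \<le> C" "\<And>r. 0 \<le> r \<Longrightarrow> r < 1 \<Longrightarrow> integral_mean p r (deriv g) \<le> 1 * (1 - r) powr (1 / p - 1) + C"
      using sg unfolding small_growth_def by (meson zero_less_one)
    have "bergman_nn p \<alpha> (gen_hilbert g f) \<le> ennreal (K * (1 powr p * AA (bergman_norm p \<alpha> f) + C powr p * (LINT t:{0..<1}|lborel. norm (f (complex_of_real t))) powr p))"
      using f by (intro K(2) g C rint[OF f] AA0 car[OF f]) (auto simp: bergman_space_def)
    thus ?thesis using Hhol[OF rint[OF f]] by (auto simp: bergman_space_iff less_top[symmetric] top_unique)
  qed
  show ?thesis unfolding compact_operator_def
  proof (intro conjI ballI allI impI)
    fix f assume "f \<in> bergman_space p \<alpha>" thus "gen_hilbert g f \<in> bergman_space p \<alpha>" by (rule maps)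
  next
    fix u :: "nat \<Rightarrow> complex \<Rightarrow> complex"
    assume u: "(\<forall>n. u n \<in> bergman_space p \<alpha>) \<and> bdd_above (range (\<lambda>n. bergman_norm p \<alpha> (u n)))"
    then obtain B where B: "\<And>n. bergman_norm p \<alpha> (u n) \<le> B" unfolding bdd_above_def by auto
    have B0: "0 \<le> B" by (rule order.trans[OF bergman_norm_nonneg B[of 0]])
    have uX: "u n \<in> bergman_space p \<alpha>" and uh: "u n holomorphic_on unit_disc" for n using u by (auto simp: bergman_space_def)
    \<comment> \<open>The ball of radius B is locally bounded by \<open>bergman_pointwise\<close>,
      so Montel's theorem applies to it.\<close>
    define HH where "HH = {h. h \<in> bergman_space p \<alpha> \<and> bergman_norm p \<alpha> h \<le> B}"
    obtain f \<sigma> where f: "f holomorphic_on unit_disc" and \<sigma>: "strict_mono (\<sigma> :: nat \<Rightarrow> nat)"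
      and ptw: "\<And>z. z \<in> unit_disc \<Longrightarrow> (\<lambda>n. u (\<sigma> n) z) \<longlonglongrightarrow> f z"
      and unif: "\<And>K. compact K \<Longrightarrow> K \<subseteq> unit_disc \<Longrightarrow> uniform_limit K (u \<circ> \<sigma>) f sequentially"
    proof (rule Montel[of unit_disc HH u])
      show "h holomorphic_on unit_disc" if "h \<in> HH" for h using that by (simp add: HH_def bergman_space_def)
      show "\<exists>b. \<forall>h\<in>HH. \<forall>z\<in>K. norm (h z) \<le> b" if K: "compact K" "K \<subseteq> unit_disc" for K
      proof -
        obtain \<rho> where \<rho>: "0 \<le> \<rho>" "\<rho> < 1" "K \<subseteq> cball 0 \<rho>"
        proof (cases "K = {}")
          case False
          then obtain z where z: "z \<in> K" "\<And>w. w \<in> K \<Longrightarrow> norm w \<le> norm z"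
            using continuous_attains_sup[OF K(1) False continuous_on_norm[OF continuous_on_id]] by auto
          thus ?thesis using K(2) by (intro that[of "norm z"]) auto
        qed (use that[of 0] in auto)
        obtain c where c: "0 < c" "\<And>h (z::complex). h \<in> bergman_space p \<alpha> \<Longrightarrow> norm z \<le> \<rho> \<Longrightarrow> norm (h z) \<le> c * bergman_norm p \<alpha> h"
          using bergman_pointwise[OF p a(1) \<rho>(1,2)] by blast
        have "norm (h z) \<le> c * B" if h: "h \<in> HH" and z: "z \<in> K" for h z
        proof -
          have "norm (h z) \<le> c * bergman_norm p \<alpha> h" using h z \<rho>(3) by (intro c(2)) (auto simp: HH_def)
          also have "\<dots> \<le> c * B" using h c by (intro mult_left_mono) (auto simp: HH_def)
          finally show ?thesis .
        qed
        thus ?thesis by blast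
      qed
      show "range u \<subseteq> HH" using uX B by (auto simp: HH_def)
    qed (auto simp: o_def)
    \<comment> \<open>Fatou's lemma along the pointwise convergent subsequence keeps the limit in
      the space.\<close>
    have fnn: "bergman_nn p \<alpha> f \<le> ennreal (pi / (\<alpha> + 1) * B powr p)"
      unfolding bergman_nn_def
    proof (rule nn_integral_le_of_AE_limit[where N=0 and u="\<lambda>n z. ennreal (norm (disc_ext (u (\<sigma> n)) z) powr p * (1 - (norm z)\<^sup>2) powr \<alpha>) * indicator unit_disc z"])
      have [measurable]: "disc_ext (u n) \<in> borel_measurable borel" for n
        using uh by (intro disc_ext_measurable holomorphic_on_imp_continuous_on)
      show "(\<lambda>z. ennreal (norm (disc_ext (u (\<sigma> n)) z) powr p * (1 - (norm z)\<^sup>2) powr \<alpha>) * indicator unit_disc z) \<in> borel_measurable lborel" for n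
        by measurable
      show "AE z in lborel. (\<lambda>n. ennreal (norm (disc_ext (u (\<sigma> n)) z) powr p * (1 - (norm z)\<^sup>2) powr \<alpha>) * indicator unit_disc z) \<longlonglongrightarrow> ennreal (norm (f z) powr p * (1 - (norm z)\<^sup>2) powr \<alpha>) * indicator unit_disc z"
      proof (rule AE_I2)
        fix z :: complex
        show "(\<lambda>n. ennreal (norm (disc_ext (u (\<sigma> n)) z) powr p * (1 - (norm z)\<^sup>2) powr \<alpha>) * indicator unit_disc z) \<longlonglongrightarrow> ennreal (norm (f z) powr p * (1 - (norm z)\<^sup>2) powr \<alpha>) * indicator unit_disc z"
        proof (cases "z \<in> unit_disc")
          case True
          have "(\<lambda>n. norm (u (\<sigma> n) z) powr p * (1 - (norm z)\<^sup>2) powr \<alpha>) \<longlonglongrightarrow> norm (f z) powr p * (1 - (norm z)\<^sup>2) powr \<alpha>"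
            using ptw[OF True] p by (intro tendsto_mult tendsto_powr' tendsto_norm tendsto_const) auto
          thus ?thesis using True by simp
        qed simp
      qed
      show "(\<integral>\<^sup>+z. ennreal (norm (disc_ext (u (\<sigma> n)) z) powr p * (1 - (norm z)\<^sup>2) powr \<alpha>) * indicator unit_disc z \<partial>lborel) \<le> ennreal (pi / (\<alpha> + 1) * B powr p)" for n
      proof -
        have "(\<integral>\<^sup>+z. ennreal (norm (disc_ext (u (\<sigma> n)) z) powr p * (1 - (norm z)\<^sup>2) powr \<alpha>) * indicator unit_disc z \<partial>lborel) = bergman_nn p \<alpha> (u (\<sigma> n))"
          unfolding bergman_nn_def by (intro nn_integral_cong) (auto simp: indicator_def)
        also have "\<dots> = ennreal (pi / (\<alpha> + 1) * bergman_norm p \<alpha> (u (\<sigma> n)) powr p)" using p by (intro bergman_nn_eq uX a) auto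
        also have "\<dots> \<le> ennreal (pi / (\<alpha> + 1) * B powr p)"
          using B p a by (intro ennreal_leI mult_left_mono powr_mono2) auto
        finally show ?thesis .
      qed
    qed
    hence fX: "f \<in> bergman_space p \<alpha>" using f by (auto simp: bergman_space_iff less_top[symmetric] top_unique)
    define v where "v = (\<lambda>n z. u (\<sigma> n) z - f z)"
    have vh: "v n holomorphic_on unit_disc" for n unfolding v_def using uh f by (intro holomorphic_intros) auto
    have vi: "set_integrable lborel {0..<1} (\<lambda>t. v n (complex_of_real t))" for n
      unfolding v_def by (intro set_integral_diff rint uX fX)
    define A where "A = 2 powr p * (AA B + AA (bergman_norm p \<alpha> f))"
    have A0: "0 \<le> A" using AA0 by (simp add: A_def)
    have vA: "(\<integral>\<^sup>+t\<in>{0..<1}. ennreal (norm (v n (complex_of_real t)) powr p * (1 - t) powr (\<alpha> + 1)) \<partial>lborel) \<le> ennreal A" for n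
    proof -
      have [measurable]: "disc_ext (u n) \<in> borel_measurable borel" "disc_ext f \<in> borel_measurable borel" for n
        using uh f by (auto intro!: disc_ext_measurable holomorphic_on_imp_continuous_on)
      let ?X = "\<lambda>h t. ennreal (norm (disc_ext h (complex_of_real t)) powr p * (1 - t) powr (\<alpha> + 1)) * indicator {0..<1} t"
      have X: "(\<integral>\<^sup>+t. ?X h t \<partial>lborel) = (\<integral>\<^sup>+t\<in>{0..<1}. ennreal (norm (h (complex_of_real t)) powr p * (1 - t) powr (\<alpha> + 1)) \<partial>lborel)" for h
        by (intro nn_integral_cong) (auto simp: indicator_def)
      have "(\<integral>\<^sup>+t\<in>{0..<1}. ennreal (norm (v n (complex_of_real t)) powr p * (1 - t) powr (\<alpha> + 1)) \<partial>lborel) \<le> (\<integral>\<^sup>+t. ennreal (2 powr p) * (?X (u (\<sigma> n)) t + ?X f t) \<partial>lborel)"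
      proof (rule nn_integral_mono)
        fix t :: real
        show "ennreal (norm (v n (complex_of_real t)) powr p * (1 - t) powr (\<alpha> + 1)) * indicator {0..<1} t \<le> ennreal (2 powr p) * (?X (u (\<sigma> n)) t + ?X f t)"
        proof (cases "t \<in> {0..<1}")
          case True
          let ?a = "norm (u (\<sigma> n) (complex_of_real t))" and ?b = "norm (f (complex_of_real t))" and ?w = "(1 - t) powr (\<alpha> + 1)"
          have "norm (v n (complex_of_real t)) powr p \<le> (?a + ?b) powr p"
            unfolding v_def using p by (intro powr_mono2 norm_triangle_ineq4) auto
          also have "\<dots> \<le> 2 powr p * (?a powr p + ?b powr p)" using p by (intro powr_add_le) auto
          finally have "norm (v n (complex_of_real t)) powr p * ?w \<le> 2 powr p * (?a powr p + ?b powr p) * ?w" by (rule mult_right_mono) simp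
          hence "ennreal (norm (v n (complex_of_real t)) powr p * ?w) \<le> ennreal (2 powr p * (?a powr p * ?w + ?b powr p * ?w))"
            by (intro ennreal_leI) (simp add: algebra_simps)
          also have "\<dots> = ennreal (2 powr p) * (ennreal (?a powr p * ?w) + ennreal (?b powr p * ?w))" by (simp add: ennreal_mult ennreal_plus)
          finally show ?thesis using True by simp
        qed auto
      qed
      also have "\<dots> = ennreal (2 powr p) * ((\<integral>\<^sup>+t. ?X (u (\<sigma> n)) t \<partial>lborel) + (\<integral>\<^sup>+t. ?X f t \<partial>lborel))"
        by (simp add: nn_integral_add nn_integral_cmult)
      also have "\<dots> \<le> ennreal (2 powr p) * (ennreal (AA B) + ennreal (AA (bergman_norm p \<alpha> f)))"
        unfolding X by (intro mult_left_mono add_mono car uX fX B order.refl) auto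
      also have "\<dots> = ennreal A" using AA0 by (simp add: A_def ennreal_mult ennreal_plus)
      finally show ?thesis .
    qed
    \<comment> \<open>On [0, \<delta>] the convergence is uniform, and the integral over [\<delta>,
      1) is uniformly small by \<open>radial_integral_tail\<close>; \<eta> is fixed first, then
      \<delta>, then the index.\<close>
    have I0: "(\<lambda>n. LINT t:{0..<1}|lborel. norm (v n (complex_of_real t))) \<longlonglongrightarrow> 0"
    proof (rule LIMSEQ_I)
      fix e :: real assume e: "0 < e"
      define \<eta> where "\<eta> = e / (4 * (A + 1))"
      have \<eta>: "0 < \<eta>" "\<eta> * A \<le> e / 4" using e A0 by (auto simp: \<eta>_def field_simps)
      define q where "q = 1 - (\<alpha> + 1) / (p - 1)"
      have q: "0 < q" using p a by (simp add: q_def field_simps)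
      define c where "c = \<eta> powr (- 1 / (p - 1))"
      have "((\<lambda>\<delta>. c * ((1 - \<delta>) powr q / q)) \<longlongrightarrow> c * ((1 - 1) powr q / q)) (at_left 1)"
        using q by (intro tendsto_intros tendsto_powr') (auto intro!: eventually_at_leftI[of 0])
      hence "\<forall>\<^sub>F \<delta> in at_left 1. c * ((1 - \<delta>) powr q / q) < e / 4" by (rule order_tendstoD(2)) (use e in simp)
      moreover have "\<forall>\<^sub>F \<delta> in at_left (1::real). \<delta> \<in> {0<..<1}" by (rule eventually_at_left_real) simp
      ultimately have "\<forall>\<^sub>F \<delta> in at_left (1::real). c * ((1 - \<delta>) powr q / q) < e / 4 \<and> \<delta> \<in> {0<..<1}" by (rule eventually_conj)
      then obtain \<delta> where \<delta>: "c * ((1 - \<delta>) powr q / q) < e / 4" "0 < \<delta>" "\<delta> < 1"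
        using eventually_happens[of _ "at_left (1::real)"] trivial_limit_at_left_real by fastforce
      have "uniform_limit (cball 0 \<delta>) (u \<circ> \<sigma>) f sequentially" using \<delta> by (intro unif) auto
      hence "\<exists>N. \<forall>n\<ge>N. \<forall>z\<in>cball 0 \<delta>. dist ((u \<circ> \<sigma>) n z) (f z) < e / 4"
        unfolding uniform_limit_sequentially_iff by (rule allE[where x="e / 4"]) (use e in auto)
      then obtain N where "\<forall>n\<ge>N. \<forall>z\<in>cball 0 \<delta>. dist ((u \<circ> \<sigma>) n z) (f z) < e / 4" ..
      hence N: "dist (u (\<sigma> n) z) (f z) < e / 4" if "n \<ge> N" "z \<in> cball 0 \<delta>" for n z
        using that by (auto simp only: o_apply)
      have "norm ((LINT t:{0..<1}|lborel. norm (v n (complex_of_real t))) - 0) < e" if n: "n \<ge> N" for n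
      proof -
        have m: "(\<lambda>t. indicator {0..<1} t *\<^sub>R norm (v n (complex_of_real t))) \<in> borel_measurable lborel"
          using set_integrable_norm[OF vi[of n]] unfolding set_integrable_def by measurable
        define w where "w = (\<lambda>t. indicator {0..<1} t *\<^sub>R v n (complex_of_real t))"
        have [measurable]: "w \<in> borel_measurable borel" unfolding w_def by (rule radial_measurable[OF vh])
        have "ennreal (LINT t:{0..<1}|lborel. norm (v n (complex_of_real t))) = (\<integral>\<^sup>+t\<in>{0..<1}. ennreal (norm (v n (complex_of_real t))) \<partial>lborel)"
          using set_integrable_iff_nn_integral(2)[OF m _ set_integrable_norm[OF vi]] by simp
        also have "\<dots> \<le> (\<integral>\<^sup>+t. ennreal (e / 4) * indicator {0..\<delta>} t + ennreal (norm (w t)) * indicator {\<delta>..<1} t \<partial>lborel)"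
        proof (rule nn_integral_mono)
          fix t :: real
          have "norm (v n (complex_of_real t)) \<le> e / 4" if "0 \<le> t" "t \<le> \<delta>"
            using N[OF n, of "complex_of_real t"] that by (auto simp: v_def dist_norm)
          thus "ennreal (norm (v n (complex_of_real t))) * indicator {0..<1} t \<le> ennreal (e / 4) * indicator {0..\<delta>} t + ennreal (norm (w t)) * indicator {\<delta>..<1} t"
            using \<delta> by (cases "t \<le> \<delta>") (auto simp: indicator_def w_def intro!: ennreal_leI add_increasing2)
        qed
        also have "\<dots> = (\<integral>\<^sup>+t. ennreal (e / 4) * indicator {0..\<delta>} t \<partial>lborel) + (\<integral>\<^sup>+t. ennreal (norm (w t)) * indicator {\<delta>..<1} t \<partial>lborel)"
          by (rule nn_integral_add) measurable
        also have "(\<integral>\<^sup>+t. ennreal (norm (w t)) * indicator {\<delta>..<1} t \<partial>lborel) = (\<integral>\<^sup>+t\<in>{\<delta>..<1}. ennreal (norm (v n (complex_of_real t))) \<partial>lborel)"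
          using \<delta> by (intro nn_integral_cong) (auto simp: indicator_def w_def)
        also have "\<dots> \<le> ennreal (\<eta> * A + c * ((1 - \<delta>) powr q / q))"
          unfolding c_def q_def using \<delta> by (intro radial_integral_tail[OF vh p a A0 vA \<eta>(1)]) auto
        also have "(\<integral>\<^sup>+t. ennreal (e / 4) * indicator {0..\<delta>} t \<partial>lborel) = ennreal (e / 4 * \<delta>)"
          using \<delta> e by (subst nn_integral_cmult_indicator) (auto simp: ennreal_mult[symmetric])
        also have "ennreal (e / 4 * \<delta>) + ennreal (\<eta> * A + c * ((1 - \<delta>) powr q / q)) = ennreal (e / 4 * \<delta> + (\<eta> * A + c * ((1 - \<delta>) powr q / q)))"
          using e \<delta> \<eta> A0 q by (intro ennreal_plus[symmetric]) (auto simp: c_def intro!: add_nonneg_nonneg)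
        finally have "ennreal (LINT t:{0..<1}|lborel. norm (v n (complex_of_real t))) \<le> ennreal (e / 4 * \<delta> + (\<eta> * A + c * ((1 - \<delta>) powr q / q)))"
          by (simp add: add_left_mono)
        hence "(LINT t:{0..<1}|lborel. norm (v n (complex_of_real t))) \<le> e / 4 * \<delta> + (\<eta> * A + c * ((1 - \<delta>) powr q / q))"
          using e \<delta> \<eta> A0 q by (subst (asm) ennreal_le_iff) (auto simp: c_def intro!: add_nonneg_nonneg)
        also have "\<dots> < e"
        proof -
          have "e / 4 * \<delta> \<le> e / 4 * 1" using e \<delta> by (intro mult_left_mono) auto
          thus ?thesis using \<eta>(2) \<delta>(1) e by linarith
        qed
        finally show ?thesis
          unfolding set_lebesgue_integral_def by (subst diff_0_right, subst real_norm_def, subst abs_of_nonneg) (auto intro!: integral_nonneg_AE)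
      qed
      thus "\<exists>N. \<forall>n\<ge>N. norm ((LINT t:{0..<1}|lborel. norm (v n (complex_of_real t))) - 0) < e" by blast
    qed
    have vX: "gen_hilbert g (v n) \<in> bergman_space p \<alpha>"
      and vle: "\<And>e C. 0 < e \<Longrightarrow> 0 \<le> C \<Longrightarrow> (\<And>r. 0 \<le> r \<Longrightarrow> r < 1 \<Longrightarrow> integral_mean p r (deriv g) \<le> e * (1 - r) powr (1 / p - 1) + C) \<Longrightarrow>
        bergman_nn p \<alpha> (gen_hilbert g (v n)) \<le> ennreal (K * (e powr p * A + C powr p * (LINT t:{0..<1}|lborel. norm (v n (complex_of_real t))) powr p))" for n
    proof -
      show le: "bergman_nn p \<alpha> (gen_hilbert g (v n)) \<le> ennreal (K * (e powr p * A + C powr p * (LINT t:{0..<1}|lborel. norm (v n (complex_of_real t))) powr p))"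
        if "0 < e" "0 \<le> C" "\<And>r. 0 \<le> r \<Longrightarrow> r < 1 \<Longrightarrow> integral_mean p r (deriv g) \<le> e * (1 - r) powr (1 / p - 1) + C" for e C
        by (rule K(2)[OF vh g that(1,2) that(3) vi order.refl A0 vA])
      obtain C where C: "0 \<le> C" "\<And>r. 0 \<le> r \<Longrightarrow> r < 1 \<Longrightarrow> integral_mean p r (deriv g) \<le> 1 * (1 - r) powr (1 / p - 1) + C"
        using sg unfolding small_growth_def by (meson zero_less_one)
      show "gen_hilbert g (v n) \<in> bergman_space p \<alpha>"
        using le[OF zero_less_one C] Hhol[OF vi] by (auto simp: bergman_space_iff less_top[symmetric] top_unique)
    qed
    have lim: "(\<lambda>n. bergman_norm p \<alpha> (gen_hilbert g (v n))) \<longlonglongrightarrow> 0"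
    proof (rule LIMSEQ_I)
      fix \<epsilon> :: real assume \<epsilon>: "0 < \<epsilon>"
      \<comment> \<open>The value of \<open>bergman_nn\<close> that corresponds to norm \<epsilon>;
        the two terms of the estimate are kept below 3/4 and 1/4 of it.\<close>
      define \<tau> where "\<tau> = pi / (\<alpha> + 1) * (\<epsilon> powr p)"
      have \<tau>: "0 < \<tau>" using \<epsilon> a by (simp add: \<tau>_def)
      define e where "e = (\<tau> / (2 * K * (A + 1))) powr (1 / p)"
      have e: "0 < e" "K * (e powr p * A) < \<tau> / 2 + \<tau> / 4"
      proof -
        have x: "0 < \<tau> / (2 * K * (A + 1))" using \<tau> K A0 by simp
        thus "0 < e" unfolding e_def by (subst powr_gt_zero) (metis less_irrefl)
        have "(y powr (1 / p)) powr p = y" if "0 < y" for y using that p by (simp add: powr_powr)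
        from this[OF x] have "e powr p = \<tau> / (2 * K * (A + 1))" unfolding e_def .
        moreover have "k * (\<tau> / (2 * k * d) * A) = \<tau> / 2 * (A / d)" if "k \<noteq> 0" "d \<noteq> 0" for k d
          using that by simp
        from this[of K "A + 1"] have "K * (\<tau> / (2 * K * (A + 1)) * A) = \<tau> / 2 * (A / (A + 1))" using K(1) A0 by linarith
        ultimately have "K * (e powr p * A) = \<tau> / 2 * (A / (A + 1))" by (simp only:)
        also have "\<dots> \<le> \<tau> / 2 * 1" using \<tau> A0 by (intro mult_left_mono) auto
        finally show "K * (e powr p * A) < \<tau> / 2 + \<tau> / 4" using \<tau> by simp
      qed
      \<comment> \<open>C depends on e, so e is fixed before the index is taken large enough for the
        C-term.\<close>
      obtain C where C: "0 \<le> C" "\<And>r. 0 \<le> r \<Longrightarrow> r < 1 \<Longrightarrow> integral_mean p r (deriv g) \<le> e * (1 - r) powr (1 / p - 1) + C"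
        using sg e(1) unfolding small_growth_def by meson
      have "(\<lambda>n. K * (C powr p * (LINT t:{0..<1}|lborel. norm (v n (complex_of_real t))) powr p)) \<longlonglongrightarrow> K * (C powr p * 0 powr p)"
        using I0 p by (intro tendsto_mult tendsto_const tendsto_powr')
          (auto simp: set_lebesgue_integral_def intro!: always_eventually integral_nonneg_AE)
      hence "\<forall>\<^sub>F n in sequentially. K * (C powr p * (LINT t:{0..<1}|lborel. norm (v n (complex_of_real t))) powr p) < \<tau> / 4"
        by (rule order_tendstoD(2)) (use \<tau> in simp)
      then obtain N where N: "\<And>n. n \<ge> N \<Longrightarrow> K * (C powr p * (LINT t:{0..<1}|lborel. norm (v n (complex_of_real t))) powr p) < \<tau> / 4"
        by (auto simp: eventually_sequentially)
      have "norm (bergman_norm p \<alpha> (gen_hilbert g (v n)) - 0) < \<epsilon>" if n: "n \<ge> N" for n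
      proof -
        let ?b = "bergman_norm p \<alpha> (gen_hilbert g (v n))"
        have "ennreal (pi / (\<alpha> + 1) * ?b powr p) \<le> ennreal (K * (e powr p * A + C powr p * (LINT t:{0..<1}|lborel. norm (v n (complex_of_real t))) powr p))"
          using vle[OF e(1) C, of n] bergman_nn_eq[OF vX _ a(1), of n] p by simp
        hence "pi / (\<alpha> + 1) * ?b powr p \<le> K * (e powr p * A + C powr p * (LINT t:{0..<1}|lborel. norm (v n (complex_of_real t))) powr p)"
          using K A0 by (subst (asm) ennreal_le_iff) auto
        also have "\<dots> = K * (e powr p * A) + K * (C powr p * (LINT t:{0..<1}|lborel. norm (v n (complex_of_real t))) powr p)"
          by (simp add: distrib_left)
        also have "\<dots> < \<tau>" using e(2) N[OF n] by linarith
        finally have "?b powr p < \<epsilon> powr p" using a unfolding \<tau>_def by (subst (asm) mult_less_cancel_left_pos) auto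
        hence "?b < \<epsilon>" using p \<epsilon> by (meson bergman_norm_nonneg less_imp_le not_le powr_mono2 zero_less_one order.trans)
        thus ?thesis by simp
      qed
      thus "\<exists>N. \<forall>n\<ge>N. norm (bergman_norm p \<alpha> (gen_hilbert g (v n)) - 0) < \<epsilon>" by blast
    qed
    \<comment> \<open>The norm sees only the values on the disc, where linearity of the integral
      identifies the two functions.\<close>
    have eq: "bergman_norm p \<alpha> (gen_hilbert g (u (\<sigma> n)) - gen_hilbert g f) = bergman_norm p \<alpha> (gen_hilbert g (v n))" for n
    proof (rule bergman_norm_cong)
      fix z :: complex assume z: "norm z < 1"
      show "(gen_hilbert g (u (\<sigma> n)) - gen_hilbert g f) z = gen_hilbert g (v n) z"
        unfolding gen_hilbert_def v_def fun_diff_def left_diff_distrib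
        using set_integrable_mult_dilation[OF cd rint[OF uX] z] set_integrable_mult_dilation[OF cd rint[OF fX] z]
        by (intro set_integral_diff(2)[symmetric]) auto
    qed
    show "\<exists>\<sigma>. \<exists>y\<in>bergman_space p \<alpha>. strict_mono \<sigma> \<and> (\<lambda>n. bergman_norm p \<alpha> (gen_hilbert g (u (\<sigma> n)) - y)) \<longlonglongrightarrow> 0"
      using \<sigma> maps[OF fX] lim eq by (intro exI[of _ \<sigma>] bexI[of _ "gen_hilbert g f"]) auto
  qed
qed

section \<open>Necessity\<close>

lemma beta_integral:
  fixes a b :: real
  assumes a: "-1 < a" and b: "-1 < b"
  shows "set_integrable lborel {0..<1} (\<lambda>t. t powr a * (1 - t) powr b)"
    and "(LINT t:{0..<1}|lborel. t powr a * (1 - t) powr b) = Beta (a + 1) (b + 1)"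
proof -
  have eq: "(\<lambda>t. indicator {0..<1} t *\<^sub>R (t powr a * (1 - t) powr b)) = (\<lambda>t::real. indicator {0..1} t *\<^sub>R (t powr (a + 1 - 1) * (1 - t) powr (b + 1 - 1)))"
    by (auto simp: indicator_def fun_eq_iff)
  have i: "set_integrable lborel {0..1} (\<lambda>t. t powr (a + 1 - 1) * (1 - t) powr (b + 1 - 1))"
    using a b by (intro integrable_Beta) auto
  show "set_integrable lborel {0..<1} (\<lambda>t. t powr a * (1 - t) powr b)"
    using i unfolding set_integrable_def eq .
  have "(LINT t:{0..<1}|lborel. t powr a * (1 - t) powr b) = (LINT t:{0..1}|lborel. t powr (a + 1 - 1) * (1 - t) powr (b + 1 - 1))"
    unfolding set_lebesgue_integral_def eq ..
  also have "\<dots> = integral {0..1} (\<lambda>t. t powr (a + 1 - 1) * (1 - t) powr (b + 1 - 1))"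
    by (rule set_borel_integral_eq_integral(2)[OF i])
  also have "\<dots> = Beta (a + 1) (b + 1)"
    using a b by (intro integral_unique has_integral_Beta_real) auto
  finally show "(LINT t:{0..<1}|lborel. t powr a * (1 - t) powr b) = Beta (a + 1) (b + 1)" .
qed

text \<open>From t <= exp(t - 1) one gets t^x <= exp(-x (1 - t)), and the substitution u = x (1 - t)
  turns the integral into part of Euler's integral for Gamma(c).\<close>

lemma beta_integral_upper:
  fixes x c :: real
  assumes x: "0 < x" and c: "0 < c"
  shows "(\<integral>\<^sup>+t\<in>{0..<1}. ennreal (t powr x * (1 - t) powr (c - 1)) \<partial>lborel) \<le> ennreal (Gamma c * x powr (- c))"
proof -
  define h where "h = (\<lambda>u::real. ennreal (indicator {0..} u * u powr (c - 1) / exp u))"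
  have [measurable]: "h \<in> borel_measurable borel" unfolding h_def by measurable
  have "(\<integral>\<^sup>+t\<in>{0..<1}. ennreal (t powr x * (1 - t) powr (c - 1)) \<partial>lborel) \<le> (\<integral>\<^sup>+t. ennreal (x powr (1 - c)) * h (x + (- x) * t) \<partial>lborel)"
  proof (rule nn_integral_mono)
    fix t :: real
    show "ennreal (t powr x * (1 - t) powr (c - 1)) * indicator {0..<1} t \<le> ennreal (x powr (1 - c)) * h (x + (- x) * t)"
    proof (cases "t \<in> {0..<1}")
      case True
      have u: "x + (- x) * t = x * (1 - t)" by (simp add: algebra_simps)
      have "t \<le> exp (t - 1)" using exp_ge_add_one_self[of "t - 1"] by simp
      hence "t powr x \<le> exp (t - 1) powr x" using True x by (intro powr_mono2) auto
      also have "\<dots> = 1 / exp (x * (1 - t))" by (simp add: powr_def exp_minus[symmetric] inverse_eq_divide[symmetric] algebra_simps)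
      finally have "t powr x * (1 - t) powr (c - 1) \<le> 1 / exp (x * (1 - t)) * (1 - t) powr (c - 1)" by (rule mult_right_mono) simp
      also have "\<dots> = x powr (1 - c) * ((x * (1 - t)) powr (c - 1) / exp (x * (1 - t)))"
      proof -
        have "x powr (1 - c) * x powr (c - 1) = 1" using x by (simp add: powr_add[symmetric])
        thus ?thesis using True x by (simp add: powr_mult)
      qed
      finally have "ennreal (t powr x * (1 - t) powr (c - 1)) \<le> ennreal (x powr (1 - c) * ((x * (1 - t)) powr (c - 1) / exp (x * (1 - t))))" by (rule ennreal_leI)
      also have "\<dots> = ennreal (x powr (1 - c)) * h (x + (- x) * t)"
        unfolding u h_def using True x by (simp add: ennreal_mult[symmetric])
      finally show ?thesis using True by simp
    qed auto
  qed
  also have "\<dots> = ennreal (x powr (1 - c)) * (\<integral>\<^sup>+t. h (x + (- x) * t) \<partial>lborel)"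
    by (rule nn_integral_cmult) measurable
  also have "ennreal (x powr (1 - c)) = ennreal (x powr (- c)) * ennreal \<bar>- x\<bar>"
    using x by (simp add: ennreal_mult[symmetric] powr_diff powr_minus field_simps)
  also have "ennreal (x powr (- c)) * ennreal \<bar>- x\<bar> * (\<integral>\<^sup>+t. h (x + (- x) * t) \<partial>lborel) = ennreal (x powr (- c)) * (\<integral>\<^sup>+u. h u \<partial>lborel)"
    using nn_integral_real_affine[of h "- x" x] x by (simp add: mult.assoc)
  also have "(\<integral>\<^sup>+u. h u \<partial>lborel) = ennreal (Gamma c)"
    unfolding h_def by (rule Gamma_conv_nn_integral_real[OF c, symmetric])
  also have "ennreal (x powr (- c)) * ennreal (Gamma c) = ennreal (Gamma c * x powr (- c))"
    using c by (simp add: ennreal_mult[symmetric] mult.commute)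
  finally show ?thesis .
qed

text \<open>On the radius this is the Beta density t^k (1 - t)^(-\<gamma>), so its moments are Beta
  values; the factor z^k pushes the mass towards |z| = 1 - 1/k.\<close>

definition test_function :: "real \<Rightarrow> nat \<Rightarrow> complex \<Rightarrow> complex" where
  "test_function \<gamma> k z = z ^ k * (1 - z) powr (- complex_of_real \<gamma>)"

lemma test_function_holomorphic: "test_function \<gamma> k holomorphic_on unit_disc"
proof -
  have "1 - z \<notin> \<real>\<^sub>\<le>\<^sub>0" if "z \<in> unit_disc" for z
  proof -
    have "Re z < 1" using that complex_Re_le_cmod[of z] by simp
    thus ?thesis by (auto simp: complex_nonpos_Reals_iff)
  qed
  thus ?thesis unfolding test_function_def[abs_def] by (intro holomorphic_intros) auto
qed

lemma norm_test_function: "norm (test_function \<gamma> k z) = norm z ^ k * norm (1 - z) powr (- \<gamma>)"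
  by (simp add: test_function_def norm_mult norm_power norm_powr_real_powr')

text \<open>k > 0 matters at t = 0, where \<open>0 ^ 0 = 1\<close> but
  \<open>0 powr 0 = 0\<close>.\<close>

lemma test_function_of_real:
  assumes "t \<in> {0..<1}" "0 < k"
  shows "test_function \<gamma> k (complex_of_real t) = complex_of_real (t powr real k * (1 - t) powr (- \<gamma>))"
proof -
  have "complex_of_real (1 - t) powr complex_of_real (- \<gamma>) = complex_of_real ((1 - t) powr (- \<gamma>))"
    using assms by (intro powr_of_real) auto
  moreover have "t ^ k = t powr real k" using assms by (cases "t = 0") (auto simp: powr_realpow)
  ultimately show ?thesis by (simp add: test_function_def flip: of_real_power)
qed

text \<open>Since \<gamma> p > 1, the circle integral of |1 - z|^(-\<gamma> p) is of order (1 -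
  r)^(1 - \<gamma> p). What remains is a Beta integral with r^(k p) and exponent \<alpha> + 1 -
  \<gamma> p > -1, which decays like the stated power of k.\<close>

lemma test_function_bergman:
  fixes p \<alpha> \<gamma> :: real
  assumes p: "1 < p" and a: "-1 < \<alpha>" and g: "1 / p < \<gamma>" "\<gamma> < (\<alpha> + 2) / p"
  obtains C where "0 < C" "\<And>k. 0 < k \<Longrightarrow> bergman_nn p \<alpha> (test_function \<gamma> k) \<le> ennreal (C * real k powr (- (\<alpha> + 2 - \<gamma> * p)))"
proof -
  define b where "b = \<gamma> * p"
  have b: "1 < b" "b < \<alpha> + 2" using g p by (auto simp: b_def field_simps)
  obtain K where K: "0 < K" "\<And>r. 0 \<le> r \<Longrightarrow> r < 1 \<Longrightarrow>
    (\<integral>\<^sup>+t\<in>{0..2*pi}. ennreal (norm (1 - complex_of_real r * cis t) powr (- b)) \<partial>lborel) \<le> ennreal (K * (1 - r) powr (1 - b))"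
    using circle_kernel_integral[OF b(1)] by blast
  define ca where "ca = max 1 (2 powr \<alpha>)"
  define c where "c = \<alpha> + 2 - b"
  have c: "0 < c" using b by (simp add: c_def)
  define C where "C = ca * K * (Gamma c * p powr (- c))"
  show ?thesis
  proof (rule that[of C])
    show "0 < C" using K c p by (auto simp: C_def ca_def intro!: mult_pos_pos Gamma_real_pos)
    fix k :: nat assume k: "0 < k"
    have circ: "circle_power p r (test_function \<gamma> k) \<le> ennreal (K * (r powr (real k * p) * (1 - r) powr (1 - b)))" if r: "0 < r" "r < 1" for r
    proof -
      have eq: "norm (test_function \<gamma> k (complex_of_real r * cis t)) powr p = r powr (real k * p) * norm (1 - complex_of_real r * cis t) powr (- b)" for t
      proof -
        have "norm (test_function \<gamma> k (complex_of_real r * cis t)) = r powr real k * norm (1 - complex_of_real r * cis t) powr (- \<gamma>)"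
          using r by (simp add: norm_test_function norm_mult powr_realpow)
        thus ?thesis by (simp add: powr_mult powr_powr b_def)
      qed
      have "circle_power p r (test_function \<gamma> k) = (\<integral>\<^sup>+t. ennreal (r powr (real k * p)) * (ennreal (norm (1 - complex_of_real r * cis t) powr (- b)) * indicator {0..2*pi} t) \<partial>lborel)"
        unfolding circle_power_def eq by (intro nn_integral_cong) (simp add: ennreal_mult mult.assoc)
      also have "\<dots> = ennreal (r powr (real k * p)) * (\<integral>\<^sup>+t\<in>{0..2*pi}. ennreal (norm (1 - complex_of_real r * cis t) powr (- b)) \<partial>lborel)"
        by (rule nn_integral_cmult) measurable
      also have "\<dots> \<le> ennreal (r powr (real k * p)) * ennreal (K * (1 - r) powr (1 - b))"
        using r by (intro mult_left_mono K(2)) auto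
      also have "\<dots> = ennreal (K * (r powr (real k * p) * (1 - r) powr (1 - b)))"
        using K by (subst ennreal_mult[symmetric]) (auto simp: mult_ac)
      finally show ?thesis .
    qed
    have "bergman_nn p \<alpha> (test_function \<gamma> k) = (\<integral>\<^sup>+r\<in>{0<..<1}. ennreal (r * (1 - r\<^sup>2) powr \<alpha>) * circle_power p r (test_function \<gamma> k) \<partial>lborel)"
      by (intro bergman_nn_polar holomorphic_on_imp_continuous_on test_function_holomorphic)
    also have "\<dots> \<le> (\<integral>\<^sup>+r. ennreal (ca * K) * (ennreal (r powr (real k * p) * (1 - r) powr (c - 1)) * indicator {0..<1} r) \<partial>lborel)"
    proof (rule nn_integral_mono)
      fix r :: real
      show "ennreal (r * (1 - r\<^sup>2) powr \<alpha>) * circle_power p r (test_function \<gamma> k) * indicator {0<..<1} r \<le> ennreal (ca * K) * (ennreal (r powr (real k * p) * (1 - r) powr (c - 1)) * indicator {0..<1} r)"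
      proof (cases "r \<in> {0<..<1}")
        case True
        hence r: "0 < r" "r < 1" by auto
        have w: "r * (1 - r\<^sup>2) powr \<alpha> \<le> ca * (1 - r) powr \<alpha>" unfolding ca_def by (rule weight_le) (use r in auto)
        have "ennreal (r * (1 - r\<^sup>2) powr \<alpha>) * circle_power p r (test_function \<gamma> k) \<le> ennreal (ca * (1 - r) powr \<alpha>) * ennreal (K * (r powr (real k * p) * (1 - r) powr (1 - b)))"
          by (rule mult_mono[OF ennreal_leI[OF w] circ[OF r]]) auto
        also have "\<dots> = ennreal (ca * (1 - r) powr \<alpha> * (K * (r powr (real k * p) * (1 - r) powr (1 - b))))"
          using K by (intro ennreal_mult[symmetric]) (auto simp: ca_def)
        also have "ca * (1 - r) powr \<alpha> * (K * (r powr (real k * p) * (1 - r) powr (1 - b))) = ca * K * (r powr (real k * p) * (1 - r) powr (c - 1))"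
        proof -
          have "(1 - r) powr (c - 1) = (1 - r) powr \<alpha> * (1 - r) powr (1 - b)"
            unfolding powr_add[symmetric] by (rule arg_cong) (simp add: c_def)
          thus ?thesis by (simp add: mult_ac)
        qed
        also have "ennreal \<dots> = ennreal (ca * K) * ennreal (r powr (real k * p) * (1 - r) powr (c - 1))"
          using K by (intro ennreal_mult) (auto simp: ca_def)
        finally show ?thesis using r by simp
      qed auto
    qed
    also have "\<dots> = ennreal (ca * K) * (\<integral>\<^sup>+r\<in>{0..<1}. ennreal (r powr (real k * p) * (1 - r) powr (c - 1)) \<partial>lborel)"
      by (rule nn_integral_cmult) measurable
    also have "\<dots> \<le> ennreal (ca * K) * ennreal (Gamma c * (real k * p) powr (- c))"
      using k p c by (intro mult_left_mono beta_integral_upper) auto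
    also have "\<dots> = ennreal (C * real k powr (- c))"
      using K c p k by (subst ennreal_mult[symmetric]) (auto simp: C_def ca_def powr_mult mult_ac)
    finally show "bergman_nn p \<alpha> (test_function \<gamma> k) \<le> ennreal (C * real k powr (- (\<alpha> + 2 - \<gamma> * p)))"
      by (simp add: c_def b_def)
  qed
qed

text \<open>Abel inversion: the two Beta moments multiply to \<open>\<kappa> / (n + k + 1)\<close>, the moments of
  \<open>\<kappa> x\<^sup>k dx\<close>.\<close>

lemma abel_inversion:
  fixes G :: "complex \<Rightarrow> complex" and \<gamma> :: real and k :: nat
  assumes G: "G holomorphic_on unit_disc" and \<gamma>: "0 < \<gamma>" "\<gamma> < 1" and k: "0 < k" and z: "norm z < 1"
  shows "(LINT t:{0..<1}|lborel. complex_of_real (t powr (real k + 1 - \<gamma>) * (1 - t) powr (\<gamma> - 1)) *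
       (LINT s:{0..<1}|lborel. test_function \<gamma> k (complex_of_real s) * G (complex_of_real s * (complex_of_real t * z)))) =
     complex_of_real (Gamma (1 - \<gamma>) * Gamma \<gamma>) * (LINT x:{0..<1}|lborel. complex_of_real (x powr real k) * G (complex_of_real x * z))"
proof -
  define b where "b = (\<lambda>n. (deriv ^^ n) G 0 / fact n)"
  have bs: "(\<lambda>n. b n * w ^ n) sums G w" if "norm w < 1" for w
    unfolding b_def by (rule holomorphic_power_series_disc[OF G that])
  have moment: "set_integrable lborel {0..<1} (\<lambda>t. complex_of_real (t powr c * (1 - t) powr d))"
    "(LINT t:{0..<1}|lborel. complex_of_real (t powr c * (1 - t) powr d) * complex_of_real t ^ n) = complex_of_real (Beta (c + real n + 1) (d + 1))"
    if c: "0 < c" and d: "-1 < d" for c d :: real and n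
  proof -
    have "set_integrable lborel {0..<1} (\<lambda>t. t powr c * (1 - t) powr d)" using c d by (intro beta_integral) auto
    thus "set_integrable lborel {0..<1} (\<lambda>t. complex_of_real (t powr c * (1 - t) powr d))"
      unfolding set_integrable_def by (simp add: scaleR_conv_of_real flip: of_real_mult)
    have "(LINT t:{0..<1}|lborel. complex_of_real (t powr c * (1 - t) powr d) * complex_of_real t ^ n) = (LINT t:{0..<1}|lborel. complex_of_real (t powr (c + real n) * (1 - t) powr d))"
    proof (intro set_lebesgue_integral_cong allI impI)
      fix t :: real assume t: "t \<in> {0..<1}"
      have "t powr (c + real n) = t powr c * t ^ n" using t c by (cases "t = 0") (auto simp: powr_add powr_realpow)
      thus "complex_of_real (t powr c * (1 - t) powr d) * complex_of_real t ^ n = complex_of_real (t powr (c + real n) * (1 - t) powr d)" by simp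
    qed auto
    also have "\<dots> = complex_of_real (LINT t:{0..<1}|lborel. t powr (c + real n) * (1 - t) powr d)"
      by (rule set_integral_complex_of_real)
    also have "\<dots> = complex_of_real (Beta (c + real n + 1) (d + 1))" using c d by (subst beta_integral(2)) auto
    finally show "(LINT t:{0..<1}|lborel. complex_of_real (t powr c * (1 - t) powr d) * complex_of_real t ^ n) = complex_of_real (Beta (c + real n + 1) (d + 1))" .
  qed
  define H where "H = (\<lambda>w. LINT s:{0..<1}|lborel. test_function \<gamma> k (complex_of_real s) * G (complex_of_real s * w))"
  define \<mu> where "\<mu> = (\<lambda>n. complex_of_real (Beta (real k + real n + 1) (1 - \<gamma>)))"
  \<comment> \<open>The power k + 1 - \<gamma> in the outer kernel is chosen so that the first
    argument of this Beta value is the sum of the two arguments of the inner one.\<close>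
  define \<nu> where "\<nu> = (\<lambda>n. complex_of_real (Beta (real k + 1 - \<gamma> + real n + 1) \<gamma>))"
  have "set_integrable lborel {0..<1} (\<lambda>s. test_function \<gamma> k (complex_of_real s)) = set_integrable lborel {0..<1} (\<lambda>s. complex_of_real (s powr real k * (1 - s) powr (- \<gamma>)))"
    using k by (intro set_integrable_cong) (auto simp: test_function_of_real)
  hence ti: "set_integrable lborel {0..<1} (\<lambda>s. test_function \<gamma> k (complex_of_real s))"
    using moment(1)[of "real k" "- \<gamma>"] k \<gamma> by simp
  have tm: "(LINT s:{0..<1}|lborel. test_function \<gamma> k (complex_of_real s) * complex_of_real s ^ n) = \<mu> n" for n
  proof -
    have "(LINT s:{0..<1}|lborel. test_function \<gamma> k (complex_of_real s) * complex_of_real s ^ n) = (LINT s:{0..<1}|lborel. complex_of_real (s powr real k * (1 - s) powr (- \<gamma>)) * complex_of_real s ^ n)"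
      using k by (intro set_lebesgue_integral_cong) (auto simp: test_function_of_real)
    also have "\<dots> = \<mu> n" using moment(2)[of "real k" "- \<gamma>" n] k \<gamma> by (simp add: \<mu>_def add.commute)
    finally show ?thesis .
  qed
  have Hs: "(\<lambda>n. b n * \<mu> n * w ^ n) sums H w" if "norm w < 1" for w
    using integral_dilation_sums[OF bs ti that] unfolding tm H_def .
  have 1: "(\<lambda>n. b n * \<mu> n * \<nu> n * z ^ n) sums (LINT t:{0..<1}|lborel. complex_of_real (t powr (real k + 1 - \<gamma>) * (1 - t) powr (\<gamma> - 1)) * H (complex_of_real t * z))"
  proof -
    have c: "0 < real k + 1 - \<gamma>" "-1 < \<gamma> - 1" using k \<gamma> by auto
    show ?thesis using integral_dilation_sums[OF Hs moment(1)[OF c] z] unfolding moment(2)[OF c] by (simp add: \<nu>_def)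
  qed
  have "(\<lambda>n. b n * (LINT x:{0..<1}|lborel. complex_of_real (x powr real k) * complex_of_real x ^ n) * z ^ n) sums (LINT x:{0..<1}|lborel. complex_of_real (x powr real k) * G (complex_of_real x * z))"
  proof (rule integral_dilation_sums[OF bs _ z])
    have "set_integrable lborel {0..<1} (\<lambda>x. complex_of_real (x powr real k)) = set_integrable lborel {0..<1} (\<lambda>x. complex_of_real (x powr real k * (1 - x) powr 0))"
      by (intro set_integrable_cong) auto
    thus "set_integrable lborel {0..<1} (\<lambda>x. complex_of_real (x powr real k))" using moment(1)[of "real k" 0] k by simp
  qed
  hence "(\<lambda>n. complex_of_real (Gamma (1 - \<gamma>) * Gamma \<gamma>) * (b n * (LINT x:{0..<1}|lborel. complex_of_real (x powr real k) * complex_of_real x ^ n) * z ^ n)) sums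
     (complex_of_real (Gamma (1 - \<gamma>) * Gamma \<gamma>) * (LINT x:{0..<1}|lborel. complex_of_real (x powr real k) * G (complex_of_real x * z)))"
    by (rule sums_mult)
  moreover have "complex_of_real (Gamma (1 - \<gamma>) * Gamma \<gamma>) * (b n * (LINT x:{0..<1}|lborel. complex_of_real (x powr real k) * complex_of_real x ^ n) * z ^ n) = b n * \<mu> n * \<nu> n * z ^ n" for n
  proof -
    have "(LINT x:{0..<1}|lborel. complex_of_real (x powr real k) * complex_of_real x ^ n) = (LINT x:{0..<1}|lborel. complex_of_real (x powr real k * (1 - x) powr 0) * complex_of_real x ^ n)"
      by (intro set_lebesgue_integral_cong) auto
    also have "\<dots> = complex_of_real (Beta (real k + real n + 1) 1)" using moment(2)[of "real k" 0 n] k by simp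
    finally have m: "(LINT x:{0..<1}|lborel. complex_of_real (x powr real k) * complex_of_real x ^ n) = complex_of_real (Beta (real k + real n + 1) 1)" .
    \<comment> \<open>With y = k + n + 1 the value Gamma(y + 1 - \<gamma>) is the denominator of the
      first Beta factor and a numerator of the second; it cancels and leaves Gamma(y)/Gamma(y + 1) =
      Beta(y, 1).\<close>
    define y where "y = real k + real n + 1"
    have y: "0 < y" "0 < y + (1 - \<gamma>)" using \<gamma> by (auto simp: y_def)
    have "Beta y (1 - \<gamma>) * Beta (y + (1 - \<gamma>)) \<gamma> = Gamma (1 - \<gamma>) * Gamma \<gamma> * Beta y 1"
    proof -
      have "Gamma (y + (1 - \<gamma>)) \<noteq> 0" using y by (metis Gamma_real_pos less_irrefl)
      thus ?thesis by (simp add: Beta_def)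
    qed
    moreover have "real k + 1 - \<gamma> + real n + 1 = y + (1 - \<gamma>)" by (simp add: y_def)
    hence "\<nu> n = complex_of_real (Beta (y + (1 - \<gamma>)) \<gamma>)" unfolding \<nu>_def by (simp only:)
    moreover have "\<mu> n = complex_of_real (Beta y (1 - \<gamma>))" by (simp add: \<mu>_def y_def)
    ultimately have "\<mu> n * \<nu> n = complex_of_real (Gamma (1 - \<gamma>) * Gamma \<gamma>) * complex_of_real (Beta y 1)"
      by (simp flip: of_real_mult)
    thus ?thesis unfolding m y_def[symmetric] by (simp add: mult_ac)
  qed
  ultimately have "(\<lambda>n. b n * \<mu> n * \<nu> n * z ^ n) sums (complex_of_real (Gamma (1 - \<gamma>) * Gamma \<gamma>) * (LINT x:{0..<1}|lborel. complex_of_real (x powr real k) * G (complex_of_real x * z)))"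
    by (simp only:)
  from sums_unique2[OF 1 this] show ?thesis by (simp add: H_def)
qed

lemma bergman_space_diff:
  assumes f: "f \<in> bergman_space p \<alpha>" and h: "h \<in> bergman_space p \<alpha>" and p: "0 < p"
  shows "f - h \<in> bergman_space p \<alpha>"
proof -
  have fh: "f holomorphic_on unit_disc" and hh: "h holomorphic_on unit_disc" using f h by (auto simp: bergman_space_def)
  have [measurable]: "disc_ext f \<in> borel_measurable borel" "disc_ext h \<in> borel_measurable borel"
    using fh hh by (auto intro!: disc_ext_measurable holomorphic_on_imp_continuous_on)
  let ?X = "\<lambda>h z. ennreal (norm (disc_ext h z) powr p * (1 - (norm z)\<^sup>2) powr \<alpha>) * indicator unit_disc z"
  have X: "(\<integral>\<^sup>+z. ?X h z \<partial>lborel) = bergman_nn p \<alpha> h" for h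
    unfolding bergman_nn_def by (intro nn_integral_cong) (auto simp: indicator_def)
  have "bergman_nn p \<alpha> (f - h) \<le> (\<integral>\<^sup>+z. ennreal (2 powr p) * (?X f z + ?X h z) \<partial>lborel)"
    unfolding bergman_nn_def
  proof (rule nn_integral_mono)
    fix z :: complex
    show "ennreal (norm ((f - h) z) powr p * (1 - (norm z)\<^sup>2) powr \<alpha>) * indicator unit_disc z \<le> ennreal (2 powr p) * (?X f z + ?X h z)"
    proof (cases "z \<in> unit_disc")
      case True
      let ?a = "norm (f z)" and ?b = "norm (h z)" and ?w = "(1 - (norm z)\<^sup>2) powr \<alpha>"
      have "norm ((f - h) z) powr p \<le> (?a + ?b) powr p"
        unfolding fun_diff_def using p by (intro powr_mono2 norm_triangle_ineq4) auto
      also have "\<dots> \<le> 2 powr p * (?a powr p + ?b powr p)" using p by (intro powr_add_le) auto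
      finally have "norm ((f - h) z) powr p * ?w \<le> 2 powr p * (?a powr p + ?b powr p) * ?w" by (rule mult_right_mono) simp
      hence "ennreal (norm ((f - h) z) powr p * ?w) \<le> ennreal (2 powr p * (?a powr p * ?w + ?b powr p * ?w))"
        by (intro ennreal_leI) (simp add: algebra_simps)
      also have "\<dots> = ennreal (2 powr p) * (ennreal (?a powr p * ?w) + ennreal (?b powr p * ?w))" by (simp add: ennreal_mult ennreal_plus)
      finally show ?thesis using True by simp
    qed auto
  qed
  also have "\<dots> = ennreal (2 powr p) * (bergman_nn p \<alpha> f + bergman_nn p \<alpha> h)"
    unfolding X[symmetric] by (simp add: nn_integral_add nn_integral_cmult)
  also have "\<dots> < \<infinity>" using f h by (simp add: bergman_space_iff ennreal_mult_less_top)
  finally show ?thesis using fh hh by (simp add: bergman_space_iff fun_diff_def holomorphic_on_diff)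
qed

lemma bergman_nn_scale:
  assumes f: "f holomorphic_on unit_disc"
  shows "bergman_nn p \<alpha> (\<lambda>z. c * f z) = ennreal (norm c powr p) * bergman_nn p \<alpha> f"
proof -
  have [measurable]: "disc_ext f \<in> borel_measurable borel"
    using f by (auto intro!: disc_ext_measurable holomorphic_on_imp_continuous_on)
  have "bergman_nn p \<alpha> (\<lambda>z. c * f z) = (\<integral>\<^sup>+z. ennreal (norm c powr p) * (ennreal (norm (disc_ext f z) powr p * (1 - (norm z)\<^sup>2) powr \<alpha>) * indicator unit_disc z) \<partial>lborel)"
    unfolding bergman_nn_def by (intro nn_integral_cong) (auto simp: indicator_def norm_mult powr_mult ennreal_mult mult.assoc)
  also have "\<dots> = ennreal (norm c powr p) * (\<integral>\<^sup>+z. ennreal (norm (disc_ext f z) powr p * (1 - (norm z)\<^sup>2) powr \<alpha>) * indicator unit_disc z \<partial>lborel)"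
    by (rule nn_integral_cmult) measurable
  also have "(\<integral>\<^sup>+z. ennreal (norm (disc_ext f z) powr p * (1 - (norm z)\<^sup>2) powr \<alpha>) * indicator unit_disc z \<partial>lborel) = bergman_nn p \<alpha> f"
    unfolding bergman_nn_def by (intro nn_integral_cong) (auto simp: indicator_def)
  finally show ?thesis .
qed

text \<open>Otherwise a subsequence of the images stays away from 0 in norm. Compactness gives it a
  norm limit along a further subsequence; norm convergence implies pointwise convergence, so that
  limit vanishes on the disc, a contradiction.\<close>

lemma compact_operator_null:
  assumes p: "1 < p" and a: "-1 < \<alpha>"
    and T: "compact_operator X NX (bergman_space p \<alpha>) (bergman_norm p \<alpha>) T"
    and u: "\<And>n. u n \<in> X" and bdd: "\<And>n. NX (u n) \<le> B"
    and ptw: "\<And>z. norm z < 1 \<Longrightarrow> (\<lambda>n. T (u n) z) \<longlonglongrightarrow> 0"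
  shows "(\<lambda>n. bergman_norm p \<alpha> (T (u n))) \<longlonglongrightarrow> 0"
proof (rule ccontr)
  assume "\<not> ?thesis"
  then obtain e where e: "0 < e" "\<And>N. \<exists>n\<ge>N. e \<le> bergman_norm p \<alpha> (T (u n))"
    unfolding LIMSEQ_iff by (auto simp: bergman_norm_nonneg not_less)
  define S where "S = {n. e \<le> bergman_norm p \<alpha> (T (u n))}"
  have "infinite S" unfolding infinite_nat_iff_unbounded_le S_def using e(2) by auto
  then obtain \<tau> :: "nat \<Rightarrow> nat" where \<tau>: "strict_mono \<tau>" "\<And>n. \<tau> n \<in> S"
    using infinite_enumerate[of S] by blast
  have "\<exists>\<sigma> :: nat \<Rightarrow> nat. \<exists>y\<in>bergman_space p \<alpha>. strict_mono \<sigma> \<and> (\<lambda>n. bergman_norm p \<alpha> (T (u (\<tau> (\<sigma> n))) - y)) \<longlonglongrightarrow> 0"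
  proof -
    have "(\<forall>n. u (\<tau> n) \<in> X) \<and> bdd_above (range (\<lambda>n. NX (u (\<tau> n))))"
      using u bdd by (auto intro!: bdd_aboveI[of _ B])
    thus ?thesis using T unfolding compact_operator_def by (auto dest!: spec[of _ "\<lambda>n. u (\<tau> n)"])
  qed
  then obtain \<sigma> y where \<sigma>: "strict_mono (\<sigma> :: nat \<Rightarrow> nat)" and y: "y \<in> bergman_space p \<alpha>"
    and lim: "(\<lambda>n. bergman_norm p \<alpha> (T (u (\<tau> (\<sigma> n))) - y)) \<longlonglongrightarrow> 0" by blast
  have D: "T (u (\<tau> (\<sigma> n))) - y \<in> bergman_space p \<alpha>" for n
    using T u y p unfolding compact_operator_def by (intro bergman_space_diff) auto
  have sub: "strict_mono (\<lambda>n. \<tau> (\<sigma> n))" using strict_mono_o[OF \<tau>(1) \<sigma>] by (simp add: o_def)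
  \<comment> \<open>Point evaluation is continuous on the Bergman space, so the norm limit must
    agree with the pointwise limit 0.\<close>
  have y0: "y z = 0" if z: "norm z < 1" for z
  proof -
    obtain C where C: "0 < C" "\<And>f (w :: complex). f \<in> bergman_space p \<alpha> \<Longrightarrow> norm w \<le> norm z \<Longrightarrow> norm (f w) \<le> C * bergman_norm p \<alpha> f"
      using bergman_pointwise[OF p a norm_ge_zero z] by blast
    have 1: "(\<lambda>n. T (u (\<tau> (\<sigma> n))) z - y z) \<longlonglongrightarrow> 0"
    proof (rule Lim_null_comparison)
      show "\<forall>\<^sub>F n in sequentially. norm (T (u (\<tau> (\<sigma> n))) z - y z) \<le> C * bergman_norm p \<alpha> (T (u (\<tau> (\<sigma> n))) - y)"
        using C(2)[OF D order.refl] by simp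
      show "(\<lambda>n. C * bergman_norm p \<alpha> (T (u (\<tau> (\<sigma> n))) - y)) \<longlonglongrightarrow> 0"
        using tendsto_mult[OF tendsto_const lim] by simp
    qed
    have "(\<lambda>n. T (u (\<tau> (\<sigma> n))) z) \<longlonglongrightarrow> 0"
      using LIMSEQ_subseq_LIMSEQ[OF ptw[OF z] sub] by (simp add: o_def)
    hence "(\<lambda>n. T (u (\<tau> (\<sigma> n))) z - y z) \<longlonglongrightarrow> 0 - y z" by (intro tendsto_diff tendsto_const)
    with 1 have "0 - y z = 0" by (rule LIMSEQ_unique[rotated])
    thus ?thesis by simp
  qed
  have "e \<le> bergman_norm p \<alpha> (T (u (\<tau> (\<sigma> n))) - y)" for n
  proof -
    have "bergman_norm p \<alpha> (T (u (\<tau> (\<sigma> n))) - y) = bergman_norm p \<alpha> (T (u (\<tau> (\<sigma> n))))"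
      by (rule bergman_norm_cong) (simp add: y0)
    thus ?thesis using \<tau>(2)[of "\<sigma> n"] by (simp add: S_def)
  qed
  hence "e \<le> 0" by (intro LIMSEQ_le_const[OF lim]) auto
  thus False using e(1) by simp
qed

lemma beta_integral_le:
  fixes x c :: real
  assumes x: "0 < x" and c: "0 < c"
  shows "(LINT t:{0..<1}|lborel. t powr x * (1 - t) powr (c - 1)) \<le> Gamma c * x powr (- c)"
proof -
  have "(\<lambda>t. indicator {0..<1} t *\<^sub>R (t powr x * (1 - t) powr (c - 1))) \<in> borel_measurable lborel" by measurable
  hence "ennreal (LINT t:{0..<1}|lborel. t powr x * (1 - t) powr (c - 1)) = (\<integral>\<^sup>+t\<in>{0..<1}. ennreal (t powr x * (1 - t) powr (c - 1)) \<partial>lborel)"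
    using x c by (intro set_integrable_iff_nn_integral(2)[symmetric] beta_integral) auto
  also have "\<dots> \<le> ennreal (Gamma c * x powr (- c))" by (rule beta_integral_upper[OF x c])
  finally show ?thesis using c by (subst (asm) ennreal_le_iff) (auto intro!: mult_nonneg_nonneg less_imp_le[OF Gamma_real_pos])
qed

text \<open>For fixed z the derivative of g is bounded on |w| <= |z|, so the image is bounded by the
  mass of the Beta density, of order k^(\<gamma> - 1). Multiplied by the normalisation k^((\<alpha>
  + 2)/p - \<gamma>), this still tends to 0 if \<alpha> + 2 < p.\<close>

lemma gen_hilbert_test_function_bound:
  fixes g :: "complex \<Rightarrow> complex" and \<gamma> :: real
  assumes g: "g holomorphic_on unit_disc" and \<gamma>: "\<gamma> < 1" and z: "norm z < 1"
  obtains C where "0 \<le> C" "\<And>k. 0 < k \<Longrightarrow> norm (gen_hilbert g (test_function \<gamma> k) z) \<le> C * real k powr (\<gamma> - 1)"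
proof -
  have "deriv g holomorphic_on unit_disc" using g by (intro holomorphic_deriv) auto
  hence "continuous_on (cball 0 (norm z)) (deriv g)"
    using z by (intro holomorphic_on_imp_continuous_on) (auto elim!: holomorphic_on_subset)
  hence "bounded (deriv g ` cball 0 (norm z))" by (intro compact_imp_bounded compact_continuous_image) auto
  then obtain B where B: "0 < B" "\<And>w. norm w \<le> norm z \<Longrightarrow> norm (deriv g w) \<le> B"
    unfolding bounded_pos by auto
  show ?thesis
  proof (rule that[of "B * Gamma (1 - \<gamma>)"])
    show "0 \<le> B * Gamma (1 - \<gamma>)" using B \<gamma> by (intro mult_nonneg_nonneg less_imp_le[OF Gamma_real_pos]) auto
    fix k :: nat assume k: "0 < k"
    let ?f = "\<lambda>t. indicator {0..<1} t *\<^sub>R (test_function \<gamma> k (complex_of_real t) * deriv g (complex_of_real t * z))"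
    let ?h = "\<lambda>t::real. B * (indicator {0..<1} t *\<^sub>R (t powr real k * (1 - t) powr (1 - \<gamma> - 1)))"
    have hi: "integrable lborel ?h"
      using beta_integral(1)[of "real k" "1 - \<gamma> - 1"] k \<gamma> unfolding set_integrable_def by (intro integrable_mult_right) auto
    have h0: "0 \<le> (LINT t|lborel. ?h t)" using B by (intro integral_nonneg_AE) auto
    have "norm (LINT t|lborel. ?f t) \<le> (LINT t|lborel. ?h t)"
    \<comment> \<open>A non-integrable function has Bochner integral 0, and then \<open>h0\<close>
      gives the inequality.\<close>
    proof (cases "integrable lborel ?f")
      case True
      show ?thesis
      proof (rule Bochner_Integration.integral_norm_bound_integral[OF True hi])
        fix t :: real
        show "norm (?f t) \<le> ?h t"
        proof (cases "t \<in> {0..<1}")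
          case t: True
          have "norm (complex_of_real t * z) \<le> norm z" using t by (simp add: norm_mult mult_left_le_one_le)
          hence "norm (deriv g (complex_of_real t * z)) \<le> B" by (rule B)
          hence "t powr real k * (1 - t) powr (- \<gamma>) * norm (deriv g (complex_of_real t * z)) \<le> t powr real k * (1 - t) powr (- \<gamma>) * B"
            by (intro mult_left_mono) auto
          thus ?thesis using t k by (simp add: test_function_of_real norm_mult mult_ac)
        qed auto
      qed
    qed (use h0 in \<open>simp add: not_integrable_integral_eq\<close>)
    also have "(LINT t|lborel. ?h t) = B * (LINT t:{0..<1}|lborel. t powr real k * (1 - t) powr (1 - \<gamma> - 1))"
      unfolding set_lebesgue_integral_def by (rule integral_mult_right_zero)
    also have "\<dots> \<le> B * (Gamma (1 - \<gamma>) * real k powr (- (1 - \<gamma>)))"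
      using B k \<gamma> by (intro mult_left_mono beta_integral_le) auto
    finally show "norm (gen_hilbert g (test_function \<gamma> k) z) \<le> B * Gamma (1 - \<gamma>) * real k powr (\<gamma> - 1)"
      by (simp add: gen_hilbert_def set_lebesgue_integral_def mult.assoc)
  qed
qed

lemma integral_mean_scale:
  assumes "\<And>t. norm (f (complex_of_real r * cis t)) = M * norm (h (complex_of_real r * cis t))" "0 \<le> M" "0 < p"
  shows "integral_mean p r f = M * integral_mean p r h"
proof -
  have "(LINT t:{0..2*pi}|lborel. norm (f (complex_of_real r * cis t)) powr p) = M powr p * (LINT t:{0..2*pi}|lborel. norm (h (complex_of_real r * cis t)) powr p)"
    by (simp add: assms powr_mult)
  moreover have "0 \<le> (LINT t:{0..2*pi}|lborel. norm (h (complex_of_real r * cis t)) powr p)"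
    unfolding set_lebesgue_integral_def by (intro integral_nonneg_AE) auto
  ultimately show ?thesis using assms(2,3) by (simp add: integral_mean_def powr_mult powr_powr powr_divide)
qed

text \<open>The reciprocal of 1 - 1/k is 1 + 1/(k - 1) <= exp(1/(k - 1)), and k/(k - 1) <= 2. It
  allows division by |z|^k on the circle of radius 1 - 1/k.\<close>

lemma one_minus_inverse_power:
  assumes k: "2 \<le> k" shows "exp (- 2) \<le> (1 - 1 / real k) ^ k"
proof -
  have "1 / (1 - 1 / real k) = 1 + 1 / (real k - 1)" using k by (simp add: field_simps)
  also have "\<dots> \<le> exp (1 / (real k - 1))" by (rule exp_ge_add_one_self)
  finally have "(1 / (1 - 1 / real k)) ^ k \<le> exp (1 / (real k - 1)) ^ k" using k by (intro power_mono) auto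
  also have "\<dots> = exp (real k / (real k - 1))" by (simp add: exp_of_nat_mult[symmetric])
  also have "\<dots> \<le> exp 2" using k by (simp add: field_simps)
  finally have "1 \<le> exp 2 * (1 - 1 / real k) ^ k" using k by (simp add: power_one_over field_simps)
  hence "exp (- 2) * 1 \<le> exp (- 2) * (exp 2 * (1 - 1 / real k) ^ k)" by (intro mult_left_mono) auto
  thus ?thesis by (simp add: mult.assoc[symmetric] exp_add[symmetric])
qed

text \<open>Means of the dilates of H are at most the mean of H, so the fractional integral costs
  only the mass of its kernel, a Beta integral of order k^(-\<gamma>).\<close>

lemma abel_inversion_mean_bound:
  fixes G H :: "complex \<Rightarrow> complex"
  assumes p: "1 < p" and \<gamma>: "0 < \<gamma>" "\<gamma> < 1" and k: "0 < k" and G: "G holomorphic_on unit_disc"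
    and H: "H holomorphic_on unit_disc" and R: "0 \<le> R" "R < 1" and M: "0 < M" "integral_mean p R H \<le> M"
  shows "circle_power p R (\<lambda>z. LINT t:{0..<1}|lborel. complex_of_real (t powr (real k + 1 - \<gamma>) * (1 - t) powr (\<gamma> - 1)) * H (complex_of_real t * z))
    \<le> ennreal (2 * pi * (M * (Gamma \<gamma> * real k powr (- \<gamma>))) powr p)"
proof -
  let ?w = "\<lambda>t::real. t powr (real k + 1 - \<gamma>) * (1 - t) powr (\<gamma> - 1)"
  have wi: "set_integrable lborel {0..<1} ?w" using k \<gamma> by (intro beta_integral) auto
  have eq: "(\<lambda>t. norm (complex_of_real (?w t)) * M) = (\<lambda>t. M * ?w t)" by (simp add: fun_eq_iff norm_mult)
  have "circle_power p R (\<lambda>z. LINT t:{0..<1}|lborel. complex_of_real (?w t) * H (complex_of_real t * z))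
    \<le> ennreal (2 * pi * (LINT t:{0..<1}|lborel. norm (complex_of_real (?w t)) * M) powr p)"
  proof (rule radial_minkowski[OF holomorphic_on_imp_continuous_on[OF H] p R])
    show "set_integrable lborel {0..<1} (\<lambda>t. norm (complex_of_real (?w t)) * M)"
      unfolding eq using wi by (intro set_integrable_mult_right) auto
    fix t :: real assume t: "t \<in> {0..<1}"
    have "integral_mean p (R * t) H \<le> integral_mean p R H"
      using t R by (intro integral_mean_mono H p) (auto simp: mult_left_le)
    thus "integral_mean p (R * t) H \<le> M" using M by simp
  qed (use M in auto)
  also have "(LINT t:{0..<1}|lborel. norm (complex_of_real (?w t)) * M) = M * (LINT t:{0..<1}|lborel. ?w t)"
    unfolding eq by (rule set_integral_mult_right)
  also have "ennreal (2 * pi * (M * (LINT t:{0..<1}|lborel. ?w t)) powr p) \<le> ennreal (2 * pi * (M * (Gamma \<gamma> * real k powr (- \<gamma>))) powr p)"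
  proof (intro ennreal_leI mult_left_mono powr_mono2)
    have "(LINT t:{0..<1}|lborel. ?w t) \<le> Gamma \<gamma> * (real k + 1 - \<gamma>) powr (- \<gamma>)" using k \<gamma> by (intro beta_integral_le) auto
    also have "\<dots> \<le> Gamma \<gamma> * real k powr (- \<gamma>)"
      using k \<gamma> by (intro mult_left_mono powr_mono2' less_imp_le[OF Gamma_real_pos]) auto
    finally show "(LINT t:{0..<1}|lborel. ?w t) \<le> Gamma \<gamma> * real k powr (- \<gamma>)" .
    show "0 \<le> M * (LINT t:{0..<1}|lborel. ?w t)"
      unfolding set_lebesgue_integral_def using M by (intro mult_nonneg_nonneg integral_nonneg_AE) auto
  qed (use p M in auto)
  finally show ?thesis .
qed

text \<open>The mean of the image at radius R is at most (2 k)^((\<alpha> + 1)/p) times its norm;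
  the fractional integral contributes k^(-\<gamma>) and, by Abel inversion, produces a primitive of
  a multiple of z^k g'; the Cauchy estimate from radius R to r contributes 2 k.\<close>

lemma test_function_mean_bound:
  fixes p \<alpha> \<gamma> :: real
  assumes p: "1 < p" and a: "-1 < \<alpha>" and \<gamma>: "0 < \<gamma>" "\<gamma> < 1"
  obtains K where "0 < K" "\<And>g k d. g holomorphic_on unit_disc \<Longrightarrow> 2 \<le> k \<Longrightarrow> 0 < d \<Longrightarrow>
    gen_hilbert g (test_function \<gamma> k) \<in> bergman_space p \<alpha> \<Longrightarrow> bergman_norm p \<alpha> (gen_hilbert g (test_function \<gamma> k)) \<le> d \<Longrightarrow>
    integral_mean p (1 - 1 / real k) (deriv g) \<le> K * d * real k powr (1 - \<gamma> + (\<alpha> + 1) / p)"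
proof -
  define q where "q = (\<alpha> + 1) / p"
  have q: "0 < q" using a p by (simp add: q_def)
  define \<kappa> where "\<kappa> = Gamma (1 - \<gamma>) * Gamma \<gamma>"
  have \<kappa>: "0 < \<kappa>" using \<gamma> by (simp add: \<kappa>_def Gamma_real_pos)
  \<comment> \<open>exp 2 undoes r^k, \<kappa> is the constant of the inversion, and 2 and 2^q come
    from R - r = 1/(2 k) and 1 - R^2 >= 1/(2 k).\<close>
  define K where "K = exp 2 * (2 * 2 powr q * Gamma \<gamma> / \<kappa>)"
  show ?thesis
  proof (rule that[of K])
    show "0 < K" using \<kappa> \<gamma> by (simp add: K_def Gamma_real_pos)
    fix g :: "complex \<Rightarrow> complex" and k :: nat and d :: real
    assume g: "g holomorphic_on unit_disc" and k: "2 \<le> k" and d: "0 < d"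
      and Hb: "gen_hilbert g (test_function \<gamma> k) \<in> bergman_space p \<alpha>" "bergman_norm p \<alpha> (gen_hilbert g (test_function \<gamma> k)) \<le> d"
    have hd: "deriv g holomorphic_on unit_disc" using g by (intro holomorphic_deriv) auto
    define H where "H = gen_hilbert g (test_function \<gamma> k)"
    have H: "H holomorphic_on unit_disc" using Hb by (simp add: H_def bergman_space_def)
    \<comment> \<open>On the circle of radius r the factor |z|^k is bounded below; R leaves the
      distance 1/(2 k) both to r and to the boundary.\<close>
    define r R where "r = 1 - 1 / real k" and "R = 1 - 1 / (2 * real k)"
    have rR: "0 \<le> r" "r < R" "R < 1" "R - r = 1 / (2 * real k)" "0 \<le> R" "0 < r"
      using k by (auto simp: r_def R_def field_simps)
    define M where "M = (2 * real k) powr q * d"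
    have M: "0 < M" using d k by (simp add: M_def)
    have mH: "integral_mean p R H \<le> M"
    proof -
      have "integral_mean p R H \<le> (1 - R\<^sup>2) powr (- (\<alpha> + 1) / p) * bergman_norm p \<alpha> H"
        unfolding H_def by (rule mean_le_bergman_norm[OF Hb(1) p a rR(5,3)])
      also have "\<dots> \<le> (1 - R\<^sup>2) powr (- (\<alpha> + 1) / p) * d"
        using Hb by (intro mult_left_mono) (auto simp: H_def)
      also have "(1 - R\<^sup>2) powr (- (\<alpha> + 1) / p) \<le> (1 / (2 * real k)) powr (- q)"
      proof -
        have "R\<^sup>2 \<le> R" using rR by (simp add: power2_eq_square mult_left_le)
        hence "1 / (2 * real k) \<le> 1 - R\<^sup>2" by (simp add: R_def)
        moreover have "- (\<alpha> + 1) / p = - q" by (simp only: q_def minus_divide_left)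
        ultimately show ?thesis using k q by (simp only:) (intro powr_mono2', auto)
      qed
      also have "(1 / (2 * real k)) powr (- q) = (2 * real k) powr q"
        using k by (simp add: powr_minus powr_divide inverse_eq_divide)
      finally show ?thesis using d by (simp add: M_def)
    qed
    \<comment> \<open>A primitive of z^k g', whose derivative gives back g' after division by
      z^k.\<close>
    obtain P where P: "\<And>w. w \<in> unit_disc \<Longrightarrow> (P has_field_derivative w ^ k * deriv g w) (at w within unit_disc)"
    proof -
      have "(\<lambda>w. w ^ k * deriv g w) holomorphic_on unit_disc" by (intro holomorphic_intros hd)
      thus ?thesis using holomorphic_convex_primitive'[of unit_disc "\<lambda>w. w ^ k * deriv g w"] that by auto
    qed
    have P': "(P has_field_derivative w ^ k * deriv g w) (at w)" if "norm w < 1" for w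
      using P[of w] that at_within_open[of w unit_disc] by simp
    have Ph: "P holomorphic_on unit_disc" unfolding holomorphic_on_def field_differentiable_def using P by blast
    have dP: "deriv P w = w ^ k * deriv g w" if "norm w < 1" for w by (rule DERIV_imp_deriv[OF P'[OF that]])
    define V where "V = (\<lambda>z. complex_of_real \<kappa> * (P z - P 0))"
    have Vh: "V holomorphic_on unit_disc" unfolding V_def by (intro holomorphic_intros Ph)
    have dV: "deriv V z = complex_of_real \<kappa> * (z ^ k * deriv g z)" if "norm z < 1" for z
      unfolding V_def by (rule DERIV_imp_deriv) (auto intro!: derivative_eq_intros P'[OF that])
    define J where "J = (\<lambda>z. LINT t:{0..<1}|lborel. complex_of_real (t powr (real k + 1 - \<gamma>) * (1 - t) powr (\<gamma> - 1)) * H (complex_of_real t * z))"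
    \<comment> \<open>Abel inversion expresses the fractional integral \<open>J\<close> of the image
      by the integral of x^k g'(x z), which is a primitive of z^k g' up to the factor
      z^(k+1).\<close>
    have VJ: "V z = z ^ (k + 1) * J z" if z: "norm z < 1" for z
    proof -
      have "J z = complex_of_real \<kappa> * (LINT x:{0..<1}|lborel. complex_of_real (x powr real k) * deriv g (complex_of_real x * z))"
        unfolding J_def H_def gen_hilbert_def \<kappa>_def by (rule abel_inversion[OF hd \<gamma> _ z]) (use k in simp)
      moreover have "P z - P 0 = z * (LINT x:{0..<1}|lborel. deriv P (complex_of_real x * z))"
        using radial_difference[OF Ph, of 0 z] z by simp
      moreover have "(LINT x:{0..<1}|lborel. deriv P (complex_of_real x * z)) = (LINT x:{0..<1}|lborel. z ^ k * (complex_of_real (x powr real k) * deriv g (complex_of_real x * z)))"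
      proof (intro set_lebesgue_integral_cong allI impI)
        fix x :: real assume x: "x \<in> {0..<1}"
        have "norm (complex_of_real x * z) \<le> norm z" using x by (simp add: norm_mult mult_left_le_one_le)
        hence "deriv P (complex_of_real x * z) = (complex_of_real x * z) ^ k * deriv g (complex_of_real x * z)" using z by (intro dP) auto
        moreover have "complex_of_real (x powr real k) = complex_of_real x ^ k"
          using x k by (cases "x = 0") (auto simp: powr_realpow)
        ultimately show "deriv P (complex_of_real x * z) = z ^ k * (complex_of_real (x powr real k) * deriv g (complex_of_real x * z))"
          by (simp add: power_mult_distrib mult_ac)
      qed auto
      moreover have "(LINT x:{0..<1}|lborel. z ^ k * (complex_of_real (x powr real k) * deriv g (complex_of_real x * z))) = z ^ k * (LINT x:{0..<1}|lborel. complex_of_real (x powr real k) * deriv g (complex_of_real x * z))"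
        by (rule set_integral_mult_right)
      ultimately show ?thesis by (simp add: V_def mult_ac)
    qed
    define N where "N = M * (Gamma \<gamma> * real k powr (- \<gamma>))"
    have N: "0 \<le> N" using M \<gamma> by (auto simp: N_def intro!: mult_nonneg_nonneg less_imp_le[OF Gamma_real_pos])
    have "circle_power p R V \<le> circle_power p R J"
      unfolding circle_power_def
    proof (intro nn_integral_mono mult_right_mono ennreal_leI powr_mono2)
      fix t :: real
      let ?z = "complex_of_real R * cis t"
      have n: "norm ?z = R" using rR by (simp add: norm_mult)
      have "norm (V ?z) = R ^ (k + 1) * norm (J ?z)" using VJ[of ?z] rR n by (simp add: norm_mult norm_power)
      also have "\<dots> \<le> norm (J ?z)" using rR by (intro mult_left_le_one_le zero_le_power power_le_one) auto
      finally show "norm (V ?z) \<le> norm (J ?z)" .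
    qed (use p in auto)
    also have "\<dots> \<le> ennreal (2 * pi * N powr p)"
      unfolding J_def N_def by (rule abel_inversion_mean_bound[OF p \<gamma> _ hd H rR(5,3) M mH]) (use k in simp)
    finally have mV: "integral_mean p R V \<le> N"
      using p by (subst integral_mean_le_iff[OF holomorphic_on_imp_continuous_on[OF Vh] rR(5,3) _ N]) auto
    have "\<kappa> * r ^ k * integral_mean p r (deriv g) = integral_mean p r (deriv V)"
    proof (rule integral_mean_scale[symmetric])
      fix t :: real
      have n: "norm (complex_of_real r * cis t) = r" using rR by (simp add: norm_mult)
      show "norm (deriv V (complex_of_real r * cis t)) = \<kappa> * r ^ k * norm (deriv g (complex_of_real r * cis t))"
        using \<kappa> rR n by (subst dV) (auto simp: norm_mult norm_power)
    qed (use \<kappa> rR p in auto)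
    also have "\<dots> \<le> integral_mean p R V / (R - r)" by (rule deriv_mean_cauchy[OF Vh p rR(1-3)])
    also have "\<dots> \<le> N * (2 * real k)" using mV k by (simp add: rR(4) mult_right_mono)
    also have "\<dots> = 2 * 2 powr q * Gamma \<gamma> * (d * real k powr (1 - \<gamma> + q))"
    proof -
      have "real k powr (1 - \<gamma> + q) = real k * real k powr (- \<gamma>) * real k powr q"
      proof -
        have "1 - \<gamma> + q = 1 + (- \<gamma>) + q" by simp
        thus ?thesis using k by (simp only: powr_add) simp
      qed
      thus ?thesis using k by (simp add: N_def M_def powr_mult mult_ac)
    qed
    finally have main: "\<kappa> * r ^ k * integral_mean p r (deriv g) \<le> 2 * 2 powr q * Gamma \<gamma> * (d * real k powr (1 - \<gamma> + q))" .
    have "\<kappa> * exp (- 2) * integral_mean p r (deriv g) \<le> \<kappa> * r ^ k * integral_mean p r (deriv g)"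
      using one_minus_inverse_power[OF k] \<kappa> by (intro mult_right_mono mult_left_mono) (auto simp: r_def)
    also note main
    finally have "exp 2 / \<kappa> * (\<kappa> * exp (- 2) * integral_mean p r (deriv g)) \<le> exp 2 / \<kappa> * (2 * 2 powr q * Gamma \<gamma> * (d * real k powr (1 - \<gamma> + q)))"
      using \<kappa> by (intro mult_left_mono) auto
    moreover have "exp 2 / \<kappa> * (\<kappa> * exp (- 2) * x) = x" for x :: real
      using \<kappa> by (simp add: exp_minus)
    ultimately have "integral_mean p r (deriv g) \<le> exp 2 / \<kappa> * (2 * 2 powr q * Gamma \<gamma> * (d * real k powr (1 - \<gamma> + q)))"
      by (simp only:)
    thus "integral_mean p (1 - 1 / real k) (deriv g) \<le> K * d * real k powr (1 - \<gamma> + (\<alpha> + 1) / p)"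
      by (simp add: K_def r_def q_def mult_ac)
  qed
qed

text \<open>Means are monotone, so a radius r is compared with the next radius of the form 1 - 1/k.
  Small k are absorbed in the constant C, taken as the mean at 1 - 1/N.\<close>

lemma small_growthI_discrete:
  fixes g :: "complex \<Rightarrow> complex"
  assumes g: "g holomorphic_on unit_disc" and p: "1 < p"
    and le: "\<And>e. 0 < e \<Longrightarrow> \<exists>N. \<forall>k\<ge>N. 2 \<le> k \<longrightarrow> integral_mean p (1 - 1 / real k) (deriv g) \<le> e * real k powr (1 - 1 / p)"
  shows "small_growth p g"
  unfolding small_growth_def
proof (intro allI impI)
  fix e :: real assume e: "0 < e"
  have hd: "deriv g holomorphic_on unit_disc" using g by (intro holomorphic_deriv) auto
  obtain N0 where N0: "\<And>k. N0 \<le> k \<Longrightarrow> 2 \<le> k \<Longrightarrow> integral_mean p (1 - 1 / real k) (deriv g) \<le> e / 2 * real k powr (1 - 1 / p)"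
    using le[of "e / 2"] e by auto
  define N where "N = max N0 2"
  have N: "2 \<le> N" "N0 \<le> N" by (auto simp: N_def)
  show "\<exists>C\<ge>0. \<forall>r. 0 \<le> r \<longrightarrow> r < 1 \<longrightarrow> integral_mean p r (deriv g) \<le> e * (1 - r) powr (1 / p - 1) + C"
  proof (intro exI conjI allI impI)
    show "0 \<le> integral_mean p (1 - 1 / real N) (deriv g)" by simp
    fix r :: real assume r: "0 \<le> r" "r < 1"
    \<comment> \<open>Then r <= 1 - 1/k, and k <= 1/(1 - r) + 1 <= 2/(1 - r).\<close>
    define k where "k = nat \<lceil>1 / (1 - r)\<rceil>"
    have k: "1 / (1 - r) \<le> real k" "real k \<le> 1 / (1 - r) + 1" "1 \<le> real k"
    proof -
      have "1 \<le> 1 / (1 - r)" using r by simp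
      moreover show "1 / (1 - r) \<le> real k" unfolding k_def by linarith
      ultimately show "1 \<le> real k" by linarith
      show "real k \<le> 1 / (1 - r) + 1" unfolding k_def using \<open>1 \<le> 1 / (1 - r)\<close> by linarith
    qed
    have rk: "r \<le> 1 - 1 / real k" using k r by (simp add: field_simps)
    show "integral_mean p r (deriv g) \<le> e * (1 - r) powr (1 / p - 1) + integral_mean p (1 - 1 / real N) (deriv g)"
    proof (cases "N \<le> k")
      case True
      have "1 \<le> 1 / (1 - r)" using r by simp
      hence "real k \<le> 2 * (1 / (1 - r))" using k(2) by simp
      hence "real k powr (1 - 1 / p) \<le> (2 * (1 / (1 - r))) powr (1 - 1 / p)" using p by (intro powr_mono2) auto
      also have "\<dots> = 2 powr (1 - 1 / p) * (1 - r) powr (1 / p - 1)"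
        using r powr_minus_divide[of "1 - r" "1 - 1 / p"] by (simp add: powr_mult powr_divide)
      also have "\<dots> \<le> 2 * (1 - r) powr (1 / p - 1)"
        using p powr_mono[of "1 - 1 / p" 1 "2::real"] by (intro mult_right_mono) auto
      finally have kp: "real k powr (1 - 1 / p) \<le> 2 * (1 - r) powr (1 / p - 1)" .
      have "integral_mean p r (deriv g) \<le> integral_mean p (1 - 1 / real k) (deriv g)"
        using rk r k by (intro integral_mean_mono hd p) auto
      also have "\<dots> \<le> e / 2 * real k powr (1 - 1 / p)" using True N by (intro N0) auto
      also have "\<dots> \<le> e / 2 * (2 * (1 - r) powr (1 / p - 1))" using e kp by (intro mult_left_mono) auto
      finally show ?thesis by (simp add: add_increasing2)
    next
      case False
      have "1 / real N \<le> 1 / real k" using False k by (intro divide_left_mono) auto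
      hence "r \<le> 1 - 1 / real N" using rk by linarith
      hence "integral_mean p r (deriv g) \<le> integral_mean p (1 - 1 / real N) (deriv g)"
        using N r by (intro integral_mean_mono hd p) auto
      thus ?thesis using e by (simp add: add_increasing)
    qed
  qed
qed

text \<open>For boundedness alone the normalised images would merely have bounded norms and give a
  big-oh bound; compactness turns the norms into a null sequence, and
  \<open>test_function_mean_bound\<close> passes the smallness on to the means of the
  derivative.\<close>

theorem compact_imp_small_growth:
  fixes p \<alpha> :: real and g :: "complex \<Rightarrow> complex"
  assumes p: "1 < p" and a: "-1 < \<alpha>" "\<alpha> < p - 2" and g: "g holomorphic_on unit_disc"
    and T: "compact_operator (bergman_space p \<alpha>) (bergman_norm p \<alpha>) (bergman_space p \<alpha>) (bergman_norm p \<alpha>) (gen_hilbert g)"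
  shows "small_growth p g"
proof -
  define s where "s = (\<alpha> + 2) / p"
  have s: "1 / p < s" "s < 1" "0 < 1 / p" using p a by (auto simp: s_def field_simps)
  \<comment> \<open>The midpoint of the admissible interval; \<gamma> disappears from the final
    exponent.\<close>
  define \<gamma> where "\<gamma> = (1 / p + s) / 2"
  have \<gamma>: "1 / p < \<gamma>" "\<gamma> < s" using s by (auto simp: \<gamma>_def)
  hence \<gamma>01: "0 < \<gamma>" "\<gamma> < 1" using s by linarith+
  \<comment> \<open>By \<open>test_function_bergman\<close> the p-th power of the norm of the test
    function is at most of order k^(- p (s - \<gamma>)), so this factor keeps the norms
    bounded.\<close>
  define c where "c = (\<lambda>k. real k powr (s - \<gamma>))"
  have c: "0 < c k" if "0 < k" for k using that by (simp add: c_def)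
  \<comment> \<open>\<open>Suc n\<close> keeps the parameter positive, as the formulas on the radius
    require.\<close>
  define u where "u = (\<lambda>n z. complex_of_real (c (Suc n)) * test_function \<gamma> (Suc n) z)"
  obtain C where C: "0 < C" "\<And>k. 0 < k \<Longrightarrow> bergman_nn p \<alpha> (test_function \<gamma> k) \<le> ennreal (C * real k powr (- (\<alpha> + 2 - \<gamma> * p)))"
    using test_function_bergman[OF p a(1), of \<gamma>] \<gamma> unfolding s_def by blast
  have unn: "bergman_nn p \<alpha> (u n) \<le> ennreal C" for n
  proof -
    have "bergman_nn p \<alpha> (u n) = ennreal (c (Suc n) powr p) * bergman_nn p \<alpha> (test_function \<gamma> (Suc n))"
      unfolding u_def by (subst bergman_nn_scale[OF test_function_holomorphic]) (simp add: c_def)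
    also have "\<dots> \<le> ennreal (c (Suc n) powr p) * ennreal (C * real (Suc n) powr (- (\<alpha> + 2 - \<gamma> * p)))"
      by (intro mult_left_mono C) auto
    also have "\<dots> = ennreal (C * (real (Suc n) powr ((s - \<gamma>) * p) * real (Suc n) powr (- (\<alpha> + 2 - \<gamma> * p))))"
      using C by (subst ennreal_mult[symmetric]) (auto simp: c_def powr_powr mult_ac)
    also have "real (Suc n) powr ((s - \<gamma>) * p) * real (Suc n) powr (- (\<alpha> + 2 - \<gamma> * p)) = 1"
    proof -
      have "(s - \<gamma>) * p + - (\<alpha> + 2 - \<gamma> * p) = 0" using p by (simp add: s_def left_diff_distrib)
      thus ?thesis unfolding powr_add[symmetric] by simp
    qed
    finally show ?thesis by simp
  qed
  have uX: "u n \<in> bergman_space p \<alpha>" for n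
    unfolding bergman_space_iff
  proof
    show "u n holomorphic_on unit_disc" unfolding u_def by (intro holomorphic_intros test_function_holomorphic)
    show "bergman_nn p \<alpha> (u n) < \<infinity>" using unn[of n] by (auto simp: less_top[symmetric] top_unique)
  qed
  have ub: "bergman_norm p \<alpha> (u n) \<le> (C * (\<alpha> + 1) / pi) powr (1 / p)" for n
  proof -
    have "ennreal (pi / (\<alpha> + 1) * bergman_norm p \<alpha> (u n) powr p) \<le> ennreal C"
      using unn[of n] p by (subst bergman_nn_eq[OF uX _ a(1), symmetric]) auto
    hence "pi / (\<alpha> + 1) * bergman_norm p \<alpha> (u n) powr p \<le> C" using C by (subst (asm) ennreal_le_iff) auto
    hence "bergman_norm p \<alpha> (u n) powr p \<le> C * (\<alpha> + 1) / pi" using a by (simp add: field_simps)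
    hence "(bergman_norm p \<alpha> (u n) powr p) powr (1 / p) \<le> (C * (\<alpha> + 1) / pi) powr (1 / p)"
      using p by (intro powr_mono2) auto
    thus ?thesis using p bergman_norm_nonneg[of p \<alpha> "u n"] by (simp add: powr_powr)
  qed
  have gu: "gen_hilbert g (u n) z = complex_of_real (c (Suc n)) * gen_hilbert g (test_function \<gamma> (Suc n)) z" for n z
    unfolding gen_hilbert_def u_def mult.assoc by (rule set_integral_mult_right)
  have lim: "(\<lambda>n. bergman_norm p \<alpha> (gen_hilbert g (u n))) \<longlonglongrightarrow> 0"
  proof (rule compact_operator_null[where u = u, OF p a(1) T uX ub])
    fix z :: complex assume z: "norm z < 1"
    obtain B where B: "0 \<le> B" "\<And>k. 0 < k \<Longrightarrow> norm (gen_hilbert g (test_function \<gamma> k) z) \<le> B * real k powr (\<gamma> - 1)"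
      using gen_hilbert_test_function_bound[OF g \<gamma>01(2) z] by blast
    show "(\<lambda>n. gen_hilbert g (u n) z) \<longlonglongrightarrow> 0"
    proof (rule Lim_null_comparison)
      show "\<forall>\<^sub>F n in sequentially. norm (gen_hilbert g (u n) z) \<le> B * real (Suc n) powr (s - 1)"
      proof (intro always_eventually allI)
        fix n
        have "norm (gen_hilbert g (u n) z) = c (Suc n) * norm (gen_hilbert g (test_function \<gamma> (Suc n)) z)"
          unfolding gu norm_mult by (simp add: c_def)
        also have "\<dots> \<le> c (Suc n) * (B * real (Suc n) powr (\<gamma> - 1))" by (intro mult_left_mono B less_imp_le[OF c]) auto
        also have "\<dots> = B * (real (Suc n) powr (s - \<gamma>) * real (Suc n) powr (\<gamma> - 1))" by (simp add: c_def mult_ac)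
        also have "\<dots> = B * real (Suc n) powr (s - 1)" unfolding powr_add[symmetric] by simp
        finally show "norm (gen_hilbert g (u n) z) \<le> B * real (Suc n) powr (s - 1)" .
      qed
      have "(\<lambda>n. real n powr (s - 1)) \<longlonglongrightarrow> 0"
        using s by (intro tendsto_neg_powr filterlim_real_sequentially) auto
      hence "(\<lambda>n. real (Suc n) powr (s - 1)) \<longlonglongrightarrow> 0" by (rule LIMSEQ_Suc)
      thus "(\<lambda>n. B * real (Suc n) powr (s - 1)) \<longlonglongrightarrow> 0" by (rule tendsto_mult_right_zero)
    qed
  qed
  obtain K where K: "0 < K" "\<And>g k d. g holomorphic_on unit_disc \<Longrightarrow> 2 \<le> k \<Longrightarrow> 0 < d \<Longrightarrow>
    gen_hilbert g (test_function \<gamma> k) \<in> bergman_space p \<alpha> \<Longrightarrow> bergman_norm p \<alpha> (gen_hilbert g (test_function \<gamma> k)) \<le> d \<Longrightarrow>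
    integral_mean p (1 - 1 / real k) (deriv g) \<le> K * d * real k powr (1 - \<gamma> + (\<alpha> + 1) / p)"
    by (rule test_function_mean_bound[OF p a(1) \<gamma>01]) blast
  show ?thesis
  proof (rule small_growthI_discrete[OF g p])
    fix e :: real assume e: "0 < e"
    have "0 < e / K" using e K by simp
    then obtain N where N: "\<And>n. N \<le> n \<Longrightarrow> norm (bergman_norm p \<alpha> (gen_hilbert g (u n)) - 0) < e / K"
      using LIMSEQ_D[OF lim] by blast
    show "\<exists>N. \<forall>k\<ge>N. 2 \<le> k \<longrightarrow> integral_mean p (1 - 1 / real k) (deriv g) \<le> e * real k powr (1 - 1 / p)"
    proof (intro exI[of _ "Suc N"] allI impI)
      fix k :: nat assume k: "Suc N \<le> k" "2 \<le> k"
      then obtain n where n: "k = Suc n" "N \<le> n" by (cases k) auto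
      define H where "H = gen_hilbert g (test_function \<gamma> k)"
      have ck: "0 < c k" using c k by simp
      have Heq: "H = (\<lambda>z. complex_of_real (1 / c k) * gen_hilbert g (u n) z)"
        using ck by (simp add: gu H_def n(1)[symmetric] fun_eq_iff)
      have TX: "gen_hilbert g (u n) \<in> bergman_space p \<alpha>" using T uX by (simp add: compact_operator_def)
      hence Th: "gen_hilbert g (u n) holomorphic_on unit_disc" by (simp add: bergman_space_def)
      have nn: "bergman_nn p \<alpha> H = ennreal ((1 / c k) powr p) * bergman_nn p \<alpha> (gen_hilbert g (u n))"
        unfolding Heq using ck by (subst bergman_nn_scale[OF Th]) (simp add: norm_divide)
      have HX: "H \<in> bergman_space p \<alpha>"
        unfolding bergman_space_iff nn
      proof
        show "H holomorphic_on unit_disc" unfolding Heq by (intro holomorphic_intros Th)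
        show "ennreal ((1 / c k) powr p) * bergman_nn p \<alpha> (gen_hilbert g (u n)) < \<infinity>"
          using TX by (simp add: bergman_space_iff ennreal_mult_less_top)
      qed
      have Hn: "bergman_norm p \<alpha> H \<le> e / K / c k"
      proof -
        have "bergman_norm p \<alpha> (gen_hilbert g (u n)) \<le> e / K" using N[OF n(2)] by simp
        moreover have "bergman_norm p \<alpha> H = bergman_norm p \<alpha> (gen_hilbert g (u n)) / c k"
        proof -
          let ?x = "bergman_norm p \<alpha> H" and ?y = "bergman_norm p \<alpha> (gen_hilbert g (u n))"
          have "ennreal (pi / (\<alpha> + 1) * ?x powr p) = ennreal ((1 / c k) powr p) * ennreal (pi / (\<alpha> + 1) * ?y powr p)"
            using nn p by (simp only: bergman_nn_eq[OF HX _ a(1)] bergman_nn_eq[OF TX _ a(1)])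
          also have "\<dots> = ennreal (pi / (\<alpha> + 1) * (?y / c k) powr p)"
            using ck a bergman_norm_nonneg[of p \<alpha> "gen_hilbert g (u n)"] by (simp add: ennreal_mult[symmetric] powr_divide)
          finally have "?x powr p = (?y / c k) powr p" using a by (subst (asm) ennreal_inj) auto
          hence "(?x powr p) powr (1 / p) = ((?y / c k) powr p) powr (1 / p)" by simp
          thus ?thesis using p ck bergman_norm_nonneg[of p \<alpha> H] bergman_norm_nonneg[of p \<alpha> "gen_hilbert g (u n)"] by (simp add: powr_powr)
        qed
        ultimately show ?thesis using ck by (simp only:) (intro divide_right_mono, auto)
      qed
      have "integral_mean p (1 - 1 / real k) (deriv g) \<le> K * (e / K / c k) * real k powr (1 - \<gamma> + (\<alpha> + 1) / p)"
        using K(2)[OF g k(2), of "e / K / c k"] HX Hn e K(1) ck unfolding H_def by simp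
      also have "\<dots> = e * (real k powr (1 - \<gamma> + (\<alpha> + 1) / p) / real k powr (s - \<gamma>))" using K(1) by (simp add: c_def)
      also have "\<dots> = e * real k powr (1 - 1 / p)"
      proof -
        \<comment> \<open>Undoing the normalisation cancels \<gamma> and leaves the critical
          exponent.\<close>
        have "1 - \<gamma> + (\<alpha> + 1) / p - (s - \<gamma>) = 1 - 1 / p" using p by (simp add: s_def field_simps)
        thus ?thesis unfolding powr_diff[symmetric] by simp
      qed
      finally show "integral_mean p (1 - 1 / real k) (deriv g) \<le> e * real k powr (1 - 1 / p)" .
    qed
  qed
qed

theorem theorem9:
  fixes p \<alpha> :: real and g :: "complex \<Rightarrow> complex"
  assumes "1 < p" and "-1 < \<alpha>" and "\<alpha> < p - 2"
    and "g holomorphic_on unit_disc"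
  shows "compact_operator
           (bergman_space p \<alpha>) (bergman_norm p \<alpha>)
           (bergman_space p \<alpha>) (bergman_norm p \<alpha>) (gen_hilbert g)
         \<longleftrightarrow> g \<in> little_mean_lipschitz p (1 / p)"
proof
  assume "compact_operator (bergman_space p \<alpha>) (bergman_norm p \<alpha>) (bergman_space p \<alpha>) (bergman_norm p \<alpha>) (gen_hilbert g)"
  hence "small_growth p g" by (rule compact_imp_small_growth[OF assms])
  thus "g \<in> little_mean_lipschitz p (1 / p)" by (rule small_growth_imp_lipschitz[OF assms(4,1)])
next
  assume "g \<in> little_mean_lipschitz p (1 / p)"
  hence "small_growth p g" by (rule lipschitz_imp_small_growth[OF assms(4,1)])
  thus "compact_operator (bergman_space p \<alpha>) (bergman_norm p \<alpha>) (bergman_space p \<alpha>) (bergman_norm p \<alpha>) (gen_hilbert g)"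
    by (rule small_growth_imp_compact[OF assms])
qed

end
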